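(* (i) The mapping $\psi:\mathcal{G}_0\to\Xi_0$ is bijective. (ii) Let $P^\sigma\in\mathcal{G}_0$ and $u=\psi(P^\sigma)\in\Xi_0$ (a function on $\mathbf{R}$). Write $\sigma=\sum_{j=1}^n c_j^2\delta_{p_j}$ and define $\tilde\sigma=\sum_{j=1}^n c_j^2\delta_{-p_j}$. Then $$u(x)=\psi(P^{\tilde\sigma})(-x),\qquad x\le 0.$$
   Context: $\mathcal{W}$ is the space of continuous functions $w:[0,\infty)\to\mathbf{R}$ with $w(0)=0$, with the topology of uniform convergence on compacts and its Borel $\sigma$-field; $X(x,w)=w(x)$ is the coordinate process. $\Sigma_0$ is the set of measures on $\mathbf{R}$ of the form $\sum_{j=1}^n c_j^2\delta_{p_j}$ with $n\in\mathbf{N}$ ($n\ge1$), $c_j>0$, $p_j\in\mathbf{R}$, $p_i\ne p_j$ for $i\neq j$ ($\delta_p$ is the Dirac measure at $p$). For $\sigma\in\Sigma_0$ let $$R_\sigma(x,y)=\int_{\mathbf{R}}\frac{e^{\zeta(x+y)}-e^{\zeta|x-y|}}{2\zeta}\,\sigma(d\zeta),\quad x,y\ge0$$ (the integrand at $\zeta=0$ is its limit $\min\{x,y\}$), and let $P^\sigma$ be the probability measure on $\mathcal{W}$ under which $\{X(x)\}_{x\ge0}$ is a centered Gaussian process with covariance function $R_\sigma$. Put $\mathcal{G}_0=\{P^\sigma\mid\sigma\in\Sigma_0\}$. Reflectionless potentials: $\mathcal{S}$ is the set of all finite sequences $\mathbf{s}=\{\eta_j,m_j\}_{1\le j\le n}$,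 $n=1,2,\dots$, of positive real numbers with $\eta_1<\dots<\eta_n$. For $\mathbf{s}\in\mathcal{S}$, $$u_{\mathbf{s}}(x)=-2\Bigl(\frac{d}{dx}\Bigr)^2\log\det(I+G_{\mathbf{s}}(x)),\quad x\in\mathbf{R},\qquad G_{\mathbf{s}}(x)=\Bigl(\frac{\sqrt{m_im_j}\,e^{-(\eta_i+\eta_j)x}}{\eta_i+\eta_j}\Bigr)_{1\le i,j\le n}.$$ $\Xi_0=\{u_{\mathbf{s}}\mid\mathbf{s}\in\mathcal{S}\}$. For $P^\sigma\in\mathcal{G}_0$ put $$\psi(P^\sigma)(x)=4\Bigl(\frac{d}{dx}\Bigr)^2\log\Bigl(\int_{\mathcal{W}}\exp\Bigl(-\frac12\int_0^xX(y)^2dy\Bigr)dP^\sigma\Bigr),\quad x\ge0.$$ It is known (earlier work of Ikeda and Taniguchi) that this is well defined and equals on $[0,\infty)$ the restriction of an element of $\Xi_0$; since elements of $\Xi_0$ are real analytic on $\mathbf{R}$, that element is unique, and $\psi(P^\sigma)$ is identified with it. Thus $\psi$ is regarded as a mapping $\mathcal{G}_0\to\Xi_0$. *)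

theory Defs
  imports "HOL-Probability.Probability" "Jordan_Normal_Form.Determinant"
begin

text \<open>Paths live on [0, \<infinity>); as functions on all of \<^typ>\<open>real\<close> they are pinned down
  by \<^const>\<open>extensional\<close>.\<close>

definition path_set :: "(real \<Rightarrow> real) set" where
  "path_set = {w \<in> extensional {0..}. continuous_on {0..} w \<and> w 0 = 0}"

definition coord :: "real \<Rightarrow> (real \<Rightarrow> real) \<Rightarrow> real" where
  "coord x w = w x"

definition ucc_open :: "(real \<Rightarrow> real) set \<Rightarrow> bool" where
  "ucc_open U \<longleftrightarrow> U \<subseteq> path_set \<and>
     (\<forall>w\<in>U. \<exists>K e. compact K \<and> K \<subseteq> {0..} \<and> e > 0 \<and>
        (\<forall>v\<in>path_set. (\<forall>x\<in>K. \<bar>v x - w x\<bar> < e) \<longrightarrow> v \<in> U))"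

definition ucc_topology :: "(real \<Rightarrow> real) topology" where
  "ucc_topology = topology ucc_open"

lemma istopology_ucc_open: "istopology ucc_open"
  unfolding istopology_def
proof (intro conjI allI impI)
  fix S T assume S: "ucc_open S" and T: "ucc_open T"
  show "ucc_open (S \<inter> T)"
    unfolding ucc_open_def
  proof (intro conjI ballI)
    show "S \<inter> T \<subseteq> path_set" using S by (auto simp: ucc_open_def)
  next
    fix w assume w: "w \<in> S \<inter> T"
    have "\<exists>K e. compact K \<and> K \<subseteq> {0..} \<and> e > 0 \<and>
        (\<forall>v\<in>path_set. (\<forall>x\<in>K. \<bar>v x - w x\<bar> < e) \<longrightarrow> v \<in> S)"
      using S w unfolding ucc_open_def by (elim conjE IntE) (erule bspec)
    then obtain K e where 1: "compact K" "K \<subseteq> {0..}" "e > 0"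
      "\<forall>v\<in>path_set. (\<forall>x\<in>K. \<bar>v x - w x\<bar> < e) \<longrightarrow> v \<in> S"
      by (elim exE conjE)
    have "\<exists>K e. compact K \<and> K \<subseteq> {0..} \<and> e > 0 \<and>
        (\<forall>v\<in>path_set. (\<forall>x\<in>K. \<bar>v x - w x\<bar> < e) \<longrightarrow> v \<in> T)"
      using T w unfolding ucc_open_def by (elim conjE IntE) (erule bspec)
    then obtain L d where 2: "compact L" "L \<subseteq> {0..}" "d > 0"
      "\<forall>v\<in>path_set. (\<forall>x\<in>L. \<bar>v x - w x\<bar> < d) \<longrightarrow> v \<in> T"
      by (elim exE conjE)
    have "v \<in> S \<inter> T"
      if v: "v \<in> path_set" and close: "\<forall>x\<in>K \<union> L. \<bar>v x - w x\<bar> < min e d" for v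
    proof
      have "\<forall>x\<in>K. \<bar>v x - w x\<bar> < e" using close by simp
      then show "v \<in> S" using 1(4) v by simp
      have "\<forall>x\<in>L. \<bar>v x - w x\<bar> < d" using close by simp
      then show "v \<in> T" using 2(4) v by simp
    qed
    moreover have "compact (K \<union> L)" "K \<union> L \<subseteq> {0..}" "min e d > 0"
      using 1(1-3) 2(1-3) by (simp_all add: compact_Un)
    ultimately show "\<exists>K e. compact K \<and> K \<subseteq> {0..} \<and> e > 0 \<and>
        (\<forall>v\<in>path_set. (\<forall>x\<in>K. \<bar>v x - w x\<bar> < e) \<longrightarrow> v \<in> S \<inter> T)"
      by (intro exI[of _ "K \<union> L"] exI[of _ "min e d"] conjI ballI impI)
  qed
next
  fix \<K> assume *: "\<forall>K\<in>\<K>. ucc_open K"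
  show "ucc_open (\<Union>\<K>)"
    unfolding ucc_open_def
  proof (intro conjI ballI)
    show "\<Union>\<K> \<subseteq> path_set" using * by (auto simp: ucc_open_def)
  next
    fix w assume "w \<in> \<Union>\<K>"
    then obtain U where U: "U \<in> \<K>" "w \<in> U" by blast
    have "ucc_open U" using * U(1) by (rule bspec)
    then have "\<exists>K e. compact K \<and> K \<subseteq> {0..} \<and> e > 0 \<and>
        (\<forall>v\<in>path_set. (\<forall>x\<in>K. \<bar>v x - w x\<bar> < e) \<longrightarrow> v \<in> U)"
      using U(2) unfolding ucc_open_def by (elim conjE) (erule bspec)
    then obtain K e where 1: "compact K" "K \<subseteq> {0..}" "e > 0"
      "\<forall>v\<in>path_set. (\<forall>x\<in>K. \<bar>v x - w x\<bar> < e) \<longrightarrow> v \<in> U"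
      by (elim exE conjE)
    have "v \<in> \<Union>\<K>"
      if "v \<in> path_set" "\<forall>x\<in>K. \<bar>v x - w x\<bar> < e" for v
      using 1(4) that U(1) by (intro UnionI[of U]) simp_all
    with 1(1-3) show "\<exists>K e. compact K \<and> K \<subseteq> {0..} \<and> e > 0 \<and>
        (\<forall>v\<in>path_set. (\<forall>x\<in>K. \<bar>v x - w x\<bar> < e) \<longrightarrow> v \<in> \<Union>\<K>)"
      by (intro exI[of _ K] exI[of _ e] conjI ballI impI)
  qed
qed

lemma openin_ucc_topology: "openin ucc_topology U \<longleftrightarrow> ucc_open U"
  by (simp add: ucc_topology_def istopology_ucc_open)

lemma topspace_ucc_topology: "topspace ucc_topology = path_set"
proof -
  have "ucc_open path_set"
    unfolding ucc_open_def by (auto intro!: exI[of _ "{}"] exI[of _ "1::real"])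
  then show ?thesis
    by (auto simp: topspace_def openin_ucc_topology ucc_open_def)
qed

text \<open>Only the measurable structure of \<open>path_space\<close> is used.\<close>

definition path_space :: "(real \<Rightarrow> real) measure" where
  "path_space = sigma (topspace ucc_topology) {U. openin ucc_topology U}"

text \<open>Constants count as Gaussian: the coordinate process starts at 0, and its covariance
  may be degenerate.\<close>

definition gaussian_rv :: "'a measure \<Rightarrow> ('a \<Rightarrow> real) \<Rightarrow> bool" where
  "gaussian_rv M Y \<longleftrightarrow> Y \<in> borel_measurable M \<and>
     (\<exists>m. (AE \<omega> in M. Y \<omega> = m) \<or>
          (\<exists>s>0. distributed M lborel Y (\<lambda>x. ennreal (normal_density m s x))))"

definition centered_gaussian_process ::
    "'a measure \<Rightarrow> 't set \<Rightarrow> ('t \<Rightarrow> 'a \<Rightarrow> real) \<Rightarrow> ('t \<Rightarrow> 't \<Rightarrow> real) \<Rightarrow> bool" where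
  "centered_gaussian_process M T Y R \<longleftrightarrow>
     (\<forall>F a. finite F \<and> F \<subseteq> T \<longrightarrow> gaussian_rv M (\<lambda>\<omega>. \<Sum>t\<in>F. a t * Y t \<omega>)) \<and>
     (\<forall>t\<in>T. (\<integral>\<omega>. Y t \<omega> \<partial>M) = 0) \<and>
     (\<forall>s\<in>T. \<forall>t\<in>T. (\<integral>\<omega>. Y s \<omega> * Y t \<omega> \<partial>M) = R s t)"

definition atomic_measure :: "nat \<Rightarrow> (nat \<Rightarrow> real) \<Rightarrow> (nat \<Rightarrow> real) \<Rightarrow> real measure" where
  "atomic_measure n c p =
     measure_of UNIV (sets borel)
       (\<lambda>A. \<Sum>j=1..n. ennreal ((c j)\<^sup>2) * emeasure (return borel (p j)) A)"

definition atom_data :: "nat \<Rightarrow> (nat \<Rightarrow> real) \<Rightarrow> (nat \<Rightarrow> real) \<Rightarrow> bool" where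
  "atom_data n c p \<longleftrightarrow> n \<ge> 1 \<and> (\<forall>j\<in>{1..n}. c j > 0) \<and> inj_on p {1..n}"

definition Sigma0 :: "real measure set" where
  "Sigma0 = {atomic_measure n c p |n c p. atom_data n c p}"

definition cov_kernel :: "real \<Rightarrow> real \<Rightarrow> real \<Rightarrow> real" where
  "cov_kernel x y \<zeta> =
     (if \<zeta> = 0 then min x y
      else (exp (\<zeta> * (x + y)) - exp (\<zeta> * \<bar>x - y\<bar>)) / (2 * \<zeta>))"

definition cov :: "real measure \<Rightarrow> real \<Rightarrow> real \<Rightarrow> real" where
  "cov \<sigma> x y = (\<integral>\<zeta>. cov_kernel x y \<zeta> \<partial>\<sigma>)"

definition gaussian_law :: "real measure \<Rightarrow> (real \<Rightarrow> real) measure" where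
  "gaussian_law \<sigma> = (THE P. prob_space P \<and> sets P = sets path_space \<and>
     centered_gaussian_process P {0..} coord (cov \<sigma>))"

definition G0 :: "(real \<Rightarrow> real) measure set" where
  "G0 = gaussian_law ` Sigma0"

text \<open>The list \<open>[(\<eta>\<^sub>1, m\<^sub>1), \<dots>, (\<eta>\<^sub>n, m\<^sub>n)]\<close>; indices are shifted to start at 0.\<close>

definition scattering_data :: "(real \<times> real) list set" where
  "scattering_data =
     {s. s \<noteq> [] \<and> (\<forall>(\<eta>, m)\<in>set s. \<eta> > 0 \<and> m > 0) \<and> sorted_wrt (<) (map fst s)}"

definition G_mat :: "(real \<times> real) list \<Rightarrow> real \<Rightarrow> real mat" where
  "G_mat s x = mat (length s) (length s) (\<lambda>(i, j).
     sqrt (snd (s ! i) * snd (s ! j)) * exp (- (fst (s ! i) + fst (s ! j)) * x)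
       / (fst (s ! i) + fst (s ! j)))"

definition potential :: "(real \<times> real) list \<Rightarrow> real \<Rightarrow> real" where
  "potential s x =
     - 2 * deriv (deriv (\<lambda>y. ln (Determinant.det (1\<^sub>m (length s) + G_mat s y)))) x"

definition Xi0 :: "(real \<Rightarrow> real) set" where
  "Xi0 = potential ` scattering_data"

definition log_functional :: "(real \<Rightarrow> real) measure \<Rightarrow> real \<Rightarrow> real" where
  "log_functional P x =
     ln (\<integral>w. exp (- (1/2) * integral {0..x} (\<lambda>y. (coord y w)\<^sup>2)) \<partial>P)"

text \<open>\<open>psi P\<close> is the element of \<^const>\<open>Xi0\<close> that equals four times the second derivative of
  \<open>log_functional P\<close> on [0, \<infinity>), the derivatives at 0 being one-sided.\<close>

definition psi :: "(real \<Rightarrow> real) measure \<Rightarrow> real \<Rightarrow> real" where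
  "psi P = (THE u. u \<in> Xi0 \<and>
     (\<exists>f' f''. \<forall>x\<ge>0.
        (log_functional P has_real_derivative f' x) (at x within {0..}) \<and>
        (f' has_real_derivative f'' x) (at x within {0..}) \<and>
        u x = 4 * f'' x))"

end

theory Submission
  imports Defs "HOL-Real_Asymp.Real_Asymp"
begin

text \<open>Under \<open>P\<^sup>\<sigma>\<close> the process is a sum \<open>X = \<Sum> a\<^sub>i Z\<^sub>i\<close> over independent standard Gaussians (a Schauder
  expansion after a deterministic time change). Put \<open>\<Phi>(T) = E exp (- 1/2 \<integral>\<^sub>0\<^sup>T X\<^sup>2)\<close>, so that
  \<open>\<Phi>' = - G\<^sub>T(T) / 2\<close> with \<open>G\<^sub>T(s) = E X\<^sub>s X\<^sub>T exp (- 1/2 \<integral>\<^sub>0\<^sup>T X\<^sup>2)\<close>. Integrating by parts in each \<open>Z\<^sub>i\<close> gives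
  the Fredholm equation \<open>G\<^sub>T(s) + \<integral>\<^sub>0\<^sup>T R\<^sub>\<sigma>(s, y) G\<^sub>T(y) dy = R\<^sub>\<sigma>(s, T) \<Phi>(T)\<close>, which a linear system of
  differential equations solves in the eigenbasis of \<open>diag (p\<^sup>2) + c c\<^sup>T\<close>, with eigenvalues \<open>\<eta>\<^sub>i\<^sup>2\<close>. The outcome is that
  \<open>det W(T) exp (T \<Sum> p\<^sub>j) \<Phi>(T)\<^sup>2\<close> is constant for an explicit matrix \<open>W\<close>, while
  \<open>det W(x)\<close> is a multiple of \<open>exp (x \<Sum> \<eta>\<^sub>i) det (I + G\<^sub>s(x))\<close>. Hence \<open>\<psi>(P\<^sup>\<sigma>) = u\<^sub>s\<close>.

  The map from \<open>(c, p)\<close> to \<open>s\<close> is inverted through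
  \<open>(diag \<eta> - M)\<^sup>-\<^sup>1 = ((\<delta>\<^sub>i \<delta>\<^sub>k + [i = k]) / (\<eta>\<^sub>i + \<eta>\<^sub>k))\<close>, where \<open>M\<close> is \<open>diag p\<close> in the eigenbasis and
  \<open>m\<^sub>i = 2 \<eta>\<^sub>i \<delta>\<^sub>i\<^sup>2\<close>; and \<open>u\<^sub>s\<close> determines \<open>s\<close> by the asymptotics of \<open>det (I + G\<^sub>s(x))\<close> at minus infinity.
  Replacing \<open>p\<close> by \<open>- p\<close> keeps the eigenbasis and turns \<open>W(x)\<close> into \<open>W(- x)\<close> up to a
  diagonal factor, which is the reflection formula.\<close>

section \<open>Gaussian laws on path space\<close>

text \<open>\<open>gaussian_law\<close> and \<open>psi\<close> are definite descriptions: existence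
  and uniqueness of the law, and injectivity of \<open>potential\<close> seen on x \<ge> 0 only,
  have to precede any statement about bijectivity. The matrix diag(p^2) + c c^T arises as follows.
  The kernel of an atom is exp(p max) times a function of min, so its integral operator is inverted
  by a first order system, and the Fredholm equation becomes h_j' = p_j h_j + c_j r_j, r_j' = - p_j
  r_j + G with G = \<Sum> c_j h_j. In h'' the r_j cancel and h'' = (diag(p^2) + c c^T) h remains. In
  the eigenbasis h(0) = 0 leaves one slope per mode, and the end condition r_j(T) = \<Phi>(T) is a
  linear system for the slopes with matrix W(T). By this system and Jacobi's formula det W has
  logarithmic derivative G_T(T) / \<Phi>(T) - \<Sum> p_j, while \<Phi>^2 has - G_T(T) / \<Phi>(T):
  the constancy is a cancellation. Hence log \<Phi> is - 1/2 log tau plus an affine function, which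
  the second derivative removes, and the factor 4 yields the - 2 of
  \<open>potential\<close>.\<close>

lemma space_path_space: "space path_space = path_set"
  unfolding path_space_def topspace_ucc_topology
  by (rule space_measure_of) (auto simp: openin_ucc_topology ucc_open_def)

lemma sets_path_space: "sets path_space = sigma_sets path_set {U. ucc_open U}"
  unfolding path_space_def topspace_ucc_topology openin_ucc_topology
  by (rule sets_measure_of) (auto simp: ucc_open_def)

text \<open>Evaluation at a point is continuous in this topology, since a one-point set is an
  admissible compact set.\<close>

lemma measurable_coord:
  assumes "x \<ge> 0"
  shows "coord x \<in> borel_measurable path_space"
proof (rule borel_measurableI)
  fix S :: "real set" assume S: "open S"
  have "ucc_open (coord x -` S \<inter> path_set)"
    unfolding ucc_open_def
  proof (intro conjI ballI)
    fix w assume "w \<in> coord x -` S \<inter> path_set"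
    then have "w x \<in> S" by (simp add: coord_def)
    then obtain e where e: "e > 0" "ball (w x) e \<subseteq> S" using S openE by blast
    show "\<exists>K e. compact K \<and> K \<subseteq> {0..} \<and> e > 0 \<and>
        (\<forall>v\<in>path_set. (\<forall>x\<in>K. \<bar>v x - w x\<bar> < e) \<longrightarrow> v \<in> coord x -` S \<inter> path_set)"
      using e assms
      by (intro exI[of _ "{x}"] exI[of _ e])
         (auto simp: coord_def subset_eq dist_real_def abs_minus_commute)
  qed auto
  then show "coord x -` S \<inter> space path_space \<in> sets path_space"
    unfolding space_path_space sets_path_space by (intro sigma_sets.Basic) simp
qed

section \<open>Cylinder sets generate the Borel sets of path space\<close>

definition cylinders :: "(real \<Rightarrow> real) set set" where
  "cylinders = {{w \<in> path_set. \<forall>x\<in>F. w x \<in> A x} |F A.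
     finite F \<and> F \<subseteq> {0..} \<and> (\<forall>x\<in>F. A x \<in> sets borel)}"

lemma cylinders_subset: "cylinders \<subseteq> Pow path_set"
  by (auto simp: cylinders_def)

lemma Int_stable_cylinders: "Int_stable cylinders"
proof (rule Int_stableI)
  fix a b assume "a \<in> cylinders" "b \<in> cylinders"
  then obtain F A G B where
    a: "a = {w \<in> path_set. \<forall>x\<in>F. w x \<in> A x}" "finite F" "F \<subseteq> {0..}" "\<forall>x\<in>F. A x \<in> sets borel" and
    b: "b = {w \<in> path_set. \<forall>x\<in>G. w x \<in> B x}" "finite G" "G \<subseteq> {0..}" "\<forall>x\<in>G. B x \<in> sets borel"
    unfolding cylinders_def mem_Collect_eq by (elim exE conjE) (rule that; assumption)
  \<comment> \<open>The two cylinders may constrain different times; \<open>UNIV\<close> leaves a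
    time free that only the other one constrains.\<close>
  define C where "C = (\<lambda>x. (if x \<in> F then A x else UNIV) \<inter> (if x \<in> G then B x else UNIV))"
  have "a \<inter> b = {w \<in> path_set. \<forall>x\<in>F \<union> G. w x \<in> C x}"
    unfolding a b C_def by auto
  moreover have "finite (F \<union> G)" "F \<union> G \<subseteq> {0..}" "\<forall>x\<in>F \<union> G. C x \<in> sets borel"
    using a b by (auto simp: C_def)
  ultimately show "a \<inter> b \<in> cylinders" unfolding cylinders_def by blast
qed

text \<open>A countable family of closed tubes around step functions: cells of length 1/m, rational
  heights \<open>r\<close>, tolerance 1/(j+1). It serves as a substitute for a countable base, since
  every open set is a union of such tubes.\<close>

definition step_box :: "nat \<Rightarrow> rat list \<Rightarrow> nat \<Rightarrow> (real \<Rightarrow> real) set" where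
  "step_box m r j = {v \<in> path_set. \<forall>k<length r. \<forall>x\<in>{real k / real m..real (Suc k) / real m}.
     \<bar>v x - of_rat (r ! k)\<bar> \<le> 1 / real (Suc j)}"

lemma continuous_on_abs_le_dense:
  fixes v :: "real \<Rightarrow> real"
  assumes "continuous_on {a..b} v" "a < b"
    and "\<forall>x\<in>{a<..<b} \<inter> \<rat>. \<bar>v x - q\<bar> \<le> e" and "x \<in> {a..b}"
  shows "\<bar>v x - q\<bar> \<le> e"
proof -
  have cl: "closure ({a<..<b} \<inter> \<rat>) = {a..b}"
    using closure_open_Int_superset[of "{a<..<b}" "\<rat>"] assms(2) by (simp add: Rats_closure_real)
  have "norm ((\<lambda>x. v x - q) x) \<le> e"
    by (rule continuous_on_closure_norm_le[of "{a<..<b} \<inter> \<rat>"])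
       (use assms cl in \<open>auto intro!: continuous_intros\<close>)
  then show ?thesis by simp
qed

text \<open>A non-strict inequality for a continuous path only has to be tested at the rational
  times inside each cell, so a tube is a countable intersection of cylinders over single
  times.\<close>

lemma step_box_in_sigma_cylinders:
  assumes "m > 0"
  shows "step_box m r j \<in> sigma_sets path_set cylinders"
proof -
  interpret sigma_algebra path_set "sigma_sets path_set cylinders"
    using cylinders_subset by (rule sigma_algebra_sigma_sets)
  define I where "I = (SIGMA k:{..<length r}. {real k / real m<..<real (Suc k) / real m} \<inter> \<rat>)"
  have "countable I" unfolding I_def by (intro countable_SIGMA) (auto simp: countable_rat)
  have eq: "step_box m r j = path_set \<inter> (\<Inter>i\<in>I. {v \<in> path_set. \<bar>v (snd i) - of_rat (r ! fst i)\<bar> \<le> 1 / real (Suc j)})"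
    (is "_ = ?R")
  proof (rule Set.set_eqI, rule iffI)
    fix v assume "v \<in> step_box m r j"
    then show "v \<in> ?R" unfolding step_box_def I_def by fastforce
  next
    fix v assume v: "v \<in> ?R"
    show "v \<in> step_box m r j" unfolding step_box_def mem_Collect_eq
    proof (intro conjI allI impI ballI)
      show "v \<in> path_set" using v by blast
      fix k x assume k: "k < length r" and x: "x \<in> {real k / real m..real (Suc k) / real m}"
      show "\<bar>v x - of_rat (r ! k)\<bar> \<le> 1 / real (Suc j)"
      proof (rule continuous_on_abs_le_dense[OF _ _ _ x])
        have "continuous_on {0..} v" using v by (auto simp: path_set_def)
        then show "continuous_on {real k / real m..real (Suc k) / real m} v"
          by (rule continuous_on_subset) (auto intro: order_trans[of 0 "real k / real m"])
        show "real k / real m < real (Suc k) / real m" using assms by (simp add: divide_strict_right_mono)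
        show "\<forall>x\<in>{real k / real m<..<real (Suc k) / real m} \<inter> \<rat>. \<bar>v x - of_rat (r ! k)\<bar> \<le> 1 / real (Suc j)"
        proof
          fix y assume "y \<in> {real k / real m<..<real (Suc k) / real m} \<inter> \<rat>"
          then have "(k, y) \<in> I" using k by (simp add: I_def)
          then show "\<bar>v y - of_rat (r ! k)\<bar> \<le> 1 / real (Suc j)" using v by fastforce
        qed
      qed
    qed
  qed
  have cell: "{v \<in> path_set. \<bar>v (snd i) - of_rat (r ! fst i)\<bar> \<le> 1 / real (Suc j)} \<in> sigma_sets path_set cylinders"
    if "i \<in> I" for i
  proof (rule sigma_sets.Basic)
    have "0 \<le> real (fst i) / real m" by simp
    moreover have "real (fst i) / real m < snd i" using that by (auto simp: I_def)
    ultimately have "snd i \<ge> 0" by linarith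
    then show "{v \<in> path_set. \<bar>v (snd i) - of_rat (r ! fst i)\<bar> \<le> 1 / real (Suc j)} \<in> cylinders"
      unfolding cylinders_def mem_Collect_eq
      by (intro exI[of _ "{snd i}"] exI[of _ "\<lambda>_. cball (of_rat (r ! fst i)) (1 / real (Suc j))"])
         (auto simp: dist_real_def abs_minus_commute)
  qed
  \<comment> \<open>Countable intersections need a nonempty index set; with an empty one the tube is
    all of \<open>path_set\<close>.\<close>
  show ?thesis
  proof (cases "I = {}")
    case True
    then have "step_box m r j = path_set" unfolding eq by auto
    then show ?thesis using top by simp
  next
    case False
    show ?thesis unfolding eq
      by (intro Int top countable_INT'[OF \<open>countable I\<close> False]) (use cell in auto)
  qed
qed

lemma step_box_in_open:
  assumes "ucc_open U" "w \<in> U"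
  shows "\<exists>m r j. m > 0 \<and> w \<in> step_box m r j \<and> step_box m r j \<subseteq> U"
proof -
  obtain K e where K: "compact K" "K \<subseteq> {0..}" "e > 0"
    and U: "\<forall>v\<in>path_set. (\<forall>x\<in>K. \<bar>v x - w x\<bar> < e) \<longrightarrow> v \<in> U"
    using assms unfolding ucc_open_def by meson
  have w: "w \<in> path_set" using assms by (auto simp: ucc_open_def)
  obtain N0 :: nat where N0: "K \<subseteq> {0..real N0}"
  proof -
    obtain b where "\<forall>x\<in>K. norm x \<le> b" using K(1) compact_imp_bounded bounded_iff by blast
    moreover obtain N0 where "b \<le> real N0" using real_arch_simple by blast
    ultimately have "K \<subseteq> {0..real N0}" using K(2) by fastforce
    then show ?thesis using that by blast
  qed
  \<comment> \<open>A path in the tube and \<open>w\<close> itself both lie within 1/(j+1) of the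
    same rational height, hence the factor 2.\<close>
  obtain j where j: "1 / real (Suc j) < e / 2"
    using K(3) by (metis half_gt_zero nat_approx_posE)
  have "uniformly_continuous_on {0..real N0 + 1} w"
    by (rule compact_uniformly_continuous)
       (use w in \<open>auto simp: path_set_def intro: continuous_on_subset\<close>)
  then obtain d where d: "d > 0" "\<And>x y. x \<in> {0..real N0 + 1} \<Longrightarrow> y \<in> {0..real N0 + 1} \<Longrightarrow>
      \<bar>x - y\<bar> < d \<Longrightarrow> \<bar>w x - w y\<bar> < 1 / (2 * real (Suc j))"
  proof -
    have "1 / (2 * real (Suc j)) > 0" by simp
    then show ?thesis
      using \<open>uniformly_continuous_on {0..real N0 + 1} w\<close> that
      unfolding uniformly_continuous_on_def dist_real_def by (meson abs_minus_commute)
  qed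
  obtain m0 where m0: "1 / real (Suc m0) < d" using d(1) nat_approx_posE by blast
  define m where "m = Suc m0"
  have m: "m > 0" "1 / real m < d" using m0 by (auto simp: m_def)
  have "\<exists>q::rat. \<bar>w (real k / real m) - of_rat q\<bar> < 1 / (2 * real (Suc j))" for k
  proof -
    have "w (real k / real m) - 1 / (2 * real (Suc j)) < w (real k / real m)" by simp
    then obtain q where "w (real k / real m) - 1 / (2 * real (Suc j)) < of_rat q" "of_rat q < w (real k / real m)"
      using of_rat_dense by blast
    then show ?thesis by (intro exI[of _ q]) linarith
  qed
  then obtain Q where Q: "\<And>k. \<bar>w (real k / real m) - of_rat (Q k)\<bar> < 1 / (2 * real (Suc j))" by metis
  \<comment> \<open>The extra cell catches the endpoint x = N0, whose cell index is exactly
    \<open>N0 * m\<close>. It reaches into [N0, N0 + 1], which is why uniform continuity was taken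
    up to N0 + 1.\<close>
  define r where "r = map Q [0..<N0 * m + 1]"
  have lr: "length r = N0 * m + 1" and rk: "k < N0 * m + 1 \<Longrightarrow> r ! k = Q k" for k
    by (auto simp: r_def simp del: upt_Suc)
  have half: "1 / (2 * real (Suc j)) + 1 / (2 * real (Suc j)) = 1 / real (Suc j)" by (simp add: field_simps)
  have "w \<in> step_box m r j" unfolding step_box_def mem_Collect_eq
  proof (intro conjI allI impI ballI w)
    fix k x assume k: "k < length r" and x: "x \<in> {real k / real m..real (Suc k) / real m}"
    have kk: "k \<le> N0 * m" using k lr by simp
    have km: "real k / real m \<le> real N0" using m kk
      by (simp add: divide_le_eq) (metis of_nat_le_iff of_nat_mult)
    have s: "real (Suc k) / real m = real k / real m + 1 / real m" by (simp add: add_divide_distrib)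
    have m1: "1 / real m \<le> 1" using m(1) by simp
    define b where "b = real k / real m"
    have b: "0 \<le> b" "b \<le> real N0" "b \<le> x" "x \<le> b + 1 / real m"
      using x km s by (auto simp: b_def)
    have "\<bar>w x - w b\<bar> < 1 / (2 * real (Suc j))"
    proof (rule d(2))
      show "x \<in> {0..real N0 + 1}" "b \<in> {0..real N0 + 1}" using b m1 by auto
      show "\<bar>x - b\<bar> < d" using b m(2) by linarith
    qed
    then have "\<bar>w x - w (real k / real m)\<bar> < 1 / (2 * real (Suc j))" by (simp add: b_def)
    then show "\<bar>w x - of_rat (r ! k)\<bar> \<le> 1 / real (Suc j)"
      using Q[of k] half k lr rk by simp
  qed
  moreover have "step_box m r j \<subseteq> U"
  proof
    fix v assume v: "v \<in> step_box m r j"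
    have "\<bar>v x - w x\<bar> < e" if "x \<in> K" for x
    proof -
      have x: "0 \<le> x" "x \<le> real N0" using that N0 by auto
      define k where "k = nat \<lfloor>x * real m\<rfloor>"
      have k: "real k \<le> x * real m" "x * real m < real k + 1"
        unfolding k_def using x m by (auto simp: of_nat_nat)
      have "real k \<le> real N0 * real m" using k(1) x m by (meson mult_right_mono of_nat_0_le_iff order_trans)
      then have "k \<le> N0 * m" by (metis of_nat_le_iff of_nat_mult)
      then have kl: "k < length r" by (simp add: lr)
      have xc: "x \<in> {real k / real m..real (Suc k) / real m}"
        using k m by (auto simp: field_simps)
      have "\<bar>v x - of_rat (r ! k)\<bar> \<le> 1 / real (Suc j)" using v kl xc unfolding step_box_def by blast
      moreover have "\<bar>w x - of_rat (r ! k)\<bar> \<le> 1 / real (Suc j)"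
        using \<open>w \<in> step_box m r j\<close> kl xc unfolding step_box_def by blast
      ultimately show ?thesis using j by linarith
    qed
    then show "v \<in> U" using U v by (auto simp: step_box_def)
  qed
  ultimately show ?thesis using m by blast
qed

text \<open>An open set is the union of all tubes that it contains, and there are only countably
  many tubes, so it lies in the sigma-field of the cylinders. The converse inclusion is
  measurability of evaluations.\<close>

lemma sets_path_space_cylinders: "sets path_space = sigma_sets path_set cylinders"
proof
  interpret sigma_algebra path_set "sigma_sets path_set cylinders"
    using cylinders_subset by (rule sigma_algebra_sigma_sets)
  show "sets path_space \<subseteq> sigma_sets path_set cylinders"
    unfolding sets_path_space
  proof (rule sigma_sets_subset)
    show "{U. ucc_open U} \<subseteq> sigma_sets path_set cylinders"
    proof
      fix U assume "U \<in> {U. ucc_open U}"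
      then have U: "ucc_open U" by simp
      define J where "J = {(m, r, j). m > 0 \<and> step_box m r j \<subseteq> U}"
      have "U = (\<Union>(m, r, j)\<in>J. step_box m r j)"
        using step_box_in_open[OF U] by (fastforce simp: J_def)
      moreover have "(\<Union>(m, r, j)\<in>J. step_box m r j) \<in> sigma_sets path_set cylinders"
        by (intro countable_UN'') (auto simp: J_def intro: step_box_in_sigma_cylinders)
      ultimately show "U \<in> sigma_sets path_set cylinders" by simp
    qed
  qed
  interpret P: sigma_algebra path_set "sets path_space"
    using sets.sigma_algebra_axioms[of path_space] by (simp add: space_path_space)
  show "sigma_sets path_set cylinders \<subseteq> sets path_space"
  proof (rule P.sigma_sets_subset)
    show "cylinders \<subseteq> sets path_space"
    proof
      fix a assume "a \<in> cylinders"
      then obtain F A where a: "a = {w \<in> path_set. \<forall>x\<in>F. w x \<in> A x}" "finite F" "F \<subseteq> {0..}"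
        "\<forall>x\<in>F. A x \<in> sets borel" unfolding cylinders_def by blast
      have *: "coord x \<in> borel_measurable path_space" if "x \<in> F" for x
        using that a by (intro measurable_coord) auto
      have "{w \<in> space path_space. \<forall>x\<in>F. coord x w \<in> A x} \<in> sets path_space"
        by (rule sets.sets_Collect_finite_All) (use a * in \<open>auto intro: measurable_sets_Collect\<close>)
      then show "a \<in> sets path_space" by (simp add: a(1) space_path_space coord_def)
    qed
  qed
qed

lemma measurable_into_path_space:
  assumes "\<And>\<omega>. \<omega> \<in> space M \<Longrightarrow> X \<omega> \<in> path_set"
    and "\<And>x. x \<ge> 0 \<Longrightarrow> (\<lambda>\<omega>. X \<omega> x) \<in> borel_measurable M"
  shows "X \<in> measurable M path_space"
proof (rule measurable_sigma_sets[OF sets_path_space_cylinders cylinders_subset])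
  show "X \<in> space M \<rightarrow> path_set" using assms(1) by auto
  fix a assume "a \<in> cylinders"
  then obtain F A where a: "a = {w \<in> path_set. \<forall>x\<in>F. w x \<in> A x}" "finite F" "F \<subseteq> {0..}"
    "\<forall>x\<in>F. A x \<in> sets borel" unfolding cylinders_def by blast
  have "{\<omega> \<in> space M. \<forall>x\<in>F. X \<omega> x \<in> A x} \<in> sets M"
    by (rule sets.sets_Collect_finite_All)
       (use a assms(2) in \<open>auto intro: measurable_sets_Collect\<close>)
  moreover have "X -` a \<inter> space M = {\<omega> \<in> space M. \<forall>x\<in>F. X \<omega> x \<in> A x}"
    using assms(1) by (auto simp: a)
  ultimately show "X -` a \<inter> space M \<in> sets M" by simp
qed

section \<open>Uniqueness of Gaussian laws through characteristic functionals\<close>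

lemma iexp_mult: "iexp (a + b) = iexp a * iexp (b :: real)"
  by (simp add: exp_add[symmetric] algebra_simps)

text \<open>Dividing the weight by its total mass \<open>m\<close> gives a probability measure, to
  which the uniqueness theorem for characteristic functions applies; s = 0 shows that both masses
  agree. For m = 0 both sides vanish.\<close>

lemma weighted_Levy_uniqueness:
  fixes Y w :: "'a \<Rightarrow> real" and Y' w' :: "'b \<Rightarrow> real"
  assumes "prob_space P" "prob_space Q"
    and [measurable]: "Y \<in> borel_measurable P" "w \<in> borel_measurable P"
      "Y' \<in> borel_measurable Q" "w' \<in> borel_measurable Q"
    and w: "\<And>x. 0 \<le> w x" "\<And>x. w x \<le> K" and w': "\<And>x. 0 \<le> w' x" "\<And>x. w' x \<le> K"
    and eq: "\<And>s. (LINT x|P. w x *\<^sub>R iexp (s * Y x)) = (LINT x|Q. w' x *\<^sub>R iexp (s * Y' x))"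
    and [measurable]: "B \<in> sets borel"
  shows "(LINT x|P. w x * indicator B (Y x)) = (LINT x|Q. w' x * indicator B (Y' x))"
proof -
  interpret P: prob_space P by fact
  interpret Q: prob_space Q by fact
  define m where "m = (LINT x|P. w x)"
  have intP: "integrable P w" by (rule P.integrable_const_bound[of _ K]) (use w in auto)
  have intQ: "integrable Q w'" by (rule Q.integrable_const_bound[of _ K]) (use w' in auto)
  have m': "m = (LINT x|Q. w' x)"
    using eq[of 0] by (simp add: m_def scaleR_conv_of_real)
  have m0: "m \<ge> 0" unfolding m_def using w by (intro integral_nonneg_AE) auto
  show ?thesis
  proof (cases "m = 0")
    case True
    have "AE x in P. w x = 0"
      using integral_nonneg_eq_0_iff_AE[OF intP] w True by (simp add: m_def)
    then have "(LINT x|P. w x * indicator B (Y x)) = (LINT x|P. 0)"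
      by (intro integral_cong_AE) auto
    moreover have "AE x in Q. w' x = 0"
      using integral_nonneg_eq_0_iff_AE[OF intQ] w' True m' by simp
    then have "(LINT x|Q. w' x * indicator B (Y' x)) = (LINT x|Q. 0)"
      by (intro integral_cong_AE) auto
    ultimately show ?thesis by simp
  next
    case False
    then have mp: "m > 0" using m0 by simp
    have *: "real_distribution (distr (density M (\<lambda>x. ennreal (v x / m))) borel Z) \<and>
        (\<forall>s. char (distr (density M (\<lambda>x. ennreal (v x / m))) borel Z) s
          = (1 / m) *\<^sub>R (LINT x|M. v x *\<^sub>R iexp (s * Z x))) \<and>
        measure (distr (density M (\<lambda>x. ennreal (v x / m))) borel Z) B = (1 / m) * (LINT x|M. v x * indicator B (Z x))"
      if "prob_space M" and [measurable]: "Z \<in> borel_measurable M" "v \<in> borel_measurable M"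
        and v: "\<And>x. 0 \<le> v x" "integrable M v" "(LINT x|M. v x) = m"
      for M :: "'c measure" and Z v
    proof -
      interpret M: prob_space M by fact
      have "emeasure (density M (\<lambda>x. ennreal (v x / m))) (space (density M (\<lambda>x. ennreal (v x / m)))) = 1"
      proof -
        have "emeasure (density M (\<lambda>x. ennreal (v x / m))) (space M) = (\<integral>\<^sup>+x. ennreal (v x / m) \<partial>M)"
          by (subst emeasure_density) (auto intro!: nn_integral_cong)
        also have "\<dots> = ennreal (LINT x|M. v x / m)"
          by (rule nn_integral_eq_integral) (use v mp in auto)
        also have "\<dots> = 1" using v mp by simp
        finally show ?thesis by simp
      qed
      then interpret D: prob_space "density M (\<lambda>x. ennreal (v x / m))" by (rule prob_spaceI)
      interpret R: prob_space "distr (density M (\<lambda>x. ennreal (v x / m))) borel Z"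
        by (rule D.prob_space_distr) auto
      have "real_distribution (distr (density M (\<lambda>x. ennreal (v x / m))) borel Z)"
        by (intro real_distribution.intro R.prob_space_axioms real_distribution_axioms.intro) auto
      moreover have "char (distr (density M (\<lambda>x. ennreal (v x / m))) borel Z) s
          = (1 / m) *\<^sub>R (LINT x|M. v x *\<^sub>R iexp (s * Z x))" for s
      proof -
        have "char (distr (density M (\<lambda>x. ennreal (v x / m))) borel Z) s = (LINT x|M. (v x / m) *\<^sub>R iexp (s * Z x))"
          unfolding char_def using v mp by (simp add: integral_distr integral_density)
        also have "\<dots> = (LINT x|M. (1 / m) *\<^sub>R (v x *\<^sub>R iexp (s * Z x)))" by simp
        finally show ?thesis unfolding integral_scaleR_right .
      qed
      moreover have "measure (distr (density M (\<lambda>x. ennreal (v x / m))) borel Z) B = (1 / m) * (LINT x|M. v x * indicator B (Z x))"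
      proof -
        have "measure (distr (density M (\<lambda>x. ennreal (v x / m))) borel Z) B
            = (LINT y|distr (density M (\<lambda>x. ennreal (v x / m))) borel Z. indicator B y)"
          by simp
        also have "\<dots> = (LINT x|M. (v x / m) *\<^sub>R indicator B (Z x))"
          using v mp by (subst integral_distr) (auto simp: integral_density)
        also have "\<dots> = (LINT x|M. (1 / m) * (v x * indicator B (Z x)))" by simp
        finally show ?thesis unfolding integral_mult_right_zero .
      qed
      ultimately show ?thesis by blast
    qed
    note 1 = *[OF \<open>prob_space P\<close> assms(3,4) w(1) intP m_def[symmetric]]
    note 2 = *[OF \<open>prob_space Q\<close> assms(5,6) w'(1) intQ m'[symmetric]]
    have "distr (density P (\<lambda>x. ennreal (w x / m))) borel Y = distr (density Q (\<lambda>x. ennreal (w' x / m))) borel Y'"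
      using 1 2 eq by (intro Levy_uniqueness ext) auto
    then show ?thesis using 1 2 mp by simp
  qed
qed

lemma prod_indicator_bounds:
  fixes Y :: "'t \<Rightarrow> 'a \<Rightarrow> real"
  shows "0 \<le> (\<Prod>t\<in>F. indicator (A t) (Y t x) :: real)" "(\<Prod>t\<in>F. indicator (A t) (Y t x) :: real) \<le> 1"
  by (auto intro!: prod_nonneg prod_le_1)

text \<open>Joint laws are recovered from the characteristic functional one coordinate at a time;
  the weights \<open>1 + cos (\<dots>)\<close> keep all measures in the induction nonnegative.\<close>

lemma joint_law_unique:
  fixes Y :: "'t \<Rightarrow> 'a \<Rightarrow> real"
  assumes P: "prob_space P" and Q: "prob_space Q"
    and G: "finite G" and YP: "\<And>t. t \<in> G \<Longrightarrow> Y t \<in> borel_measurable P"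
    and YQ: "\<And>t. t \<in> G \<Longrightarrow> Y t \<in> borel_measurable Q"
    and eq: "\<And>a. (LINT x|P. iexp (\<Sum>t\<in>G. a t * Y t x)) = (LINT x|Q. iexp (\<Sum>t\<in>G. a t * Y t x))"
    and F: "F \<subseteq> G" and A: "\<And>t. t \<in> F \<Longrightarrow> A t \<in> sets borel"
  shows "(LINT x|P. (\<Prod>t\<in>F. indicator (A t) (Y t x) :: real) *\<^sub>R iexp (\<Sum>t\<in>G. a t * Y t x))
    = (LINT x|Q. (\<Prod>t\<in>F. indicator (A t) (Y t x) :: real) *\<^sub>R iexp (\<Sum>t\<in>G. a t * Y t x))"
proof -
  have "finite F" using F G finite_subset by blast
  then show ?thesis using F A
  proof (induction F arbitrary: a)
    case empty
    show ?case using eq[of a] by simp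
  next
    case (insert u F)
    interpret P: prob_space P by fact
    interpret Q: prob_space Q by fact
    define g where "g = (\<lambda>x. \<Prod>t\<in>F. indicator (A t) (Y t x) :: real)"
    define \<theta> where "\<theta> = (\<lambda>x. \<Sum>t\<in>G. a t * Y t x)"
    have Au: "A u \<in> sets borel" and uG: "u \<in> G" using insert.prems by auto
    have gb: "0 \<le> g x" "g x \<le> 1" for x unfolding g_def by (rule prod_indicator_bounds)+
    have meas: "g \<in> borel_measurable M" "\<theta> \<in> borel_measurable M" "Y u \<in> borel_measurable M"
      if "\<And>t. t \<in> G \<Longrightarrow> Y t \<in> borel_measurable M" for M
    proof -
      have "(\<lambda>x. indicator (A t) (Y t x) :: real) \<in> borel_measurable M" if "t \<in> F" for t
        using that insert.prems \<open>\<And>t. t \<in> G \<Longrightarrow> Y t \<in> borel_measurable M\<close>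
        by (intro measurable_compose[OF _ borel_measurable_indicator]) auto
      then show "g \<in> borel_measurable M" unfolding g_def by (intro borel_measurable_prod)
      show "\<theta> \<in> borel_measurable M" "Y u \<in> borel_measurable M"
        unfolding \<theta>_def using that uG by (auto intro!: borel_measurable_sum borel_measurable_times)
    qed
    have mP[measurable]: "g \<in> borel_measurable P" "\<theta> \<in> borel_measurable P" "Y u \<in> borel_measurable P"
      by (rule meas; rule YP; assumption)+
    have mQ[measurable]: "g \<in> borel_measurable Q" "\<theta> \<in> borel_measurable Q" "Y u \<in> borel_measurable Q"
      by (rule meas; rule YQ; assumption)+
    \<comment> \<open>A phase built from \<open>Y u\<close> and \<open>\<theta>\<close> is again a
      linear combination over \<open>G\<close>, so the induction hypothesis, being stated for all
      coefficients, covers every phase that occurs below.\<close>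
    have IH: "(LINT x|P. g x *\<^sub>R iexp (s * Y u x + c * \<theta> x)) = (LINT x|Q. g x *\<^sub>R iexp (s * Y u x + c * \<theta> x))" for s c
    proof -
      have "s * Y u x + c * \<theta> x = (\<Sum>t\<in>G. (c * a t + (if t = u then s else 0)) * Y t x)" for x
      proof -
        have "(\<Sum>t\<in>G. (c * a t + (if t = u then s else 0)) * Y t x)
            = (\<Sum>t\<in>G. c * (a t * Y t x)) + (\<Sum>t\<in>G. if t = u then s * Y t x else 0)"
          unfolding sum.distrib[symmetric] by (intro sum.cong refl) (auto simp: algebra_simps)
        then show ?thesis using G uG by (simp add: \<theta>_def sum_distrib_left)
      qed
      then show ?thesis
        using insert.IH[of "\<lambda>t. c * a t + (if t = u then s else 0)"] insert.prems by (simp add: g_def)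
    qed
    have int: "integrable M (\<lambda>x. g x *\<^sub>R iexp (f x))"
      if "prob_space M" "g \<in> borel_measurable M" "f \<in> borel_measurable M" for M and f :: "'a \<Rightarrow> real"
    proof -
      interpret M: prob_space M by fact
      show ?thesis
        by (rule M.integrable_const_bound[of _ 1]) (use that gb in auto)
    qed
    define w where "w = (\<lambda>b x. g x * (1 + cos (\<theta> x + b)))"
    \<comment> \<open>By Euler's formula the weighted exponential is a sum of three pure
      exponentials, with phases shifted by 0, + \<theta> and - \<theta>.\<close>
    have w_split: "w b x *\<^sub>R iexp (s * Y u x) = g x *\<^sub>R iexp (s * Y u x + 0 * \<theta> x)
        + (iexp b / 2) * (g x *\<^sub>R iexp (s * Y u x + 1 * \<theta> x)) + (iexp (-b) / 2) * (g x *\<^sub>R iexp (s * Y u x + (-1) * \<theta> x))"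
      for b s x
    proof -
      have "complex_of_real (cos (\<theta> x + b)) = (iexp (\<theta> x + b) + iexp (-(\<theta> x + b))) / 2"
        unfolding cos_of_real[symmetric] cos_exp_eq by (simp add: algebra_simps)
      also have "\<dots> = (iexp (\<theta> x) * iexp b + iexp (- \<theta> x) * iexp (- b)) / 2"
        by (simp only: minus_add_distrib iexp_mult)
      finally have c: "complex_of_real (cos (\<theta> x + b)) = (iexp (\<theta> x) * iexp b + iexp (- \<theta> x) * iexp (- b)) / 2" .
      have e: "iexp (s * Y u x + 0 * \<theta> x) = iexp (s * Y u x)"
        "iexp (s * Y u x + 1 * \<theta> x) = iexp (s * Y u x) * iexp (\<theta> x)"
        "iexp (s * Y u x + (-1) * \<theta> x) = iexp (s * Y u x) * iexp (- \<theta> x)"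
        by (simp_all only: iexp_mult mult_1 mult_minus1 mult_zero_left add_0_right)
      show ?thesis
        unfolding e w_def scaleR_conv_of_real of_real_mult[of "g x"] of_real_add[of 1] of_real_1 c
        by (simp add: algebra_simps)
    qed
    have weq: "(LINT x|P. w b x *\<^sub>R iexp (s * Y u x)) = (LINT x|Q. w b x *\<^sub>R iexp (s * Y u x))" for b s
    proof -
      have "(LINT x|M. w b x *\<^sub>R iexp (s * Y u x)) =
          (LINT x|M. g x *\<^sub>R iexp (s * Y u x + 0 * \<theta> x)) + (iexp b / 2) * (LINT x|M. g x *\<^sub>R iexp (s * Y u x + 1 * \<theta> x))
          + (iexp (-b) / 2) * (LINT x|M. g x *\<^sub>R iexp (s * Y u x + (-1) * \<theta> x))"
        if M: "prob_space M" "g \<in> borel_measurable M" "\<theta> \<in> borel_measurable M" "Y u \<in> borel_measurable M" for M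
      proof -
        note [measurable] = M(2-4)
        have i: "integrable M (\<lambda>x. g x *\<^sub>R iexp (s * Y u x + c * \<theta> x))" for c
          by (rule int[OF M(1)]) auto
        show ?thesis unfolding w_split
          by (subst Bochner_Integration.integral_add, intro Bochner_Integration.integrable_add integrable_mult_right i,
              intro integrable_mult_right i,
              subst Bochner_Integration.integral_add, rule i, intro integrable_mult_right i)
             (simp only: integral_mult_right_zero)
      qed
      note r = this
      show ?thesis unfolding r[OF P mP] r[OF Q mQ] IH ..
    qed
    have wb: "0 \<le> w b x" "w b x \<le> 2" for b x
    proof -
      have c: "-1 \<le> cos (\<theta> x + b)" "cos (\<theta> x + b) \<le> 1" by auto
      have c2: "0 \<le> 1 + cos (\<theta> x + b)" "1 + cos (\<theta> x + b) \<le> 2" using c by linarith+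
      show "0 \<le> w b x" unfolding w_def by (rule mult_nonneg_nonneg[OF gb(1) c2(1)])
      have "g x * (1 + cos (\<theta> x + b)) \<le> 1 * 2" by (rule mult_mono[OF gb(2) c2(2)]) (use c2 in auto)
      then show "w b x \<le> 2" by (simp add: w_def)
    qed
    have wmeas[measurable]: "w b \<in> borel_measurable P" "w b \<in> borel_measurable Q" for b
      unfolding w_def by measurable
    have ind: "(LINT x|P. w b x * indicator (A u) (Y u x)) = (LINT x|Q. w b x * indicator (A u) (Y u x))" for b
      by (rule weighted_Levy_uniqueness[OF P Q _ _ _ _ wb wb weq Au]) auto
    have ind0: "(LINT x|P. g x * indicator (A u) (Y u x)) = (LINT x|Q. g x * indicator (A u) (Y u x))"
    proof (rule weighted_Levy_uniqueness[OF P Q _ _ _ _ gb gb _ Au])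
      show "(LINT x|P. g x *\<^sub>R iexp (s * Y u x)) = (LINT x|Q. g x *\<^sub>R iexp (s * Y u x))" for s
        using IH[of s 0] by simp
    qed auto
    define h where "h = (\<lambda>x. g x * indicator (A u) (Y u x))"
    have hmeas: "h \<in> borel_measurable M" if "g \<in> borel_measurable M" "Y u \<in> borel_measurable M" for M
      unfolding h_def using that Au by measurable
    have hb: "0 \<le> h x" "h x \<le> 1" for x using gb[of x] by (auto simp: h_def indicator_def)
    have hi: "integrable M h" "integrable M (\<lambda>x. h x * cos (\<theta> x + b))"
      if M: "prob_space M" "g \<in> borel_measurable M" "\<theta> \<in> borel_measurable M" "Y u \<in> borel_measurable M" for M b
    proof -
      interpret M: prob_space M by fact
      note [measurable] = M(2-4) hmeas[OF M(2,4)]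
      show "integrable M h" by (rule M.integrable_const_bound[of _ 1]) (use hb in auto)
      have "\<bar>h x * cos (\<theta> x + b)\<bar> \<le> 1 * 1" for x
        unfolding abs_mult using hb[of x] by (intro mult_mono) auto
      then show "integrable M (\<lambda>x. h x * cos (\<theta> x + b))"
        by (intro M.integrable_const_bound[of _ 1]) auto
    qed
    have cs: "(LINT x|P. h x * cos (\<theta> x + b)) = (LINT x|Q. h x * cos (\<theta> x + b))" for b
    proof -
      have "(LINT x|M. w b x * indicator (A u) (Y u x)) = (LINT x|M. h x) + (LINT x|M. h x * cos (\<theta> x + b))"
        if M: "prob_space M" "g \<in> borel_measurable M" "\<theta> \<in> borel_measurable M" "Y u \<in> borel_measurable M" for M
        by (subst Bochner_Integration.integral_add[symmetric, OF hi(1)[OF M] hi(2)[OF M]])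
           (auto simp: w_def h_def algebra_simps intro!: Bochner_Integration.integral_cong)
      from this[OF P mP] this[OF Q mQ] ind[of b] ind0 show ?thesis by (simp add: h_def)
    qed
    \<comment> \<open>The shifts 0 and - pi / 2 of the cosine give the real and the imaginary part
      of \<open>iexp (\<theta> x)\<close>.\<close>
    have fin: "(LINT x|M. (\<Prod>t\<in>insert u F. indicator (A t) (Y t x) :: real) *\<^sub>R iexp (\<Sum>t\<in>G. a t * Y t x))
       = complex_of_real (LINT x|M. h x * cos (\<theta> x + 0)) + \<i> * complex_of_real (LINT x|M. h x * cos (\<theta> x + (- pi / 2)))"
      if M: "prob_space M" "g \<in> borel_measurable M" "\<theta> \<in> borel_measurable M" "Y u \<in> borel_measurable M" for M
    proof -
      have "(\<Prod>t\<in>insert u F. indicator (A t) (Y t x) :: real) *\<^sub>R iexp (\<Sum>t\<in>G. a t * Y t x)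
        = complex_of_real (h x * cos (\<theta> x + 0)) + \<i> * complex_of_real (h x * cos (\<theta> x + (- pi / 2)))" for x
      proof -
        have 1: "(\<Prod>t\<in>insert u F. indicator (A t) (Y t x) :: real) = h x"
          using insert.hyps by (simp add: h_def g_def mult.commute)
        have 2: "iexp (\<theta> x) = complex_of_real (cos (\<theta> x)) + \<i> * complex_of_real (sin (\<theta> x))"
          by (simp only: exp_Euler cos_of_real sin_of_real)
        have 3: "cos (\<theta> x + (- pi / 2)) = sin (\<theta> x)" by (simp add: cos_diff)
        have 4: "(\<Sum>t\<in>G. a t * Y t x) = \<theta> x" by (simp add: \<theta>_def)
        show ?thesis unfolding 1 4 2 3 by (simp add: scaleR_conv_of_real distrib_left)
      qed
      then show ?thesis
        by (simp only: Bochner_Integration.integral_add integrable_of_real[OF hi(2)[OF M]] integral_mult_right_zero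
             integrable_mult_right integral_complex_of_real)
    qed
    show ?case unfolding fin[OF P mP] fin[OF Q mQ] cs ..
  qed
qed

lemma (in prob_space) gaussian_rv_iexp:
  assumes "gaussian_rv M Y" "expectation Y = 0" "expectation (\<lambda>x. (Y x)\<^sup>2) = v"
  shows "(LINT x|M. iexp (Y x)) = exp (- (1 / 2) * v)"
proof -
  have [measurable]: "Y \<in> borel_measurable M" using assms(1) by (simp add: gaussian_rv_def)
  consider m where "AE x in M. Y x = m"
    | m s where "s > 0" "distributed M lborel Y (\<lambda>x. ennreal (normal_density m s x))"
    using assms(1) unfolding gaussian_rv_def by blast
  then show ?thesis
  proof cases
    case (1 m)
    have "expectation Y = expectation (\<lambda>_. m)" by (rule integral_cong_AE) (use 1 in auto)
    then have "m = 0" using assms(2) by (simp add: prob_space)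
    then have AE: "AE x in M. Y x = 0" using 1 by simp
    have "expectation (\<lambda>x. (Y x)\<^sup>2) = expectation (\<lambda>_. 0)" by (rule integral_cong_AE) (use AE in auto)
    then have "v = 0" using assms(3) by simp
    have "(LINT x|M. iexp (Y x)) = (LINT x|M. 1)" by (rule integral_cong_AE) (use AE in auto)
    then show ?thesis using \<open>v = 0\<close> by (simp add: prob_space)
  next
    case (2 m s)
    have "expectation Y = m" by (rule normal_distributed_expectation[OF 2])
    then have m: "m = 0" using assms(2) by simp
    have "variance Y = s\<^sup>2" by (rule normal_distributed_variance[OF 2])
    then have v: "v = s\<^sup>2" using assms by simp
    define Z where "Z = (\<lambda>x. (Y x - m) / s)"
    have Z: "distributed M lborel Z (\<lambda>x. ennreal (std_normal_density x))"
      using normal_standard_normal_convert[OF 2(1), of Y m] 2(2) by (simp add: Z_def)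
    then have d: "distr M lborel Z = std_normal_distribution"
      by (simp add: distributed_def)
    have [measurable]: "Z \<in> borel_measurable M" unfolding Z_def by simp
    have "(LINT x|M. iexp (Y x)) = (LINT x|M. iexp (s * Z x))"
      using 2(1) m by (simp add: Z_def)
    also have "\<dots> = (LINT z|distr M lborel Z. iexp (s * z))" by (subst integral_distr) auto
    also have "\<dots> = char std_normal_distribution s" unfolding d char_def ..
    also have "\<dots> = exp (- (1 / 2) * v)" unfolding char_std_normal_distribution v by simp
    finally show ?thesis .
  qed
qed

lemma (in prob_space) gaussian_rv_moments:
  assumes "gaussian_rv M Y"
  shows "integrable M Y" "integrable M (\<lambda>x. (Y x)\<^sup>2)"
proof -
  have [measurable]: "Y \<in> borel_measurable M" using assms(1) by (simp add: gaussian_rv_def)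
  consider m where "AE x in M. Y x = m"
    | m s where "s > 0" "distributed M lborel Y (\<lambda>x. ennreal (normal_density m s x))"
    using assms(1) unfolding gaussian_rv_def by blast
  then have "integrable M Y \<and> integrable M (\<lambda>x. (Y x)\<^sup>2)"
  proof cases
    case (1 m)
    have "integrable M Y \<longleftrightarrow> integrable M (\<lambda>_. m)"
      "integrable M (\<lambda>x. (Y x)\<^sup>2) \<longleftrightarrow> integrable M (\<lambda>_. m\<^sup>2)"
      by (rule integrable_cong_AE; use 1 in auto)+
    then show ?thesis by simp
  next
    case (2 m s)
    have "integrable lborel (\<lambda>x. normal_density m s x * (x - m) ^ k)" for k
      by (rule integrable_normal_moment[OF 2(1)])
    from this[of 0] this[of 1] this[of 2]
    have *: "integrable lborel (normal_density m s)" "integrable lborel (\<lambda>x. normal_density m s x * (x - m))"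
       "integrable lborel (\<lambda>x. normal_density m s x * (x - m)\<^sup>2)" by simp_all
    have "integrable lborel (\<lambda>x. normal_density m s x * (x - m) + m * normal_density m s x)"
      using * by (intro Bochner_Integration.integrable_add) auto
    moreover have "integrable lborel (\<lambda>x. normal_density m s x * (x - m)\<^sup>2 + 2 * m * (normal_density m s x * (x - m)) + m\<^sup>2 * normal_density m s x)"
      using * by (intro Bochner_Integration.integrable_add) auto
    ultimately have "integrable lborel (\<lambda>x. normal_density m s x * x)" "integrable lborel (\<lambda>x. normal_density m s x * x\<^sup>2)"
      by (auto simp: algebra_simps power2_eq_square)
    then show ?thesis
      using distributed_integrable[OF 2(2), of "\<lambda>x. x"] distributed_integrable[OF 2(2), of "\<lambda>x. x\<^sup>2"] by simp
  qed
  then show "integrable M Y" "integrable M (\<lambda>x. (Y x)\<^sup>2)" by auto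
qed

lemma integrable_mult_square:
  fixes f g :: "'a \<Rightarrow> real"
  assumes "f \<in> borel_measurable M" "g \<in> borel_measurable M"
    "integrable M (\<lambda>x. (f x)\<^sup>2)" "integrable M (\<lambda>x. (g x)\<^sup>2)"
  shows "integrable M (\<lambda>x. f x * g x)"
proof (rule Bochner_Integration.integrable_bound)
  show "integrable M (\<lambda>x. (f x)\<^sup>2 + (g x)\<^sup>2)" using assms by auto
  show "AE x in M. norm (f x * g x) \<le> norm ((f x)\<^sup>2 + (g x)\<^sup>2)"
  proof (rule AE_I2)
    fix x
    have "0 \<le> (\<bar>f x\<bar> - \<bar>g x\<bar>)\<^sup>2" by simp
    then have "2 * (\<bar>f x\<bar> * \<bar>g x\<bar>) \<le> (f x)\<^sup>2 + (g x)\<^sup>2" by (simp add: power2_diff)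
    moreover have "0 \<le> \<bar>f x\<bar> * \<bar>g x\<bar>" by simp
    ultimately have "\<bar>f x\<bar> * \<bar>g x\<bar> \<le> (f x)\<^sup>2 + (g x)\<^sup>2" by linarith
    then show "norm (f x * g x) \<le> norm ((f x)\<^sup>2 + (g x)\<^sup>2)" by (simp add: abs_mult)
  qed
qed (use assms in measurable)

text \<open>The right-hand side involves the process only through \<open>R\<close>; this is what
  makes two processes with the same covariance indistinguishable at finitely many times.\<close>

lemma gaussian_process_iexp:
  assumes M: "prob_space M" and g: "centered_gaussian_process M T Y R" and F: "finite F" "F \<subseteq> T"
  shows "(LINT x|M. iexp (\<Sum>t\<in>F. a t * Y t x)) = exp (- (1 / 2) * (\<Sum>s\<in>F. \<Sum>t\<in>F. a s * a t * R s t))"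
proof -
  interpret prob_space M by fact
  have rv: "gaussian_rv M (\<lambda>\<omega>. \<Sum>t\<in>F. a t * Y t \<omega>)" if "finite F" "F \<subseteq> T" for F a
    using g that unfolding centered_gaussian_process_def by blast
  have Yt: "gaussian_rv M (Y t)" if "t \<in> T" for t
    using rv[of "{t}" "\<lambda>_. 1"] that by simp
  then have meas: "Y t \<in> borel_measurable M" if "t \<in> T" for t
    using that by (auto simp: gaussian_rv_def)
  have int: "integrable M (Y t)" if "t \<in> T" for t using gaussian_rv_moments(1)[OF Yt[OF that]] .
  have int2: "integrable M (\<lambda>x. Y s x * Y t x)" if "s \<in> T" "t \<in> T" for s t
    by (rule integrable_mult_square) (use that meas gaussian_rv_moments[OF Yt] in auto)
  show ?thesis
  proof (rule gaussian_rv_iexp)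
    show "gaussian_rv M (\<lambda>\<omega>. \<Sum>t\<in>F. a t * Y t \<omega>)" using rv F .
    have "expectation (\<lambda>x. \<Sum>t\<in>F. a t * Y t x) = (\<Sum>t\<in>F. a t * expectation (Y t))"
      using int F by (subst Bochner_Integration.integral_sum) auto
    also have "\<dots> = 0"
    proof (intro sum.neutral ballI)
      fix t assume "t \<in> F"
      then have "t \<in> T" using F by blast
      then have "expectation (Y t) = 0" using g unfolding centered_gaussian_process_def by blast
      then show "a t * expectation (Y t) = 0" by simp
    qed
    finally show "expectation (\<lambda>x. \<Sum>t\<in>F. a t * Y t x) = 0" .
    have "expectation (\<lambda>x. (\<Sum>t\<in>F. a t * Y t x)\<^sup>2) = expectation (\<lambda>x. \<Sum>s\<in>F. \<Sum>t\<in>F. a s * a t * (Y s x * Y t x))"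
      unfolding power2_eq_square sum_product
      by (intro Bochner_Integration.integral_cong refl sum.cong) (simp add: ac_simps)
    also have "\<dots> = (\<Sum>s\<in>F. expectation (\<lambda>x. \<Sum>t\<in>F. a s * a t * (Y s x * Y t x)))"
      by (rule Bochner_Integration.integral_sum, rule Bochner_Integration.integrable_sum, rule integrable_mult_right, rule int2)
         (use F in auto)
    also have "\<dots> = (\<Sum>s\<in>F. \<Sum>t\<in>F. expectation (\<lambda>x. a s * a t * (Y s x * Y t x)))"
      by (rule sum.cong[OF refl], rule Bochner_Integration.integral_sum, rule integrable_mult_right, rule int2)
         (use F in auto)
    also have "\<dots> = (\<Sum>s\<in>F. \<Sum>t\<in>F. a s * a t * expectation (\<lambda>x. Y s x * Y t x))"
      by simp
    also have "\<dots> = (\<Sum>s\<in>F. \<Sum>t\<in>F. a s * a t * R s t)"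
    proof (intro sum.cong refl)
      fix s t assume "s \<in> F" "t \<in> F"
      then have "s \<in> T" "t \<in> T" using F by auto
      then have "expectation (\<lambda>x. Y s x * Y t x) = R s t" using g unfolding centered_gaussian_process_def by blast
      then show "a s * a t * expectation (\<lambda>x. Y s x * Y t x) = a s * a t * R s t" by simp
    qed
    finally show "expectation (\<lambda>x. (\<Sum>t\<in>F. a t * Y t x)\<^sup>2) = (\<Sum>s\<in>F. \<Sum>t\<in>F. a s * a t * R s t)" .
  qed
qed

lemma emeasure_cylinder_eq:
  assumes P: "prob_space P" "sets P = sets path_space" "centered_gaussian_process P {0..} coord R"
    and Q: "prob_space Q" "sets Q = sets path_space" "centered_gaussian_process Q {0..} coord R"
    and a: "a \<in> cylinders"
  shows "emeasure P a = emeasure Q a"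
proof -
  obtain F A where a: "a = {w \<in> path_set. \<forall>x\<in>F. w x \<in> A x}" "finite F" "F \<subseteq> {0..}"
    "\<forall>x\<in>F. A x \<in> sets borel" using a unfolding cylinders_def by blast
  have meas: "coord x \<in> borel_measurable M" if "x \<in> F" "sets M = sets path_space" for x M
    using measurable_coord[of x] that a(3) measurable_cong_sets[OF that(2) refl, of "borel :: real measure"] by auto
  \<comment> \<open>Zero coefficients make the phase trivial, so the statement on joint laws becomes
    an equality of cylinder probabilities.\<close>
  have eq: "(LINT x|P. (\<Prod>t\<in>F. indicator (A t) (coord t x) :: real) *\<^sub>R iexp (\<Sum>t\<in>F. 0 * coord t x))
    = (LINT x|Q. (\<Prod>t\<in>F. indicator (A t) (coord t x) :: real) *\<^sub>R iexp (\<Sum>t\<in>F. 0 * coord t x))"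
  proof (rule joint_law_unique[OF P(1) Q(1) a(2)])
    show "(LINT x|P. iexp (\<Sum>t\<in>F. b t * coord t x)) = (LINT x|Q. iexp (\<Sum>t\<in>F. b t * coord t x))" for b
      unfolding gaussian_process_iexp[OF P(1,3) a(2,3)] gaussian_process_iexp[OF Q(1,3) a(2,3)] ..
  qed (use a meas P(2) Q(2) in auto)
  have *: "(LINT x|M. (\<Prod>t\<in>F. indicator (A t) (coord t x) :: real) *\<^sub>R iexp (\<Sum>t\<in>F. 0 * coord t x)) = complex_of_real (measure M a)"
    if "prob_space M" "sets M = sets path_space" for M
  proof -
    interpret prob_space M by fact
    have sp: "space M = path_set" using sets_eq_imp_space_eq[OF that(2)] space_path_space by simp
    have aM: "a \<in> sets M" using assms(7) that(2) by (simp add: sets_path_space_cylinders sigma_sets.Basic)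
    have "(\<Prod>t\<in>F. indicator (A t) (coord t x) :: real) = indicator a x" if "x \<in> space M" for x
    proof (cases "x \<in> a")
      case True
      then show ?thesis by (simp add: a(1) coord_def)
    next
      case False
      then have "\<not> (\<forall>t\<in>F. x t \<in> A t)" using that unfolding sp a(1) by simp
      then obtain t where "t \<in> F" "x t \<notin> A t" by blast
      then have "(\<Prod>t\<in>F. indicator (A t) (coord t x) :: real) = 0"
        by (intro prod_zero[OF a(2)] bexI[of _ t]) (simp_all add: coord_def)
      then show ?thesis using False by simp
    qed
    then have "(LINT x|M. (\<Prod>t\<in>F. indicator (A t) (coord t x) :: real) *\<^sub>R iexp (\<Sum>t\<in>F. 0 * coord t x))
       = (LINT x|M. complex_of_real (indicator a x))"
      by (intro Bochner_Integration.integral_cong refl) (simp add: scaleR_conv_of_real)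
    also have "\<dots> = complex_of_real (measure M a)"
      using aM by (subst integral_complex_of_real) (simp add: sets.Int_space_eq2 Int_absorb2 sets.sets_into_space)
    finally show ?thesis .
  qed
  have "measure P a = measure Q a" using eq *[OF P(1,2)] *[OF Q(1,2)] by simp
  then show ?thesis
    by (simp add: finite_measure.emeasure_eq_measure[OF prob_space.finite_measure[OF P(1)]]
        finite_measure.emeasure_eq_measure[OF prob_space.finite_measure[OF Q(1)]])
qed

lemma gaussian_law_unique:
  assumes P: "prob_space P" "sets P = sets path_space" "centered_gaussian_process P {0..} coord R"
    and Q: "prob_space Q" "sets Q = sets path_space" "centered_gaussian_process Q {0..} coord R"
  shows "P = Q"
proof (rule measure_eqI_generator_eq[OF Int_stable_cylinders cylinders_subset])
  interpret P: prob_space P by fact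
  show "emeasure P X = emeasure Q X" if "X \<in> cylinders" for X
    by (rule emeasure_cylinder_eq[OF assms that])
  show "sets P = sigma_sets path_set cylinders" "sets Q = sigma_sets path_set cylinders"
    using assms by (simp_all add: sets_path_space_cylinders)
  show "range (\<lambda>_. path_set) \<subseteq> cylinders"
    unfolding cylinders_def by (auto intro!: exI[of _ "{}"])
  show "(\<Union>i::nat. path_set) = path_set" by simp
  show "emeasure P path_set \<noteq> \<infinity>" for i :: nat by simp
qed

lemma gaussian_law_eqI:
  assumes "prob_space P" "sets P = sets path_space" "centered_gaussian_process P {0..} coord (cov \<sigma>)"
  shows "gaussian_law \<sigma> = P"
  unfolding gaussian_law_def using assms gaussian_law_unique by (intro the_equality) blast+

text \<open>\<open>measure_of\<close> yields the intended values only for a countably additive set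
  function. As the image of a weighted point measure this is automatic, and integrals become finite
  sums.\<close>

lemma atomic_measure_eq:
  "atomic_measure n c p = distr (point_measure {1..n} (\<lambda>j. ennreal ((c j)\<^sup>2))) borel p"
proof -
  define D where "D = distr (point_measure {1..n} (\<lambda>j. ennreal ((c j)\<^sup>2))) borel p"
  have e: "(\<Sum>j=1..n. ennreal ((c j)\<^sup>2) * emeasure (return borel (p j)) A) = emeasure D A" if "A \<in> sets borel" for A
  proof -
    have "emeasure D A = emeasure (point_measure {1..n} (\<lambda>j. ennreal ((c j)\<^sup>2))) (p -` A \<inter> {1..n})"
      unfolding D_def using that by (subst emeasure_distr) (auto simp: space_point_measure)
    also have "\<dots> = (\<Sum>j\<in>p -` A \<inter> {1..n}. ennreal ((c j)\<^sup>2))"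
      by (rule emeasure_point_measure_finite) auto
    also have "\<dots> = (\<Sum>j=1..n. ennreal ((c j)\<^sup>2) * indicator A (p j))"
      by (rule sum.mono_neutral_cong_left) (auto simp: indicator_def)
    finally show ?thesis using that by simp
  qed
  have "atomic_measure n c p = measure_of UNIV (sets borel) (emeasure D)"
    unfolding atomic_measure_def
    by (rule measure_of_eq) (use e sets.sigma_sets_eq[of "borel :: real measure"] in auto)
  also have "\<dots> = measure_of (space D) (sets D) (emeasure D)" by (simp add: D_def)
  also have "\<dots> = D" by (rule measure_of_of_measure)
  finally show ?thesis unfolding D_def .
qed

lemma integral_atomic_measure:
  fixes f :: "real \<Rightarrow> real"
  assumes "f \<in> borel_measurable borel"
  shows "(\<integral>x. f x \<partial>atomic_measure n c p) = (\<Sum>j=1..n. (c j)\<^sup>2 * f (p j))"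
  unfolding atomic_measure_eq
  using assms by (subst integral_distr) (auto simp: lebesgue_integral_point_measure_finite)

lemma cov_atomic_measure: "cov (atomic_measure n c p) x y = (\<Sum>j=1..n. (c j)\<^sup>2 * cov_kernel x y (p j))"
  unfolding cov_def
  by (rule integral_atomic_measure) (simp add: cov_kernel_def)

text \<open>Testing on indicator sums avoids comparing the representations: the same measure arises
  from every renumbering of its atoms.\<close>

lemma atomic_measure_eqI:
  assumes "\<And>A. A \<in> sets borel \<Longrightarrow> (\<Sum>j=1..n. (c j)\<^sup>2 * indicator A (p j)) = (\<Sum>j=1..n'. (c' j)\<^sup>2 * indicator A (p' j) :: real)"
  shows "atomic_measure n c p = atomic_measure n' c' p'"
proof (rule measure_eqI)
  show "sets (atomic_measure n c p) = sets (atomic_measure n' c' p')"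
    by (simp add: atomic_measure_eq)
  fix A assume "A \<in> sets (atomic_measure n c p)"
  then have A: "A \<in> sets borel" by (simp add: atomic_measure_eq)
  have *: "emeasure (atomic_measure n c p) A = ennreal (\<Sum>j=1..n. (c j)\<^sup>2 * indicator A (p j))" for n c p
  proof -
    have "emeasure (atomic_measure n c p) A = emeasure (point_measure {1..n} (\<lambda>j. ennreal ((c j)\<^sup>2))) (p -` A \<inter> {1..n})"
      unfolding atomic_measure_eq using A by (subst emeasure_distr) (auto simp: space_point_measure)
    also have "\<dots> = (\<Sum>j\<in>p -` A \<inter> {1..n}. ennreal ((c j)\<^sup>2))"
      by (rule emeasure_point_measure_finite) auto
    also have "\<dots> = ennreal (\<Sum>j\<in>p -` A \<inter> {1..n}. (c j)\<^sup>2)" by (rule sum_ennreal) auto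
    also have "(\<Sum>j\<in>p -` A \<inter> {1..n}. (c j)\<^sup>2) = (\<Sum>j=1..n. (c j)\<^sup>2 * indicator A (p j))"
      by (rule sum.mono_neutral_cong_left) (auto simp: indicator_def)
    finally show ?thesis .
  qed
  show "emeasure (atomic_measure n c p) A = emeasure (atomic_measure n' c' p') A"
    unfolding * using assms[OF A] by simp
qed

section \<open>Schauder expansion of the covariance\<close>

definition tent :: "real \<Rightarrow> real" where "tent u = max 0 (min u (1 - u))"

lemma tent_eq_0: "\<not> (0 < u \<and> u < 1) \<Longrightarrow> tent u = 0"
  by (auto simp: tent_def)

lemma tent_abs_le: "\<bar>tent u\<bar> \<le> 1"
  by (auto simp: tent_def)

text \<open>Covariance of the Brownian bridge on [0, 1], extended by 0 so that rescaled copies on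
  dyadic cells can be added freely.\<close>

definition bridge_kernel :: "real \<Rightarrow> real \<Rightarrow> real" where
  "bridge_kernel s t = (if 0 \<le> s \<and> s \<le> 1 \<and> 0 \<le> t \<and> t \<le> 1 then min s t - s * t else 0)"

lemma bridge_kernel_commute: "bridge_kernel s t = bridge_kernel t s"
  by (auto simp: bridge_kernel_def min_def)

text \<open>Midpoint displacement: a bridge is the tent interpolation of its value at 1/2 plus two
  independent bridges of half length, each with half the covariance in rescaled time. The value at
  1/2 has variance 1/4, which is \<open>tent (1 / 2)\<close> squared.\<close>

lemma bridge_kernel_split_le:
  assumes "s \<le> t"
  shows "bridge_kernel s t = tent s * tent t
    + (bridge_kernel (2 * s) (2 * t) + bridge_kernel (2 * s - 1) (2 * t - 1)) / 2"
proof -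
  consider "s < 0" | "t > 1" | "0 \<le> s" "t \<le> 1 / 2" | "s \<ge> 1 / 2" "t \<le> 1" "t \<noteq> 1 / 2" "s \<noteq> 1 / 2"
    | "0 \<le> s" "s < 1 / 2" "1 / 2 < t" "t \<le> 1" | "s = 1 / 2" "t \<le> 1" "t \<noteq> 1/2"
    using assms by fastforce
  then show ?thesis
    using assms
    by cases (auto simp: bridge_kernel_def tent_def min_def max_def algebra_simps add_divide_distrib diff_divide_distrib)
qed

lemma bridge_kernel_split:
  "bridge_kernel s t = tent s * tent t
    + (bridge_kernel (2 * s) (2 * t) + bridge_kernel (2 * s - 1) (2 * t - 1)) / 2"
proof (cases "s \<le> t")
  case True
  then show ?thesis by (rule bridge_kernel_split_le)
next
  case False
  then have "t \<le> s" by simp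
  from bridge_kernel_split_le[OF this] show ?thesis
    by (simp add: bridge_kernel_commute mult.commute)
qed

definition schauder :: "nat \<Rightarrow> nat \<Rightarrow> real \<Rightarrow> real" where
  "schauder l k t = (1 / sqrt 2) ^ l * tent (2 ^ l * t - real k)"

lemma sum_lessThan_double: "(\<Sum>k<2 * m. f k) = (\<Sum>k<m. f (2 * k) + f (2 * k + 1 :: nat) :: real)"
  by (induction m) (simp_all add: algebra_simps)

text \<open>The midpoint split iterated \<open>L\<close> times; the remainder is the covariance of
  the bridges left on the 2^L cells.\<close>

lemma schauder_partial_sum:
  "(\<Sum>l<L. \<Sum>k<2 ^ l. schauder l k s * schauder l k t)
    = bridge_kernel s t - (1 / 2) ^ L * (\<Sum>k<2 ^ L. bridge_kernel (2 ^ L * s - real k) (2 ^ L * t - real k))"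
proof (induction L)
  case 0
  show ?case by simp
next
  case (Suc L)
  have pw: "(1 / sqrt 2) ^ L * (1 / sqrt 2) ^ L = (1 / 2 :: real) ^ L"
    by (simp add: power_mult_distrib[symmetric])
  have "(\<Sum>k<2 ^ L. bridge_kernel (2 ^ L * s - real k) (2 ^ L * t - real k))
      = (\<Sum>k<2 ^ L. tent (2 ^ L * s - real k) * tent (2 ^ L * t - real k))
       + (\<Sum>k<2 ^ L. bridge_kernel (2 ^ Suc L * s - real (2 * k)) (2 ^ Suc L * t - real (2 * k))
          + bridge_kernel (2 ^ Suc L * s - real (2 * k + 1)) (2 ^ Suc L * t - real (2 * k + 1))) / 2"
  proof -
    have d: "2 * (2 ^ L * u - real k) = 2 ^ Suc L * u - real (2 * k)"
      "2 ^ Suc L * u - real (2 * k) - 1 = 2 ^ Suc L * u - real (2 * k + 1)" for u k by auto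
    have "bridge_kernel (2 ^ L * s - real k) (2 ^ L * t - real k) = tent (2 ^ L * s - real k) * tent (2 ^ L * t - real k)
       + (bridge_kernel (2 ^ Suc L * s - real (2 * k)) (2 ^ Suc L * t - real (2 * k))
          + bridge_kernel (2 ^ Suc L * s - real (2 * k + 1)) (2 ^ Suc L * t - real (2 * k + 1))) / 2" for k
      using bridge_kernel_split[of "2 ^ L * s - real k" "2 ^ L * t - real k"] unfolding d .
    then show ?thesis by (simp only: sum.distrib sum_divide_distrib[symmetric])
  qed
  also have "(\<Sum>k<2 ^ L. bridge_kernel (2 ^ Suc L * s - real (2 * k)) (2 ^ Suc L * t - real (2 * k))
          + bridge_kernel (2 ^ Suc L * s - real (2 * k + 1)) (2 ^ Suc L * t - real (2 * k + 1)))
     = (\<Sum>k<2 ^ Suc L. bridge_kernel (2 ^ Suc L * s - real k) (2 ^ Suc L * t - real k))"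
    by (simp only: power_Suc[of "2 :: nat" L] sum_lessThan_double)
  finally have e: "(\<Sum>k<2 ^ L. bridge_kernel (2 ^ L * s - real k) (2 ^ L * t - real k))
      = (\<Sum>k<2 ^ L. tent (2 ^ L * s - real k) * tent (2 ^ L * t - real k))
       + (\<Sum>k<2 ^ Suc L. bridge_kernel (2 ^ Suc L * s - real k) (2 ^ Suc L * t - real k)) / 2" .
  have "(\<Sum>k<2 ^ L. schauder L k s * schauder L k t)
      = (1 / 2) ^ L * (\<Sum>k<2 ^ L. tent (2 ^ L * s - real k) * tent (2 ^ L * t - real k))"
    unfolding sum_distrib_left schauder_def pw[symmetric] by (intro sum.cong refl) (simp only: ac_simps)
  then show ?case unfolding sum.lessThan_Suc[of _ L] Suc.IH e by (simp add: algebra_simps)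
qed

text \<open>The supports are disjoint unit cells, so at a given point at most the index floor(u)
  contributes.\<close>

lemma sum_abs_single_cell:
  fixes f :: "nat \<Rightarrow> real"
  assumes "\<And>k. \<not> (0 < u - real k \<and> u - real k < 1) \<Longrightarrow> f k = 0" "\<And>k. \<bar>f k\<bar> \<le> M"
  shows "(\<Sum>k<n. \<bar>f k\<bar>) \<le> M"
proof -
  have M: "M \<ge> 0" using assms(2)[of 0] by linarith
  have "(\<Sum>k<n. \<bar>f k\<bar>) \<le> (\<Sum>k<n. if k = nat \<lfloor>u\<rfloor> then M else 0)"
  proof (rule sum_mono)
    fix k
    show "\<bar>f k\<bar> \<le> (if k = nat \<lfloor>u\<rfloor> then M else 0)"
    proof (cases "0 < u - real k \<and> u - real k < 1")
      case True
      then have "\<lfloor>u\<rfloor> = int k" by (intro floor_unique) auto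
      then show ?thesis using assms(2) by simp
    next
      case False
      then show ?thesis using assms(1) M by simp
    qed
  qed
  also have "\<dots> \<le> M" using M by simp
  finally show ?thesis .
qed

lemma bridge_kernel_abs_le: "\<bar>bridge_kernel s t\<bar> \<le> 1"
proof -
  have "0 \<le> min s t - s * t \<and> min s t - s * t \<le> 1" if "0 \<le> s" "s \<le> 1" "0 \<le> t" "t \<le> 1"
  proof -
    have "s * t \<le> s * 1" "s * t \<le> 1 * t" using that by (intro mult_left_mono mult_right_mono; simp)+
    moreover have "0 \<le> s * t" using that by simp
    moreover have "min s t \<le> 1" using that by simp
    ultimately show ?thesis by (simp add: min_def split: if_splits)
  qed
  then show ?thesis by (auto simp: bridge_kernel_def)
qed

lemma bridge_kernel_eq_0: "\<not> (0 < s \<and> s < 1) \<Longrightarrow> bridge_kernel s t = 0"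
  by (auto simp: bridge_kernel_def min_def)

lemma schauder_sums: "(\<lambda>l. \<Sum>k<2 ^ l. schauder l k s * schauder l k t) sums bridge_kernel s t"
proof -
  have "(\<lambda>L. (1 / 2) ^ L * (\<Sum>k<2 ^ L. bridge_kernel (2 ^ L * s - real k) (2 ^ L * t - real k))) \<longlonglongrightarrow> 0"
  proof (rule Lim_null_comparison[of _ "\<lambda>L. (1 / 2) ^ L"])
    show "(\<lambda>L. (1 / 2 :: real) ^ L) \<longlonglongrightarrow> 0" by (rule LIMSEQ_power_zero) simp
    show "\<forall>\<^sub>F L in sequentially. norm ((1 / 2) ^ L * (\<Sum>k<2 ^ L. bridge_kernel (2 ^ L * s - real k) (2 ^ L * t - real k)))
      \<le> (1 / 2) ^ L"
    proof (rule always_eventually, rule allI)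
      fix L
      have "\<bar>\<Sum>k<2 ^ L. bridge_kernel (2 ^ L * s - real k) (2 ^ L * t - real k)\<bar>
         \<le> (\<Sum>k<2 ^ L. \<bar>bridge_kernel (2 ^ L * s - real k) (2 ^ L * t - real k)\<bar>)" by (rule sum_abs)
      also have "\<dots> \<le> 1"
        by (rule sum_abs_single_cell[of "2 ^ L * s"]) (simp_all add: bridge_kernel_eq_0 bridge_kernel_abs_le)
      finally show "norm ((1 / 2) ^ L * (\<Sum>k<2 ^ L. bridge_kernel (2 ^ L * s - real k) (2 ^ L * t - real k)))
        \<le> (1 / 2) ^ L" by (simp add: abs_mult mult_le_cancel_left1)
    qed
  qed
  from tendsto_diff[OF tendsto_const[of "bridge_kernel s t"] this] show ?thesis
    unfolding sums_def schauder_partial_sum by simp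
qed

text \<open>At each point at most one tent per level is active; this is the source of the decay rate
  demanded in \<open>bound_a\<close> below.\<close>

lemma schauder_sum_abs_le: "(\<Sum>k<2 ^ l. \<bar>schauder l k t\<bar>) \<le> (1 / sqrt 2) ^ l"
proof -
  have "(\<Sum>k<2 ^ l. \<bar>schauder l k t\<bar>) = (1 / sqrt 2) ^ l * (\<Sum>k<2 ^ l. \<bar>tent (2 ^ l * t - real k)\<bar>)"
    by (simp add: schauder_def sum_distrib_left abs_mult)
  also have "\<dots> \<le> (1 / sqrt 2) ^ l * 1"
    by (intro mult_left_mono sum_abs_single_cell[of "2 ^ l * t"]) (simp_all add: tent_eq_0 tent_abs_le)
  finally show ?thesis by simp
qed

lemma continuous_on_tent: "continuous_on S tent"
  unfolding tent_def by (intro continuous_intros)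

text \<open>The integral of exp(- 2 p y) over [0, x], with its value at p = 0 written
  separately.\<close>

definition clock :: "real \<Rightarrow> real \<Rightarrow> real" where
  "clock p x = (if p = 0 then x else (1 - exp (- 2 * p * x)) / (2 * p))"

lemma clock_has_derivative: "(clock p has_real_derivative exp (- 2 * p * x)) (at x within S)"
  unfolding clock_def by (cases "p = 0") (auto intro!: derivative_eq_intros simp: field_simps)

lemma clock_mono: "x \<le> y \<Longrightarrow> clock p x \<le> clock p y"
  by (rule DERIV_nonneg_imp_nondecreasing[of x y]) (use clock_has_derivative in \<open>auto intro!: exI\<close>)

lemma clock_0: "clock p 0 = 0"
  by (simp add: clock_def)

lemma clock_nonneg: "x \<ge> 0 \<Longrightarrow> clock p x \<ge> 0"
  using clock_mono[of 0 x p] by (simp add: clock_0)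

lemma continuous_on_clock: "continuous_on S (clock p)"
  using clock_has_derivative by (meson DERIV_continuous_on)

text \<open>An Ornstein--Uhlenbeck process is a Brownian motion run at the time \<open>clock p\<close> and rescaled,
  and a Brownian motion is a rescaled Brownian bridge.\<close>

lemma cov_kernel_bridge:
  assumes "x \<ge> 0" "y \<ge> 0"
  shows "cov_kernel x y p = (exp (p * x) * (1 + clock p x)) * (exp (p * y) * (1 + clock p y))
    * bridge_kernel (clock p x / (1 + clock p x)) (clock p y / (1 + clock p y))"
proof -
  have *: "cov_kernel x y p = (exp (p * x) * (1 + clock p x)) * (exp (p * y) * (1 + clock p y))
    * bridge_kernel (clock p x / (1 + clock p x)) (clock p y / (1 + clock p y))" if xy: "x \<le> y" "0 \<le> x" for x y
  proof -
    define a b where "a = clock p x" and "b = clock p y"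
    have ab: "0 \<le> a" "a \<le> b" using xy by (auto simp: a_def b_def clock_mono clock_nonneg)
    have "a / (1 + a) \<le> b / (1 + b)" using ab by (simp add: field_simps)
    then have "bridge_kernel (a / (1 + a)) (b / (1 + b)) = a / (1 + a) - (a / (1 + a)) * (b / (1 + b))"
      using ab unfolding bridge_kernel_def by (simp add: field_simps min_def)
    also have "\<dots> = a / (1 + a) * (1 - b / (1 + b))" by (simp only: right_diff_distrib mult_1_right)
    also have "1 - b / (1 + b) = 1 / (1 + b)" using ab by (simp add: field_simps)
    also have "a / (1 + a) * (1 / (1 + b)) = a / ((1 + a) * (1 + b))" by simp
    \<comment> \<open>A bridge at time a / (1 + a), multiplied by 1 + a, is a Brownian motion at
      time a. Here this appears as the covariance min of a and b, which is a because a \<le>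
      b.\<close>
    finally have 1: "(1 + a) * (1 + b) * bridge_kernel (a / (1 + a)) (b / (1 + b)) = a"
      using ab by simp
    have 2: "cov_kernel x y p = exp (p * x) * exp (p * y) * a"
    proof (cases "p = 0")
      case True
      then show ?thesis using xy by (simp add: cov_kernel_def a_def clock_def)
    next
      case False
      have "exp (p * x) * exp (p * y) * exp (- 2 * p * x) = exp (p * \<bar>x - y\<bar>)"
        using xy by (simp add: exp_add[symmetric] algebra_simps)
      then show ?thesis using False by (simp add: cov_kernel_def a_def clock_def field_simps exp_add)
    qed
    have 3: "(exp (p * x) * (1 + a)) * (exp (p * y) * (1 + b)) * bridge_kernel (a / (1 + a)) (b / (1 + b))
      = exp (p * x) * exp (p * y) * ((1 + a) * (1 + b) * bridge_kernel (a / (1 + a)) (b / (1 + b)))"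
      by (simp only: ac_simps)
    show ?thesis by (simp only: a_def[symmetric] b_def[symmetric] 3 1 2)
  qed
  show ?thesis
  proof (cases "x \<le> y")
    case True
    then show ?thesis using * assms by blast
  next
    case False
    have "cov_kernel x y p = cov_kernel y x p" by (simp add: cov_kernel_def add.commute abs_minus_commute min.commute)
    also have "\<dots> = (exp (p * y) * (1 + clock p y)) * (exp (p * x) * (1 + clock p x))
      * bridge_kernel (clock p y / (1 + clock p y)) (clock p x / (1 + clock p x))"
      using * False assms by simp
    finally show ?thesis by (simp only: mult.commute bridge_kernel_commute)
  qed
qed

section \<open>Gaussian integration by parts\<close>

abbreviation "stdn \<equiv> density lborel std_normal_density"

lemma std_normal_density_has_derivative:
  "(std_normal_density has_real_derivative - x * std_normal_density x) (at x)"
  unfolding std_normal_density_def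
  by (auto intro!: derivative_eq_intros simp: field_simps)

lemma gaussian_decay: "((\<lambda>x::real. (1 + \<bar>x\<bar>) * exp (- x\<^sup>2 / 2)) \<longlongrightarrow> 0) at_top"
   "((\<lambda>x::real. (1 + \<bar>x\<bar>) * exp (- x\<^sup>2 / 2)) \<longlongrightarrow> 0) at_bot"
  by real_asymp+

lemma std_normal_boundary:
  assumes "\<And>z. \<bar>f z\<bar> \<le> K * (1 + \<bar>z\<bar>)" and F: "F = at_top \<or> F = at_bot"
  shows "((\<lambda>z. f z * std_normal_density z) \<longlongrightarrow> 0) F"
proof (rule Lim_null_comparison)
  have "((\<lambda>z. (K / sqrt (2 * pi)) * ((1 + \<bar>z\<bar>) * exp (- z\<^sup>2 / 2))) \<longlongrightarrow> (K / sqrt (2 * pi)) * 0) F"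
    using F gaussian_decay by (intro tendsto_intros) auto
  then show "((\<lambda>z. (K / sqrt (2 * pi)) * ((1 + \<bar>z\<bar>) * exp (- z\<^sup>2 / 2))) \<longlongrightarrow> 0) F" by simp
  have "\<bar>f z * std_normal_density z\<bar> \<le> (K * (1 + \<bar>z\<bar>)) * std_normal_density z" for z
    unfolding abs_mult using assms(1)[of z] by (intro mult_mono) auto
  then show "\<forall>\<^sub>F z in F. norm (f z * std_normal_density z) \<le> (K / sqrt (2 * pi)) * ((1 + \<bar>z\<bar>) * exp (- z\<^sup>2 / 2))"
    by (intro always_eventually allI) (simp add: std_normal_density_def mult.assoc)
qed

text \<open>The derivative of f times the normal density is (f' - z f) times the density, so the
  identity is the fundamental theorem on the whole line; linear growth of f removes the boundary
  terms.\<close>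

lemma std_normal_ibp:
  fixes f f' :: "real \<Rightarrow> real"
  assumes d: "\<And>z. (f has_real_derivative f' z) (at z)" and c: "\<And>z. isCont f' z"
    and g: "\<And>z. \<bar>f z\<bar> \<le> K * (1 + \<bar>z\<bar>)"
    and i: "integrable stdn (\<lambda>z. z * f z)" "integrable stdn f'"
  shows "(LINT z|stdn. z * f z) = (LINT z|stdn. f' z)"
proof -
  have [measurable]: "f' \<in> borel_measurable borel" "f \<in> borel_measurable borel"
    using c DERIV_isCont[OF d] by (auto intro!: borel_measurable_continuous_onI continuous_at_imp_continuous_on)
  let ?\<phi> = std_normal_density
  have i': "integrable lborel (\<lambda>z. ?\<phi> z * (z * f z))" "integrable lborel (\<lambda>z. ?\<phi> z * f' z)"
    using i by (simp_all add: integrable_density)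
  have eq: "(LINT z|stdn. z * f z) = (LINT z|lborel. ?\<phi> z * (z * f z))"
      "(LINT z|stdn. f' z) = (LINT z|lborel. ?\<phi> z * f' z)"
    by (simp_all add: integral_density)
  have int: "integrable lborel (\<lambda>z. ?\<phi> z * f' z - ?\<phi> z * (z * f z))" using i' by simp
  have "(LBINT z=-\<infinity>..\<infinity>. ?\<phi> z * f' z - ?\<phi> z * (z * f z)) = 0 - 0"
  proof (rule interval_integral_FTC_integrable[where F = "\<lambda>z. f z * ?\<phi> z"])
    show "((\<lambda>z. f z * ?\<phi> z) has_vector_derivative ?\<phi> x * f' x - ?\<phi> x * (x * f x)) (at x)" for x
      unfolding has_real_derivative_iff_has_vector_derivative[symmetric]
      by (rule derivative_eq_intros d std_normal_density_has_derivative refl)+ (simp add: algebra_simps)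
    have "isCont ?\<phi> x" for x using std_normal_density_has_derivative DERIV_isCont by blast
    moreover have "isCont f x" for x using d DERIV_isCont by blast
    ultimately show "isCont (\<lambda>z. ?\<phi> z * f' z - ?\<phi> z * (z * f z)) x" for x
      using c by (intro continuous_intros) auto
    show "set_integrable lborel (einterval (- \<infinity>) \<infinity>) (\<lambda>z. ?\<phi> z * f' z - ?\<phi> z * (z * f z))"
      using int by (simp add: set_integrable_def einterval_def)
    show "(((\<lambda>z. f z * ?\<phi> z) \<circ> real_of_ereal) \<longlongrightarrow> 0) (at_right (- \<infinity>))"
      using std_normal_boundary[of f K, OF g] by (simp add: ereal_tendsto_simps)
    show "(((\<lambda>z. f z * ?\<phi> z) \<circ> real_of_ereal) \<longlongrightarrow> 0) (at_left \<infinity>)"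
      using std_normal_boundary[of f K, OF g] by (simp add: ereal_tendsto_simps)
  qed auto
  then have "(LINT z|lborel. ?\<phi> z * f' z - ?\<phi> z * (z * f z)) = 0"
    by (simp add: interval_lebesgue_integral_def einterval_def set_lebesgue_integral_def)
  then show ?thesis using i' by (simp add: eq)
qed

section \<open>Products of standard Gaussians\<close>

abbreviation gauss_space :: "('i \<Rightarrow> real) measure" where
  "gauss_space \<equiv> PiM UNIV (\<lambda>_. stdn)"

lemma prob_space_stdn: "prob_space stdn"
  by (rule prob_space_normal_density) simp

lemma prob_space_gauss_space: "prob_space gauss_space"
  by (rule prob_space_PiM) (rule prob_space_stdn)

lemma measurable_gauss_component[measurable]: "(\<lambda>w. w i) \<in> borel_measurable gauss_space"
  using measurable_component_singleton[of i UNIV "\<lambda>_. stdn"] by simp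

lemma gauss_space_split:
  "gauss_space = distr (stdn \<Otimes>\<^sub>M PiM (UNIV - {i}) (\<lambda>_. stdn)) gauss_space (\<lambda>(x, X). X(i := x))"
  using distr_pair_PiM_eq_PiM[of "UNIV - {i}" "\<lambda>_. stdn" i] prob_space_stdn by (simp add: insert_UNIV)

text \<open>Fubini splits off the i-th coordinate; for almost every choice of the others both
  sections are integrable and the identity in one variable applies. The growth constant may depend
  on the other coordinates, as it serves one section at a time.\<close>

lemma gauss_space_ibp:
  fixes F F' :: "('i \<Rightarrow> real) \<Rightarrow> real"
  assumes i: "integrable gauss_space (\<lambda>w. w i * F w)" "integrable gauss_space F'"
    and d: "\<And>w z. ((\<lambda>z. F (w(i := z))) has_real_derivative F' (w(i := z))) (at z)"
    and c: "\<And>w z. isCont (\<lambda>z. F' (w(i := z))) z"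
    and g: "\<And>w. \<exists>K. \<forall>z. \<bar>F (w(i := z))\<bar> \<le> K * (1 + \<bar>z\<bar>)"
  shows "(LINT w|gauss_space. w i * F w) = (LINT w|gauss_space. F' w)"
proof -
  let ?N = "PiM (UNIV - {i}) (\<lambda>_. stdn)"
  let ?h = "\<lambda>(x, X). X(i := x) :: 'i \<Rightarrow> real"
  interpret S: prob_space stdn by (rule prob_space_stdn)
  interpret N: prob_space ?N by (rule prob_space_PiM) (rule prob_space_stdn)
  interpret P: pair_prob_space stdn ?N ..
  have h: "?h \<in> measurable (stdn \<Otimes>\<^sub>M ?N) gauss_space"
  proof -
    have "?h \<in> measurable (stdn \<Otimes>\<^sub>M ?N) (PiM (insert i (UNIV - {i})) (\<lambda>_. stdn))"
      by (auto simp: split_beta' intro!: measurable_fun_upd[of _ "UNIV - {i}"])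
    then show ?thesis by (simp add: insert_UNIV)
  qed
  have tr: "(LINT w|gauss_space. G w) = (LINT X|?N. (LINT x|stdn. G (X(i := x)))) \<and>
      (AE X in ?N. integrable stdn (\<lambda>x. G (X(i := x))))"
    if G: "integrable gauss_space G" for G :: "('i \<Rightarrow> real) \<Rightarrow> real"
  proof -
    have Gm: "G \<in> borel_measurable gauss_space" using G by simp
    have "integrable (distr (stdn \<Otimes>\<^sub>M ?N) gauss_space ?h) G"
      using G by (subst gauss_space_split[symmetric])
    then have I: "integrable (stdn \<Otimes>\<^sub>M ?N) (\<lambda>(x, X). G (X(i := x)))"
      using integrable_distr_eq[OF h Gm] by (simp add: split_beta')
    have "(LINT w|gauss_space. G w) = (LINT w|distr (stdn \<Otimes>\<^sub>M ?N) gauss_space ?h. G w)"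
      by (subst gauss_space_split[of i]) (rule refl)
    also have "\<dots> = (LINT y|(stdn \<Otimes>\<^sub>M ?N). (\<lambda>(x, X). G (X(i := x))) y)"
      using integral_distr[OF h Gm] by (simp add: split_beta')
    also have "\<dots> = (LINT X|?N. (LINT x|stdn. G (X(i := x))))"
      by (rule P.integral_snd[symmetric]) (use I in simp)
    finally show ?thesis using P.AE_integrable_snd[OF I] by simp
  qed
  have "AE X in ?N. (LINT x|stdn. (X(i := x)) i * F (X(i := x))) = (LINT x|stdn. F' (X(i := x)))"
    using tr[OF i(1), THEN conjunct2] tr[OF i(2), THEN conjunct2]
  proof eventually_elim
    case (elim X)
    obtain K where "\<And>z. \<bar>F (X(i := z))\<bar> \<le> K * (1 + \<bar>z\<bar>)" using g by blast
    then show ?case unfolding fun_upd_same by (rule std_normal_ibp[OF d c]) (use elim in auto)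
  qed
  then have "(LINT X|?N. (LINT x|stdn. (X(i := x)) i * F (X(i := x)))) = (LINT X|?N. (LINT x|stdn. F' (X(i := x))))"
  proof (rule integral_cong_AE[rotated 2])
    have [measurable]: "(\<lambda>x. G (?h x)) \<in> borel_measurable (stdn \<Otimes>\<^sub>M ?N)" if "integrable gauss_space G" for G :: "_ \<Rightarrow> real"
      using measurable_compose[OF h] that by (auto simp: split_beta')
    have *: "(\<lambda>X. LINT x|stdn. G (X(i := x))) \<in> borel_measurable ?N" if "integrable gauss_space G" for G :: "_ \<Rightarrow> real"
    proof -
      have "(\<lambda>(X, x). G (?h (x, X))) \<in> borel_measurable (?N \<Otimes>\<^sub>M stdn)"
        using measurable_compose[OF measurable_pair_swap' measurable_compose[OF h borel_measurable_integrable[OF that]]]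
        by (simp add: split_beta')
      from S.borel_measurable_lebesgue_integral[OF this] show ?thesis by simp
    qed
    show "(\<lambda>X. LINT x|stdn. (X(i := x)) i * F (X(i := x))) \<in> borel_measurable ?N" by (rule *[OF i(1)])
    show "(\<lambda>X. LINT x|stdn. F' (X(i := x))) \<in> borel_measurable ?N" by (rule *[OF i(2)])
  qed
  then show ?thesis using tr[OF i(1)] tr[OF i(2)] by simp
qed

lemma gauss_space_component_integral:
  fixes f :: "real \<Rightarrow> real"
  assumes "integrable stdn f"
  shows "integrable gauss_space (\<lambda>w. f (w i))" "(LINT w|gauss_space. f (w i)) = (LINT z|stdn. f z)"
proof -
  have D: "distr gauss_space stdn (\<lambda>w. w i) = stdn"
    by (rule distr_PiM_component) (auto intro: prob_space_stdn)
  have m: "(\<lambda>w. w i) \<in> measurable gauss_space stdn" by simp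
  show "integrable gauss_space (\<lambda>w. f (w i))"
    using integrable_distr_eq[OF m, of f] assms D by simp
  show "(LINT w|gauss_space. f (w i)) = (LINT z|stdn. f z)"
    using integral_distr[OF m, of f] assms D by simp
qed

lemma gauss_component_moments:
  "integrable gauss_space (\<lambda>w. (w i) ^ k)" "(LINT w|gauss_space. w i) = 0"
  "(LINT w|gauss_space. (w i)\<^sup>2) = 1" "(LINT w|gauss_space. (w i) ^ 4) = 3"
proof -
  show "integrable gauss_space (\<lambda>w. (w i) ^ k)"
    by (rule gauss_space_component_integral) (rule integrable_std_normal_distribution_moment)
  have "integrable stdn (\<lambda>z. z)" using integrable_std_normal_distribution_moment[of 1] by simp
  moreover have "(LINT z|stdn. z) = 0" using integral_std_normal_distribution_moment_odd[of 1] by simp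
  ultimately show "(LINT w|gauss_space. w i) = 0" using gauss_space_component_integral(2)[of "\<lambda>z. z"] by simp
  show "(LINT w|gauss_space. (w i)\<^sup>2) = 1"
    using gauss_space_component_integral(2)[OF integrable_std_normal_distribution_moment[of 2], of i]
      std_normal_distribution_even_moments(1)[of 1] by (simp add: fact_numeral)
  show "(LINT w|gauss_space. (w i) ^ 4) = 3"
    using gauss_space_component_integral(2)[OF integrable_std_normal_distribution_moment[of 4], of i]
      std_normal_distribution_even_moments(1)[of 2] by (simp add: fact_numeral)
qed

text \<open>For i \<noteq> j this is integration by parts in \<open>w i\<close> applied to the
  function \<open>w j\<close>, whose derivative is 0.\<close>

lemma gauss_component_covariance:
  fixes i j :: 'i
  shows "(LINT w|gauss_space. w i * w j) = (if i = j then 1 else 0)"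
proof (cases "i = j")
  case True
  then show ?thesis using gauss_component_moments(3)[of j] by (simp add: power2_eq_square)
next
  case False
  have int: "integrable gauss_space (\<lambda>w. w i * w j)"
    by (rule integrable_mult_square) (auto intro: gauss_component_moments(1))
  have "(LINT w|gauss_space. w i * (\<lambda>w. w j) w) = (LINT w|gauss_space. (\<lambda>_ :: 'i \<Rightarrow> real. 0) w)"
  proof (rule gauss_space_ibp[where F = "\<lambda>w. w j" and F' = "\<lambda>_. 0"])
    show "((\<lambda>z. (w(i := z)) j) has_real_derivative 0) (at z)" for w z
      using False by simp
    show "\<exists>K. \<forall>z. \<bar>(w(i := z)) j\<bar> \<le> K * (1 + \<bar>z\<bar>)" for w :: "'i \<Rightarrow> real"
    proof (intro exI allI)
      fix z
      have "\<bar>w j\<bar> * 1 \<le> \<bar>w j\<bar> * (1 + \<bar>z\<bar>)" by (intro mult_left_mono) auto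
      then show "\<bar>(w(i := z)) j\<bar> \<le> \<bar>w j\<bar> * (1 + \<bar>z\<bar>)" using False by simp
    qed
  qed (use int in auto)
  then show ?thesis using False by simp
qed

section \<open>Gaussian series\<close>

text \<open>Level \<open>l\<close> carries the Gaussians indexed by \<open>Q l\<close>. The rates
  2^l for their number and 2^(-l/2) for the sum of their coefficients are those of a Schauder
  expansion, and \<open>m\<close> counts the independent copies.\<close>

locale gauss_series =
  fixes Q :: "nat \<Rightarrow> 'q set" and a :: "nat \<Rightarrow> 'q \<Rightarrow> real \<Rightarrow> real"
    and R :: "real \<Rightarrow> real \<Rightarrow> real" and m :: nat
  assumes finite_Q: "\<And>l. finite (Q l)" and card_Q: "\<And>l. card (Q l) \<le> m * 2 ^ l"
    and cont_a: "\<And>l q. continuous_on UNIV (a l q)" and a_0: "\<And>l q. a l q 0 = 0"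
    and bound_a: "\<And>T. \<exists>C\<ge>0. \<forall>t\<in>{0..T}. \<forall>l. (\<Sum>q\<in>Q l. \<bar>a l q t\<bar>) \<le> C * (1 / sqrt 2) ^ l"
    and sums_R: "\<And>s t. s \<ge> 0 \<Longrightarrow> t \<ge> 0 \<Longrightarrow> (\<lambda>l. \<Sum>q\<in>Q l. a l q s * a l q t) sums R s t"
begin

abbreviation \<Omega> :: "(nat \<times> 'q \<Rightarrow> real) measure" where "\<Omega> \<equiv> gauss_space"

text \<open>The ratio r = 1/3 has to satisfy r < 1/2, so that the expectations, of order (2 r)^l,
  are summable, and r > 1/4, so that the resulting bound r^(-l/4) for a coordinate loses against
  2^(-l/2). With squares instead of fourth powers the two conditions would exclude each
  other.\<close>

definition wt :: "(nat \<times> 'q \<Rightarrow> real) \<Rightarrow> nat \<Rightarrow> real" where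
  "wt w l = (1 / 3) ^ l * (\<Sum>q\<in>Q l. w (l, q) ^ 4)"

definition good :: "(nat \<times> 'q \<Rightarrow> real) set" where
  "good = {w. summable (wt w)}"

text \<open>On \<open>good\<close> one has \<open>\<bar>w (l, q)\<bar> \<le> 3 powr (l / 4) * S w\<close>, which the decay \<open>2 powr (- l / 2)\<close> of \<open>bound_a\<close>
  outweighs; so \<open>X w\<close> converges locally uniformly, with a square integrable bound \<open>const * S w\<close>.\<close>

definition S :: "(nat \<times> 'q \<Rightarrow> real) \<Rightarrow> real" where
  "S w = (if w \<in> good then sqrt (sqrt (suminf (wt w))) else 0)"

definition level :: "nat \<Rightarrow> (nat \<times> 'q \<Rightarrow> real) \<Rightarrow> real \<Rightarrow> real" where
  "level l w t = (\<Sum>q\<in>Q l. a l q t * w (l, q))"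

text \<open>The value 0 off the set where the series is controlled makes every path continuous, so
  that no exceptional set appears in the push-forward.\<close>

definition X :: "(nat \<times> 'q \<Rightarrow> real) \<Rightarrow> real \<Rightarrow> real" where
  "X w t = (if w \<in> good then \<Sum>l. level l w t else 0)"

sublocale prob_space \<Omega> by (rule prob_space_gauss_space)

lemma wt_nonneg: "wt w l \<ge> 0"
  unfolding wt_def by (intro mult_nonneg_nonneg sum_nonneg) auto

lemma measurable_wt[measurable]: "(\<lambda>w. wt w l) \<in> borel_measurable \<Omega>"
  unfolding wt_def by measurable

lemma measurable_level[measurable]: "(\<lambda>w. level l w t) \<in> borel_measurable \<Omega>"
  unfolding level_def by measurable

lemma nn_integral_wt: "(\<integral>\<^sup>+w. ennreal (wt w l) \<partial>\<Omega>) \<le> ennreal (3 * real m * (2 / 3) ^ l)"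
proof -
  have "integrable \<Omega> (\<lambda>w. wt w l)" unfolding wt_def
    by (intro integrable_mult_right Bochner_Integration.integrable_sum gauss_component_moments(1))
  then have "(\<integral>\<^sup>+w. ennreal (wt w l) \<partial>\<Omega>) = ennreal (LINT w|\<Omega>. wt w l)"
    by (intro nn_integral_eq_integral) (auto simp: wt_nonneg)
  also have "(LINT w|\<Omega>. wt w l) = (1 / 3) ^ l * (real (card (Q l)) * 3)"
  proof -
    have "(LINT w|\<Omega>. (\<Sum>q\<in>Q l. w (l, q) ^ 4)) = (\<Sum>q\<in>Q l. (LINT w|\<Omega>. w (l, q) ^ 4))"
      by (rule Bochner_Integration.integral_sum) (rule gauss_component_moments(1))
    then show ?thesis unfolding wt_def by (simp add: gauss_component_moments(4))
  qed
  also have "\<dots> \<le> 3 * real m * (2 / 3) ^ l"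
  proof -
    have "real (card (Q l)) \<le> real (m * 2 ^ l)" using card_Q[of l] of_nat_le_iff by blast
    then have "(1 / 3) ^ l * (real (card (Q l)) * 3) \<le> (1 / 3) ^ l * (real (m * 2 ^ l) * 3)"
      by (intro mult_left_mono mult_right_mono) auto
    also have "\<dots> = 3 * real m * (2 / 3) ^ l" by (simp add: power_divide)
    finally show ?thesis .
  qed
  finally show ?thesis by (simp add: ennreal_leI)
qed

lemma nn_integral_sum_wt: "(\<integral>\<^sup>+w. (\<Sum>l. ennreal (wt w l)) \<partial>\<Omega>) < \<infinity>"
proof -
  have "summable (\<lambda>l. 3 * real m * (2 / 3 :: real) ^ l)" by (intro summable_mult summable_geometric) simp
  have "(\<integral>\<^sup>+w. (\<Sum>l. ennreal (wt w l)) \<partial>\<Omega>) = (\<Sum>l. \<integral>\<^sup>+w. ennreal (wt w l) \<partial>\<Omega>)"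
    by (rule nn_integral_suminf) simp
  also have "\<dots> \<le> (\<Sum>l. ennreal (3 * real m * (2 / 3) ^ l))"
    by (intro suminf_le nn_integral_wt) auto
  also have "\<dots> = ennreal (\<Sum>l. 3 * real m * (2 / 3) ^ l)"
    by (rule suminf_ennreal2) (use \<open>summable _\<close> in auto)
  also have "\<dots> < \<infinity>" by simp
  finally show ?thesis .
qed

lemma AE_good: "AE w in \<Omega>. w \<in> good"
proof -
  have "AE w in \<Omega>. (\<Sum>l. ennreal (wt w l)) \<noteq> \<infinity>"
    by (rule nn_integral_PInf_AE) (use nn_integral_sum_wt in auto)
  then show ?thesis
    by eventually_elim (auto simp: good_def wt_nonneg intro!: summable_suminf_not_top)
qed

lemma good_measurable[measurable]: "good \<in> sets \<Omega>"
proof -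
  have "good = {w \<in> space \<Omega>. Cauchy (\<lambda>n. \<Sum>l<n. wt w l)}"
    by (simp add: good_def space_PiM summable_iff_convergent Cauchy_convergent_iff)
  then show ?thesis by simp
qed

lemma S_nonneg: "S w \<ge> 0"
  by (simp add: S_def good_def suminf_nonneg wt_nonneg)

lemma measurable_S[measurable]: "S \<in> borel_measurable \<Omega>"
  unfolding S_def by measurable

lemma S_power4: "w \<in> good \<Longrightarrow> S w ^ 4 = suminf (wt w)"
proof -
  assume w: "w \<in> good"
  then have "suminf (wt w) \<ge> 0" by (simp add: good_def suminf_nonneg wt_nonneg)
  moreover have "S w ^ 4 = ((S w)\<^sup>2)\<^sup>2" by simp
  ultimately show ?thesis using w by (simp add: S_def)
qed

lemma integrable_S_square: "integrable \<Omega> (\<lambda>w. (S w)\<^sup>2)"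
proof -
  have "integrable \<Omega> (\<lambda>w. (S w) ^ 4)"
  proof (rule integrableI_bounded)
    have "(\<integral>\<^sup>+w. ennreal (norm (S w ^ 4)) \<partial>\<Omega>) = (\<integral>\<^sup>+w. (\<Sum>l. ennreal (wt w l)) \<partial>\<Omega>)"
    proof (rule nn_integral_cong_AE, use AE_good in eventually_elim)
      fix w assume w: "w \<in> good"
      have "(\<Sum>l. ennreal (wt w l)) = ennreal (suminf (wt w))"
        by (rule suminf_ennreal2) (use w in \<open>auto simp: good_def wt_nonneg\<close>)
      then show "ennreal (norm (S w ^ 4)) = (\<Sum>l. ennreal (wt w l))"
        using S_nonneg[of w] by (simp add: S_power4[OF w, symmetric])
    qed
    then show "(\<integral>\<^sup>+w. ennreal (norm (S w ^ 4)) \<partial>\<Omega>) < \<infinity>" using nn_integral_sum_wt by simp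
  qed simp
  then have "integrable \<Omega> (\<lambda>w. 1 + S w ^ 4)" by simp
  then show ?thesis
  proof (rule Bochner_Integration.integrable_bound)
    have "x\<^sup>2 \<le> 1 + x ^ 4" for x :: real
    proof -
      have "0 \<le> (x\<^sup>2 - 1)\<^sup>2" by simp
      then have "2 * x\<^sup>2 \<le> 1 + x ^ 4" by (simp add: power2_diff)
      then show ?thesis using zero_le_power2[of x] by linarith
    qed
    then show "AE w in \<Omega>. norm ((S w)\<^sup>2) \<le> norm (1 + S w ^ 4)" by simp
  qed simp
qed

lemma component_bound:
  assumes "w \<in> good" "q \<in> Q l"
  shows "\<bar>w (l, q)\<bar> \<le> sqrt (sqrt 3) ^ l * S w"
proof -
  have sm: "summable (wt w)" using assms by (simp add: good_def)
  have "(1 / 3) ^ l * w (l, q) ^ 4 \<le> wt w l"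
    unfolding wt_def by (intro mult_left_mono member_le_sum) (use assms finite_Q in auto)
  also have "\<dots> \<le> suminf (wt w)"
    using sum_le_suminf[OF sm, of "{l}"] by (simp add: wt_nonneg)
  also have "\<dots> = S w ^ 4" using S_power4 assms by simp
  finally have "w (l, q) ^ 4 \<le> 3 ^ l * S w ^ 4" by (simp add: field_simps power_divide)
  also have "\<dots> = (sqrt (sqrt 3) ^ l * S w) ^ 4"
  proof -
    have "(sqrt (sqrt 3)) ^ 4 = ((sqrt (sqrt 3))\<^sup>2)\<^sup>2" by (simp only: power_mult[symmetric]) (simp add: numeral_eq_Suc)
    then have "(sqrt (sqrt 3)) ^ 4 = 3" by simp
    then have "(sqrt (sqrt 3) ^ l) ^ 4 = 3 ^ l" by (metis mult.commute power_mult)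
    then show ?thesis by (simp add: power_mult_distrib)
  qed
  finally have "\<bar>w (l, q)\<bar> ^ 4 \<le> (sqrt (sqrt 3) ^ l * S w) ^ 4" by simp
  then show ?thesis by (rule power_le_imp_le_base[of _ 3, simplified]) (simp add: S_nonneg)
qed

definition \<rho> :: real where "\<rho> = sqrt (sqrt 3) / sqrt 2"

lemma \<rho>_bounds: "0 \<le> \<rho>" "\<rho> < 1"
proof -
  show "0 \<le> \<rho>" by (simp add: \<rho>_def)
  have "sqrt 3 < sqrt 4" by (simp only: real_sqrt_less_iff)
  then have "sqrt (sqrt 3) < sqrt 2" by simp
  then show "\<rho> < 1" by (simp add: \<rho>_def)
qed

lemma level_bound:
  assumes w: "w \<in> good" and C: "(\<Sum>q\<in>Q l. \<bar>a l q t\<bar>) \<le> C * (1 / sqrt 2) ^ l"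
  shows "\<bar>level l w t\<bar> \<le> C * \<rho> ^ l * S w"
proof -
  have "\<bar>level l w t\<bar> \<le> (\<Sum>q\<in>Q l. \<bar>a l q t\<bar> * \<bar>w (l, q)\<bar>)"
    unfolding level_def abs_mult[symmetric] by (rule sum_abs)
  also have "\<dots> \<le> (\<Sum>q\<in>Q l. \<bar>a l q t\<bar> * (sqrt (sqrt 3) ^ l * S w))"
    by (intro sum_mono mult_left_mono component_bound w) auto
  also have "\<dots> = (\<Sum>q\<in>Q l. \<bar>a l q t\<bar>) * (sqrt (sqrt 3) ^ l * S w)" by (simp add: sum_distrib_right)
  also have "\<dots> \<le> (C * (1 / sqrt 2) ^ l) * (sqrt (sqrt 3) ^ l * S w)"
    by (intro mult_right_mono C mult_nonneg_nonneg) (auto simp: S_nonneg)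
  also have "\<dots> = C * \<rho> ^ l * S w" by (simp add: \<rho>_def power_divide)
  finally show ?thesis .
qed

definition K :: "real \<Rightarrow> real" where
  "K T = (SOME C. C \<ge> 0 \<and> (\<forall>t\<in>{0..T}. \<forall>l. (\<Sum>q\<in>Q l. \<bar>a l q t\<bar>) \<le> C * (1 / sqrt 2) ^ l))"

lemma K: "K T \<ge> 0" "t \<in> {0..T} \<Longrightarrow> (\<Sum>q\<in>Q l. \<bar>a l q t\<bar>) \<le> K T * (1 / sqrt 2) ^ l"
proof -
  have "K T \<ge> 0 \<and> (\<forall>t\<in>{0..T}. \<forall>l. (\<Sum>q\<in>Q l. \<bar>a l q t\<bar>) \<le> K T * (1 / sqrt 2) ^ l)"
    unfolding K_def by (rule someI_ex) (use bound_a[of T] in blast)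
  then show "K T \<ge> 0" "t \<in> {0..T} \<Longrightarrow> (\<Sum>q\<in>Q l. \<bar>a l q t\<bar>) \<le> K T * (1 / sqrt 2) ^ l" by auto
qed

lemma summable_level_bound: "summable (\<lambda>l. K T * \<rho> ^ l * S w)"
  by (intro summable_mult2 summable_mult summable_geometric) (use \<rho>_bounds in auto)

lemma summable_level: "w \<in> good \<Longrightarrow> t \<ge> 0 \<Longrightarrow> summable (\<lambda>l. level l w t)"
  by (rule summable_comparison_test'[OF summable_level_bound[of t w], of 0])
     (use level_bound K in auto)

lemma level_sums: "w \<in> good \<Longrightarrow> t \<ge> 0 \<Longrightarrow> (\<lambda>l. level l w t) sums X w t"
  using summable_level by (simp add: X_def summable_sums)

definition M :: "real \<Rightarrow> real" where "M T = K T / (1 - \<rho>)"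

lemma M_nonneg: "M T \<ge> 0" using K(1) \<rho>_bounds by (simp add: M_def)

text \<open>Comparison with the full geometric series makes the bound independent of the truncation
  \<open>L\<close>; it is the dominating function for the limits of first and second
  moments.\<close>

lemma partial_sum_bound:
  assumes "w \<in> good" "t \<in> {0..T}"
  shows "\<bar>\<Sum>l<L. level l w t\<bar> \<le> M T * S w"
proof -
  have "\<bar>\<Sum>l<L. level l w t\<bar> \<le> (\<Sum>l<L. \<bar>level l w t\<bar>)" by (rule sum_abs)
  also have "\<dots> \<le> (\<Sum>l<L. K T * \<rho> ^ l * S w)"
    by (intro sum_mono level_bound K) (use assms in auto)
  also have "\<dots> \<le> (\<Sum>l. K T * \<rho> ^ l * S w)"
    by (rule sum_le_suminf[OF summable_level_bound]) (use K \<rho>_bounds S_nonneg in auto)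
  also have "\<dots> = K T * (1 / (1 - \<rho>)) * S w"
    using \<rho>_bounds by (subst suminf_mult2[symmetric], intro summable_mult summable_geometric)
       (auto simp: suminf_mult suminf_geometric summable_geometric)
  finally show ?thesis by (simp add: M_def)
qed

lemma X_bound:
  assumes "t \<in> {0..T}"
  shows "\<bar>X w t\<bar> \<le> M T * S w"
proof (cases "w \<in> good")
  case True
  have "(\<lambda>L. \<bar>\<Sum>l<L. level l w t\<bar>) \<longlonglongrightarrow> \<bar>X w t\<bar>"
    using level_sums[OF True, of t] assms by (auto simp: sums_def intro!: tendsto_intros)
  then show ?thesis
    by (rule LIMSEQ_le_const2) (use partial_sum_bound[OF True assms] in auto)
next
  case False
  then show ?thesis by (simp add: X_def S_nonneg M_nonneg)
qed

lemma continuous_X_Icc: "continuous_on {0..T} (X w)"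
proof (cases "w \<in> good")
  case True
  have ul: "uniform_limit {0..T} (\<lambda>n t. \<Sum>l<n. level l w t) (\<lambda>t. \<Sum>l. level l w t) sequentially"
    by (rule Weierstrass_m_test[OF _ summable_level_bound[of T w]])
       (use level_bound[OF True] K(2)[of _ T] in auto)
  have cl: "continuous_on {0..T} (\<lambda>t. level l w t)" for l
    unfolding level_def
    by (intro continuous_intros continuous_on_subset[OF cont_a]) auto
  have "continuous_on {0..T} (\<lambda>t. \<Sum>l. level l w t)"
    by (rule uniform_limit_theorem[OF _ ul trivial_limit_sequentially],
        rule always_eventually, rule allI, rule continuous_on_sum, rule cl)
  then show ?thesis using True by (simp add: X_def cong: continuous_on_cong)
next
  case False
  then have "X w = (\<lambda>_. 0)" by (simp add: X_def fun_eq_iff)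
  then show ?thesis by simp
qed

lemma continuous_X: "continuous_on {0..} (X w)"
proof (rule continuous_on_eq_continuous_within[THEN iffD2], rule ballI)
  fix x :: real assume x: "x \<in> {0..}"
  have "continuous (at x within {0..x + 1}) (X w)"
    using continuous_X_Icc[of "x + 1" w] x by (simp add: continuous_on_eq_continuous_within)
  moreover have "at x within {0..x + 1} = at x within {0..}"
    by (rule at_within_nhd[of _ "{..<x + 1}"]) auto
  ultimately show "continuous (at x within {0..}) (X w)" by simp
qed

lemma X_0: "X w 0 = 0"
  by (simp add: X_def level_def a_0)

lemma measurable_X[measurable]: "(\<lambda>w. X w t) \<in> borel_measurable \<Omega>"
  unfolding X_def by measurable

lemma measurable_X_joint: "(\<lambda>(t, w). X w t) \<in> borel_measurable (lborel \<Otimes>\<^sub>M \<Omega>)"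
proof -
  have [measurable]: "a l q \<in> borel_measurable borel" for l q
    using cont_a by (rule borel_measurable_continuous_onI)
  have "(\<lambda>x. level l (snd x) (fst x)) \<in> borel_measurable (lborel \<Otimes>\<^sub>M \<Omega>)" for l
    unfolding level_def by measurable
  then have "(\<lambda>x. if snd x \<in> good then \<Sum>l. level l (snd x) (fst x) else 0) \<in> borel_measurable (lborel \<Otimes>\<^sub>M \<Omega>)"
    by measurable
  then show ?thesis by (simp add: X_def split_beta')
qed

lemma X_square_integrable: "integrable \<Omega> (\<lambda>w. (X w t)\<^sup>2)" if "t \<ge> 0"
proof (rule Bochner_Integration.integrable_bound)
  show "integrable \<Omega> (\<lambda>w. (M t)\<^sup>2 * (S w)\<^sup>2)" using integrable_S_square by simp
  have "(X w t)\<^sup>2 \<le> (M t * S w)\<^sup>2" for w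
    using power_mono[OF X_bound[of t t w] abs_ge_zero, of 2] that by simp
  then show "AE w in \<Omega>. norm ((X w t)\<^sup>2) \<le> norm ((M t)\<^sup>2 * (S w)\<^sup>2)" by (simp add: power_mult_distrib)
qed simp

end

section \<open>From Gaussian series to laws on path space\<close>

lemma gaussian_rv_distr:
  assumes f: "f \<in> measurable M N" and g: "g \<in> borel_measurable N" and gv: "gaussian_rv M (\<lambda>x. g (f x))"
  shows "gaussian_rv (distr M N f) g"
proof -
  have [measurable]: "f \<in> measurable M N" "g \<in> borel_measurable N" by fact+
  have "(AE x in distr M N f. g x = m) \<longleftrightarrow> (AE x in M. g (f x) = m)" for m
    by (rule AE_distr_iff) auto
  moreover have "distr (distr M N f) lborel g = distr M lborel (\<lambda>x. g (f x))"
    by (subst distr_distr) (auto simp: comp_def)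
  ultimately show ?thesis using gv unfolding gaussian_rv_def distributed_def by simp
qed

lemma gauss_components_indep: "prob_space.indep_vars gauss_space (\<lambda>_. borel) (\<lambda>i w. w i) UNIV"
proof -
  interpret prob_space gauss_space by (rule prob_space_gauss_space)
  have 1: "distr gauss_space borel (\<lambda>w. w i) = stdn" for i
  proof -
    have "distr gauss_space borel (\<lambda>w. w i) = distr gauss_space stdn (\<lambda>w. w i)" by (rule distr_cong) auto
    also have "\<dots> = stdn" by (rule distr_PiM_component) (auto intro: prob_space_stdn)
    finally show ?thesis .
  qed
  have "distr gauss_space (PiM UNIV (\<lambda>_. borel)) (\<lambda>x. \<lambda>i\<in>UNIV. x i) = distr gauss_space (PiM UNIV (\<lambda>_. borel)) (\<lambda>x. x)"
    by (simp add: restrict_UNIV)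
  also have "\<dots> = gauss_space" by (rule distr_id2) (rule sets_PiM_cong, auto)
  finally show ?thesis
    by (subst indep_vars_iff_distr_eq_PiM) (simp_all add: 1)
qed

lemma gauss_space_iexp:
  fixes b :: "'i \<Rightarrow> real"
  assumes "finite I"
  shows "(LINT w|gauss_space. iexp (\<Sum>i\<in>I. b i * w i)) = exp (- (1 / 2) * (\<Sum>i\<in>I. (b i)\<^sup>2))"
proof -
  interpret prob_space "gauss_space :: ('i \<Rightarrow> real) measure" by (rule prob_space_gauss_space)
  have ind: "indep_vars (\<lambda>_. borel) (\<lambda>i w. b i * w i) I"
    by (rule indep_vars_compose2[where M' = "\<lambda>_. borel" and X = "\<lambda>i w. w i" and Y = "\<lambda>i x. b i * x"])
       (use indep_vars_subset[OF gauss_components_indep] in auto)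
  have one: "char (distr gauss_space borel (\<lambda>w::'i \<Rightarrow> real. b i * w i)) 1 = complex_of_real (exp (- ((b i)\<^sup>2) / 2))" for i
  proof -
    have D: "distr gauss_space stdn (\<lambda>w::'i \<Rightarrow> real. w i) = stdn"
      by (rule distr_PiM_component) (auto intro: prob_space_stdn)
    have "char (distr gauss_space borel (\<lambda>w::'i \<Rightarrow> real. b i * w i)) 1 = (LINT w|(gauss_space :: ('i \<Rightarrow> real) measure). iexp (b i * w i))"
      unfolding char_def by (subst integral_distr) auto
    also have "\<dots> = (LINT z|distr gauss_space stdn (\<lambda>w::'i \<Rightarrow> real. w i). iexp (b i * z))"
      by (subst integral_distr) auto
    also have "\<dots> = char stdn (b i)" unfolding D char_def ..
    finally show ?thesis unfolding char_std_normal_distribution .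
  qed
  have "(LINT w|gauss_space. iexp (\<Sum>i\<in>I. b i * w i)) = char (distr gauss_space borel (\<lambda>w. \<Sum>i\<in>I. b i * w i)) 1"
    unfolding char_def by (subst integral_distr) auto
  also have "\<dots> = (\<Prod>i\<in>I. complex_of_real (exp (- ((b i)\<^sup>2) / 2)))"
    unfolding char_distr_sum[OF ind] one ..
  also have "\<dots> = complex_of_real (exp (\<Sum>i\<in>I. - ((b i)\<^sup>2) / 2))" by (simp add: exp_sum assms)
  also have "(\<Sum>i\<in>I. - ((b i)\<^sup>2) / 2) = - (1 / 2) * (\<Sum>i\<in>I. (b i)\<^sup>2)"
    by (simp add: sum_distrib_left sum_negf)
  finally show ?thesis .
qed

text \<open>Uniqueness of characteristic functions identifies the law with a scaled standard normal.
  Variance 0 is separate, because a density exists only for a positive standard deviation.\<close>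

lemma (in prob_space) gaussian_rv_of_iexp:
  assumes [measurable]: "Y \<in> borel_measurable M" and v: "v \<ge> 0"
    and c: "\<And>\<theta>. (LINT x|M. iexp (\<theta> * Y x)) = exp (- (1 / 2) * \<theta>\<^sup>2 * v)"
  shows "gaussian_rv M Y"
proof -
  interpret D: prob_space "distr M borel Y" by (rule prob_space_distr) simp
  have rd: "real_distribution (distr M borel Y)"
    by (intro real_distribution.intro D.prob_space_axioms real_distribution_axioms.intro) auto
  have cd: "char (distr M borel Y) \<theta> = exp (- (1 / 2) * \<theta>\<^sup>2 * v)" for \<theta>
    unfolding char_def c[symmetric] by (subst integral_distr) auto
  show ?thesis
  proof (cases "v = 0")
    case True
    interpret Z: prob_space "return borel (0::real)" by (rule prob_space_return) simp
    have "real_distribution (return borel (0::real))"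
      by (intro real_distribution.intro Z.prob_space_axioms real_distribution_axioms.intro) auto
    moreover have "char (return borel (0::real)) \<theta> = 1" for \<theta>
      unfolding char_def by (subst integral_return) auto
    ultimately have eq: "distr M borel Y = return borel 0"
      using rd cd True by (intro Levy_uniqueness ext) auto
    have "AE x in return borel (0::real). x = 0" by (subst AE_return) auto
    then have "AE x in distr M borel Y. x = 0" unfolding eq .
    then have "AE x in M. Y x = 0" by (subst (asm) AE_distr_iff) auto
    then show ?thesis unfolding gaussian_rv_def by auto
  next
    case False
    then have v0: "v > 0" using v by simp
    interpret N: prob_space stdn by (rule prob_space_stdn)
    have d0: "distributed stdn lborel (\<lambda>x. x) (normal_density 0 1)"
      unfolding distributed_def by (auto intro: distr_id2 simp: distr_id2)
    have d1: "distributed stdn lborel (\<lambda>x. 0 + sqrt v * x) (\<lambda>x. ennreal (normal_density (0 + sqrt v * 0) (\<bar>sqrt v\<bar> * 1) x))"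
      by (rule N.normal_density_affine[OF d0]) (use v0 in auto)
    then have d2: "distr stdn lborel (\<lambda>x. sqrt v * x) = density lborel (normal_density 0 (sqrt v))"
      using v0 by (simp add: distributed_def)
    interpret N2: prob_space "distr stdn borel (\<lambda>x. sqrt v * x)" by (rule N.prob_space_distr) simp
    have "real_distribution (distr stdn borel (\<lambda>x. sqrt v * x))"
      by (intro real_distribution.intro N2.prob_space_axioms real_distribution_axioms.intro) auto
    moreover have "char (distr stdn borel (\<lambda>x. sqrt v * x)) \<theta> = exp (- (1 / 2) * \<theta>\<^sup>2 * v)" for \<theta>
    proof -
      have "char (distr stdn borel (\<lambda>x. sqrt v * x)) \<theta> = char stdn (\<theta> * sqrt v)"
        unfolding char_def by (subst integral_distr) (auto simp: mult.assoc)
      also have "\<dots> = exp (- (1 / 2) * \<theta>\<^sup>2 * v)"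
        unfolding char_std_normal_distribution using v0 by (simp add: power_mult_distrib)
      finally show ?thesis .
    qed
    ultimately have "distr M borel Y = distr stdn borel (\<lambda>x. sqrt v * x)"
      using rd cd by (intro Levy_uniqueness ext) auto
    then have "distr M lborel Y = density lborel (normal_density 0 (sqrt v))"
      using d2 distr_cong[of M M borel lborel Y Y] distr_cong[of stdn stdn borel lborel "\<lambda>x. sqrt v * x" "\<lambda>x. sqrt v * x"]
      by simp
    then have "distributed M lborel Y (\<lambda>x. ennreal (normal_density 0 (sqrt v) x))"
      by (simp add: distributed_def)
    moreover have "sqrt v > 0" using v0 by simp
    ultimately show ?thesis unfolding gaussian_rv_def using assms(1) by blast
  qed
qed

context gauss_series begin

lemma partial_sum_Sigma:
  "(\<Sum>l<L. level l w t) = (\<Sum>i\<in>Sigma {..<L} Q. a (fst i) (snd i) t * w i)"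
  unfolding level_def by (subst sum.Sigma) (auto simp: finite_Q split_beta')

lemma partial_cov_Sigma:
  "(\<Sum>l<L. \<Sum>q\<in>Q l. a l q s * a l q t) = (\<Sum>i\<in>Sigma {..<L} Q. a (fst i) (snd i) s * a (fst i) (snd i) t)"
  by (subst sum.Sigma) (auto simp: finite_Q split_beta')

lemma finite_SigmaQ: "finite (Sigma {..<L} Q)"
  by (rule finite_SigmaI) (auto simp: finite_Q)

lemma partial_sums_X: "w \<in> good \<Longrightarrow> t \<ge> 0 \<Longrightarrow> (\<lambda>L. \<Sum>l<L. level l w t) \<longlonglongrightarrow> X w t"
  using level_sums by (simp add: sums_def)

text \<open>For the truncated series the Gaussian formula is a finite computation, and both sides
  pass to the limit, the left one with dominating function 1. The second claim holds for a limit of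
  sums of squares.\<close>

lemma linear_combination_iexp:
  assumes F: "finite F" "F \<subseteq> {0..}"
  shows "(LINT w|\<Omega>. iexp (\<Sum>t\<in>F. b t * X w t)) = exp (- (1 / 2) * (\<Sum>s\<in>F. \<Sum>t\<in>F. b s * b t * R s t))"
    and "0 \<le> (\<Sum>s\<in>F. \<Sum>t\<in>F. b s * b t * R s t)"
proof -
  define \<beta> where "\<beta> = (\<lambda>i. \<Sum>t\<in>F. b t * a (fst i) (snd i) t)"
  define V where "V = (\<lambda>L. \<Sum>i\<in>Sigma {..<L} Q. (\<beta> i)\<^sup>2)"
  have F0: "t \<ge> 0" if "t \<in> F" for t using that F by auto
  have part: "(\<Sum>t\<in>F. b t * (\<Sum>l<L. level l w t)) = (\<Sum>i\<in>Sigma {..<L} Q. \<beta> i * w i)" for L w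
    unfolding partial_sum_Sigma \<beta>_def sum_distrib_left sum_distrib_right
    by (subst sum.swap) (simp only: mult.assoc)
  have V: "V L = (\<Sum>s\<in>F. \<Sum>t\<in>F. b s * b t * (\<Sum>l<L. \<Sum>q\<in>Q l. a l q s * a l q t))" for L
  proof -
    have "V L = (\<Sum>i\<in>Sigma {..<L} Q. \<Sum>s\<in>F. \<Sum>t\<in>F. b s * b t * (a (fst i) (snd i) s * a (fst i) (snd i) t))"
      unfolding V_def \<beta>_def power2_eq_square sum_product by (intro sum.cong refl) (simp only: ac_simps)
    also have "\<dots> = (\<Sum>s\<in>F. \<Sum>i\<in>Sigma {..<L} Q. \<Sum>t\<in>F. b s * b t * (a (fst i) (snd i) s * a (fst i) (snd i) t))"
      by (rule sum.swap)
    also have "\<dots> = (\<Sum>s\<in>F. \<Sum>t\<in>F. \<Sum>i\<in>Sigma {..<L} Q. b s * b t * (a (fst i) (snd i) s * a (fst i) (snd i) t))"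
      by (intro sum.cong refl sum.swap)
    finally show ?thesis unfolding partial_cov_Sigma sum_distrib_left .
  qed
  have Vlim: "V \<longlonglongrightarrow> (\<Sum>s\<in>F. \<Sum>t\<in>F. b s * b t * R s t)"
    unfolding V using sums_R F0 by (intro tendsto_intros) (auto simp: sums_def)
  show "0 \<le> (\<Sum>s\<in>F. \<Sum>t\<in>F. b s * b t * R s t)"
    by (rule LIMSEQ_le_const[OF Vlim]) (auto simp: V_def intro!: sum_nonneg)
  have "(\<lambda>L. LINT w|\<Omega>. iexp (\<Sum>t\<in>F. b t * (\<Sum>l<L. level l w t))) \<longlonglongrightarrow> (LINT w|\<Omega>. iexp (\<Sum>t\<in>F. b t * X w t))"
  proof (rule integral_dominated_convergence[where w = "\<lambda>_. 1"])
    show "AE w in \<Omega>. (\<lambda>L. iexp (\<Sum>t\<in>F. b t * (\<Sum>l<L. level l w t))) \<longlonglongrightarrow> iexp (\<Sum>t\<in>F. b t * X w t)"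
      using AE_good
    proof eventually_elim
      case (elim w)
      then have "(\<lambda>L. \<Sum>t\<in>F. b t * (\<Sum>l<L. level l w t)) \<longlonglongrightarrow> (\<Sum>t\<in>F. b t * X w t)"
        using partial_sums_X F0 by (intro tendsto_intros) auto
      then show ?case by (intro tendsto_exp tendsto_mult tendsto_const tendsto_of_real)
    qed
  qed auto
  moreover have "(LINT w|\<Omega>. iexp (\<Sum>t\<in>F. b t * (\<Sum>l<L. level l w t))) = exp (- (1 / 2) * V L)" for L
    unfolding part V_def by (rule gauss_space_iexp[OF finite_SigmaQ])
  moreover have "(\<lambda>L. complex_of_real (exp (- (1 / 2) * V L))) \<longlonglongrightarrow> exp (- (1 / 2) * (\<Sum>s\<in>F. \<Sum>t\<in>F. b s * b t * R s t))"
    by (intro tendsto_intros Vlim)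
  ultimately show "(LINT w|\<Omega>. iexp (\<Sum>t\<in>F. b t * X w t)) = exp (- (1 / 2) * (\<Sum>s\<in>F. \<Sum>t\<in>F. b s * b t * R s t))"
    using LIMSEQ_unique by auto
qed

lemma linear_combination_gaussian:
  assumes F: "finite F" "F \<subseteq> {0..}"
  shows "gaussian_rv \<Omega> (\<lambda>w. \<Sum>t\<in>F. b t * X w t)"
proof (rule gaussian_rv_of_iexp[OF _ linear_combination_iexp(2)[OF F, of b]])
  fix \<theta>
  have "(\<Sum>s\<in>F. \<Sum>t\<in>F. \<theta> * b s * (\<theta> * b t) * R s t) = \<theta>\<^sup>2 * (\<Sum>s\<in>F. \<Sum>t\<in>F. b s * b t * R s t)"
    unfolding sum_distrib_left power2_eq_square by (intro sum.cong refl) (simp only: ac_simps)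
  then show "(LINT w|\<Omega>. iexp (\<theta> * (\<Sum>t\<in>F. b t * X w t))) = exp (- (1 / 2) * \<theta>\<^sup>2 * (\<Sum>s\<in>F. \<Sum>t\<in>F. b s * b t * R s t))"
    using linear_combination_iexp(1)[OF F, of "\<lambda>t. \<theta> * b t"] by (simp add: sum_distrib_left mult.assoc)
qed measurable

lemma integrable_S: "integrable \<Omega> S"
proof (rule Bochner_Integration.integrable_bound)
  show "integrable \<Omega> (\<lambda>w. 1 + (S w)\<^sup>2)" using integrable_S_square by simp
  have "\<bar>x\<bar> \<le> 1 + x\<^sup>2" for x :: real
    using zero_le_power2[of "\<bar>x\<bar> - 1"] zero_le_power2[of x] by (simp add: power2_diff)
  then show "AE w in \<Omega>. norm (S w) \<le> norm (1 + (S w)\<^sup>2)" by simp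
qed simp

lemma expectation_X: "t \<ge> 0 \<Longrightarrow> (LINT w|\<Omega>. X w t) = 0"
proof -
  assume t: "t \<ge> 0"
  have "(\<lambda>L. LINT w|\<Omega>. (\<Sum>l<L. level l w t)) \<longlonglongrightarrow> (LINT w|\<Omega>. X w t)"
  proof (rule integral_dominated_convergence[where w = "\<lambda>w. M t * S w"])
    show "AE w in \<Omega>. (\<lambda>L. \<Sum>l<L. level l w t) \<longlonglongrightarrow> X w t"
      using AE_good by eventually_elim (use partial_sums_X t in auto)
    show "AE w in \<Omega>. norm (\<Sum>l<L. level l w t) \<le> M t * S w" for L
      using AE_good by eventually_elim (use partial_sum_bound t in auto)
  qed (use integrable_S in auto)
  moreover have "(LINT w|\<Omega>. (\<Sum>l<L. level l w t)) = 0" for L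
  proof -
    have i: "integrable \<Omega> (\<lambda>w. w i)" for i using gauss_component_moments(1)[of i 1] by simp
    have "(LINT w|\<Omega>. (\<Sum>i\<in>Sigma {..<L} Q. a (fst i) (snd i) t * w i))
        = (\<Sum>i\<in>Sigma {..<L} Q. (LINT w|\<Omega>. a (fst i) (snd i) t * w i))"
      by (rule Bochner_Integration.integral_sum, rule integrable_mult_right, rule i)
    then show ?thesis unfolding partial_sum_Sigma by (simp add: gauss_component_moments(2))
  qed
  ultimately have "(\<lambda>L::nat. 0) \<longlonglongrightarrow> (LINT w|\<Omega>. X w t)" by simp
  from LIMSEQ_unique[OF tendsto_const this] show ?thesis by simp
qed

lemma covariance_X:
  assumes st: "s \<ge> 0" "t \<ge> 0"
  shows "(LINT w|\<Omega>. X w s * X w t) = R s t"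
proof -
  have "(\<lambda>L. LINT w|\<Omega>. (\<Sum>l<L. level l w s) * (\<Sum>l<L. level l w t)) \<longlonglongrightarrow> (LINT w|\<Omega>. X w s * X w t)"
  proof (rule integral_dominated_convergence[where w = "\<lambda>w. M s * M t * (S w)\<^sup>2"])
    show "AE w in \<Omega>. (\<lambda>L. (\<Sum>l<L. level l w s) * (\<Sum>l<L. level l w t)) \<longlonglongrightarrow> X w s * X w t"
      using AE_good by eventually_elim (use partial_sums_X st in \<open>auto intro!: tendsto_mult\<close>)
    show "AE w in \<Omega>. norm ((\<Sum>l<L. level l w s) * (\<Sum>l<L. level l w t)) \<le> M s * M t * (S w)\<^sup>2" for L
      using AE_good
    proof eventually_elim
      case (elim w)
      have "\<bar>\<Sum>l<L. level l w s\<bar> * \<bar>\<Sum>l<L. level l w t\<bar> \<le> (M s * S w) * (M t * S w)"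
        by (intro mult_mono partial_sum_bound elim) (use st M_nonneg S_nonneg in auto)
      then show ?case by (simp add: abs_mult power2_eq_square ac_simps)
    qed
  qed (use integrable_S_square in auto)
  moreover have "(LINT w|\<Omega>. (\<Sum>l<L. level l w s) * (\<Sum>l<L. level l w t)) = (\<Sum>l<L. \<Sum>q\<in>Q l. a l q s * a l q t)" for L
  proof -
    let ?I = "Sigma {..<L} Q"
    let ?a = "\<lambda>i. a (fst i) (snd i)"
    have int: "integrable \<Omega> (\<lambda>w. w i * w j)" for i j
      by (rule integrable_mult_square) (auto intro: gauss_component_moments(1))
    have "(LINT w|\<Omega>. (\<Sum>l<L. level l w s) * (\<Sum>l<L. level l w t))
      = (LINT w|\<Omega>. (\<Sum>i\<in>?I. \<Sum>j\<in>?I. ?a i s * ?a j t * (w i * w j)))"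
      unfolding partial_sum_Sigma sum_product
      by (intro Bochner_Integration.integral_cong sum.cong refl) (simp only: ac_simps)
    also have "\<dots> = (\<Sum>i\<in>?I. (LINT w|\<Omega>. (\<Sum>j\<in>?I. ?a i s * ?a j t * (w i * w j))))"
      by (rule Bochner_Integration.integral_sum, rule Bochner_Integration.integrable_sum, rule integrable_mult_right, rule int)
    also have "\<dots> = (\<Sum>i\<in>?I. \<Sum>j\<in>?I. (LINT w|\<Omega>. ?a i s * ?a j t * (w i * w j)))"
      by (rule sum.cong[OF refl], rule Bochner_Integration.integral_sum, rule integrable_mult_right, rule int)
    also have "\<dots> = (\<Sum>i\<in>?I. \<Sum>j\<in>?I. if i = j then ?a i s * ?a i t else 0)"
      by (intro sum.cong refl) (simp add: gauss_component_covariance)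
    also have "\<dots> = (\<Sum>i\<in>?I. ?a i s * ?a i t)" using finite_SigmaQ by simp
    finally show ?thesis unfolding partial_cov_Sigma .
  qed
  ultimately show ?thesis
    using sums_R[OF st] LIMSEQ_unique by (auto simp: sums_def)
qed

text \<open>\<open>path_set\<close> consists of functions that are extensional on the half line,
  hence the \<open>restrict\<close>.\<close>

definition law :: "(real \<Rightarrow> real) measure" where
  "law = distr \<Omega> path_space (\<lambda>w. restrict (X w) {0..})"

lemma measurable_restrict_X: "(\<lambda>w. restrict (X w) {0..}) \<in> measurable \<Omega> path_space"
proof (rule measurable_into_path_space)
  show "restrict (X w) {0..} \<in> path_set" for w
  proof -
    have "continuous_on {0..} (restrict (X w) {0..})"
      by (rule continuous_on_eq[OF continuous_X[of w]]) simp
    then show ?thesis by (simp add: path_set_def X_0 restrict_extensional)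
  qed
  show "(\<lambda>w. restrict (X w) {0..} x) \<in> borel_measurable \<Omega>" if "x \<ge> 0" for x
    using that by simp
qed

lemma law_gaussian:
  "prob_space law" "sets law = sets path_space" "centered_gaussian_process law {0..} coord R"
proof -
  show "prob_space law" unfolding law_def by (rule prob_space_distr[OF measurable_restrict_X])
  show "sets law = sets path_space" by (simp add: law_def)
  have X: "coord t (restrict (X w) {0..}) = X w t" if "t \<ge> 0" for t w
    using that by (simp add: coord_def)
  note [measurable] = measurable_coord
  show "centered_gaussian_process law {0..} coord R"
    unfolding centered_gaussian_process_def law_def
  proof (intro conjI allI ballI impI)
    fix F :: "real set" and b :: "real \<Rightarrow> real" assume F: "finite F \<and> F \<subseteq> {0..}"
    then have F0: "t \<ge> 0" if "t \<in> F" for t using that by auto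
    have "(\<lambda>w. \<Sum>t\<in>F. b t * coord t (restrict (X w) {0..})) = (\<lambda>w. \<Sum>t\<in>F. b t * X w t)"
      using F0 X by (intro ext sum.cong) auto
    then show "gaussian_rv (distr \<Omega> path_space (\<lambda>w. restrict (X w) {0..})) (\<lambda>\<omega>. \<Sum>t\<in>F. b t * coord t \<omega>)"
      using F F0 linear_combination_gaussian[of F b]
      by (intro gaussian_rv_distr[OF measurable_restrict_X]) auto
  next
    fix t :: real assume "t \<in> {0..}"
    then show "(\<integral>\<omega>. coord t \<omega> \<partial>distr \<Omega> path_space (\<lambda>w. restrict (X w) {0..})) = 0"
      by (subst integral_distr[OF measurable_restrict_X]) (auto simp: X expectation_X)
  next
    fix s t :: real assume "s \<in> {0..}" "t \<in> {0..}"
    then show "(\<integral>\<omega>. coord s \<omega> * coord t \<omega> \<partial>distr \<Omega> path_space (\<lambda>w. restrict (X w) {0..})) = R s t"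
      by (subst integral_distr[OF measurable_restrict_X]) (auto simp: X covariance_X)
  qed
qed

end

section \<open>The quadratic functional and its Fredholm equation\<close>

text \<open>Rounding the time down to a multiple of 1/(m+1) leaves countably many evaluations, each
  measurable, and continuity of the path gives convergence as m grows. The maximum with 0 keeps the
  time where paths are meaningful.\<close>

lemma measurable_coord_joint: "(\<lambda>x. coord (max (fst x) 0) (snd x)) \<in> borel_measurable (borel \<Otimes>\<^sub>M path_space)"
proof (rule borel_measurable_LIMSEQ_metric)
  define f where "f = (\<lambda>m (x :: real \<times> (real \<Rightarrow> real)). coord (real (nat \<lfloor>real (Suc m) * max (fst x) 0\<rfloor>) / real (Suc m)) (snd x))"
  show "f m \<in> borel_measurable (borel \<Otimes>\<^sub>M path_space)" for m
    unfolding f_def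
  proof (rule measurable_compose_countable[where f = "\<lambda>k x. coord (real k / real (Suc m)) (snd x)"])
    show "(\<lambda>x. coord (real k / real (Suc m)) (snd x)) \<in> borel_measurable (borel \<Otimes>\<^sub>M path_space)" for k
      by (rule measurable_compose[OF measurable_snd measurable_coord]) simp
  qed measurable
  fix x :: "real \<times> (real \<Rightarrow> real)" assume x: "x \<in> space (borel \<Otimes>\<^sub>M path_space)"
  define y where "y = max (fst x) 0"
  define w where "w = snd x"
  have w: "continuous_on {0..} w" using x by (auto simp: space_pair_measure space_path_space path_set_def w_def)
  have "(\<lambda>m. real (nat \<lfloor>real (Suc m) * y\<rfloor>) / real (Suc m)) \<longlonglongrightarrow> y"
  proof (rule real_tendsto_sandwich[of "\<lambda>m. y - 1 / real (Suc m)" _ _ "\<lambda>_. y"])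
    have b: "real (Suc m) * y - 1 \<le> real (nat \<lfloor>real (Suc m) * y\<rfloor>)" "real (nat \<lfloor>real (Suc m) * y\<rfloor>) \<le> real (Suc m) * y" for m
    proof -
      have "0 \<le> real (Suc m) * y" unfolding y_def by (intro mult_nonneg_nonneg) auto
      then show "real (Suc m) * y - 1 \<le> real (nat \<lfloor>real (Suc m) * y\<rfloor>)" "real (nat \<lfloor>real (Suc m) * y\<rfloor>) \<le> real (Suc m) * y"
        by linarith+
    qed
    show "\<forall>\<^sub>F m in sequentially. y - 1 / real (Suc m) \<le> real (nat \<lfloor>real (Suc m) * y\<rfloor>) / real (Suc m)"
    proof (intro always_eventually allI)
      fix m
      have "(real (Suc m) * y - 1) / real (Suc m) \<le> real (nat \<lfloor>real (Suc m) * y\<rfloor>) / real (Suc m)"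
        by (intro divide_right_mono b) simp
      then show "y - 1 / real (Suc m) \<le> real (nat \<lfloor>real (Suc m) * y\<rfloor>) / real (Suc m)"
        by (simp add: diff_divide_distrib)
    qed
    show "\<forall>\<^sub>F m in sequentially. real (nat \<lfloor>real (Suc m) * y\<rfloor>) / real (Suc m) \<le> y"
    proof (intro always_eventually allI)
      fix m
      have "real (nat \<lfloor>real (Suc m) * y\<rfloor>) / real (Suc m) \<le> (real (Suc m) * y) / real (Suc m)"
        by (intro divide_right_mono b) simp
      then show "real (nat \<lfloor>real (Suc m) * y\<rfloor>) / real (Suc m) \<le> y" by simp
    qed
    show "(\<lambda>m. y - 1 / real (Suc m)) \<longlonglongrightarrow> y"
      using tendsto_diff[OF tendsto_const LIMSEQ_inverse_real_of_nat, of y] by (simp add: inverse_eq_divide)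
  qed simp
  then have "(\<lambda>m. w (real (nat \<lfloor>real (Suc m) * y\<rfloor>) / real (Suc m))) \<longlonglongrightarrow> w y"
    by (intro continuous_on_tendsto_compose[OF w]) (auto simp: y_def)
  then show "(\<lambda>m. f m x) \<longlonglongrightarrow> coord (max (fst x) 0) (snd x)"
    by (simp add: f_def coord_def y_def w_def)
qed

lemma integral_Icc_eq_lborel:
  fixes f :: "real \<Rightarrow> real"
  assumes "continuous_on {0..T} f"
  shows "integral {0..T} f = (LINT y|lborel. indicator {0..T} y * f y)"
proof -
  have "set_integrable lborel {0..T} f"
    using borel_integrable_atLeastAtMost'[OF assms] .
  from set_borel_integral_eq_integral(2)[OF this] show ?thesis
    by (simp add: set_lebesgue_integral_def)
qed

lemma measurable_path_functional:
  "(\<lambda>w. exp (- (1 / 2) * integral {0..x} (\<lambda>y. (coord y w)\<^sup>2))) \<in> borel_measurable path_space"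
proof -
  have eq: "integral {0..x} (\<lambda>y. (coord y w)\<^sup>2) = (LINT y|lborel. indicator {0..x} y * (coord (max y 0) w)\<^sup>2)"
    if "w \<in> space path_space" for w
  proof -
    have "continuous_on {0..} w" using that by (simp add: space_path_space path_set_def)
    then have "continuous_on {0..x} (\<lambda>y. (coord y w)\<^sup>2)"
      unfolding coord_def by (intro continuous_intros) (auto intro: continuous_on_subset)
    then have "integral {0..x} (\<lambda>y. (coord y w)\<^sup>2) = (LINT y|lborel. indicator {0..x} y * (coord y w)\<^sup>2)"
      by (rule integral_Icc_eq_lborel)
    also have "\<dots> = (LINT y|lborel. indicator {0..x} y * (coord (max y 0) w)\<^sup>2)"
      by (intro Bochner_Integration.integral_cong) (auto simp: indicator_def max_def)
    finally show ?thesis .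
  qed
  have [measurable]: "(\<lambda>z. coord (max (snd z) 0) (fst z)) \<in> borel_measurable (path_space \<Otimes>\<^sub>M lborel)"
    using measurable_compose[OF measurable_pair_swap' measurable_coord_joint]
    by (simp add: split_beta' measurable_cong_sets[OF sets_pair_measure_cong[OF refl sets_lborel] refl])
  have "(\<lambda>(w, y). indicator {0..x} y * (coord (max y 0) w)\<^sup>2) \<in> borel_measurable (path_space \<Otimes>\<^sub>M lborel)"
    unfolding split_beta' by measurable
  from lborel.borel_measurable_lebesgue_integral[OF this]
  have "(\<lambda>w. exp (- (1 / 2) * (LINT y|lborel. indicator {0..x} y * (coord (max y 0) w)\<^sup>2))) \<in> borel_measurable path_space"
    by measurable
  then show ?thesis by (rule measurable_cong[THEN iffD1, rotated]) (simp add: eq)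
qed

lemma (in prob_space) continuous_on_expectation:
  fixes f :: "real \<Rightarrow> 'a \<Rightarrow> real"
  assumes "\<And>y. y \<in> A \<Longrightarrow> f y \<in> borel_measurable M"
    and "\<And>w. w \<in> space M \<Longrightarrow> continuous_on A (\<lambda>y. f y w)"
    and "\<And>y w. y \<in> A \<Longrightarrow> \<bar>f y w\<bar> \<le> g w" and "integrable M g"
  shows "continuous_on A (\<lambda>y. expectation (f y))"
  unfolding continuous_on_sequentially
proof (intro ballI allI impI)
  fix x u assume x: "x \<in> A" and u: "(\<forall>n. u n \<in> A) \<and> u \<longlonglongrightarrow> x"
  show "((\<lambda>y. expectation (f y)) \<circ> u) \<longlonglongrightarrow> expectation (f x)"
    unfolding comp_def
  proof (rule integral_dominated_convergence[where w = g])
    show "AE w in M. (\<lambda>n. f (u n) w) \<longlonglongrightarrow> f x w"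
    proof (rule AE_I2)
      fix w assume "w \<in> space M"
      from assms(2)[OF this] show "(\<lambda>n. f (u n) w) \<longlonglongrightarrow> f x w"
        using x u unfolding continuous_on_sequentially comp_def by blast
    qed
  qed (use assms x u in auto)
qed

text \<open>By the mean value inequality the bound \<open>g\<close> on the derivative also dominates
  the difference quotients. Working within a convex set admits the one-sided derivative at time
  0.\<close>

lemma (in prob_space) has_derivative_expectation:
  fixes f f' :: "real \<Rightarrow> 'a \<Rightarrow> real"
  assumes A: "convex A" "T \<in> A"
    and m: "\<And>t. t \<in> A \<Longrightarrow> f t \<in> borel_measurable M" "f' T \<in> borel_measurable M"
    and i: "\<And>t. t \<in> A \<Longrightarrow> integrable M (f t)"
    and d: "\<And>t w. t \<in> A \<Longrightarrow> w \<in> space M \<Longrightarrow> ((\<lambda>t. f t w) has_real_derivative f' t w) (at t within A)"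
    and b: "\<And>t w. t \<in> A \<Longrightarrow> w \<in> space M \<Longrightarrow> \<bar>f' t w\<bar> \<le> g w" and g: "integrable M g"
  shows "((\<lambda>t. expectation (f t)) has_real_derivative expectation (f' T)) (at T within A)"
  unfolding has_field_derivative_iff tendsto_at_iff_sequentially
proof (intro allI impI)
  fix u assume u: "\<forall>n. u n \<in> A - {T}" "u \<longlonglongrightarrow> T"
  have "(\<lambda>n. expectation (\<lambda>w. (f (u n) w - f T w) / (u n - T))) \<longlonglongrightarrow> expectation (f' T)"
  proof (rule integral_dominated_convergence[where w = g])
    show "f' T \<in> borel_measurable M" by (rule m)
    show "(\<lambda>w. (f (u n) w - f T w) / (u n - T)) \<in> borel_measurable M" for n
      using m(1) u A by auto
    show "integrable M g" by (rule g)
    show "AE w in M. (\<lambda>n. (f (u n) w - f T w) / (u n - T)) \<longlonglongrightarrow> f' T w"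
    proof (rule AE_I2)
      fix w assume "w \<in> space M"
      from d[OF A(2) this] show "(\<lambda>n. (f (u n) w - f T w) / (u n - T)) \<longlonglongrightarrow> f' T w"
        using u unfolding has_field_derivative_iff tendsto_at_iff_sequentially comp_def by blast
    qed
    show "AE w in M. norm ((f (u n) w - f T w) / (u n - T)) \<le> g w" for n
    proof (rule AE_I2)
      fix w assume w: "w \<in> space M"
      have "norm (f (u n) w - f T w) \<le> g w * norm (u n - T)"
        by (rule field_differentiable_bound[OF A(1) d[OF _ w]]) (use b[OF _ w] u A in auto)
      then show "norm ((f (u n) w - f T w) / (u n - T)) \<le> g w"
        using u by (simp add: divide_le_eq norm_divide)
    qed
  qed
  moreover have "expectation (\<lambda>w. (f (u n) w - f T w) / (u n - T)) = (expectation (f (u n)) - expectation (f T)) / (u n - T)" for n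
    using i u A by simp
  ultimately show "((\<lambda>y. (expectation (f y) - expectation (f T)) / (y - T)) \<circ> u) \<longlonglongrightarrow> expectation (f' T)"
    by (simp only: comp_def)
qed

context gauss_series begin

definition en :: "real \<Rightarrow> (nat \<times> 'q \<Rightarrow> real) \<Rightarrow> real" where
  "en T w = integral {0..T} (\<lambda>y. (X w y)\<^sup>2)"

definition E :: "real \<Rightarrow> (nat \<times> 'q \<Rightarrow> real) \<Rightarrow> real" where
  "E T w = exp (- (1 / 2) * en T w)"

lemma measurable_integral_X:
  assumes "continuous_on UNIV b"
  shows "(\<lambda>w. integral {0..T} (\<lambda>y. b y * X w y ^ k)) \<in> borel_measurable \<Omega>"
proof -
  have [measurable]: "b \<in> borel_measurable borel" using assms by (rule borel_measurable_continuous_onI)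
  have "(\<lambda>x. X (snd x) (fst x)) \<in> borel_measurable (lborel \<Otimes>\<^sub>M \<Omega>)"
    using measurable_X_joint by (simp add: split_beta')
  from measurable_compose[OF measurable_pair_swap' this]
  have [measurable]: "(\<lambda>x. X (fst x) (snd x)) \<in> borel_measurable (\<Omega> \<Otimes>\<^sub>M lborel)"
    by (simp add: split_beta')
  have "(\<lambda>(w, y). indicator {0..T} y * (b y * X w y ^ k)) \<in> borel_measurable (\<Omega> \<Otimes>\<^sub>M lborel)"
    unfolding split_beta' by measurable
  from lborel.borel_measurable_lebesgue_integral[OF this]
  have m: "(\<lambda>w. LINT y|lborel. indicator {0..T} y * (b y * X w y ^ k)) \<in> borel_measurable \<Omega>" .
  have "integral {0..T} (\<lambda>y. b y * X w y ^ k) = (LINT y|lborel. indicator {0..T} y * (b y * X w y ^ k))" for w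
    by (rule integral_Icc_eq_lborel)
       (auto intro!: continuous_intros continuous_X_Icc intro: continuous_on_subset[OF assms])
  then show ?thesis using m by simp
qed

lemma measurable_en[measurable]: "en T \<in> borel_measurable \<Omega>"
  using measurable_integral_X[of "\<lambda>_. 1" T 2] by (simp add: en_def[abs_def])

lemma measurable_E[measurable]: "E T \<in> borel_measurable \<Omega>"
  unfolding E_def[abs_def] by measurable

lemma en_nonneg: "en T w \<ge> 0"
  unfolding en_def
  by (intro integral_nonneg integrable_continuous_real continuous_intros continuous_X_Icc) auto

lemma E_bounds: "0 < E T w" "E T w \<le> 1"
  by (auto simp: E_def en_nonneg)

lemma E_has_derivative:
  assumes "t \<in> {0..B}"
  shows "((\<lambda>t. E t w) has_real_derivative - (1 / 2) * (X w t)\<^sup>2 * E t w) (at t within {0..B})"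
proof -
  have "((\<lambda>t. en t w) has_real_derivative (X w t)\<^sup>2) (at t within {0..B})"
    unfolding en_def by (rule integral_has_real_derivative[OF _ assms]) (intro continuous_intros continuous_X_Icc)
  then show ?thesis unfolding E_def by (auto intro!: derivative_eq_intros)
qed

definition \<Phi> :: "real \<Rightarrow> real" where "\<Phi> T = (LINT w|\<Omega>. E T w)"

definition G :: "real \<Rightarrow> real \<Rightarrow> real" where "G T s = (LINT w|\<Omega>. X w s * (X w T * E T w))"

lemma XXE_bound:
  assumes "s \<in> {0..B}" "T \<in> {0..B}"
  shows "\<bar>X w s * (X w T * E T w)\<bar> \<le> (M B)\<^sup>2 * (S w)\<^sup>2"
proof -
  have "\<bar>X w s * (X w T * E T w)\<bar> \<le> (M B * S w) * ((M B * S w) * 1)"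
    unfolding abs_mult using E_bounds[of T w]
    by (intro mult_mono X_bound assms) (auto simp: M_nonneg S_nonneg)
  then show ?thesis by (simp add: power2_eq_square ac_simps)
qed

lemma integrable_E: "integrable \<Omega> (E T)"
  by (rule integrable_const_bound[of _ 1]) (use E_bounds in \<open>auto simp: abs_of_pos\<close>)

lemma \<Phi>_pos: "\<Phi> T > 0"
proof -
  have "\<Phi> T \<ge> 0" unfolding \<Phi>_def using E_bounds by (intro integral_nonneg_AE) (auto intro: less_imp_le)
  moreover have "\<Phi> T \<noteq> 0"
  proof
    assume "\<Phi> T = 0"
    then have "AE w in \<Omega>. E T w = 0"
      using integral_nonneg_eq_0_iff_AE[OF integrable_E, of T] E_bounds by (auto simp: \<Phi>_def less_imp_le)
    then have "AE w in \<Omega>. False" by eventually_elim (use E_bounds(1) in \<open>metis less_irrefl\<close>)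
    then show False by simp
  qed
  ultimately show ?thesis by simp
qed

lemma \<Phi>_0: "\<Phi> 0 = 1"
  by (simp add: \<Phi>_def E_def en_def prob_space)

lemma \<Phi>_has_derivative:
  assumes "T \<ge> 0"
  shows "(\<Phi> has_real_derivative - (1 / 2) * G T T) (at T within {0..})"
proof -
  \<comment> \<open>Path bounds are uniform only on bounded time intervals, so the derivative is
    first taken within [0, T + 1], which gives the same filter at T as the half line.\<close>
  let ?B = "T + 1"
  have "((\<lambda>t. LINT w|\<Omega>. E t w) has_real_derivative (LINT w|\<Omega>. - (1 / 2) * (X w T)\<^sup>2 * E T w)) (at T within {0..?B})"
  proof (rule has_derivative_expectation[where g = "\<lambda>w. (M ?B)\<^sup>2 * (S w)\<^sup>2"])
    show "((\<lambda>t. E t w) has_real_derivative - (1 / 2) * (X w t)\<^sup>2 * E t w) (at t within {0..?B})" if "t \<in> {0..?B}" for t w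
      by (rule E_has_derivative[OF that])
    show "\<bar>- (1 / 2) * (X w t)\<^sup>2 * E t w\<bar> \<le> (M ?B)\<^sup>2 * (S w)\<^sup>2" if "t \<in> {0..?B}" for t w
    proof -
      have b: "\<bar>X w t * (X w t * E t w)\<bar> \<le> (M ?B)\<^sup>2 * (S w)\<^sup>2" by (rule XXE_bound[OF that that])
      have eq: "- (1 / 2) * (X w t)\<^sup>2 * E t w = - (1 / 2) * (X w t * (X w t * E t w))" by (simp add: power2_eq_square)
      have "\<bar>- (1 / 2) * z\<bar> \<le> \<bar>z\<bar>" for z :: real by (simp add: abs_mult)
      then show ?thesis unfolding eq by (rule order_trans[OF _ b])
    qed
  qed (use assms integrable_S_square integrable_E in auto)
  moreover have "(LINT w|\<Omega>. - (1 / 2) * (X w T)\<^sup>2 * E T w) = - (1 / 2) * G T T"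
    unfolding G_def integral_mult_right_zero[symmetric] by (simp add: power2_eq_square mult.assoc)
  moreover have "at T within {0..?B} = at T within {0..}"
    by (rule at_within_nhd[of _ "{..<?B}"]) auto
  ultimately show ?thesis unfolding \<Phi>_def[abs_def] by simp
qed

lemma continuous_G: "T \<ge> 0 \<Longrightarrow> continuous_on {0..T} (G T)"
  unfolding G_def[abs_def]
  by (rule continuous_on_expectation[where g = "\<lambda>w. (M T)\<^sup>2 * (S w)\<^sup>2"])
     (auto intro!: continuous_intros continuous_X_Icc XXE_bound integrable_mult_right integrable_S_square)

end

text \<open>Paths change affinely in one Gaussian coordinate z, so along a coordinate line the
  energy is a quadratic polynomial in z.\<close>

lemma integral_square_line:
  fixes y b :: "real \<Rightarrow> real"
  assumes "continuous_on {0..T} y" "continuous_on {0..T} b"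
  shows "integral {0..T} (\<lambda>s. (y s + b s * z)\<^sup>2)
    = integral {0..T} (\<lambda>s. (y s)\<^sup>2) + 2 * integral {0..T} (\<lambda>s. b s * y s) * z + integral {0..T} (\<lambda>s. (b s)\<^sup>2) * z\<^sup>2"
    and "integral {0..T} (\<lambda>s. b s * (y s + b s * z)) = integral {0..T} (\<lambda>s. b s * y s) + integral {0..T} (\<lambda>s. (b s)\<^sup>2) * z"
proof -
  have i: "(\<lambda>s. (y s)\<^sup>2) integrable_on {0..T}" "(\<lambda>s. b s * y s) integrable_on {0..T}" "(\<lambda>s. (b s)\<^sup>2) integrable_on {0..T}"
    using assms by (auto intro!: integrable_continuous_real continuous_intros)
  have "((\<lambda>s. (y s)\<^sup>2 + b s * y s * (2 * z) + (b s)\<^sup>2 * z\<^sup>2) has_integral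
     integral {0..T} (\<lambda>s. (y s)\<^sup>2) + integral {0..T} (\<lambda>s. b s * y s) * (2 * z) + integral {0..T} (\<lambda>s. (b s)\<^sup>2) * z\<^sup>2) {0..T}"
    by (intro has_integral_add has_integral_mult_left integrable_integral i)
  moreover have "(\<lambda>s. (y s)\<^sup>2 + b s * y s * (2 * z) + (b s)\<^sup>2 * z\<^sup>2) = (\<lambda>s. (y s + b s * z)\<^sup>2)"
    by (auto simp: fun_eq_iff power2_eq_square algebra_simps)
  ultimately show "integral {0..T} (\<lambda>s. (y s + b s * z)\<^sup>2)
    = integral {0..T} (\<lambda>s. (y s)\<^sup>2) + 2 * integral {0..T} (\<lambda>s. b s * y s) * z + integral {0..T} (\<lambda>s. (b s)\<^sup>2) * z\<^sup>2"
    by (simp add: integral_unique)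
  have "((\<lambda>s. b s * y s + (b s)\<^sup>2 * z) has_integral
     integral {0..T} (\<lambda>s. b s * y s) + integral {0..T} (\<lambda>s. (b s)\<^sup>2) * z) {0..T}"
    by (intro has_integral_add has_integral_mult_left integrable_integral i)
  moreover have "(\<lambda>s. b s * y s + (b s)\<^sup>2 * z) = (\<lambda>s. b s * (y s + b s * z))"
    by (auto simp: fun_eq_iff power2_eq_square algebra_simps)
  ultimately show "integral {0..T} (\<lambda>s. b s * (y s + b s * z)) = integral {0..T} (\<lambda>s. b s * y s) + integral {0..T} (\<lambda>s. (b s)\<^sup>2) * z"
    by (simp add: integral_unique)
qed

lemma integral_Icc_abs_le:
  fixes f :: "real \<Rightarrow> real"
  assumes "T \<ge> 0" "continuous_on {0..T} f" "\<And>y. y \<in> {0..T} \<Longrightarrow> \<bar>f y\<bar> \<le> B"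
  shows "\<bar>integral {0..T} f\<bar> \<le> B * T"
  using integral_bound[of 0 T f B] assms by simp

context gauss_series begin

lemma wt_upd:
  "wt (w((l, q) := z)) l' = wt w l' + (if l' = l then wt (w((l, q) := z)) l - wt w l else 0)"
  by (auto simp: wt_def intro!: sum.cong)

text \<open>Changing one coordinate alters a single term of the series. So a whole coordinate line
  lies inside \<open>good\<close> or outside it, as integration by parts along the line
  requires.\<close>

lemma good_upd: "w((l, q) := z) \<in> good \<longleftrightarrow> w \<in> good"
proof -
  have *: "w((l, q) := z) \<in> good" if "w \<in> good" for w and z
  proof -
    have "summable (\<lambda>l'. wt w l' + (if l' = l then wt (w((l, q) := z)) l - wt w l else 0))"
      using that sums_single[of l "\<lambda>_. wt (w((l, q) := z)) l - wt w l"]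
      by (intro summable_add) (auto simp: good_def summable_def)
    then show ?thesis unfolding good_def mem_Collect_eq wt_upd[symmetric] .
  qed
  show ?thesis using *[of w z] *[of "w((l, q) := z)" "w (l, q)"] by auto
qed

lemma level_upd:
  assumes "q \<in> Q l"
  shows "level l' (w((l, q) := z)) t = level l' w t + (if l' = l then a l q t * (z - w (l, q)) else 0)"
proof (cases "l' = l")
  case True
  have "level l (w((l, q) := z)) t = (\<Sum>q'\<in>Q l. a l q' t * w (l, q') + (if q' = q then a l q t * (z - w (l, q)) else 0))"
    unfolding level_def by (intro sum.cong refl) (auto simp: algebra_simps)
  also have "\<dots> = level l w t + a l q t * (z - w (l, q))"
    using assms finite_Q by (simp add: sum.distrib level_def)
  finally show ?thesis using True by simp
next
  case False
  then show ?thesis by (simp add: level_def)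
qed

lemma X_upd:
  assumes q: "q \<in> Q l" and w: "w \<in> good" and t: "t \<ge> 0"
  shows "X (w((l, q) := z)) t = X w t + a l q t * (z - w (l, q))"
proof -
  have "(\<lambda>l'. level l' w t + (if l' = l then a l q t * (z - w (l, q)) else 0)) sums (X w t + a l q t * (z - w (l, q)))"
    by (intro sums_add level_sums w t sums_single)
  then have "(\<lambda>l'. level l' (w((l, q) := z)) t) sums (X w t + a l q t * (z - w (l, q)))"
    by (simp add: level_upd[OF q])
  moreover have "(\<lambda>l'. level l' (w((l, q) := z)) t) sums X (w((l, q) := z)) t"
    by (rule level_sums) (use w t good_upd in auto)
  ultimately show ?thesis by (rule sums_unique2[symmetric])
qed

lemma a_bound:
  assumes "q \<in> Q l" "t \<in> {0..T}"
  shows "\<bar>a l q t\<bar> \<le> K T"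
proof -
  have "\<bar>a l q t\<bar> \<le> (\<Sum>q\<in>Q l. \<bar>a l q t\<bar>)"
    by (rule member_le_sum) (use assms finite_Q in auto)
  also have "\<dots> \<le> K T * (1 / sqrt 2) ^ l" by (rule K(2)[OF assms(2)])
  also have "\<dots> \<le> K T * 1" by (intro mult_left_mono K(1) power_le_one) auto
  finally show ?thesis by simp
qed

text \<open>Half the derivative of \<open>en T\<close> in the coordinate \<open>(l, q)\<close>,
  along which the path moves with velocity \<open>a l q\<close>.\<close>

definition J :: "real \<Rightarrow> nat \<Rightarrow> 'q \<Rightarrow> (nat \<times> 'q \<Rightarrow> real) \<Rightarrow> real" where
  "J T l q w = integral {0..T} (\<lambda>y. a l q y * X w y)"

lemma measurable_J[measurable]: "J T l q \<in> borel_measurable \<Omega>"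
  using measurable_integral_X[where b = "a l q" and T = T and k = 1, OF cont_a] by (simp add: J_def[abs_def])

lemma J_bound: "q \<in> Q l \<Longrightarrow> T \<ge> 0 \<Longrightarrow> \<bar>J T l q w\<bar> \<le> K T * M T * T * S w"
proof -
  assume q: "q \<in> Q l" and T: "T \<ge> 0"
  have "\<bar>J T l q w\<bar> \<le> (K T * (M T * S w)) * T"
    unfolding J_def
  proof (rule integral_Icc_abs_le[OF T])
    show "continuous_on {0..T} (\<lambda>y. a l q y * X w y)"
      by (intro continuous_intros continuous_X_Icc continuous_on_subset[OF cont_a]) auto
    show "\<bar>a l q y * X w y\<bar> \<le> K T * (M T * S w)" if "y \<in> {0..T}" for y
      unfolding abs_mult using that q by (intro mult_mono a_bound X_bound) (auto simp: K)
  qed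
  then show ?thesis by (simp add: ac_simps)
qed

text \<open>Integration by parts for \<open>X w T * E T w\<close>: the first term comes from
  differentiating the endpoint of the path, the second from the exponential, whose logarithmic
  derivative is minus \<open>J\<close>.\<close>

lemma component_ibp:
  assumes q: "q \<in> Q l" and T: "T \<ge> 0"
  shows "(LINT w|\<Omega>. w (l, q) * (X w T * E T w))
    = a l q T * \<Phi> T - (LINT w|\<Omega>. X w T * E T w * J T l q w)"
proof -
  define F where "F = (\<lambda>w. X w T * E T w)"
  \<comment> \<open>Zero off \<open>good\<close>, so that the derivative identity holds on every
    coordinate line and not merely almost surely.\<close>
  define F' where "F' = (\<lambda>w. if w \<in> good then a l q T * E T w - X w T * E T w * J T l q w else 0)"
  have [measurable]: "F \<in> borel_measurable \<Omega>" "F' \<in> borel_measurable \<Omega>" unfolding F_def F'_def by measurable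
  have XE: "\<bar>X w T * E T w\<bar> \<le> M T * S w" for w
  proof -
    have "\<bar>X w T * E T w\<bar> \<le> (M T * S w) * 1" unfolding abs_mult
      using E_bounds[of T w] T by (intro mult_mono X_bound) (auto simp: M_nonneg S_nonneg)
    then show ?thesis by simp
  qed
  have iF2: "integrable \<Omega> (\<lambda>w. (F w)\<^sup>2)"
  proof (rule Bochner_Integration.integrable_bound)
    show "integrable \<Omega> (\<lambda>w. (M T)\<^sup>2 * (S w)\<^sup>2)" using integrable_S_square by simp
    have "(F w)\<^sup>2 \<le> (M T * S w)\<^sup>2" for w
      using power_mono[OF XE[of w] abs_ge_zero, of 2] by (simp add: F_def)
    then show "AE w in \<Omega>. norm ((F w)\<^sup>2) \<le> norm ((M T)\<^sup>2 * (S w)\<^sup>2)" by (simp add: power_mult_distrib)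
  qed simp
  have i1: "integrable \<Omega> (\<lambda>w. w (l, q) * F w)"
    by (rule integrable_mult_square) (use gauss_component_moments(1) iF2 in auto)
  have i2: "integrable \<Omega> (\<lambda>w. X w T * E T w * J T l q w)"
  proof (rule Bochner_Integration.integrable_bound)
    show "integrable \<Omega> (\<lambda>w. M T * (K T * M T * T) * (S w)\<^sup>2)" using integrable_S_square by simp
    have "\<bar>X w T * E T w * J T l q w\<bar> \<le> (M T * S w) * (K T * M T * T * S w)" for w
      unfolding abs_mult[of "X w T * E T w"]
      using M_nonneg S_nonneg by (intro mult_mono XE J_bound q T) auto
    then have "\<bar>X w T * E T w * J T l q w\<bar> \<le> M T * (K T * M T * T) * (S w)\<^sup>2" for w
      by (simp only: power2_eq_square ac_simps)
    then show "AE w in \<Omega>. norm (X w T * E T w * J T l q w) \<le> norm (M T * (K T * M T * T) * (S w)\<^sup>2)"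
      unfolding real_norm_def by (intro AE_I2 order_trans[OF _ abs_ge_self])
  qed simp
  have AEF: "AE w in \<Omega>. a l q T * E T w - X w T * E T w * J T l q w = F' w"
    using AE_good by eventually_elim (simp add: F'_def)
  have i3: "integrable \<Omega> (\<lambda>w. a l q T * E T w - X w T * E T w * J T l q w)"
    using i2 integrable_E by simp
  have i4: "integrable \<Omega> F'"
    by (rule Bochner_Integration.integrable_cong_AE_imp[OF i3 _ ]) (use AEF in auto)
  \<comment> \<open>On a good line F is an affine function times the exponential of a quadratic one.
    The last conjunct, that this exponential is at most 1, supplies the linear growth bound.\<close>
  have line: "\<exists>c0 A B C. (\<forall>z. F (w((l, q) := z)) = (c0 + a l q T * z) * exp (- (1 / 2) * (A + 2 * B * z + C * z\<^sup>2)) \<and>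
      F' (w((l, q) := z)) = (a l q T - (c0 + a l q T * z) * (B + C * z)) * exp (- (1 / 2) * (A + 2 * B * z + C * z\<^sup>2)) \<and>
      exp (- (1 / 2) * (A + 2 * B * z + C * z\<^sup>2)) \<le> 1)"
    if w: "w \<in> good" for w
  proof -
    define y where "y = (\<lambda>t. X w t - a l q t * w (l, q))"
    have X: "X (w((l, q) := z)) t = y t + a l q t * z" if "t \<ge> 0" for z t
      unfolding X_upd[OF q w that] y_def by (simp add: algebra_simps)
    have ca: "continuous_on {0..T} (a l q)" using cont_a continuous_on_subset by blast
    have cy: "continuous_on {0..T} y" unfolding y_def by (intro continuous_intros continuous_X_Icc ca)
    define A B C where "A = integral {0..T} (\<lambda>s. (y s)\<^sup>2)" and "B = integral {0..T} (\<lambda>s. a l q s * y s)"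
      and "C = integral {0..T} (\<lambda>s. (a l q s)\<^sup>2)"
    have en: "en T (w((l, q) := z)) = A + 2 * B * z + C * z\<^sup>2" for z
    proof -
      have "en T (w((l, q) := z)) = integral {0..T} (\<lambda>s. (y s + a l q s * z)\<^sup>2)"
        unfolding en_def by (rule integral_cong) (simp add: X)
      then show ?thesis unfolding integral_square_line(1)[OF cy ca] A_def B_def C_def .
    qed
    have J: "J T l q (w((l, q) := z)) = B + C * z" for z
    proof -
      have "J T l q (w((l, q) := z)) = integral {0..T} (\<lambda>s. a l q s * (y s + a l q s * z))"
        unfolding J_def by (rule integral_cong) (simp add: X)
      then show ?thesis unfolding integral_square_line(2)[OF cy ca] B_def C_def .
    qed
    have "F (w((l, q) := z)) = (y T + a l q T * z) * exp (- (1 / 2) * (A + 2 * B * z + C * z\<^sup>2))" for z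
      unfolding F_def E_def en X[OF T] ..
    moreover have "F' (w((l, q) := z)) = (a l q T - (y T + a l q T * z) * (B + C * z)) * exp (- (1 / 2) * (A + 2 * B * z + C * z\<^sup>2))" for z
      unfolding F'_def E_def en X[OF T] J good_upd using w by (simp add: algebra_simps)
    moreover have "exp (- (1 / 2) * (A + 2 * B * z + C * z\<^sup>2)) \<le> 1" for z
      using E_bounds(2)[of T "w((l, q) := z)"] unfolding E_def en .
    ultimately show ?thesis by blast
  qed
  have bad: "F (w((l, q) := z)) = 0" "F' (w((l, q) := z)) = 0" if "w \<notin> good" for w z
    using that by (simp_all add: F_def F'_def good_upd X_def)
  have "(LINT w|\<Omega>. w (l, q) * F w) = (LINT w|\<Omega>. F' w)"
  proof (rule gauss_space_ibp[OF i1 i4])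
    fix w z
    show "((\<lambda>z. F (w((l, q) := z))) has_real_derivative F' (w((l, q) := z))) (at z)"
    proof (cases "w \<in> good")
      case True
      from line[OF this] obtain c0 A B C where
        F: "\<And>z. F (w((l, q) := z)) = (c0 + a l q T * z) * exp (- (1 / 2) * (A + 2 * B * z + C * z\<^sup>2))" and
        F': "\<And>z. F' (w((l, q) := z)) = (a l q T - (c0 + a l q T * z) * (B + C * z)) * exp (- (1 / 2) * (A + 2 * B * z + C * z\<^sup>2))"
        by blast
      have "((\<lambda>z. - (1 / 2) * (A + 2 * B * z + C * z\<^sup>2)) has_real_derivative - (B + C * z)) (at z)"
        by (auto intro!: derivative_eq_intros simp: algebra_simps)
      from DERIV_mult[OF _ DERIV_fun_exp[OF this], of "\<lambda>z. c0 + a l q T * z" "a l q T"]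
      show ?thesis unfolding F F'
        by (auto intro!: derivative_eq_intros simp: left_diff_distrib mult.assoc elim!: DERIV_cong)
    qed (simp add: bad)
    show "isCont (\<lambda>z. F' (w((l, q) := z))) z"
    proof (cases "w \<in> good")
      case True
      from line[OF this] obtain c0 A B C where
        "\<And>z. F' (w((l, q) := z)) = (a l q T - (c0 + a l q T * z) * (B + C * z)) * exp (- (1 / 2) * (A + 2 * B * z + C * z\<^sup>2))"
        by blast
      then show ?thesis by (auto intro!: continuous_intros)
    qed (simp add: bad)
    show "\<exists>K. \<forall>z. \<bar>F (w((l, q) := z))\<bar> \<le> K * (1 + \<bar>z\<bar>)"
    proof (cases "w \<in> good")
      case True
      from line[OF this] obtain c0 A B C where
        *: "\<And>z. F (w((l, q) := z)) = (c0 + a l q T * z) * exp (- (1 / 2) * (A + 2 * B * z + C * z\<^sup>2))"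
        "\<And>z. exp (- (1 / 2) * (A + 2 * B * z + C * z\<^sup>2)) \<le> 1"
        by blast
      show ?thesis
      proof (intro exI allI)
        fix z
        have "\<bar>F (w((l, q) := z))\<bar> \<le> (\<bar>c0\<bar> + \<bar>a l q T\<bar> * \<bar>z\<bar>) * 1"
          unfolding * abs_mult[of _ "exp _"]
          using *(2)[of z] abs_triangle_ineq[of c0 "a l q T * z"] by (intro mult_mono) (auto simp: abs_mult)
        also have "\<dots> \<le> (\<bar>c0\<bar> + \<bar>a l q T\<bar>) * (1 + \<bar>z\<bar>)" by (simp add: algebra_simps)
        finally show "\<bar>F (w((l, q) := z))\<bar> \<le> (\<bar>c0\<bar> + \<bar>a l q T\<bar>) * (1 + \<bar>z\<bar>)" .
      qed
    qed (simp add: bad exI[of _ 0])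
  qed
  also have "\<dots> = (LINT w|\<Omega>. a l q T * E T w - X w T * E T w * J T l q w)"
    by (rule integral_cong_AE) (use AEF in auto)
  also have "\<dots> = a l q T * \<Phi> T - (LINT w|\<Omega>. X w T * E T w * J T l q w)"
    using i2 integrable_E by (simp add: \<Phi>_def)
  finally show ?thesis by (simp add: F_def)
qed

lemma swap_J:
  assumes q: "q \<in> Q l" and T: "T \<ge> 0"
  shows "(LINT w|\<Omega>. X w T * E T w * J T l q w) = integral {0..T} (\<lambda>y. a l q y * G T y)"
proof -
  interpret L: pair_sigma_finite lborel \<Omega> ..
  have [measurable]: "a l q \<in> borel_measurable borel" using cont_a by (rule borel_measurable_continuous_onI)
  have [measurable]: "(\<lambda>x. X (snd x) (fst x)) \<in> borel_measurable (lborel \<Otimes>\<^sub>M \<Omega>)"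
    using measurable_X_joint by (simp add: split_beta')
  define h where "h = (\<lambda>(y, w). indicator {0..T} y * (a l q y * (X w y * (X w T * E T w))))"
  have hm[measurable]: "h \<in> borel_measurable (lborel \<Otimes>\<^sub>M \<Omega>)" unfolding h_def split_beta' by measurable
  have hb: "\<bar>h (y, w)\<bar> \<le> indicator {0..T} y * (K T * ((M T)\<^sup>2 * (S w)\<^sup>2))" for y w
  proof (cases "y \<in> {0..T}")
    case True
    then have "\<bar>a l q y * (X w y * (X w T * E T w))\<bar> \<le> K T * ((M T)\<^sup>2 * (S w)\<^sup>2)"
      unfolding abs_mult[of "a l q y"] using T q by (intro mult_mono a_bound XXE_bound) (auto simp: K)
    then show ?thesis using True by (simp add: h_def)
  qed (simp add: h_def)
  have ih: "integrable \<Omega> (\<lambda>w. h (y, w))" for y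
  proof (rule Bochner_Integration.integrable_bound)
    show "integrable \<Omega> (\<lambda>w. indicator {0..T} y * (K T * ((M T)\<^sup>2 * (S w)\<^sup>2)))" using integrable_S_square by simp
    show "AE w in \<Omega>. norm (h (y, w)) \<le> norm (indicator {0..T} y * (K T * ((M T)\<^sup>2 * (S w)\<^sup>2)))"
      using hb by (intro AE_I2) (smt (verit, best) real_norm_def abs_ge_self)
  qed (use measurable_Pair2[OF hm, of y] in simp)
  have int: "integrable (lborel \<Otimes>\<^sub>M \<Omega>) h"
  proof (rule L.Fubini_integrable[OF hm])
    show "integrable lborel (\<lambda>y. LINT w|\<Omega>. norm (h (y, w)))"
    proof (rule Bochner_Integration.integrable_bound)
      show "integrable lborel (\<lambda>y. indicator {0..T} y * (LINT w|\<Omega>. K T * ((M T)\<^sup>2 * (S w)\<^sup>2)))"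
        using T by (intro integrable_mult_left integrable_real_indicator) auto
      have "(\<lambda>(y, w). norm (h (y, w))) \<in> borel_measurable (lborel \<Otimes>\<^sub>M \<Omega>)" by simp
      from borel_measurable_lebesgue_integral[OF this]
      show "(\<lambda>y. LINT w|\<Omega>. norm (h (y, w))) \<in> borel_measurable lborel" by simp
      have "(LINT w|\<Omega>. norm (h (y, w))) \<le> (LINT w|\<Omega>. indicator {0..T} y * (K T * ((M T)\<^sup>2 * (S w)\<^sup>2)))" for y
        by (rule integral_mono) (use ih hb integrable_S_square in auto)
      then have "(LINT w|\<Omega>. norm (h (y, w))) \<le> indicator {0..T} y * (LINT w|\<Omega>. K T * ((M T)\<^sup>2 * (S w)\<^sup>2))" for y
        by simp
      moreover have "(LINT w|\<Omega>. norm (h (y, w))) \<ge> 0" for y by (rule Bochner_Integration.integral_nonneg) simp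
      ultimately show "AE y in lborel. norm (LINT w|\<Omega>. norm (h (y, w))) \<le> norm (indicator {0..T} y * (LINT w|\<Omega>. K T * ((M T)\<^sup>2 * (S w)\<^sup>2)))"
        unfolding real_norm_def by (intro AE_I2 order_trans[OF _ abs_ge_self]) simp
    qed
  qed (use ih in auto)
  have 1: "(LINT y|lborel. h (y, w)) = X w T * E T w * J T l q w" for w
  proof -
    have "J T l q w = (LINT y|lborel. indicator {0..T} y * (a l q y * X w y))"
      unfolding J_def by (rule integral_Icc_eq_lborel)
        (intro continuous_intros continuous_X_Icc continuous_on_subset[OF cont_a], auto)
    then have "X w T * E T w * J T l q w = (LINT y|lborel. X w T * E T w * (indicator {0..T} y * (a l q y * X w y)))"
      by simp
    also have "\<dots> = (LINT y|lborel. h (y, w))"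
      unfolding h_def by (intro Bochner_Integration.integral_cong refl) (simp add: ac_simps)
    finally show ?thesis ..
  qed
  have 2: "(LINT w|\<Omega>. h (y, w)) = indicator {0..T} y * (a l q y * G T y)" for y
    by (simp add: h_def G_def)
  have "(LINT w|\<Omega>. LINT y|lborel. h (y, w)) = (LINT y|lborel. LINT w|\<Omega>. h (y, w))"
    using L.Fubini_integral[of "\<lambda>y w. h (y, w)"] int by simp
  then have "(LINT w|\<Omega>. X w T * E T w * J T l q w) = (LINT y|lborel. indicator {0..T} y * (a l q y * G T y))"
    unfolding 1 2 .
  also have "\<dots> = integral {0..T} (\<lambda>y. a l q y * G T y)"
    by (rule integral_Icc_eq_lborel[symmetric])
       (intro continuous_intros continuous_G T continuous_on_subset[OF cont_a], auto)
  finally show ?thesis .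
qed

lemma partial_R_bound:
  assumes "s \<in> {0..T}" "y \<in> {0..T}"
  shows "\<bar>\<Sum>l<L. \<Sum>q\<in>Q l. a l q s * a l q y\<bar> \<le> 2 * (K T)\<^sup>2"
proof -
  have pw: "(1 / sqrt 2) ^ l * (1 / sqrt 2) ^ l = (1 / 2 :: real) ^ l" for l
    by (simp add: power_mult_distrib[symmetric])
  have "\<bar>\<Sum>q\<in>Q l. a l q s * a l q y\<bar> \<le> (K T)\<^sup>2 * (1 / 2) ^ l" for l
  proof -
    have "\<bar>\<Sum>q\<in>Q l. a l q s * a l q y\<bar> \<le> (\<Sum>q\<in>Q l. \<bar>a l q s\<bar> * \<bar>a l q y\<bar>)"
      unfolding abs_mult[symmetric] by (rule sum_abs)
    also have "\<dots> \<le> (\<Sum>q\<in>Q l. \<bar>a l q s\<bar> * (\<Sum>q\<in>Q l. \<bar>a l q y\<bar>))"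
      by (intro sum_mono mult_left_mono member_le_sum) (auto simp: finite_Q)
    also have "\<dots> = (\<Sum>q\<in>Q l. \<bar>a l q s\<bar>) * (\<Sum>q\<in>Q l. \<bar>a l q y\<bar>)" by (simp add: sum_distrib_right)
    also have "\<dots> \<le> (K T * (1 / sqrt 2) ^ l) * (K T * (1 / sqrt 2) ^ l)"
      using K(1) by (intro mult_mono K(2) assms) (auto intro: sum_nonneg)
    also have "\<dots> = (K T)\<^sup>2 * ((1 / sqrt 2) ^ l * (1 / sqrt 2) ^ l)" by (simp only: power2_eq_square ac_simps)
    finally show ?thesis unfolding pw .
  qed
  then have "\<bar>\<Sum>l<L. \<Sum>q\<in>Q l. a l q s * a l q y\<bar> \<le> (\<Sum>l<L. (K T)\<^sup>2 * (1 / 2) ^ l)"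
    by (intro order_trans[OF sum_abs[of _ "{..<L}"]] sum_mono)
  also have "\<dots> = (K T)\<^sup>2 * (\<Sum>l<L. (1 / 2) ^ l)" by (simp add: sum_distrib_left)
  also have "\<dots> \<le> (K T)\<^sup>2 * 2"
  proof (intro mult_left_mono)
    have "(\<Sum>l<L. (1 / 2 :: real) ^ l) \<le> (\<Sum>l. (1 / 2) ^ l)"
      by (rule sum_le_suminf) (auto intro: summable_geometric)
    also have "\<dots> = 2" by (subst suminf_geometric) auto
    finally show "(\<Sum>l<L. (1 / 2 :: real) ^ l) \<le> 2" .
  qed simp
  finally show ?thesis by simp
qed

text \<open>Every term of the truncated series obeys \<open>component_ibp\<close> and
  \<open>swap_J\<close>; weighted by \<open>a l q s\<close> and summed, they give the equation with
  the truncated kernel. Since \<open>R\<close> is given only as a pointwise limit, integrability of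
  its product with \<open>G T\<close> comes from dominated convergence as well.\<close>

theorem fredholm:
  assumes T: "T \<ge> 0" and s: "s \<in> {0..T}"
  shows "(\<lambda>y. R s y * G T y) integrable_on {0..T}"
    and "G T s = R s T * \<Phi> T - integral {0..T} (\<lambda>y. R s y * G T y)"
proof -
  define RL where "RL = (\<lambda>L y. \<Sum>l<L. \<Sum>q\<in>Q l. a l q s * a l q y)"
  have s0: "s \<ge> 0" using s by simp
  have cG: "continuous_on {0..T} (G T)" by (rule continuous_G[OF T])
  obtain B where B': "\<forall>y\<in>{0..T}. \<bar>G T y\<bar> \<le> B"
    using compact_imp_bounded[OF compact_continuous_image[OF cG compact_Icc]] unfolding bounded_iff by auto
  then have B: "\<bar>G T y\<bar> \<le> B" if "y \<in> {0..T}" for y using that by blast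
  have ca: "continuous_on {0..T} (a l q)" for l q using cont_a continuous_on_subset by blast
  have cRL: "continuous_on {0..T} (RL L)" for L unfolding RL_def by (intro continuous_intros ca)
  have dc: "(\<lambda>y. R s y * G T y) integrable_on {0..T}"
    "(\<lambda>L. integral {0..T} (\<lambda>y. RL L y * G T y)) \<longlonglongrightarrow> integral {0..T} (\<lambda>y. R s y * G T y)"
  proof -
    have 1: "(\<lambda>y. RL L y * G T y) integrable_on {0..T}" for L
      by (intro integrable_continuous_real continuous_intros cRL cG)
    have 2: "(\<lambda>y. 2 * (K T)\<^sup>2 * B) integrable_on {0..T}"
      by (intro integrable_continuous_real continuous_on_const)
    have 3: "norm (RL L y * G T y) \<le> 2 * (K T)\<^sup>2 * B" if "y \<in> {0..T}" for L y
      unfolding real_norm_def abs_mult RL_def using that s by (intro mult_mono partial_R_bound B) auto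
    have 4: "(\<lambda>L. RL L y * G T y) \<longlonglongrightarrow> R s y * G T y" if "y \<in> {0..T}" for y
      using sums_R[OF s0, of y] that unfolding RL_def sums_def by (intro tendsto_intros) auto
    show "(\<lambda>y. R s y * G T y) integrable_on {0..T}"
      "(\<lambda>L. integral {0..T} (\<lambda>y. RL L y * G T y)) \<longlonglongrightarrow> integral {0..T} (\<lambda>y. R s y * G T y)"
      using dominated_convergence[OF 1 2 3 4] by auto
  qed
  show "(\<lambda>y. R s y * G T y) integrable_on {0..T}" by (rule dc)
  have comp: "integrable \<Omega> (\<lambda>w. w (l, q) * (X w T * E T w))" for l q
  proof (rule integrable_mult_square)
    show "integrable \<Omega> (\<lambda>w. (X w T * E T w)\<^sup>2)"
    proof (rule Bochner_Integration.integrable_bound[OF X_square_integrable[OF T]])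
      have "(X w T * E T w)\<^sup>2 \<le> (X w T)\<^sup>2 * 1" for w
        unfolding power_mult_distrib using E_bounds[of T w] by (intro mult_left_mono power_le_one) auto
      then show "AE w in \<Omega>. norm ((X w T * E T w)\<^sup>2) \<le> norm ((X w T)\<^sup>2)" by simp
    qed simp
  qed (auto intro: gauss_component_moments(1))
  have part: "(LINT w|\<Omega>. (\<Sum>l<L. level l w s) * (X w T * E T w)) = RL L T * \<Phi> T - integral {0..T} (\<lambda>y. RL L y * G T y)" for L
  proof -
    have "(LINT w|\<Omega>. (\<Sum>l<L. level l w s) * (X w T * E T w))
        = (LINT w|\<Omega>. (\<Sum>l<L. \<Sum>q\<in>Q l. a l q s * (w (l, q) * (X w T * E T w))))"
      unfolding level_def sum_distrib_right by (simp only: mult.assoc)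
    also have "\<dots> = (\<Sum>l<L. (LINT w|\<Omega>. (\<Sum>q\<in>Q l. a l q s * (w (l, q) * (X w T * E T w)))))"
      by (rule Bochner_Integration.integral_sum, rule Bochner_Integration.integrable_sum, rule integrable_mult_right, rule comp)
    also have "\<dots> = (\<Sum>l<L. \<Sum>q\<in>Q l. (LINT w|\<Omega>. a l q s * (w (l, q) * (X w T * E T w))))"
      by (rule sum.cong[OF refl], rule Bochner_Integration.integral_sum, rule integrable_mult_right, rule comp)
    also have "\<dots> = (\<Sum>l<L. \<Sum>q\<in>Q l. a l q s * a l q T * \<Phi> T - integral {0..T} (\<lambda>y. a l q s * a l q y * G T y))"
    proof (intro sum.cong refl)
      fix l q assume "q \<in> Q l"
      then show "(LINT w|\<Omega>. a l q s * (w (l, q) * (X w T * E T w))) = a l q s * a l q T * \<Phi> T - integral {0..T} (\<lambda>y. a l q s * a l q y * G T y)"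
        using component_ibp[of q l T] swap_J[of q l T] T by (simp add: right_diff_distrib mult.assoc)
    qed
    also have "\<dots> = RL L T * \<Phi> T - (\<Sum>l<L. \<Sum>q\<in>Q l. integral {0..T} (\<lambda>y. a l q s * a l q y * G T y))"
      by (simp add: RL_def sum_subtractf sum_distrib_right)
    also have "(\<Sum>l<L. \<Sum>q\<in>Q l. integral {0..T} (\<lambda>y. a l q s * a l q y * G T y)) = integral {0..T} (\<lambda>y. RL L y * G T y)"
    proof -
      have i: "(\<lambda>y. a l q s * a l q y * G T y) integrable_on {0..T}" for l q
        by (intro integrable_continuous_real continuous_intros cG ca)
      show ?thesis unfolding RL_def sum_distrib_right
        by (subst Henstock_Kurzweil_Integration.integral_sum, simp, rule integrable_sum, simp add: finite_Q, rule i,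
            intro sum.cong refl, rule Henstock_Kurzweil_Integration.integral_sum[symmetric], rule finite_Q, rule i)
    qed
    finally show ?thesis .
  qed
  have "(\<lambda>L. LINT w|\<Omega>. (\<Sum>l<L. level l w s) * (X w T * E T w)) \<longlonglongrightarrow> G T s"
    unfolding G_def
  proof (rule integral_dominated_convergence[where w = "\<lambda>w. (M T)\<^sup>2 * (S w)\<^sup>2"])
    show "AE w in \<Omega>. (\<lambda>L. (\<Sum>l<L. level l w s) * (X w T * E T w)) \<longlonglongrightarrow> X w s * (X w T * E T w)"
      using AE_good by eventually_elim (use level_sums s0 in \<open>auto simp: sums_def intro!: tendsto_mult\<close>)
    show "AE w in \<Omega>. norm ((\<Sum>l<L. level l w s) * (X w T * E T w)) \<le> (M T)\<^sup>2 * (S w)\<^sup>2" for L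
      using AE_good
    proof eventually_elim
      case (elim w)
      have "\<bar>(\<Sum>l<L. level l w s) * (X w T * E T w)\<bar> \<le> (M T * S w) * ((M T * S w) * 1)"
        unfolding abs_mult using E_bounds[of T w] T
        by (intro mult_mono X_bound partial_sum_bound elim s) (auto simp: M_nonneg S_nonneg)
      then show ?case by (simp add: power2_eq_square ac_simps)
    qed
  qed (use integrable_S_square in auto)
  moreover have "(\<lambda>L. RL L T * \<Phi> T - integral {0..T} (\<lambda>y. RL L y * G T y))
     \<longlonglongrightarrow> R s T * \<Phi> T - integral {0..T} (\<lambda>y. R s y * G T y)"
    using sums_R[OF s0 T] unfolding RL_def[symmetric] sums_def
    by (intro tendsto_intros dc(2)) (simp add: RL_def)
  ultimately show "G T s = R s T * \<Phi> T - integral {0..T} (\<lambda>y. R s y * G T y)"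
    unfolding part by (rule LIMSEQ_unique)
qed

end

section \<open>Spectral data\<close>

text \<open>Vectors and matrices are plain functions of which only the values below \<open>n\<close>
  count. This keeps carrier conditions out of the algebra; matrices of the library enter only where
  determinants or inverses do.\<close>

definition ip :: "nat \<Rightarrow> (nat \<Rightarrow> real) \<Rightarrow> (nat \<Rightarrow> real) \<Rightarrow> real" where
  "ip n x y = (\<Sum>i<n. x i * y i)"

definition app :: "nat \<Rightarrow> (nat \<Rightarrow> nat \<Rightarrow> real) \<Rightarrow> (nat \<Rightarrow> real) \<Rightarrow> nat \<Rightarrow> real" where
  "app n A x i = (\<Sum>j<n. A i j * x j)"

lemma ip_commute: "ip n x y = ip n y x"
  by (simp add: ip_def mult.commute)

lemma ip_add_left: "ip n (\<lambda>i. x i + y i) z = ip n x z + ip n y z"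
  by (simp add: ip_def distrib_right sum.distrib)

lemma ip_scale_left: "ip n (\<lambda>i. c * x i) z = c * ip n x z"
  by (simp add: ip_def sum_distrib_left mult.assoc)

lemma ip_add_right: "ip n z (\<lambda>i. x i + y i) = ip n z x + ip n z y"
  by (simp add: ip_def distrib_left sum.distrib)

lemma ip_scale_right: "ip n z (\<lambda>i. c * x i) = c * ip n z x"
  by (simp add: ip_def sum_distrib_left mult.left_commute)

lemma ip_sum_left: "ip n (\<lambda>i. \<Sum>l\<in>L. f l i) z = (\<Sum>l\<in>L. ip n (f l) z)"
  by (simp add: ip_def sum_distrib_right sum.swap[of _ _ L])

lemma ip_self_nonneg: "ip n x x \<ge> 0"
  by (simp add: ip_def sum_nonneg)

lemma ip_self_eq_0_iff: "ip n x x = 0 \<longleftrightarrow> (\<forall>i<n. x i = 0)"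
  unfolding ip_def by (subst sum_nonneg_eq_0_iff) auto

lemma app_add: "app n A (\<lambda>i. x i + y i) = (\<lambda>i. app n A x i + app n A y i)"
  by (simp add: app_def fun_eq_iff distrib_left sum.distrib)

lemma app_scale: "app n A (\<lambda>i. c * x i) = (\<lambda>i. c * app n A x i)"
  by (simp add: app_def fun_eq_iff sum_distrib_left mult.left_commute)

lemma ip_cong: "(\<And>i. i < n \<Longrightarrow> x i = x' i) \<Longrightarrow> (\<And>i. i < n \<Longrightarrow> y i = y' i) \<Longrightarrow> ip n x y = ip n x' y'"
  by (simp add: ip_def)

lemma app_cong: "(\<And>i. i < n \<Longrightarrow> x i = x' i) \<Longrightarrow> app n A x = app n A x'"
  by (simp add: app_def fun_eq_iff)

lemma app_symmetric:
  assumes "\<And>i j. i < n \<Longrightarrow> j < n \<Longrightarrow> A i j = A j i"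
  shows "ip n (app n A x) y = ip n x (app n A y)"
proof -
  have "ip n (app n A x) y = (\<Sum>i<n. \<Sum>j<n. A i j * x j * y i)"
    by (simp add: ip_def app_def sum_distrib_right)
  also have "\<dots> = (\<Sum>j<n. \<Sum>i<n. A i j * x j * y i)" by (rule sum.swap)
  also have "\<dots> = (\<Sum>j<n. \<Sum>i<n. x j * (A j i * y i))"
    by (intro sum.cong refl) (use assms in auto)
  finally show ?thesis by (simp add: ip_def app_def sum_distrib_left)
qed

section \<open>The spectral theorem by successive minimisation\<close>

lemma quadratic_nonneg_linear_zero:
  fixes \<beta> \<gamma> :: real
  assumes "\<And>t. 0 \<le> 2 * t * \<beta> + t\<^sup>2 * \<gamma>"
  shows "\<beta> = 0"
proof (rule ccontr)
  assume b: "\<beta> \<noteq> 0"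
  define g where "g = \<bar>\<gamma>\<bar> + 1"
  have g: "g > 0" "\<gamma> \<le> g" by (auto simp: g_def)
  \<comment> \<open>The point - \<beta> / g minimises the majorant 2 t \<beta> + t^2 g, where g is
    positive and at least \<gamma>.\<close>
  have "0 \<le> 2 * (- \<beta> / g) * \<beta> + (- \<beta> / g)\<^sup>2 * \<gamma>" by (rule assms)
  also have "\<dots> \<le> 2 * (- \<beta> / g) * \<beta> + (- \<beta> / g)\<^sup>2 * g" using g by (intro add_left_mono mult_left_mono) auto
  also have "\<dots> = - \<beta>\<^sup>2 / g" using g by (simp add: field_simps power2_eq_square)
  also have "\<dots> < 0" using b g by simp
  finally show False by simp
qed

text \<open>Vectors are functions on all naturals, so compactness is that of a product: the norm
  confines the first \<open>n\<close> coordinates to [-1, 1] and the others are fixed at 0. The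
  remaining conditions are closed.\<close>

lemma compact_unit_orthogonal:
  "compact {x :: nat \<Rightarrow> real. (\<forall>i\<ge>n. x i = 0) \<and> ip n x x = 1 \<and> (\<forall>l<k. ip n x (v l) = 0)}" (is "compact ?C")
proof -
  define B where "B = (PiE UNIV (\<lambda>i. if i < n then {-1..1} else {0}) :: (nat \<Rightarrow> real) set)"
  have "compactin (product_topology (\<lambda>i. euclidean) UNIV) B"
    unfolding B_def compactin_PiE by auto
  then have B: "compact B" by (simp add: euclidean_product_topology)
  have c[continuous_intros]: "continuous_on UNIV (\<lambda>x :: nat \<Rightarrow> real. x i)" for i
    by (rule continuous_on_product_coordinates)
  have e: "?C = B \<inter> ({x. ip n x x = 1} \<inter> (\<Inter>l\<in>{..<k}. {x. ip n x (v l) = 0}))"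
  proof -
    have "x i \<in> {-1..1}" if "ip n x x = 1" "i < n" for x i
    proof -
      have "x i * x i \<le> ip n x x" unfolding ip_def by (rule member_le_sum) (use that in auto)
      then have "\<bar>x i\<bar>\<^sup>2 \<le> 1\<^sup>2" using that by (simp add: power2_eq_square)
      then have "\<bar>x i\<bar> \<le> 1" by (rule power2_le_imp_le) simp
      then show ?thesis by auto
    qed
    then show ?thesis unfolding B_def by (auto simp: PiE_iff split: if_splits)
  qed
  have "closed {x :: nat \<Rightarrow> real. ip n x x = 1}"
    by (rule closed_Collect_eq) (auto simp: ip_def intro!: continuous_intros)
  moreover have "closed {x :: nat \<Rightarrow> real. ip n x (v l) = 0}" for l
    by (rule closed_Collect_eq) (auto simp: ip_def intro!: continuous_intros)
  ultimately show ?thesis unfolding e by (intro compact_Int_closed[OF B] closed_Int closed_INT) auto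
qed

text \<open>A trace argument: the residuals of the n unit vectors after projecting off the
  \<open>v l\<close> have squared norms 1 - \<Sum> (v l i)^2, which add up to n - k > 0. A unit
  vector with positive residual is projected and normalised.\<close>

lemma orthonormal_extend:
  assumes kn: "k < n" and on: "\<And>l m. l < k \<Longrightarrow> m < k \<Longrightarrow> ip n (v l) (v m) = (if l = m then 1 else 0)"
  shows "\<exists>x. (\<forall>i\<ge>n. x i = 0) \<and> ip n x x = 1 \<and> (\<forall>l<k. ip n x (v l) = 0)"
proof -
  have "(\<Sum>i<n. 1 - (\<Sum>l<k. (v l i)\<^sup>2)) = real n - (\<Sum>l<k. ip n (v l) (v l))"
    by (simp add: sum_subtractf ip_def power2_eq_square sum.swap[of _ "{..<k}"])
  also have "\<dots> = real n - real k" using on by simp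
  finally have "(\<Sum>i<n. 1 - (\<Sum>l<k. (v l i)\<^sup>2)) > 0" using kn by simp
  then have "\<not> (\<forall>i\<in>{..<n}. 1 - (\<Sum>l<k. (v l i)\<^sup>2) \<le> 0)"
    using sum_nonpos[of "{..<n}" "\<lambda>i. 1 - (\<Sum>l<k. (v l i)\<^sup>2)"] by (intro notI) auto
  then obtain i where i: "i < n" "1 - (\<Sum>l<k. (v l i)\<^sup>2) > 0" by (auto simp: not_le)
  define y where "y = (\<lambda>j. (if j = i then 1 else 0) + (\<Sum>l<k. (- v l i) * v l j))"
  have e: "ip n (\<lambda>j. if j = i then 1 else 0) z = z i" for z
    using i by (simp add: ip_def if_distrib[of "\<lambda>a. a * _"] cong: if_cong)
  have s: "ip n (\<lambda>j. \<Sum>l<k. (- v l i) * v l j) z = (\<Sum>l<k. (- v l i) * ip n (v l) z)" for z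
    by (simp only: ip_sum_left ip_scale_left)
  have yv: "ip n y (v m) = 0" if "m < k" for m
  proof -
    have "(\<Sum>l<k. (- v l i) * ip n (v l) (v m)) = (\<Sum>l<k. if l = m then - v m i else 0)"
      by (intro sum.cong refl) (use on that in auto)
    then show ?thesis unfolding y_def ip_add_left e s using that by simp
  qed
  have "ip n y y = y i + (\<Sum>l<k. (- v l i) * ip n (v l) y)"
    using ip_add_left[of n _ _ y] unfolding y_def[symmetric] e s
    by (subst (1) y_def) (simp only: ip_add_left e s)
  also have "(\<Sum>l<k. (- v l i) * ip n (v l) y) = 0"
    by (intro sum.neutral ballI) (simp add: ip_commute[of n "v _" y] yv)
  also have "y i = 1 - (\<Sum>l<k. (v l i)\<^sup>2)" by (simp add: y_def power2_eq_square sum_negf)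
  finally have yy: "ip n y y > 0" using i by simp
  define r where "r = 1 / sqrt (ip n y y)"
  define x where "x = (\<lambda>j. if j < n then r * y j else 0)"
  have x: "ip n x z = r * ip n y z" for z
    unfolding ip_scale_left[symmetric] by (rule ip_cong) (auto simp: x_def)
  have "ip n x x = r * (r * ip n y y)" unfolding x by (simp only: ip_commute[of n y x] x)
  also have "\<dots> = 1" using yy by (simp add: r_def)
  finally have "ip n x x = 1" .
  moreover have "\<forall>l<k. ip n x (v l) = 0" by (simp add: x yv)
  moreover have "\<forall>i\<ge>n. x i = 0" by (simp add: x_def)
  ultimately show ?thesis by blast
qed

text \<open>Each step minimises the quadratic form over the unit vectors orthogonal to the earlier
  eigenvectors. The third conjunct records the minimality, from which the eigenvalues come out
  ordered.\<close>

lemma spectral_functions: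
  assumes sym: "\<And>i j. i < n \<Longrightarrow> j < n \<Longrightarrow> A i j = A j i"
  shows "k \<le> n \<Longrightarrow> \<exists>v \<mu>. (\<forall>l<k. \<forall>m<k. ip n (v l) (v m) = (if l = m then 1 else 0)) \<and>
    (\<forall>l<k. \<forall>i<n. app n A (v l) i = \<mu> l * v l i) \<and>
    (\<forall>l<k. \<forall>x. (\<forall>m<l. ip n x (v m) = 0) \<longrightarrow> \<mu> l * ip n x x \<le> ip n (app n A x) x)"
proof (induction k)
  case 0
  show ?case by simp
next
  case (Suc k)
  then have "k \<le> n" by simp
  from Suc.IH[OF this] obtain v \<mu> where
    on': "\<forall>l<k. \<forall>m<k. ip n (v l) (v m) = (if l = m then 1 else 0)" and
    ev': "\<forall>l<k. \<forall>i<n. app n A (v l) i = \<mu> l * v l i" and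
    mn': "\<forall>l<k. \<forall>x. (\<forall>m<l. ip n x (v m) = 0) \<longrightarrow> \<mu> l * ip n x x \<le> ip n (app n A x) x"
    by (elim exE conjE)
  have on: "\<And>l m. l < k \<Longrightarrow> m < k \<Longrightarrow> ip n (v l) (v m) = (if l = m then 1 else 0)" and
    ev: "\<And>l i. l < k \<Longrightarrow> i < n \<Longrightarrow> app n A (v l) i = \<mu> l * v l i" and
    mn: "\<And>l x. l < k \<Longrightarrow> (\<forall>m<l. ip n x (v m) = 0) \<Longrightarrow> \<mu> l * ip n x x \<le> ip n (app n A x) x"
    using on' ev' mn' by blast+
  define C where "C = {x :: nat \<Rightarrow> real. (\<forall>i\<ge>n. x i = 0) \<and> ip n x x = 1 \<and> (\<forall>l<k. ip n x (v l) = 0)}"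
  have "compact C" unfolding C_def by (rule compact_unit_orthogonal)
  moreover have "C \<noteq> {}" using orthonormal_extend[of k n v] on Suc.prems unfolding C_def by auto
  moreover have "continuous_on C (\<lambda>x. ip n (app n A x) x)"
  proof -
    have "continuous_on C (\<lambda>x. x i)" for i
      by (rule continuous_on_subset[OF continuous_on_product_coordinates]) simp
    then show ?thesis unfolding ip_def app_def by (intro continuous_intros)
  qed
  ultimately obtain x0 where x0: "x0 \<in> C" "\<And>x. x \<in> C \<Longrightarrow> ip n (app n A x0) x0 \<le> ip n (app n A x) x"
    using continuous_attains_inf[of C] by blast
  define \<mu>0 where "\<mu>0 = ip n (app n A x0) x0"
  have x0': "ip n x0 x0 = 1" "\<And>l. l < k \<Longrightarrow> ip n x0 (v l) = 0" using x0 by (auto simp: C_def)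
  have min: "\<mu>0 * ip n x x \<le> ip n (app n A x) x" if x: "\<And>m. m < k \<Longrightarrow> ip n x (v m) = 0" for x
  proof (cases "ip n x x = 0")
    case True
    then have z: "x i = 0" if "i < n" for i using that by (simp add: ip_self_eq_0_iff)
    have "ip n (app n A x) x = 0" by (simp add: ip_def z)
    then show ?thesis using True by simp
  next
    case False
    then have p: "ip n x x > 0" using ip_self_nonneg[of n x] by simp
    define r where "r = 1 / sqrt (ip n x x)"
    define y where "y = (\<lambda>i. if i < n then r * x i else 0)"
    have y: "ip n y z = r * ip n x z" "ip n z y = r * ip n z x" for z
    proof -
      have "ip n y z = ip n (\<lambda>i. r * x i) z" "ip n z y = ip n z (\<lambda>i. r * x i)"
        by (rule ip_cong; simp add: y_def)+
      then show "ip n y z = r * ip n x z" "ip n z y = r * ip n z x"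
        by (simp_all only: ip_scale_left ip_scale_right)
    qed
    have r: "r * r * ip n x x = 1" using p by (simp add: r_def)
    have Ay: "app n A y = (\<lambda>i. r * app n A x i)"
      unfolding app_scale[symmetric] by (rule app_cong) (simp add: y_def)
    have "ip n y y = 1" using r by (simp add: y mult.assoc)
    moreover have "ip n y (v l) = 0" if "l < k" for l using x that by (simp add: y)
    moreover have "\<forall>i\<ge>n. y i = 0" by (simp add: y_def)
    ultimately have "y \<in> C" by (simp add: C_def)
    then have "\<mu>0 \<le> ip n (app n A y) y" unfolding \<mu>0_def by (rule x0(2))
    also have "\<dots> = r * r * ip n (app n A x) x" unfolding Ay y ip_scale_left by simp
    finally have "\<mu>0 * ip n x x \<le> (r * r * ip n (app n A x) x) * ip n x x"
      using p by (intro mult_right_mono) auto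
    also have "\<dots> = (r * r * ip n x x) * ip n (app n A x) x" by (simp only: ac_simps)
    finally show ?thesis by (simp only: r mult_1)
  qed
  define z where "z = (\<lambda>i. app n A x0 i + (- \<mu>0) * x0 i)"
  have zv: "ip n z (v m) = 0" if "m < k" for m
  proof -
    have "ip n (app n A x0) (v m) = ip n x0 (app n A (v m))" using app_symmetric[of n A] sym by blast
    also have "\<dots> = ip n x0 (\<lambda>i. \<mu> m * v m i)" by (rule ip_cong) (use ev that in auto)
    also have "\<dots> = 0" using x0'(2) that by (simp add: ip_scale_right)
    finally show ?thesis unfolding z_def ip_add_left ip_scale_left using x0'(2)[OF that] by simp
  qed
  have "ip n z z = 0"
  proof (rule quadratic_nonneg_linear_zero)
    fix t
    have "0 \<le> ip n (app n A (\<lambda>i. x0 i + t * z i)) (\<lambda>i. x0 i + t * z i) - \<mu>0 * ip n (\<lambda>i. x0 i + t * z i) (\<lambda>i. x0 i + t * z i)"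
      using min[of "\<lambda>i. x0 i + t * z i"] x0'(2) zv by (simp add: ip_add_left ip_scale_left)
    also have "\<dots> = (ip n (app n A x0) x0 - \<mu>0 * ip n x0 x0) + 2 * t * (ip n (app n A x0) z - \<mu>0 * ip n x0 z)
        + t\<^sup>2 * (ip n (app n A z) z - \<mu>0 * ip n z z)"
    proof -
      have "ip n (app n A z) x0 = ip n (app n A x0) z"
        using app_symmetric[of n A z x0] sym by (simp add: ip_commute)
      then show ?thesis
        by (simp add: app_add app_scale ip_add_left ip_add_right ip_scale_left ip_scale_right
            ip_commute[of n z x0] algebra_simps power2_eq_square)
    qed
    also have "ip n (app n A x0) x0 - \<mu>0 * ip n x0 x0 = 0" using x0'(1) by (simp add: \<mu>0_def)
    also have "ip n (app n A x0) z - \<mu>0 * ip n x0 z = ip n z z"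
    proof -
      have "ip n z z = ip n (app n A x0) z + (- \<mu>0) * ip n x0 z"
        by (subst (1) z_def) (simp only: ip_add_left ip_scale_left)
      then show ?thesis by simp
    qed
    finally show "0 \<le> 2 * t * ip n z z + t\<^sup>2 * (ip n (app n A z) z - \<mu>0 * ip n z z)" by simp
  qed
  then have ev0: "app n A x0 i = \<mu>0 * x0 i" if "i < n" for i
    using that unfolding ip_self_eq_0_iff z_def by auto
  define v' where "v' = v(k := x0)"
  define \<mu>' where "\<mu>' = \<mu>(k := \<mu>0)"
  have 1: "ip n (v' l) (v' m) = (if l = m then 1 else 0)" if "l < Suc k" "m < Suc k" for l m
    using that on x0' by (auto simp: v'_def less_Suc_eq ip_commute[of n "v _" x0])
  have 2: "app n A (v' l) i = \<mu>' l * v' l i" if "l < Suc k" "i < n" for l i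
    using that ev ev0 by (auto simp: v'_def \<mu>'_def less_Suc_eq)
  have 3: "\<mu>' l * ip n x x \<le> ip n (app n A x) x" if "l < Suc k" "\<forall>m<l. ip n x (v' m) = 0" for l x
  proof (cases "l = k")
    case True
    then show ?thesis using that min[of x] by (simp add: v'_def \<mu>'_def)
  next
    case False
    then show ?thesis using that mn[of l x] by (simp add: v'_def \<mu>'_def)
  qed
  show ?case using 1 2 3 by blast
qed

text \<open>Orthonormal vectors form a square matrix with a one-sided inverse, its transpose, which
  is then two-sided.\<close>

lemma orthonormal_complete:
  assumes on: "\<And>l m. l < n \<Longrightarrow> m < n \<Longrightarrow> ip n (v l) (v m) = (if l = m then 1 else 0)"
    and "i < n" "j < n"
  shows "(\<Sum>l<n. v l i * v l j) = (if i = j then 1 else 0)"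
proof -
  define V where "V = Matrix.mat n n (\<lambda>(j, i). v i j)"
  have V: "V \<in> carrier_mat n n" by (simp add: V_def)
  have VV: "transpose_mat V * V = 1\<^sub>m n"
    by (rule eq_matI) (use on in \<open>auto simp: V_def scalar_prod_def ip_def atLeast0LessThan\<close>)
  have "V * transpose_mat V = 1\<^sub>m n"
    by (rule mat_mult_left_right_inverse[OF _ V VV]) (use V in simp)
  then have "(V * transpose_mat V) $$ (i, j) = 1\<^sub>m n $$ (i, j)" by simp
  then show ?thesis using assms(2,3) by (simp add: V_def scalar_prod_def atLeast0LessThan)
qed

theorem real_spectral_theorem:
  assumes s: "\<And>i j. i < n \<Longrightarrow> j < n \<Longrightarrow> A i j = A j i"
  obtains v \<mu> where
    "\<And>l m. l < n \<Longrightarrow> m < n \<Longrightarrow> ip n (v l) (v m) = (if l = m then 1 else 0)"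
    "\<And>l i. l < n \<Longrightarrow> i < n \<Longrightarrow> app n A (v l) i = \<mu> l * v l i"
    "\<And>k l. k \<le> l \<Longrightarrow> l < n \<Longrightarrow> \<mu> k \<le> \<mu> l"
proof -
  obtain v \<mu> where
    on': "\<forall>l<n. \<forall>m<n. ip n (v l) (v m) = (if l = m then 1 else 0)" and
    ev': "\<forall>l<n. \<forall>i<n. app n A (v l) i = \<mu> l * v l i" and
    mn': "\<forall>l<n. \<forall>x. (\<forall>m<l. ip n x (v m) = 0) \<longrightarrow> \<mu> l * ip n x x \<le> ip n (app n A x) x"
  proof -
    have "\<exists>v \<mu>. (\<forall>l<n. \<forall>m<n. ip n (v l) (v m) = (if l = m then 1 else 0)) \<and>
      (\<forall>l<n. \<forall>i<n. app n A (v l) i = \<mu> l * v l i) \<and>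
      (\<forall>l<n. \<forall>x. (\<forall>m<l. ip n x (v m) = 0) \<longrightarrow> \<mu> l * ip n x x \<le> ip n (app n A x) x)"
      by (rule spectral_functions[OF _ order_refl]) (rule s)
    then show ?thesis using that by (elim exE conjE)
  qed
  have on: "\<And>l m. l < n \<Longrightarrow> m < n \<Longrightarrow> ip n (v l) (v m) = (if l = m then 1 else 0)" and
    ev: "\<And>l i. l < n \<Longrightarrow> i < n \<Longrightarrow> app n A (v l) i = \<mu> l * v l i" and
    mn: "\<And>l x. l < n \<Longrightarrow> (\<forall>m<l. ip n x (v m) = 0) \<Longrightarrow> \<mu> l * ip n x x \<le> ip n (app n A x) x"
    using on' ev' mn' by blast+
  have "\<mu> k \<le> \<mu> l" if "k \<le> l" "l < n" for k l
  proof (cases "k = l")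
    case False
    \<comment> \<open>A later eigenvector competes in the minimum that defined
      \<open>\<mu> k\<close>.\<close>
    then have "\<forall>m<k. ip n (v l) (v m) = 0" using that on by auto
    from mn[OF _ this] have "\<mu> k \<le> ip n (app n A (v l)) (v l)" using that on by simp
    also have "\<dots> = ip n (\<lambda>i. \<mu> l * v l i) (v l)" by (rule ip_cong) (use ev that in auto)
    also have "\<dots> = \<mu> l" using on that by (simp add: ip_scale_left)
    finally show ?thesis .
  qed simp
  then show ?thesis using that on ev by blast
qed

definition mm :: "nat \<Rightarrow> (nat \<Rightarrow> nat \<Rightarrow> real) \<Rightarrow> (nat \<Rightarrow> nat \<Rightarrow> real) \<Rightarrow> nat \<Rightarrow> nat \<Rightarrow> real" where
  "mm n A B i k = (\<Sum>j<n. A i j * B j k)"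

abbreviation kron :: "nat \<Rightarrow> nat \<Rightarrow> real" where "kron i k \<equiv> (if i = k then 1 else 0)"

lemma sum_kron[simp]:
  fixes f :: "nat \<Rightarrow> real"
  assumes "k < n"
  shows "(\<Sum>j<n. kron k j * f j) = f k" "(\<Sum>j<n. f j * kron j k) = f k"
    "(\<Sum>j<n. kron j k * f j) = f k" "(\<Sum>j<n. f j * kron k j) = f k"
proof -
  have e: "(\<Sum>j<n. if j = k then f j else 0) = f k" using assms by simp
  have "kron k j * f j = (if j = k then f j else 0)" "f j * kron j k = (if j = k then f j else 0)"
    "kron j k * f j = (if j = k then f j else 0)" "f j * kron k j = (if j = k then f j else 0)" for j by auto
  then show "(\<Sum>j<n. kron k j * f j) = f k" "(\<Sum>j<n. f j * kron j k) = f k"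
    "(\<Sum>j<n. kron j k * f j) = f k" "(\<Sum>j<n. f j * kron k j) = f k" by (simp_all only: e)
qed

lemma mm_assoc: "mm n (mm n A B) C i k = mm n A (mm n B C) i k"
proof -
  have "mm n (mm n A B) C i k = (\<Sum>j<n. \<Sum>l<n. A i l * B l j * C j k)"
    by (simp add: mm_def sum_distrib_right)
  also have "\<dots> = (\<Sum>l<n. \<Sum>j<n. A i l * B l j * C j k)" by (rule sum.swap)
  finally show ?thesis by (simp add: mm_def sum_distrib_left mult.assoc)
qed

lemma app_mm: "app n (mm n A B) x i = app n A (app n B x) i"
proof -
  have "app n (mm n A B) x i = (\<Sum>j<n. \<Sum>l<n. A i l * B l j * x j)"
    by (simp add: mm_def app_def sum_distrib_right)
  also have "\<dots> = (\<Sum>l<n. \<Sum>j<n. A i l * B l j * x j)" by (rule sum.swap)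
  finally show ?thesis by (simp add: app_def sum_distrib_left mult.assoc)
qed

lemma mm_cong:
  "(\<And>j. j < n \<Longrightarrow> A i j = A' i j) \<Longrightarrow> (\<And>j. j < n \<Longrightarrow> B j k = B' j k) \<Longrightarrow> mm n A B i k = mm n A' B' i k"
  by (simp add: mm_def)

lemma inverse_of_trivial_kernel:
  assumes "\<And>x. (\<And>i. i < n \<Longrightarrow> app n A x i = 0) \<Longrightarrow> (\<And>i. i < n \<Longrightarrow> x i = 0)"
  obtains B where "\<And>i k. i < n \<Longrightarrow> k < n \<Longrightarrow> mm n A B i k = kron i k"
    "\<And>i k. i < n \<Longrightarrow> k < n \<Longrightarrow> mm n B A i k = kron i k"
proof -
  define MA where "MA = Matrix.mat n n (\<lambda>(i, j). A i j)"
  have MA: "MA \<in> carrier_mat n n" by (simp add: MA_def)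
  have "Determinant.det MA \<noteq> 0"
  proof
    assume "Determinant.det MA = 0"
    then obtain x where x: "x \<in> carrier_vec n" "x \<noteq> 0\<^sub>v n" "MA *\<^sub>v x = 0\<^sub>v n"
      using det_0_iff_vec_prod_zero_field[OF MA] by blast
    have "app n A (\<lambda>i. vec_index x i) i = 0" if "i < n" for i
      using arg_cong[OF x(3), of "\<lambda>u. vec_index u i"] that x(1)
      by (simp add: MA_def app_def scalar_prod_def atLeast0LessThan)
    then have "vec_index x i = 0" if "i < n" for i using assms that by blast
    then have "x = 0\<^sub>v n" using x(1) by (intro eq_vecI) auto
    then show False using x by simp
  qed
  then obtain MB where MB: "MB \<in> carrier_mat n n" "MB * MA = 1\<^sub>m n" "MA * MB = 1\<^sub>m n"
    using det_non_zero_imp_unit[OF MA, of undefined] unfolding Units_def ring_mat_def by auto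
  have "mm n A (\<lambda>i j. MB $$ (i, j)) i k = kron i k" "mm n (\<lambda>i j. MB $$ (i, j)) A i k = kron i k"
    if "i < n" "k < n" for i k
    using arg_cong[OF MB(3), of "\<lambda>X. X $$ (i, k)"] arg_cong[OF MB(2), of "\<lambda>X. X $$ (i, k)"] that MB(1)
    by (simp_all add: MA_def mm_def scalar_prod_def atLeast0LessThan)
  then show ?thesis using that by blast
qed

lemma inverse_unique:
  assumes "\<And>i k. i < n \<Longrightarrow> k < n \<Longrightarrow> mm n B A i k = kron i k" "\<And>i k. i < n \<Longrightarrow> k < n \<Longrightarrow> mm n A C i k = kron i k"
    and ik: "i < n" "k < n"
  shows "B i k = C i k"
proof -
  have "B i k = mm n B (mm n A C) i k" using assms(2) ik by (simp add: mm_def[of n B])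
  also have "\<dots> = mm n (mm n B A) C i k" by (rule mm_assoc[symmetric])
  also have "\<dots> = C i k" using assms(1) ik by (simp add: mm_def[of n "mm n B A"])
  finally show ?thesis .
qed

lemma left_inverse_imp_right:
  assumes "\<And>i k. i < n \<Longrightarrow> k < n \<Longrightarrow> mm n B A i k = kron i k" and "i < n" "k < n"
  shows "mm n A B i k = kron i k"
proof -
  have "x i = 0" if x: "\<And>i. i < n \<Longrightarrow> app n A x i = 0" and "i < n" for x i
  proof -
    have "app n B (app n A x) i = 0" by (simp add: app_def[of n B] x)
    moreover have "app n (mm n B A) x i = x i" using assms(1) \<open>i < n\<close> by (simp add: app_def)
    ultimately show ?thesis by (simp add: app_mm)
  qed
  then obtain C where C: "\<And>i k. i < n \<Longrightarrow> k < n \<Longrightarrow> mm n A C i k = kron i k"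
    "\<And>i k. i < n \<Longrightarrow> k < n \<Longrightarrow> mm n C A i k = kron i k" using inverse_of_trivial_kernel[of n A] by blast
  have "mm n A B i k = mm n A C i k"
    by (rule mm_cong) (use inverse_unique[OF assms(1) C(1)] assms in auto)
  then show ?thesis using C assms by simp
qed

definition ymat :: "(nat \<Rightarrow> real) \<Rightarrow> (nat \<Rightarrow> real) \<Rightarrow> nat \<Rightarrow> nat \<Rightarrow> real" where
  "ymat \<eta> \<delta> i k = (\<delta> i * \<delta> k + kron i k) / (\<eta> i + \<eta> k)"

text \<open>\<open>v i\<close> is the eigenvector of \<open>diag (p\<^sup>2) + c c\<^sup>T\<close> for the eigenvalue \<open>(\<eta> i)\<^sup>2\<close>. In the basis of
  these eigenvectors write \<open>M\<close> for \<open>diag p\<close> and \<open>\<gamma>\<close> for \<open>c\<close>; then \<open>M\<^sup>2 + \<gamma> \<gamma>\<^sup>T = diag (\<eta>\<^sup>2)\<close>, and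
  \<open>ymat \<eta> \<delta>\<close> is the inverse of \<open>diag \<eta> - M\<close>, with \<open>\<delta> = (diag \<eta> - M)\<^sup>-\<^sup>1 \<gamma>\<close>.\<close>

locale soliton_rel =
  fixes n :: nat and c p \<eta> \<delta> :: "nat \<Rightarrow> real" and v :: "nat \<Rightarrow> nat \<Rightarrow> real"
  assumes eta_pos: "\<And>i. i < n \<Longrightarrow> \<eta> i > 0" and delta_pos: "\<And>i. i < n \<Longrightarrow> \<delta> i > 0"
    and eta_less: "\<And>i j. i < j \<Longrightarrow> j < n \<Longrightarrow> \<eta> i < \<eta> j"
    and orth: "\<And>i k. i < n \<Longrightarrow> k < n \<Longrightarrow> ip n (v i) (v k) = kron i k"
    and eigen: "\<And>i j. i < n \<Longrightarrow> j < n \<Longrightarrow> v i j * ((\<eta> i)\<^sup>2 - (p j)\<^sup>2) = ip n c (v i) * c j"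
    and ymat_v: "\<And>i j. i < n \<Longrightarrow> j < n \<Longrightarrow> (\<Sum>k<n. ymat \<eta> \<delta> i k * (v k j * (\<eta> k - p j))) = v i j"
    and ymat_gamma: "\<And>i. i < n \<Longrightarrow> (\<Sum>k<n. ymat \<eta> \<delta> i k * ip n c (v k)) = \<delta> i"

definition mmat :: "nat \<Rightarrow> (nat \<Rightarrow> real) \<Rightarrow> (nat \<Rightarrow> nat \<Rightarrow> real) \<Rightarrow> nat \<Rightarrow> nat \<Rightarrow> real" where
  "mmat n p v i k = (\<Sum>j<n. v i j * p j * v k j)"

lemma mmat_sym: "mmat n p v i k = mmat n p v k i"
  by (simp add: mmat_def mult.commute mult.left_commute)

context
  fixes n :: nat and v :: "nat \<Rightarrow> nat \<Rightarrow> real"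
  assumes orth: "\<And>i k. i < n \<Longrightarrow> k < n \<Longrightarrow> ip n (v i) (v k) = kron i k"
begin

lemma orth2: "i < n \<Longrightarrow> j < n \<Longrightarrow> (\<Sum>l<n. v l i * v l j) = kron i j"
  by (rule orthonormal_complete[OF orth])

lemma mmat_v:
  assumes "j < n"
  shows "(\<Sum>k<n. mmat n p v i k * v k j) = v i j * p j"
proof -
  have "(\<Sum>k<n. mmat n p v i k * v k j) = (\<Sum>k<n. \<Sum>l<n. v i l * p l * (v k l * v k j))"
    by (simp add: mmat_def sum_distrib_right mult.assoc)
  also have "\<dots> = (\<Sum>l<n. \<Sum>k<n. v i l * p l * (v k l * v k j))" by (rule sum.swap)
  also have "\<dots> = (\<Sum>l<n. v i l * p l * kron l j)"
    by (intro sum.cong refl) (use orth2 assms in \<open>simp add: sum_distrib_left[symmetric]\<close>)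
  also have "\<dots> = v i j * p j" using assms by (rule sum_kron)
  finally show ?thesis .
qed

lemma mmat_square: "mm n (mmat n p v) (mmat n p v) i k = (\<Sum>j<n. v i j * (p j)\<^sup>2 * v k j)"
proof -
  have "mm n (mmat n p v) (mmat n p v) i k = (\<Sum>m<n. \<Sum>j<n. (mmat n p v i m * v m j) * (p j * v k j))"
    unfolding mm_def mmat_def[of n p v _ k] by (simp add: sum_distrib_left mult.assoc)
  also have "\<dots> = (\<Sum>j<n. \<Sum>m<n. (mmat n p v i m * v m j) * (p j * v k j))" by (rule sum.swap)
  also have "\<dots> = (\<Sum>j<n. (v i j * p j) * (p j * v k j))"
    by (intro sum.cong refl) (simp add: sum_distrib_right[symmetric] mmat_v)
  finally show ?thesis by (simp add: power2_eq_square ac_simps)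
qed

lemma gamma_outer:
  assumes eigen: "\<And>i j. i < n \<Longrightarrow> j < n \<Longrightarrow> v i j * ((\<eta> i)\<^sup>2 - (p j)\<^sup>2) = ip n c (v i) * c j"
    and ik: "i < n" "k < n"
  shows "(\<eta> i)\<^sup>2 * kron i k - mm n (mmat n p v) (mmat n p v) i k = ip n c (v i) * ip n c (v k)"
proof -
  have "ip n c (v i) * ip n c (v k) = (\<Sum>j<n. (v i j * ((\<eta> i)\<^sup>2 - (p j)\<^sup>2)) * v k j)"
    unfolding ip_def[of n c "v k"] sum_distrib_left by (intro sum.cong refl) (use eigen ik in \<open>simp add: mult.assoc\<close>)
  also have "\<dots> = (\<eta> i)\<^sup>2 * ip n (v i) (v k) - (\<Sum>j<n. v i j * (p j)\<^sup>2 * v k j)"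
    by (simp add: ip_def sum_distrib_left sum_subtractf[symmetric] algebra_simps)
  finally show ?thesis using orth[OF ik] by (simp only: mmat_square)
qed

text \<open>As the values of \<open>p\<close> are distinct, such a \<open>v a\<close> is a multiple
  of a unit vector, and \<open>c\<close> has no zero entry.\<close>

lemma gamma_nonzero:
  assumes c: "\<And>j. j < n \<Longrightarrow> c j > 0" and p: "inj_on p {..<n}"
    and a: "a < n" "\<And>j. j < n \<Longrightarrow> v a j * p j = r * v a j"
  shows "ip n c (v a) \<noteq> 0"
proof -
  have "ip n (v a) (v a) \<noteq> 0" using orth a by simp
  then obtain j0 where j0: "j0 < n" "v a j0 \<noteq> 0" unfolding ip_self_eq_0_iff by blast
  have z: "v a j = 0" if "j < n" "j \<noteq> j0" for j
  proof (rule ccontr)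
    assume "v a j \<noteq> 0"
    then have "p j = p j0" using a(2)[of j] a(2)[of j0] j0 that by simp
    then show False using p that j0 by (simp add: inj_on_eq_iff)
  qed
  have "ip n c (v a) = (\<Sum>j<n. if j = j0 then c j0 * v a j0 else 0)"
    unfolding ip_def by (intro sum.cong refl) (use z in auto)
  also have "\<dots> = c j0 * v a j0" using j0 by simp
  finally show ?thesis using j0 c[of j0] by simp
qed

end

definition nmat :: "nat \<Rightarrow> (nat \<Rightarrow> real) \<Rightarrow> (nat \<Rightarrow> real) \<Rightarrow> (nat \<Rightarrow> nat \<Rightarrow> real) \<Rightarrow> nat \<Rightarrow> nat \<Rightarrow> real" where
  "nmat n \<eta> p v i k = \<eta> i * kron i k - mmat n p v i k"

lemma nmat_sym: "nmat n \<eta> p v i k = nmat n \<eta> p v k i"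
  by (simp add: nmat_def mmat_sym[of n p v i k])

lemma app_nmat: "i < n \<Longrightarrow> app n (nmat n \<eta> p v) x i = \<eta> i * x i - app n (mmat n p v) x i"
  by (simp add: app_def nmat_def left_diff_distrib sum_subtractf mult.assoc sum_distrib_left[symmetric])

lemma nmat_v:
  assumes "\<And>i k. i < n \<Longrightarrow> k < n \<Longrightarrow> ip n (v i) (v k) = kron i k" "k < n" "j < n"
  shows "(\<Sum>m<n. nmat n \<eta> p v k m * v m j) = v k j * (\<eta> k - p j)"
  using app_nmat[OF assms(2), of \<eta> p v "\<lambda>m. v m j"] mmat_v[OF assms(1) assms(3), of p k]
  by (simp add: app_def algebra_simps)

text \<open>Suppose M y = diag(\<eta>) y. Comparing |M y|^2 with y . M^2 y, where M^2 =
  diag(\<eta>^2) - \<gamma> \<gamma>^T, gives \<gamma> . y = 0. Then M diag(\<eta>) y = M^2 y =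
  diag(\<eta>)^2 y shows that the kernel is stable under diag(\<eta>). As the \<eta> are distinct, a
  nonzero kernel contains a unit vector, which contradicts \<open>gamma_nonzero\<close>.\<close>

lemma nmat_trivial_kernel:
  assumes orth: "\<And>i k. i < n \<Longrightarrow> k < n \<Longrightarrow> ip n (v i) (v k) = kron i k"
    and eigen: "\<And>i j. i < n \<Longrightarrow> j < n \<Longrightarrow> v i j * ((\<eta> i)\<^sup>2 - (p j)\<^sup>2) = ip n c (v i) * c j"
    and eta: "\<And>i j. i < j \<Longrightarrow> j < n \<Longrightarrow> \<eta> i < \<eta> j"
    and c: "\<And>j. j < n \<Longrightarrow> c j > 0" and p: "inj_on p {..<n}"
    and x: "\<And>i. i < n \<Longrightarrow> app n (nmat n \<eta> p v) x i = 0" and i: "i < n"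
  shows "x i = 0"
proof (rule ccontr)
  assume xi: "x i \<noteq> 0"
  let ?M = "mmat n p v"
  define ker where "ker = (\<lambda>y. \<forall>i<n. app n ?M y i = \<eta> i * y i)"
  define supp where "supp = (\<lambda>y :: nat \<Rightarrow> real. card {i. i < n \<and> y i \<noteq> 0})"
  have inv: "ip n (\<lambda>i. ip n c (v i)) y = 0" "ker (\<lambda>i. \<eta> i * y i)" if y: "ker y" for y
  proof -
    define g where "g = ip n (\<lambda>i. ip n c (v i)) y"
    have MM: "app n (mm n ?M ?M) y i = (\<eta> i)\<^sup>2 * y i - ip n c (v i) * g" if "i < n" for i
    proof -
      have "app n (mm n ?M ?M) y i = (\<Sum>k<n. ((\<eta> i)\<^sup>2 * kron i k - ip n c (v i) * ip n c (v k)) * y k)"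
        unfolding app_def
        by (intro sum.cong refl) (use gamma_outer[OF orth eigen, of i _] that in \<open>auto simp: algebra_simps\<close>)
      also have "\<dots> = (\<eta> i)\<^sup>2 * y i - ip n c (v i) * g"
        using that by (simp add: left_diff_distrib sum_subtractf mult.assoc sum_distrib_left[symmetric] g_def ip_def)
      finally show ?thesis .
    qed
    have My: "app n ?M y i = \<eta> i * y i" if "i < n" for i using y that by (simp add: ker_def)
    have MM2: "app n (mm n ?M ?M) y i = app n ?M (\<lambda>i. \<eta> i * y i) i" for i
      unfolding app_mm by (rule fun_cong[OF app_cong[OF My]])
    have "ip n y (\<lambda>i. app n (mm n ?M ?M) y i) = ip n (app n ?M y) (app n ?M y)"
      unfolding app_mm by (rule app_symmetric[symmetric]) (rule mmat_sym)
    also have "\<dots> = ip n (\<lambda>i. \<eta> i * y i) (\<lambda>i. \<eta> i * y i)" by (rule ip_cong; erule My)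
    finally have "ip n y (\<lambda>i. (\<eta> i)\<^sup>2 * y i - ip n c (v i) * g) = ip n (\<lambda>i. \<eta> i * y i) (\<lambda>i. \<eta> i * y i)"
      by (subst (asm) ip_cong[of n y y _ "\<lambda>i. (\<eta> i)\<^sup>2 * y i - ip n c (v i) * g"]) (use MM in auto)
    moreover have "ip n y (\<lambda>i. (\<eta> i)\<^sup>2 * y i - ip n c (v i) * g) = ip n (\<lambda>i. \<eta> i * y i) (\<lambda>i. \<eta> i * y i) - g * g"
      unfolding g_def ip_def[of n _ y] sum_distrib_left[of g] ip_def[of n y]  ip_def[of n "\<lambda>i. \<eta> i * y i"]
      by (simp add: right_diff_distrib sum_subtractf power2_eq_square sum_distrib_right ac_simps)
    ultimately have g0: "g = 0" by simp
    then show "ip n (\<lambda>i. ip n c (v i)) y = 0" by (simp add: g_def)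
    show "ker (\<lambda>i. \<eta> i * y i)"
      unfolding ker_def using MM MM2 g0 by (simp add: power2_eq_square mult.assoc)
  qed
  have "ker x \<and> (\<exists>i<n. x i \<noteq> 0)" using x app_nmat[of _ n \<eta> p v x] xi i by (auto simp: ker_def)
  \<comment> \<open>Minimal support yields the unit vector: diag(\<eta>) y - \<eta>_a y stays in the
    kernel, loses the coordinate a and gains none, so it must be 0.\<close>
  then obtain y where y: "ker y" "\<exists>i<n. y i \<noteq> 0"
    and min: "\<And>z. ker z \<Longrightarrow> \<exists>i<n. z i \<noteq> 0 \<Longrightarrow> supp y \<le> supp z"
    using ex_has_least_nat[of "\<lambda>y. ker y \<and> (\<exists>i<n. y i \<noteq> 0)" x supp] by blast
  obtain a where a: "a < n" "y a \<noteq> 0" using y by blast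
  have ya: "y b = 0" if "b < n" "b \<noteq> a" for b
  proof (rule ccontr)
    assume yb: "y b \<noteq> 0"
    define z where "z = (\<lambda>i. \<eta> i * y i + (- \<eta> a) * y i)"
    have "ker z" using inv(2)[OF y(1)] y(1) unfolding ker_def z_def app_add app_scale by (simp add: algebra_simps)
    moreover have "\<eta> b \<noteq> \<eta> a" using eta[of a b] eta[of b a] that a by (metis less_irrefl linorder_neqE_nat)
    then have "z b \<noteq> 0" using yb by (simp add: z_def)
    ultimately have "supp y \<le> supp z" using min that by blast
    moreover have "supp z < supp y" unfolding supp_def
    proof (rule psubset_card_mono)
      show "{i. i < n \<and> z i \<noteq> 0} \<subset> {i. i < n \<and> y i \<noteq> 0}" using a by (auto simp: z_def)
    qed simp
    ultimately show False by simp
  qed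
  have app_y: "app n ?M y i = ?M i a * y a" for i
  proof -
    have "app n ?M y i = (\<Sum>k<n. if k = a then ?M i a * y a else 0)"
      unfolding app_def by (intro sum.cong refl) (use ya in auto)
    then show ?thesis using a by simp
  qed
  have Ma: "?M k a = \<eta> a * kron k a" if "k < n" for k
  proof -
    have "?M k a * y a = \<eta> k * y k" using y(1) that app_y[of k] by (simp add: ker_def)
    then show ?thesis using a ya[OF that] by (cases "k = a") auto
  qed
  have vp: "v a j * p j = \<eta> a * v a j" if "j < n" for j
  proof -
    have "v a j * p j = (\<Sum>k<n. ?M a k * v k j)" using mmat_v[OF orth that, of p a] by simp
    also have "\<dots> = (\<Sum>k<n. kron a k * (\<eta> a * v k j))"
      by (intro sum.cong refl) (use Ma mmat_sym[of n p v a] in auto)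
    also have "\<dots> = \<eta> a * v a j" using a by simp
    finally show ?thesis .
  qed
  have g: "ip n c (v a) \<noteq> 0" by (rule gamma_nonzero[where c = c and p = p, OF orth c p a(1) vp])
  have "ip n (\<lambda>i. ip n c (v i)) y = (\<Sum>k<n. if k = a then ip n c (v a) * y a else 0)"
    unfolding ip_def[of n _ y] by (intro sum.cong refl) (use ya in auto)
  also have "\<dots> = ip n c (v a) * y a" using a by simp
  finally show False using inv(1)[OF y(1)] g a by simp
qed

text \<open>Conjugating the Lyapunov type equation \<open>N diag \<eta> + diag \<eta> N - N\<^sup>2 = \<gamma> \<gamma>\<^sup>T\<close> with \<open>N\<^sup>-\<^sup>1\<close> turns it into
  \<open>Y diag \<eta> + diag \<eta> Y = 1 + \<delta> \<delta>\<^sup>T\<close>, which determines \<open>Y\<close> entrywise.\<close>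

lemma lyapunov_inverse:
  assumes NY: "\<And>i k. i < n \<Longrightarrow> k < n \<Longrightarrow> mm n N Y i k = kron i k"
    and YN: "\<And>i k. i < n \<Longrightarrow> k < n \<Longrightarrow> mm n Y N i k = kron i k"
    and sym: "\<And>i k. N i k = N k i"
    and L: "\<And>i k. i < n \<Longrightarrow> k < n \<Longrightarrow> N i k * (\<eta> i + \<eta> k) - mm n N N i k = \<gamma> i * \<gamma> k"
    and eta: "\<And>i. i < n \<Longrightarrow> \<eta> i > 0" and ik: "i < n" "k < n"
  shows "Y i k = ymat \<eta> (app n Y \<gamma>) i k"
proof -
  have Ysym: "Y i k = Y k i" if "i < n" "k < n" for i k
  proof (rule inverse_unique[where B = Y and A = N and C = "\<lambda>i k. Y k i"])
    show "mm n N (\<lambda>i k. Y k i) i k = kron i k" if "i < n" "k < n" for i k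
      using YN[of k i] that unfolding mm_def by (subst sym) (simp add: mult.commute eq_commute)
  qed (use YN that in auto)
  define L where "L = (\<lambda>i k. N i k * (\<eta> i + \<eta> k) - mm n N N i k)"
  have "mm n Y (mm n L Y) i k = \<eta> k * Y i k + \<eta> i * Y i k - kron i k"
  proof -
    have 1: "mm n L Y a k = \<eta> a * kron a k + mm n N (\<lambda>b k. \<eta> b * Y b k) a k - N a k" if "a < n" for a
    proof -
      have "mm n L Y a k = \<eta> a * mm n N Y a k + mm n N (\<lambda>b k. \<eta> b * Y b k) a k - mm n (mm n N N) Y a k"
        unfolding L_def mm_def[of n _ Y] mm_def[of n N "\<lambda>b k. \<eta> b * Y b k"]
        by (simp add: sum_distrib_left sum.distrib sum_subtractf algebra_simps)
      also have "mm n (mm n N N) Y a k = mm n N (mm n N Y) a k" by (rule mm_assoc)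
      also have "\<dots> = N a k" using NY ik by (simp add: mm_def[of n N "mm n N Y"])
      finally show ?thesis using NY that ik by simp
    qed
    have "mm n Y (mm n L Y) i k = (\<Sum>a<n. Y i a * (\<eta> a * kron a k)) + mm n Y (mm n N (\<lambda>b k. \<eta> b * Y b k)) i k - mm n Y N i k"
      unfolding mm_def[of n Y] by (simp add: 1 algebra_simps sum.distrib sum_subtractf)
    also have "(\<Sum>a<n. Y i a * (\<eta> a * kron a k)) = Y i k * \<eta> k"
      using sum_kron(2)[OF ik(2), of "\<lambda>a. Y i a * \<eta> a"] by (simp only: mult.assoc)
    also have "mm n Y (mm n N (\<lambda>b k. \<eta> b * Y b k)) i k = mm n (mm n Y N) (\<lambda>b k. \<eta> b * Y b k) i k"
      by (rule mm_assoc[symmetric])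
    also have "\<dots> = \<eta> i * Y i k" using YN ik by (simp add: mm_def[of n "mm n Y N"])
    finally show ?thesis using YN ik by (simp add: mult.commute)
  qed
  moreover have "mm n Y (mm n L Y) i k = app n Y \<gamma> i * app n Y \<gamma> k"
  proof -
    have "mm n Y (mm n L Y) i k = (\<Sum>a<n. Y i a * (\<Sum>b<n. \<gamma> a * \<gamma> b * Y b k))"
      unfolding mm_def[of n Y] mm_def[of n L] by (intro sum.cong refl arg_cong2[of _ _ _ _ "(*)"]) (use L in \<open>auto simp: L_def\<close>)
    also have "\<dots> = (\<Sum>a<n. \<Sum>b<n. (Y i a * \<gamma> a) * (\<gamma> b * Y b k))"
      by (simp add: sum_distrib_left mult.assoc)
    also have "\<dots> = (\<Sum>a<n. Y i a * \<gamma> a) * (\<Sum>b<n. \<gamma> b * Y b k)"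
      by (rule sum_product[symmetric])
    also have "(\<Sum>b<n. \<gamma> b * Y b k) = (\<Sum>b<n. Y k b * \<gamma> b)"
      by (intro sum.cong refl) (use Ysym ik in \<open>simp add: mult.commute\<close>)
    finally show ?thesis by (simp add: app_def)
  qed
  ultimately have "Y i k * (\<eta> i + \<eta> k) = app n Y \<gamma> i * app n Y \<gamma> k + kron i k" by (simp add: algebra_simps)
  moreover have "\<eta> i + \<eta> k \<noteq> 0" using eta[OF ik(1)] eta[OF ik(2)] by linarith
  ultimately show ?thesis by (simp add: ymat_def eq_divide_eq)
qed

text \<open>Substitute M = diag(\<eta>) - N in M^2 + \<gamma> \<gamma>^T = diag(\<eta>^2).\<close>

lemma nmat_lyapunov:
  assumes orth: "\<And>i k. i < n \<Longrightarrow> k < n \<Longrightarrow> ip n (v i) (v k) = kron i k"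
    and eigen: "\<And>i j. i < n \<Longrightarrow> j < n \<Longrightarrow> v i j * ((\<eta> i)\<^sup>2 - (p j)\<^sup>2) = ip n c (v i) * c j"
    and ik: "i < n" "k < n"
  shows "nmat n \<eta> p v i k * (\<eta> i + \<eta> k) - mm n (nmat n \<eta> p v) (nmat n \<eta> p v) i k = ip n c (v i) * ip n c (v k)"
proof -
  let ?M = "mmat n p v"
  have "mm n (nmat n \<eta> p v) (nmat n \<eta> p v) i k
      = (\<Sum>j<n. kron i j * (\<eta> i * (\<eta> j * kron j k - ?M j k))) - ((\<Sum>j<n. (?M i j * \<eta> j) * kron j k) - mm n ?M ?M i k)"
    unfolding mm_def nmat_def sum_subtractf[symmetric] by (intro sum.cong refl) (simp add: algebra_simps)
  also have "\<dots> = \<eta> i * (\<eta> i * kron i k - ?M i k) - (?M i k * \<eta> k - mm n ?M ?M i k)"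
    using ik by (simp only: sum_kron)
  finally show ?thesis
    using gamma_outer[OF orth eigen ik] ik by (auto simp: nmat_def algebra_simps power2_eq_square)
qed

theorem soliton_rel_exists_delta:
  assumes orth: "\<And>i k. i < n \<Longrightarrow> k < n \<Longrightarrow> ip n (v i) (v k) = kron i k"
    and eigen: "\<And>i j. i < n \<Longrightarrow> j < n \<Longrightarrow> v i j * ((\<eta> i)\<^sup>2 - (p j)\<^sup>2) = ip n c (v i) * c j"
    and eta: "\<And>i j. i < j \<Longrightarrow> j < n \<Longrightarrow> \<eta> i < \<eta> j" and eta0: "\<And>i. i < n \<Longrightarrow> \<eta> i > 0"
    and c: "\<And>j. j < n \<Longrightarrow> c j > 0" and p: "inj_on p {..<n}"
  obtains \<delta> where "\<And>i. i < n \<Longrightarrow> \<delta> i \<noteq> 0"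
    "\<And>i j. i < n \<Longrightarrow> j < n \<Longrightarrow> (\<Sum>k<n. ymat \<eta> \<delta> i k * (v k j * (\<eta> k - p j))) = v i j"
    "\<And>i. i < n \<Longrightarrow> (\<Sum>k<n. ymat \<eta> \<delta> i k * ip n c (v k)) = \<delta> i"
proof -
  let ?N = "nmat n \<eta> p v"
  define \<gamma> where "\<gamma> = (\<lambda>i. ip n c (v i))"
  obtain Y where NY: "\<And>i k. i < n \<Longrightarrow> k < n \<Longrightarrow> mm n ?N Y i k = kron i k"
    and YN: "\<And>i k. i < n \<Longrightarrow> k < n \<Longrightarrow> mm n Y ?N i k = kron i k"
    using inverse_of_trivial_kernel[of n ?N] nmat_trivial_kernel[where c = c, OF orth eigen eta c p] by blast
  define \<delta> where "\<delta> = app n Y \<gamma>"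
  have Y: "Y i k = ymat \<eta> \<delta> i k" if "i < n" "k < n" for i k
    unfolding \<delta>_def
    by (rule lyapunov_inverse[OF NY YN nmat_sym _ eta0 that])
       (simp_all add: nmat_lyapunov[where c = c, OF orth eigen] \<gamma>_def)
  have Nd: "app n ?N \<delta> i = \<gamma> i" if "i < n" for i
  proof -
    have "app n ?N \<delta> i = app n (mm n ?N Y) \<gamma> i" unfolding \<delta>_def app_mm ..
    also have "\<dots> = \<gamma> i" using NY that by (simp add: app_def)
    finally show ?thesis .
  qed
  have e2: "(\<Sum>k<n. ymat \<eta> \<delta> i k * (v k j * (\<eta> k - p j))) = v i j" if "i < n" "j < n" for i j
  proof -
    have "(\<Sum>k<n. ymat \<eta> \<delta> i k * (v k j * (\<eta> k - p j))) = (\<Sum>k<n. Y i k * app n ?N (\<lambda>m. v m j) k)"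
      by (intro sum.cong refl) (use Y that nmat_v[OF orth, of _ j] in \<open>auto simp: app_def\<close>)
    also have "\<dots> = app n (mm n Y ?N) (\<lambda>m. v m j) i" unfolding app_mm by (simp add: app_def)
    also have "\<dots> = v i j" using YN that by (simp add: app_def)
    finally show ?thesis .
  qed
  have e3: "(\<Sum>k<n. ymat \<eta> \<delta> i k * ip n c (v k)) = \<delta> i" if "i < n" for i
  proof -
    have "(\<Sum>k<n. ymat \<eta> \<delta> i k * ip n c (v k)) = (\<Sum>k<n. Y i k * \<gamma> k)"
      by (intro sum.cong refl) (use Y that in \<open>simp add: \<gamma>_def\<close>)
    then show ?thesis by (simp add: \<delta>_def app_def)
  qed
  \<comment> \<open>If \<delta> a = 0, column a of Y is a unit vector over 2 \<eta> a, so this unit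
    vector is an eigenvector of M for - \<eta> a. Then \<gamma> a \<noteq> 0 by
    \<open>gamma_nonzero\<close>, while \<gamma> = N \<delta> gives \<gamma> a = 2 \<eta> a \<delta>
    a = 0.\<close>
  have "\<delta> a \<noteq> 0" if a: "a < n" for a
  proof
    assume d0: "\<delta> a = 0"
    have Ya: "Y k a = kron k a * (1 / (2 * \<eta> a))" if "k < n" for k
      using Y[OF that a] d0 by (auto simp: ymat_def)
    have Na: "?N i a = 2 * \<eta> a * kron i a" if "i < n" for i
    proof -
      have "kron i a = (\<Sum>k<n. ?N i k * Y k a)" using NY[OF that a] by (simp add: mm_def)
      also have "\<dots> = (\<Sum>k<n. ?N i k * (1 / (2 * \<eta> a)) * kron k a)"
        by (intro sum.cong refl) (use Ya in auto)
      also have "\<dots> = ?N i a * (1 / (2 * \<eta> a))" using a by (simp only: sum_kron)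
      finally show ?thesis using eta0[OF a] by (simp add: field_simps)
    qed
    have Ma: "mmat n p v a k = - \<eta> a * kron k a" if "k < n" for k
      using Na[OF that] mmat_sym[of n p v a k] by (auto simp: nmat_def)
    have vp: "v a j * p j = - \<eta> a * v a j" if "j < n" for j
    proof -
      have "v a j * p j = (\<Sum>k<n. mmat n p v a k * v k j)" using mmat_v[OF orth that, of p a] by simp
      also have "\<dots> = (\<Sum>k<n. kron k a * (- \<eta> a * v k j))"
        by (intro sum.cong refl) (use Ma in auto)
      also have "\<dots> = - \<eta> a * v a j" using a by (simp only: sum_kron)
      finally show ?thesis .
    qed
    have "\<gamma> a \<noteq> 0" unfolding \<gamma>_def by (rule gamma_nonzero[where c = c and p = p, OF orth c p a vp])
    moreover have "\<gamma> a = (\<Sum>k<n. kron k a * (2 * \<eta> a * \<delta> k))"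
      unfolding Nd[OF a, symmetric] app_def
      by (intro sum.cong refl) (use Na nmat_sym[of n \<eta> p v a] in auto)
    then have "\<gamma> a = 2 * \<eta> a * \<delta> a" using a by (simp only: sum_kron)
    ultimately show False using d0 by simp
  qed
  then show ?thesis using that e2 e3 by blast
qed

text \<open>Eigenvectors are determined up to sign only, and flipping one flips the corresponding
  \<delta>; the signs \<open>s\<close> make all of them positive. The given basis stays visible in
  the conclusion because the reflection has to compare the bases for \<open>p\<close> and
  \<open>- p\<close>.\<close>

theorem soliton_rel_of_eigenbasis:
  assumes orth: "\<And>i k. i < n \<Longrightarrow> k < n \<Longrightarrow> ip n (v i) (v k) = kron i k"
    and eigen: "\<And>i j. i < n \<Longrightarrow> j < n \<Longrightarrow> v i j * ((\<eta> i)\<^sup>2 - (p j)\<^sup>2) = ip n c (v i) * c j"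
    and eta: "\<And>i j. i < j \<Longrightarrow> j < n \<Longrightarrow> \<eta> i < \<eta> j" and eta0: "\<And>i. i < n \<Longrightarrow> \<eta> i > 0"
    and c: "\<And>j. j < n \<Longrightarrow> c j > 0" and p: "inj_on p {..<n}"
  shows "\<exists>\<delta> s. soliton_rel n c p \<eta> \<delta> (\<lambda>i j. s i * v i j) \<and> (\<forall>i<n. s i \<noteq> 0)"
proof -
  obtain \<delta> where d: "\<And>i. i < n \<Longrightarrow> \<delta> i \<noteq> 0"
    and e2: "\<And>i j. i < n \<Longrightarrow> j < n \<Longrightarrow> (\<Sum>k<n. ymat \<eta> \<delta> i k * (v k j * (\<eta> k - p j))) = v i j"
    and e3: "\<And>i. i < n \<Longrightarrow> (\<Sum>k<n. ymat \<eta> \<delta> i k * ip n c (v k)) = \<delta> i"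
    using soliton_rel_exists_delta[where c = c, OF orth eigen eta eta0 c p] by blast
  define s where "s = (\<lambda>i. sgn (\<delta> i))"
  have ss: "s i * s i = 1" if "i < n" for i using d[OF that] by (simp add: s_def sgn_real_def)
  define v' where "v' = (\<lambda>i j. s i * v i j)"
  have y: "ymat \<eta> (\<lambda>i. \<bar>\<delta> i\<bar>) i k = s i * s k * ymat \<eta> \<delta> i k" if "i < n" "k < n" for i k
  proof -
    have "\<bar>\<delta> i\<bar> = s i * \<delta> i" for i by (simp add: s_def sgn_real_def)
    then have "\<bar>\<delta> i\<bar> * \<bar>\<delta> k\<bar> + kron i k = s i * s k * (\<delta> i * \<delta> k + kron i k)"
      using ss[OF that(1)] by (auto simp: algebra_simps)
    then show ?thesis by (simp add: ymat_def)
  qed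
  have g: "ip n c (v' i) = s i * ip n c (v i)" for i unfolding v'_def by (rule ip_scale_right)
  have "soliton_rel n c p \<eta> (\<lambda>i. \<bar>\<delta> i\<bar>) v'"
  proof
    show "\<eta> i > 0" if "i < n" for i using eta0 that .
    show "\<bar>\<delta> i\<bar> > 0" if "i < n" for i using d that by simp
    show "\<eta> i < \<eta> j" if "i < j" "j < n" for i j using eta that .
    show "ip n (v' i) (v' k) = kron i k" if "i < n" "k < n" for i k
      unfolding v'_def ip_scale_left ip_scale_right using orth that ss by simp
    show "v' i j * ((\<eta> i)\<^sup>2 - (p j)\<^sup>2) = ip n c (v' i) * c j" if "i < n" "j < n" for i j
      unfolding g using eigen[OF that] by (simp add: v'_def mult.assoc)
    show "(\<Sum>k<n. ymat \<eta> (\<lambda>i. \<bar>\<delta> i\<bar>) i k * (v' k j * (\<eta> k - p j))) = v' i j" if "i < n" "j < n" for i j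
    proof -
      have "(\<Sum>k<n. ymat \<eta> (\<lambda>i. \<bar>\<delta> i\<bar>) i k * (v' k j * (\<eta> k - p j)))
        = (\<Sum>k<n. (s k * s k) * (s i * (ymat \<eta> \<delta> i k * (v k j * (\<eta> k - p j)))))"
        by (intro sum.cong refl) (use y that in \<open>simp add: v'_def\<close>)
      also have "\<dots> = (\<Sum>k<n. s i * (ymat \<eta> \<delta> i k * (v k j * (\<eta> k - p j))))"
        by (intro sum.cong refl) (use ss in simp)
      finally show ?thesis using e2[OF that] by (simp add: sum_distrib_left[symmetric] v'_def)
    qed
    show "(\<Sum>k<n. ymat \<eta> (\<lambda>i. \<bar>\<delta> i\<bar>) i k * ip n c (v' k)) = \<bar>\<delta> i\<bar>" if "i < n" for i
    proof -
      have "(\<Sum>k<n. ymat \<eta> (\<lambda>i. \<bar>\<delta> i\<bar>) i k * ip n c (v' k))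
        = (\<Sum>k<n. (s k * s k) * (s i * (ymat \<eta> \<delta> i k * ip n c (v k))))"
        by (intro sum.cong refl) (use y that in \<open>simp add: g\<close>)
      also have "\<dots> = (\<Sum>k<n. s i * (ymat \<eta> \<delta> i k * ip n c (v k)))"
        by (intro sum.cong refl) (use ss in simp)
      also have "\<dots> = s i * \<delta> i" using e3[OF that] by (simp add: sum_distrib_left[symmetric])
      finally show ?thesis by (simp add: s_def sgn_real_def)
    qed
  qed
  moreover have "\<forall>i<n. s i \<noteq> 0" using ss by fastforce
  ultimately show ?thesis unfolding v'_def by blast
qed

theorem soliton_rel_exists:
  assumes c: "\<And>j. j < n \<Longrightarrow> c j > 0" and p: "inj_on p {..<n}"
  shows "\<exists>\<eta> \<delta> v. soliton_rel n c p \<eta> \<delta> v"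
proof -
  define A where "A = (\<lambda>i j. (p i)\<^sup>2 * kron i j + c i * c j)"
  have As: "A i j = A j i" for i j by (simp add: A_def)
  obtain v \<mu> where
    orth: "\<And>l m. l < n \<Longrightarrow> m < n \<Longrightarrow> ip n (v l) (v m) = kron l m" and
    ev: "\<And>l i. l < n \<Longrightarrow> i < n \<Longrightarrow> app n A (v l) i = \<mu> l * v l i" and
    mono: "\<And>k l. k \<le> l \<Longrightarrow> l < n \<Longrightarrow> \<mu> k \<le> \<mu> l"
    using real_spectral_theorem[of n A] As by blast
  have appA: "app n A x i = (p i)\<^sup>2 * x i + c i * ip n c x" if "i < n" for x i
    using that by (simp add: app_def A_def distrib_right sum.distrib mult.assoc sum_distrib_left[symmetric] ip_def)
  have eig: "v i j * (\<mu> i - (p j)\<^sup>2) = ip n c (v i) * c j" if "i < n" "j < n" for i j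
    using ev[OF that] appA[OF that(2), of "v i"] by (simp add: algebra_simps)
  \<comment> \<open>The eigenvalue is \<Sum> (p j v i j)^2 + (c . v i)^2. If it were 0,
    \<open>v i\<close> would be an eigenvector of diag(p) orthogonal to \<open>c\<close>.\<close>
  have \<mu>_pos: "\<mu> i > 0" if i: "i < n" for i
  proof -
    have "\<mu> i = ip n (v i) (\<lambda>j. \<mu> i * v i j)" using orth[OF i i] by (simp add: ip_scale_right)
    also have "\<dots> = ip n (v i) (\<lambda>j. (p j)\<^sup>2 * v i j + c j * ip n c (v i))"
      by (rule ip_cong) (use ev[OF i] appA[of _ "v i"] in auto)
    also have "\<dots> = (\<Sum>j<n. (p j * v i j)\<^sup>2) + (ip n c (v i))\<^sup>2"
      by (simp add: ip_def[of n "v i"] distrib_left sum.distrib power2_eq_square ip_def[of n c] sum_distrib_left sum_distrib_right ac_simps)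
    finally have e: "\<mu> i = (\<Sum>j<n. (p j * v i j)\<^sup>2) + (ip n c (v i))\<^sup>2" .
    have nn: "(\<Sum>j<n. (p j * v i j)\<^sup>2) \<ge> 0" by (intro sum_nonneg) auto
    have "\<mu> i \<noteq> 0"
    proof
      assume "\<mu> i = 0"
      then have z: "(\<Sum>j<n. (p j * v i j)\<^sup>2) = 0" "(ip n c (v i))\<^sup>2 = 0" using e nn zero_le_power2[of "ip n c (v i)"] by linarith+
      then have "p j * v i j = 0" if "j < n" for j
        using that by (subst (asm) sum_nonneg_eq_0_iff) auto
      then have vp: "v i j * p j = 0 * v i j" if "j < n" for j using that by (simp add: mult.commute)
      have "ip n c (v i) \<noteq> 0" by (rule gamma_nonzero[where c = c and p = p, OF orth c p i vp])
      then show False using z by simp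
    qed
    then show ?thesis using e nn zero_le_power2[of "ip n c (v i)"] by linarith
  qed
  \<comment> \<open>Simplicity of the spectrum. If one of the vectors is not orthogonal to
    \<open>c\<close>, no \<mu> - (p j)^2 vanishes and both are multiples of c j / (\<mu> - (p j)^2).
    Otherwise both live where (p j)^2 = \<mu>, that is on at most two indices with opposite
    \<open>p\<close>, and orthogonality to \<open>c\<close> leaves one dimension.\<close>
  have ne: "\<mu> i \<noteq> \<mu> k" if ik: "i < n" "k < n" "i \<noteq> k" for i k
  proof
    assume eq: "\<mu> i = \<mu> k"
    define a b where "a = ip n c (v i)" and "b = ip n c (v k)"
    have indep: False if "\<And>j. j < n \<Longrightarrow> x * v i j = y * v k j" "x \<noteq> 0 \<or> y \<noteq> 0" for x y
    proof -
      have "ip n (\<lambda>j. x * v i j) (v i) = ip n (\<lambda>j. y * v k j) (v i)" "ip n (\<lambda>j. x * v i j) (v k) = ip n (\<lambda>j. y * v k j) (v k)"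
        by (rule ip_cong; use that in simp)+
      then have "x * ip n (v i) (v i) = y * ip n (v k) (v i)" "x * ip n (v i) (v k) = y * ip n (v k) (v k)"
        by (simp_all only: ip_scale_left)
      then show False using that(2) orth ik by simp
    qed
    show False
    proof (cases "a = 0 \<and> b = 0")
      case False
      have "b * v i j = a * v k j" if j: "j < n" for j
      proof -
        have 1: "v i j * (\<mu> k - (p j)\<^sup>2) = a * c j" "v k j * (\<mu> k - (p j)\<^sup>2) = b * c j"
          using eig[OF ik(1) j] eig[OF ik(2) j] unfolding eq a_def b_def by simp_all
        have "\<mu> k - (p j)\<^sup>2 \<noteq> 0" using 1 False c[OF j] by auto
        moreover have "(b * v i j) * (\<mu> k - (p j)\<^sup>2) = (a * v k j) * (\<mu> k - (p j)\<^sup>2)"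
          using 1 by (simp add: mult.assoc)
        ultimately show ?thesis by simp
      qed
      then show False using indep[of b a] False by blast
    next
      case True
      have "ip n (v i) (v i) \<noteq> 0" using orth ik by simp
      then obtain j0 where j0: "j0 < n" "v i j0 \<noteq> 0" unfolding ip_self_eq_0_iff by blast
      have sup: "(p j)\<^sup>2 = \<mu> k" if "j < n" "v i j \<noteq> 0 \<or> v k j \<noteq> 0" for j
        using eig[of i j] eig[of k j] that ik True eq by (auto simp: a_def b_def)
      \<comment> \<open>This combination vanishes at j0, so it lives on the one index where
        \<open>p\<close> equals - p j0; orthogonality to \<open>c\<close> then makes it 0.\<close>
      define x where "x = (\<lambda>j. v k j0 * v i j + (- v i j0) * v k j)"
      have cx: "ip n c x = 0"
        unfolding x_def ip_add_right ip_scale_right using True by (simp add: a_def b_def)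
      have x0: "x j0 = 0" by (simp add: x_def)
      have xs: "p j = - p j0" if "j < n" "x j \<noteq> 0" for j
      proof -
        have "v i j \<noteq> 0 \<or> v k j \<noteq> 0" using that by (auto simp: x_def)
        then have "(p j)\<^sup>2 = (p j0)\<^sup>2" using sup[OF that(1)] sup[OF j0(1)] j0 by simp
        moreover have "p j \<noteq> p j0" using p that j0 x0 by (auto simp: inj_on_def)
        ultimately show ?thesis by (simp add: power2_eq_iff)
      qed
      have "x j = 0" if j: "j < n" for j
      proof (rule ccontr)
        assume xj: "x j \<noteq> 0"
        have "x l = 0" if "l < n" "l \<noteq> j" for l
        proof (rule ccontr)
          assume "x l \<noteq> 0"
          then have "p l = p j" using xs[of l] xs[of j] xj that j by simp
          then show False using inj_onD[OF p, of l j] that j by simp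
        qed
        then have "ip n c x = (\<Sum>l<n. if l = j then c j * x j else 0)"
          unfolding ip_def by (intro sum.cong refl) auto
        then show False using cx xj j c[OF j] by simp
      qed
      then have "v k j0 * v i j = v i j0 * v k j" if "j < n" for j using that by (auto simp: x_def)
      then show False using indep[of "v k j0" "v i j0"] j0 by blast
    qed
  qed
  have "\<exists>\<delta> s. soliton_rel n c p (\<lambda>i. sqrt (\<mu> i)) \<delta> (\<lambda>i j. s i * v i j) \<and> (\<forall>i<n. s i \<noteq> 0)"
  proof (rule soliton_rel_of_eigenbasis[where v = v])
    show "v i j * ((sqrt (\<mu> i))\<^sup>2 - (p j)\<^sup>2) = ip n c (v i) * c j" if "i < n" "j < n" for i j
      using eig[OF that] \<mu>_pos[OF that(1)] by simp
    show "sqrt (\<mu> i) < sqrt (\<mu> j)" if "i < j" "j < n" for i j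
      using mono[of i j] ne[of i j] that by simp
  qed (use orth \<mu>_pos c p in auto)
  then show ?thesis by blast
qed

text \<open>The quadratic form of \<open>exp (- (\<eta> i + \<eta> k) t) / (\<eta> i + \<eta> k)\<close> tends to 0 and has the
  derivative \<open>- (\<Sum>i. x i exp (- \<eta> i t))\<^sup>2\<close>.\<close>

lemma cauchy_kernel_nonneg:
  fixes \<eta> x :: "nat \<Rightarrow> real"
  assumes "\<And>i. i < n \<Longrightarrow> \<eta> i > 0"
  shows "0 \<le> (\<Sum>i<n. \<Sum>k<n. x i * x k / (\<eta> i + \<eta> k))"
proof -
  define q where "q = (\<lambda>t. \<Sum>i<n. \<Sum>k<n. x i * x k * exp (- (\<eta> i + \<eta> k) * t) / (\<eta> i + \<eta> k))"
  have pos: "\<eta> i + \<eta> k > 0" if "i < n" "k < n" for i k using assms that by (simp add: add_pos_pos)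
  have d: "(q has_real_derivative - (\<Sum>i<n. x i * exp (- \<eta> i * t))\<^sup>2) (at t)" for t
  proof -
    have "(q has_real_derivative (\<Sum>i<n. \<Sum>k<n. - (x i * exp (- \<eta> i * t)) * (x k * exp (- \<eta> k * t)))) (at t)"
      unfolding q_def
    proof (intro DERIV_sum)
      fix i k assume "i \<in> {..<n}" "k \<in> {..<n}"
      then have nz: "\<eta> i + \<eta> k \<noteq> 0" using pos[of i k] by simp
      have e: "exp (- (\<eta> i + \<eta> k) * t) = exp (- \<eta> i * t) * exp (- \<eta> k * t)"
        by (simp add: exp_add[symmetric] algebra_simps)
      have "((\<lambda>t. x i * x k * exp (- (\<eta> i + \<eta> k) * t) / (\<eta> i + \<eta> k)) has_real_derivative
          x i * x k * (exp (- (\<eta> i + \<eta> k) * t) * - (\<eta> i + \<eta> k)) / (\<eta> i + \<eta> k)) (at t)"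
        using nz by (auto intro!: derivative_eq_intros)
      also have "x i * x k * (exp (- (\<eta> i + \<eta> k) * t) * - (\<eta> i + \<eta> k)) / (\<eta> i + \<eta> k)
          = - (x i * exp (- \<eta> i * t)) * (x k * exp (- \<eta> k * t))"
        unfolding e using nz by (simp add: field_simps)
      finally show "((\<lambda>t. x i * x k * exp (- (\<eta> i + \<eta> k) * t) / (\<eta> i + \<eta> k)) has_real_derivative
          - (x i * exp (- \<eta> i * t)) * (x k * exp (- \<eta> k * t))) (at t)" .
    qed
    then show ?thesis by (simp add: power2_eq_square sum_product sum_negf)
  qed
  have "q t \<le> q 0" if "t \<ge> 0" for t
    by (rule DERIV_nonpos_imp_nonincreasing[OF that]) (use d in \<open>auto intro!: exI\<close>)
  moreover have "(q \<longlongrightarrow> (\<Sum>i<n. \<Sum>k<n. x i * x k * 0 / (\<eta> i + \<eta> k))) at_top"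
    unfolding q_def
  proof (intro tendsto_sum tendsto_divide tendsto_mult tendsto_const)
    fix i k assume ik: "i \<in> {..<n}" "k \<in> {..<n}"
    then have neg: "- (\<eta> i + \<eta> k) < 0" using pos[of i k] by (simp only: neg_less_0_iff_less lessThan_iff)
    have "filterlim (\<lambda>t. - (\<eta> i + \<eta> k) * t) at_bot at_top"
      by (rule filterlim_tendsto_neg_mult_at_bot[OF tendsto_const neg filterlim_ident])
    then show "((\<lambda>t. exp (- (\<eta> i + \<eta> k) * t)) \<longlongrightarrow> 0) at_top"
      by (rule filterlim_compose[OF exp_at_bot])
    show "\<eta> i + \<eta> k \<noteq> 0" using pos[of i k] ik by auto
  qed
  then have "(q \<longlongrightarrow> 0) at_top" by simp
  ultimately have "0 \<le> q 0"
    by (intro tendsto_upperbound[of q 0 at_top]) (auto simp: eventually_at_top_linorder)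
  then show ?thesis by (simp add: q_def)
qed

text \<open>The quadratic form of \<open>ymat\<close> is a Cauchy form in the products x i \<delta>
  i plus \<Sum> (x i)^2 / (2 \<eta> i), hence positive definite.\<close>

lemma ymat_trivial_kernel:
  assumes eta: "\<And>i. i < n \<Longrightarrow> \<eta> i > 0" and x: "\<And>i. i < n \<Longrightarrow> app n (ymat \<eta> \<delta>) x i = 0" and i: "i < n"
  shows "x i = 0"
proof (rule ccontr)
  assume "x i \<noteq> 0"
  have "0 = (\<Sum>i<n. x i * app n (ymat \<eta> \<delta>) x i)" using x by simp
  also have "\<dots> = (\<Sum>i<n. \<Sum>k<n. (x i * \<delta> i) * (x k * \<delta> k) / (\<eta> i + \<eta> k) + kron i k * (x i * x k / (\<eta> i + \<eta> k)))"
    unfolding app_def ymat_def sum_distrib_left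
    by (intro sum.cong refl) (simp add: add_divide_distrib ring_distribs)
  also have "\<dots> = (\<Sum>i<n. \<Sum>k<n. (x i * \<delta> i) * (x k * \<delta> k) / (\<eta> i + \<eta> k)) + (\<Sum>i<n. x i * x i / (\<eta> i + \<eta> i))"
    unfolding sum.distrib by (intro arg_cong2[of _ _ _ _ "(+)"] refl sum.cong, rule sum_kron(1), simp)
  finally have "(\<Sum>i<n. x i * x i / (\<eta> i + \<eta> i)) \<le> 0"
    using cauchy_kernel_nonneg[of n \<eta> "\<lambda>i. x i * \<delta> i"] eta by simp
  moreover have "(\<Sum>i<n. x i * x i / (\<eta> i + \<eta> i)) > 0"
  proof (rule sum_pos2[of _ i])
    show "0 < x i * x i / (\<eta> i + \<eta> i)"
      using eta[OF i] \<open>x i \<noteq> 0\<close> by (auto intro!: divide_pos_pos add_pos_pos simp: zero_less_mult_iff linorder_neq_iff)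
    show "0 \<le> x j * x j / (\<eta> j + \<eta> j)" if "j \<in> {..<n}" for j
      using eta[of j] that by (auto intro!: divide_nonneg_nonneg)
  qed (use i in auto)
  ultimately show False by simp
qed

lemma ymat_sym: "ymat \<eta> \<delta> i k = ymat \<eta> \<delta> k i"
  by (simp add: ymat_def add.commute mult.commute)

text \<open>Conjugation in the direction opposite to \<open>lyapunov_inverse\<close>: Y diag(\<eta>)
  + diag(\<eta>) Y = 1 + \<delta> \<delta>^T is multiplied by N on both sides.\<close>

lemma lyapunov_reverse:
  assumes NY: "\<And>i k. i < n \<Longrightarrow> k < n \<Longrightarrow> mm n N (ymat \<eta> \<delta>) i k = kron i k"
    and YN: "\<And>i k. i < n \<Longrightarrow> k < n \<Longrightarrow> mm n (ymat \<eta> \<delta>) N i k = kron i k"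
    and sym: "\<And>i k. i < n \<Longrightarrow> k < n \<Longrightarrow> N i k = N k i"
    and eta: "\<And>i. i < n \<Longrightarrow> \<eta> i > 0" and ik: "i < n" "k < n"
  shows "N i k * (\<eta> i + \<eta> k) - mm n N N i k = app n N \<delta> i * app n N \<delta> k"
proof -
  let ?Y = "ymat \<eta> \<delta>"
  define L where "L = (\<lambda>i k. \<delta> i * \<delta> k + kron i k)"
  have L: "L i k = ?Y i k * (\<eta> i + \<eta> k)" if "i < n" "k < n" for i k
    using eta[OF that(1)] eta[OF that(2)] by (simp add: L_def ymat_def)
  have "mm n N (mm n L N) i k = \<eta> i * N i k + \<eta> k * N i k"
  proof -
    have 1: "mm n L N a k = mm n ?Y (\<lambda>b k. \<eta> b * N b k) a k + \<eta> a * kron a k" if a: "a < n" for a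
    proof -
      have "mm n L N a k = (\<Sum>b<n. ?Y a b * (\<eta> b * N b k)) + \<eta> a * mm n ?Y N a k"
        unfolding mm_def sum_distrib_left sum.distrib[symmetric]
        by (intro sum.cong refl) (use L a in \<open>simp add: algebra_simps\<close>)
      then show ?thesis using YN[OF a ik(2)] by (simp add: mm_def)
    qed
    have "mm n N (mm n L N) i k = mm n N (mm n ?Y (\<lambda>b k. \<eta> b * N b k)) i k + (\<Sum>a<n. N i a * \<eta> a * kron a k)"
      unfolding mm_def[of n N] sum.distrib[symmetric] by (intro sum.cong refl) (simp add: 1 distrib_left mult.assoc)
    also have "(\<Sum>a<n. N i a * \<eta> a * kron a k) = N i k * \<eta> k" using ik by (simp only: sum_kron)
    also have "mm n N (mm n ?Y (\<lambda>b k. \<eta> b * N b k)) i k = mm n (mm n N ?Y) (\<lambda>b k. \<eta> b * N b k) i k"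
      by (rule mm_assoc[symmetric])
    also have "\<dots> = (\<Sum>b<n. kron i b * (\<eta> b * N b k))"
      unfolding mm_def[of n "mm n N ?Y"] by (intro sum.cong refl) (use NY ik in simp)
    also have "\<dots> = \<eta> i * N i k" using ik by (simp only: sum_kron)
    finally show ?thesis by (simp add: mult.commute)
  qed
  moreover have "mm n N (mm n L N) i k = app n N \<delta> i * app n N \<delta> k + mm n N N i k"
  proof -
    have 1: "mm n L N a k = \<delta> a * app n N \<delta> k + N a k" if a: "a < n" for a
    proof -
      have "mm n L N a k = (\<Sum>b<n. \<delta> a * (N k b * \<delta> b)) + (\<Sum>b<n. kron a b * N b k)"
        unfolding mm_def L_def sum.distrib[symmetric]
        by (intro sum.cong refl) (use sym[of _ k] ik in \<open>auto simp: algebra_simps\<close>)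
      then show ?thesis using a by (simp only: sum_kron app_def sum_distrib_left)
    qed
    have "mm n N (mm n L N) i k = (\<Sum>a<n. N i a * \<delta> a * app n N \<delta> k) + mm n N N i k"
      unfolding mm_def[of n N] sum.distrib[symmetric] by (intro sum.cong refl) (simp add: 1 distrib_left mult.assoc)
    then show ?thesis by (simp add: app_def[of n N \<delta> i] sum_distrib_right)
  qed
  ultimately show ?thesis by (simp add: algebra_simps)
qed

lemma ymat_inverse:
  assumes eta: "\<And>i. i < n \<Longrightarrow> \<eta> i > 0"
  shows "\<exists>N. (\<forall>i<n. \<forall>k<n. mm n (ymat \<eta> \<delta>) N i k = kron i k) \<and> (\<forall>i<n. \<forall>k<n. mm n N (ymat \<eta> \<delta>) i k = kron i k)"
proof (rule inverse_of_trivial_kernel[of n "ymat \<eta> \<delta>"])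
  show "x i = 0" if "\<And>i. i < n \<Longrightarrow> app n (ymat \<eta> \<delta>) x i = 0" "i < n" for x i
    by (rule ymat_trivial_kernel[OF eta that])
qed blast

text \<open>Now M is defined as diag(\<eta>) - N with N inverse to Y, and \<gamma> as N \<delta>.
  The atoms \<open>p\<close> are the eigenvalues of M, and \<open>c\<close> holds the components of
  \<gamma> along the eigenvectors, up to sign. The content is that these eigenvalues are distinct
  and these components nonzero.\<close>

theorem soliton_rel_surj:
  assumes eta: "\<And>i. i < n \<Longrightarrow> \<eta> i > 0" and delta: "\<And>i. i < n \<Longrightarrow> \<delta> i > 0"
    and less: "\<And>i j. i < j \<Longrightarrow> j < n \<Longrightarrow> \<eta> i < \<eta> j"
  shows "\<exists>c p v. (\<forall>j<n. c j > 0) \<and> inj_on p {..<n} \<and> soliton_rel n c p \<eta> \<delta> v"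
proof -
  let ?Y = "ymat \<eta> \<delta>"
  obtain N where YN: "\<And>i k. i < n \<Longrightarrow> k < n \<Longrightarrow> mm n ?Y N i k = kron i k"
    and NY: "\<And>i k. i < n \<Longrightarrow> k < n \<Longrightarrow> mm n N ?Y i k = kron i k"
    using ymat_inverse[where n = n and \<eta> = \<eta> and \<delta> = \<delta>, OF eta] by blast
  have Nsym: "N i k = N k i" if "i < n" "k < n" for i k
  proof (rule inverse_unique[where B = N and A = ?Y and C = "\<lambda>i k. N k i"])
    show "mm n ?Y (\<lambda>i k. N k i) i k = kron i k" if "i < n" "k < n" for i k
      using NY[of k i] that unfolding mm_def by (subst ymat_sym) (simp add: mult.commute eq_commute)
  qed (use NY that in auto)
  define M where "M = (\<lambda>i k. \<eta> i * kron i k - N i k)"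
  define \<gamma> where "\<gamma> = app n N \<delta>"
  have Msym: "M i k = M k i" if "i < n" "k < n" for i k using Nsym[OF that] by (auto simp: M_def)
  have appN: "app n N x i = \<eta> i * x i - app n M x i" if "i < n" for x i
    using that by (simp add: app_def M_def left_diff_distrib sum_subtractf mult.assoc sum_distrib_left[symmetric])
  have MM: "(\<eta> i)\<^sup>2 * kron i k - mm n M M i k = \<gamma> i * \<gamma> k" if ik: "i < n" "k < n" for i k
  proof -
    have "mm n M M i k = (\<Sum>j<n. kron i j * (\<eta> i * (\<eta> j * kron j k - N j k))) - ((\<Sum>j<n. (N i j * \<eta> j) * kron j k) - mm n N N i k)"
      unfolding mm_def M_def sum_subtractf[symmetric] by (intro sum.cong refl) (simp add: algebra_simps)
    also have "\<dots> = \<eta> i * (\<eta> i * kron i k - N i k) - (N i k * \<eta> k - mm n N N i k)"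
      using ik by (simp only: sum_kron)
    finally show ?thesis
      using lyapunov_reverse[OF NY YN Nsym eta ik] by (auto simp: \<gamma>_def algebra_simps power2_eq_square)
  qed
  have eigM: "(\<eta> i)\<^sup>2 * x i - r\<^sup>2 * x i = \<gamma> i * ip n \<gamma> x"
    if x: "\<And>i. i < n \<Longrightarrow> app n M x i = r * x i" and i: "i < n" for x r i
  proof -
    have "app n (mm n M M) x i = app n M (\<lambda>i. r * x i) i"
      unfolding app_mm by (rule fun_cong[OF app_cong[OF x]])
    also have "\<dots> = r\<^sup>2 * x i" unfolding app_scale using x i by (simp add: power2_eq_square)
    finally have "r\<^sup>2 * x i = app n (mm n M M) x i" by simp
    also have "\<dots> = (\<Sum>k<n. kron i k * ((\<eta> i)\<^sup>2 * x k) - \<gamma> i * (\<gamma> k * x k))"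
      unfolding app_def by (intro sum.cong refl) (use MM[OF i] in \<open>auto simp: algebra_simps\<close>)
    also have "\<dots> = (\<eta> i)\<^sup>2 * x i - \<gamma> i * ip n \<gamma> x"
      using i by (simp only: sum_subtractf sum_kron ip_def sum_distrib_left)
    finally show ?thesis by simp
  qed
  \<comment> \<open>No eigenvector x is orthogonal to \<gamma>. Otherwise \<eta> = |r| on its
    support, which is then a single index i. The case r = \<eta> i contradicts invertibility of N,
    and r = - \<eta> i makes the entry \<open>?Y i i\<close> equal to 1 / (2 \<eta> i), which forces
    \<delta> i = 0.\<close>
  have no: "x i = 0" if x: "\<And>i. i < n \<Longrightarrow> app n M x i = r * x i" and g: "ip n \<gamma> x = 0" and i: "i < n" for x r i
  proof (rule ccontr)
    assume xi: "x i \<noteq> 0"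
    have er: "\<eta> k = \<bar>r\<bar>" if "k < n" "x k \<noteq> 0" for k
    proof -
      have "(\<eta> k)\<^sup>2 = r\<^sup>2" using eigM[OF x that(1)] g that by simp
      then show ?thesis using eta[OF that(1)] by (metis abs_of_pos power2_eq_iff abs_minus_cancel)
    qed
    have xk: "x k = 0" if "k < n" "k \<noteq> i" for k
      using er[of k] er[of i] xi that i less[of k i] less[of i k] by (metis less_irrefl linorder_neqE_nat)
    have "x i = app n (mm n ?Y N) x i" using YN i by (simp add: app_def)
    also have "\<dots> = app n ?Y (\<lambda>k. (\<eta> k - r) * x k) i"
    proof -
      have "app n N x k = (\<eta> k - r) * x k" if "k < n" for k
        using appN[OF that, of x] x[OF that] by (simp add: left_diff_distrib)
      then show ?thesis unfolding app_mm by (intro fun_cong[OF app_cong])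
    qed
    also have "\<dots> = (\<Sum>k<n. if k = i then ?Y i i * ((\<eta> i - r) * x i) else 0)"
      unfolding app_def by (intro sum.cong refl) (use xk in auto)
    also have "\<dots> = ?Y i i * (\<eta> i - r) * x i" using i by simp
    finally have y: "?Y i i * (\<eta> i - r) = 1" using xi by simp
    then have "\<eta> i \<noteq> r" by auto
    then have "r = - \<eta> i" using er[OF i xi] by (auto simp: abs_if split: if_splits)
    then have "(\<delta> i * \<delta> i + 1) / (\<eta> i + \<eta> i) * (\<eta> i + \<eta> i) = 1" using y by (simp add: ymat_def)
    then have "\<delta> i * \<delta> i + 1 = 1" using eta[OF i] by simp
    then show False using delta[OF i] by simp
  qed
  obtain w p where
    orth: "\<And>l m. l < n \<Longrightarrow> m < n \<Longrightarrow> ip n (w l) (w m) = kron l m" and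
    ev: "\<And>l i. l < n \<Longrightarrow> i < n \<Longrightarrow> app n M (w l) i = p l * w l i"
  proof (rule real_spectral_theorem[of n M])
    show "M i j = M j i" if "i < n" "j < n" for i j by (rule Msym[OF that])
  qed (rule that)
  have g0: "ip n \<gamma> (w j) \<noteq> 0" if j: "j < n" for j
  proof
    assume "ip n \<gamma> (w j) = 0"
    then have "w j i = 0" if "i < n" for i using no[of "w j" "p j" i] ev[OF j] that by blast
    then have "ip n (w j) (w j) = 0" unfolding ip_self_eq_0_iff by blast
    then show False using orth j by simp
  qed
  \<comment> \<open>Two eigenvectors for one eigenvalue would have a nonzero combination orthogonal
    to \<gamma>.\<close>
  have inj: "inj_on p {..<n}"
  proof (rule inj_onI, rule ccontr)
    fix j l assume jl: "j \<in> {..<n}" "l \<in> {..<n}" "p j = p l" "j \<noteq> l"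
    define x where "x = (\<lambda>i. ip n \<gamma> (w l) * w j i + (- ip n \<gamma> (w j)) * w l i)"
    have "x i = 0" if "i < n" for i
    proof (rule no[of x "p j"])
      show "app n M x i = p j * x i" if "i < n" for i
        unfolding x_def app_add app_scale using ev[of j i] ev[of l i] jl that by (simp add: algebra_simps)
      show "ip n \<gamma> x = 0" unfolding x_def ip_add_right ip_scale_right by simp
    qed (use that in auto)
    then have "ip n (w j) x = ip n (w j) (\<lambda>_. 0)" by (intro ip_cong) auto
    then have "ip n \<gamma> (w l) = 0"
      unfolding x_def ip_add_right ip_scale_right using orth jl by (simp add: ip_def)
    then show False using g0 jl by simp
  qed
  define s where "s = (\<lambda>j. sgn (ip n \<gamma> (w j)))"
  define c where "c = (\<lambda>j. s j * ip n \<gamma> (w j))"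
  \<comment> \<open>A transposition: up to sign the eigenvectors of M are the columns of
    \<open>v\<close>, and completeness makes its rows orthonormal.\<close>
  define v where "v = (\<lambda>i j. s j * w j i)"
  have ss: "s j * s j = 1" if "j < n" for j using g0[OF that] by (simp add: s_def sgn_real_def)
  have vv: "(\<Sum>j<n. v i j * v k j) = kron i k" if "i < n" "k < n" for i k
  proof -
    have "(\<Sum>j<n. v i j * v k j) = (\<Sum>j<n. (s j * s j) * (w j i * w j k))"
      by (intro sum.cong refl) (simp add: v_def)
    also have "\<dots> = (\<Sum>j<n. w j i * w j k)" by (intro sum.cong refl) (use ss in simp)
    finally show ?thesis using orthonormal_complete[OF orth that] by simp
  qed
  have cv: "ip n c (v i) = \<gamma> i" if i: "i < n" for i
  proof -
    have "ip n c (v i) = (\<Sum>j<n. \<Sum>k<n. \<gamma> k * (v k j * v i j))"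
      unfolding ip_def c_def by (simp add: v_def sum_distrib_left sum_distrib_right ac_simps)
    also have "\<dots> = (\<Sum>k<n. \<gamma> k * (\<Sum>j<n. v k j * v i j))"
      unfolding sum_distrib_left by (rule sum.swap)
    also have "\<dots> = (\<Sum>k<n. \<gamma> k * kron k i)" by (intro sum.cong refl) (use vv i in auto)
    also have "\<dots> = \<gamma> i" using i by (simp only: sum_kron)
    finally show ?thesis .
  qed
  have "soliton_rel n c p \<eta> \<delta> v"
  proof
    show "\<eta> i > 0" "\<delta> i > 0" if "i < n" for i using eta delta that by auto
    show "\<eta> i < \<eta> j" if "i < j" "j < n" for i j using less that .
    show "ip n (v i) (v k) = kron i k" if "i < n" "k < n" for i k using vv[OF that] by (simp add: ip_def)
    show "v i j * ((\<eta> i)\<^sup>2 - (p j)\<^sup>2) = ip n c (v i) * c j" if "i < n" "j < n" for i j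
      using eigM[of "w j" "p j" i] ev[OF that(2)] that unfolding cv[OF that(1)] by (simp add: v_def c_def algebra_simps)
    show "(\<Sum>k<n. ?Y i k * (v k j * (\<eta> k - p j))) = v i j" if "i < n" "j < n" for i j
    proof -
      have "(\<Sum>k<n. ?Y i k * (v k j * (\<eta> k - p j))) = (\<Sum>k<n. s j * (?Y i k * app n N (w j) k))"
      proof (intro sum.cong refl)
        fix k assume "k \<in> {..<n}"
        then have "app n N (w j) k = (\<eta> k - p j) * w j k"
          using appN[of k "w j"] ev[OF that(2), of k] by (simp add: left_diff_distrib)
        then show "?Y i k * (v k j * (\<eta> k - p j)) = s j * (?Y i k * app n N (w j) k)"
          by (simp add: v_def)
      qed
      also have "\<dots> = s j * app n (mm n ?Y N) (w j) i"
        unfolding app_mm by (simp add: app_def[of n ?Y] sum_distrib_left)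
      also have "\<dots> = v i j" using YN that by (simp add: app_def v_def)
      finally show ?thesis .
    qed
    show "(\<Sum>k<n. ?Y i k * ip n c (v k)) = \<delta> i" if "i < n" for i
    proof -
      have "(\<Sum>k<n. ?Y i k * ip n c (v k)) = app n (mm n ?Y N) \<delta> i"
        unfolding app_mm by (simp add: cv app_def[of n ?Y] \<gamma>_def)
      also have "\<dots> = \<delta> i" using YN that by (simp add: app_def)
      finally show ?thesis .
    qed
  qed
  moreover have "c j > 0" if "j < n" for j
    using g0[OF that] by (simp add: c_def s_def sgn_real_def)
  ultimately show ?thesis using inj by blast
qed

section \<open>Uniqueness of the atoms for given (\<eta>, \<delta>)\<close>

context soliton_rel begin

lemma ymat_nmat:
  assumes "i < n" "m < n"
  shows "mm n (ymat \<eta> \<delta>) (nmat n \<eta> p v) i m = kron i m"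
proof -
  have N: "nmat n \<eta> p v k m = (\<Sum>j<n. (v k j * (\<eta> k - p j)) * v m j)" if "k < n" for k
  proof -
    have "(\<Sum>j<n. (v k j * (\<eta> k - p j)) * v m j) = \<eta> k * ip n (v k) (v m) - mmat n p v k m"
      by (simp add: ip_def mmat_def sum_distrib_left sum_subtractf[symmetric] algebra_simps)
    then show ?thesis using orth[OF that assms(2)] by (simp add: nmat_def)
  qed
  have "mm n (ymat \<eta> \<delta>) (nmat n \<eta> p v) i m = (\<Sum>k<n. \<Sum>j<n. (ymat \<eta> \<delta> i k * (v k j * (\<eta> k - p j))) * v m j)"
    unfolding mm_def by (intro sum.cong refl) (simp add: N sum_distrib_left mult.assoc)
  also have "\<dots> = (\<Sum>j<n. \<Sum>k<n. (ymat \<eta> \<delta> i k * (v k j * (\<eta> k - p j))) * v m j)" by (rule sum.swap)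
  also have "\<dots> = (\<Sum>j<n. v i j * v m j)"
    by (intro sum.cong refl) (use ymat_v assms in \<open>simp add: sum_distrib_right[symmetric]\<close>)
  finally show ?thesis using orth[OF assms] by (simp add: ip_def)
qed

lemma nmat_ymat: "i < n \<Longrightarrow> k < n \<Longrightarrow> mm n (nmat n \<eta> p v) (ymat \<eta> \<delta>) i k = kron i k"
  by (rule left_inverse_imp_right[OF ymat_nmat])

text \<open>Together with \<open>nmat_ymat\<close> this shows that \<eta> and \<delta> determine
  both N and \<gamma> = N \<delta>.\<close>

lemma gamma_eq:
  assumes "i < n"
  shows "ip n c (v i) = app n (nmat n \<eta> p v) \<delta> i"
proof -
  have "app n (nmat n \<eta> p v) \<delta> i = app n (nmat n \<eta> p v) (app n (ymat \<eta> \<delta>) (\<lambda>k. ip n c (v k))) i"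
    by (rule fun_cong[OF app_cong]) (simp add: app_def ymat_gamma)
  also have "\<dots> = ip n c (v i)" unfolding app_mm[symmetric] using nmat_ymat assms by (simp add: app_def)
  finally show ?thesis by simp
qed

end

text \<open>Both systems of atoms diagonalise the same M and represent the same \<gamma>. The change
  of basis W maps \<open>c\<close> to \<open>c'\<close> and has nonzero entries only where p j = p'
  i, so the sums agree for every f; indicators then give equality of the measures.\<close>

theorem soliton_rel_unique:
  fixes f :: "real \<Rightarrow> real"
  assumes 1: "soliton_rel n c p \<eta> \<delta> v" and 2: "soliton_rel n c' p' \<eta> \<delta> v'"
  shows "(\<Sum>j<n. (c j)\<^sup>2 * f (p j)) = (\<Sum>j<n. (c' j)\<^sup>2 * f (p' j))"
proof -
  interpret A: soliton_rel n c p \<eta> \<delta> v by fact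
  interpret B: soliton_rel n c' p' \<eta> \<delta> v' by fact
  have N: "nmat n \<eta> p v i k = nmat n \<eta> p' v' i k" if "i < n" "k < n" for i k
    by (rule inverse_unique[OF A.nmat_ymat B.ymat_nmat that])
  have M: "mmat n p v i k = mmat n p' v' i k" if "i < n" "k < n" for i k
    using N[OF that] by (simp add: nmat_def)
  have g: "ip n c (v i) = ip n c' (v' i)" if "i < n" for i
    unfolding A.gamma_eq[OF that] B.gamma_eq[OF that] app_def by (intro sum.cong refl) (use N that in simp)
  define W where "W = (\<lambda>i j. \<Sum>k<n. v' k i * v k j)"
  have Wp: "W i j * p j = W i j * p' i" if ij: "i < n" "j < n" for i j
  proof -
    have "W i j * p j = (\<Sum>k<n. v' k i * (\<Sum>m<n. mmat n p v k m * v m j))"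
      unfolding W_def sum_distrib_right by (intro sum.cong refl) (simp add: mmat_v[OF A.orth ij(2)])
    also have "\<dots> = (\<Sum>k<n. \<Sum>m<n. v' k i * mmat n p' v' k m * v m j)"
      unfolding sum_distrib_left by (intro sum.cong refl) (simp add: M)
    also have "\<dots> = (\<Sum>m<n. \<Sum>k<n. v' k i * mmat n p' v' k m * v m j)" by (rule sum.swap)
    also have "\<dots> = (\<Sum>m<n. (\<Sum>k<n. mmat n p' v' m k * v' k i) * v m j)"
      unfolding sum_distrib_right by (intro sum.cong refl) (simp add: mmat_sym[of n p' v'] mult.commute)
    also have "\<dots> = (\<Sum>m<n. (v' m i * p' i) * v m j)"
      by (intro sum.cong refl) (simp add: mmat_v[OF B.orth ij(1)])
    also have "\<dots> = W i j * p' i"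
      by (simp add: W_def sum_distrib_left sum_distrib_right ac_simps)
    finally show ?thesis .
  qed
  have Wf: "W i j * f (p j) = W i j * f (p' i)" if "i < n" "j < n" for i j
    using Wp[OF that] by (cases "W i j = 0") auto
  have c': "c' i = (\<Sum>j<n. W i j * c j)" if i: "i < n" for i
  proof -
    have "(\<Sum>j<n. W i j * c j) = (\<Sum>j<n. \<Sum>k<n. v' k i * (c j * v k j))"
      unfolding W_def sum_distrib_right by (simp add: ac_simps)
    also have "\<dots> = (\<Sum>k<n. v' k i * ip n c (v k))" unfolding ip_def sum_distrib_left by (rule sum.swap)
    also have "\<dots> = (\<Sum>k<n. v' k i * ip n c' (v' k))" by (intro sum.cong refl) (simp add: g)
    also have "\<dots> = (\<Sum>k<n. \<Sum>j<n. c' j * (v' k i * v' k j))"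
      unfolding ip_def sum_distrib_left by (intro sum.cong refl) (simp only: ac_simps)
    also have "\<dots> = (\<Sum>j<n. c' j * (\<Sum>k<n. v' k i * v' k j))" unfolding sum_distrib_left by (rule sum.swap)
    also have "\<dots> = (\<Sum>j<n. c' j * kron i j)" by (intro sum.cong refl) (use orth2[OF B.orth i] in auto)
    also have "\<dots> = c' i" using i by (simp only: sum_kron)
    finally show ?thesis by simp
  qed
  have c: "c j = (\<Sum>i<n. W i j * c' i)" if j: "j < n" for j
  proof -
    have "(\<Sum>i<n. W i j * c' i) = (\<Sum>i<n. \<Sum>k<n. v k j * (c' i * v' k i))"
      unfolding W_def sum_distrib_right by (simp add: ac_simps)
    also have "\<dots> = (\<Sum>k<n. v k j * ip n c' (v' k))" unfolding ip_def sum_distrib_left by (rule sum.swap)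
    also have "\<dots> = (\<Sum>k<n. v k j * ip n c (v k))" by (intro sum.cong refl) (simp add: g)
    also have "\<dots> = (\<Sum>k<n. \<Sum>i<n. c i * (v k j * v k i))"
      unfolding ip_def sum_distrib_left by (intro sum.cong refl) (simp only: ac_simps)
    also have "\<dots> = (\<Sum>i<n. c i * (\<Sum>k<n. v k j * v k i))" unfolding sum_distrib_left by (rule sum.swap)
    also have "\<dots> = (\<Sum>i<n. c i * kron j i)" by (intro sum.cong refl) (use orth2[OF A.orth j] in auto)
    also have "\<dots> = c j" using j by (simp only: sum_kron)
    finally show ?thesis by simp
  qed
  have "(\<Sum>i<n. (c' i)\<^sup>2 * f (p' i)) = (\<Sum>i<n. \<Sum>j<n. c' i * (W i j * f (p' i)) * c j)"
    by (intro sum.cong refl) (use c' in \<open>simp add: power2_eq_square sum_distrib_left sum_distrib_right ac_simps\<close>)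
  also have "\<dots> = (\<Sum>i<n. \<Sum>j<n. c' i * (W i j * f (p j)) * c j)"
    by (intro sum.cong refl) (simp only: Wf lessThan_iff)
  also have "\<dots> = (\<Sum>j<n. \<Sum>i<n. c' i * (W i j * f (p j)) * c j)" by (rule sum.swap)
  also have "\<dots> = (\<Sum>j<n. (\<Sum>i<n. W i j * c' i) * (f (p j) * c j))"
    by (simp add: sum_distrib_left sum_distrib_right ac_simps)
  also have "\<dots> = (\<Sum>j<n. (c j)\<^sup>2 * f (p j))"
    by (intro sum.cong refl) (use c in \<open>simp add: power2_eq_square\<close>)
  finally show ?thesis by simp
qed

section \<open>Tau functions and reflectionless potentials\<close>

definition sdata :: "nat \<Rightarrow> (nat \<Rightarrow> real) \<Rightarrow> (nat \<Rightarrow> real) \<Rightarrow> (real \<times> real) list" where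
  "sdata n \<eta> \<delta> = map (\<lambda>i. (\<eta> i, 2 * \<eta> i * (\<delta> i)\<^sup>2)) [0..<n]"

definition tau :: "(real \<times> real) list \<Rightarrow> real \<Rightarrow> real" where
  "tau s x = Determinant.det (1\<^sub>m (length s) + G_mat s x)"

lemma length_sdata[simp]: "length (sdata n \<eta> \<delta>) = n"
  by (simp add: sdata_def)

lemma sdata_nth: "i < n \<Longrightarrow> sdata n \<eta> \<delta> ! i = (\<eta> i, 2 * \<eta> i * (\<delta> i)\<^sup>2)"
  by (simp add: sdata_def)

lemma sdata_in_scattering_data:
  assumes "n \<ge> 1" "\<And>i. i < n \<Longrightarrow> \<eta> i > 0" "\<And>i. i < n \<Longrightarrow> \<delta> i > 0" "\<And>i j. i < j \<Longrightarrow> j < n \<Longrightarrow> \<eta> i < \<eta> j"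
  shows "sdata n \<eta> \<delta> \<in> scattering_data"
proof -
  have "sdata n \<eta> \<delta> \<noteq> []" using assms(1) by (simp add: sdata_def)
  moreover have "\<forall>(\<eta>', m)\<in>set (sdata n \<eta> \<delta>). \<eta>' > 0 \<and> m > 0"
  proof -
    have "0 < \<eta> i \<and> 0 < 2 * \<eta> i * (\<delta> i)\<^sup>2" if "i < n" for i
      using assms(2)[OF that] zero_less_power[OF assms(3)[OF that], of 2] by simp
    then show ?thesis by (auto simp: sdata_def)
  qed
  moreover have "sorted_wrt (<) (map fst (sdata n \<eta> \<delta>))"
    using assms(4) by (simp add: sdata_def sorted_wrt_iff_nth_less comp_def)
  ultimately show ?thesis by (simp add: scattering_data_def)
qed

lemma scattering_data_sdata:
  assumes "s \<in> scattering_data"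
  obtains n \<eta> \<delta> where "n \<ge> 1" "s = sdata n \<eta> \<delta>" "\<And>i. i < n \<Longrightarrow> \<eta> i > 0" "\<And>i. i < n \<Longrightarrow> \<delta> i > 0"
    "\<And>i j. i < j \<Longrightarrow> j < n \<Longrightarrow> \<eta> i < \<eta> j"
proof -
  define \<eta> where "\<eta> = (\<lambda>i. fst (s ! i))"
  define \<delta> where "\<delta> = (\<lambda>i. sqrt (snd (s ! i) / (2 * fst (s ! i))))"
  have pos: "fst (s ! i) > 0 \<and> snd (s ! i) > 0" if "i < length s" for i
  proof -
    have "s ! i \<in> set s" using that by simp
    then show ?thesis using assms unfolding scattering_data_def by (auto simp: split_beta')
  qed
  have "s = sdata (length s) \<eta> \<delta>"
  proof (rule nth_equalityI)
    fix i assume i: "i < length s"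
    then show "s ! i = sdata (length s) \<eta> \<delta> ! i"
      using pos[OF i] by (simp add: sdata_nth \<eta>_def \<delta>_def prod_eq_iff)
  qed simp
  moreover have "length s \<ge> 1" using assms by (cases s) (auto simp: scattering_data_def)
  moreover have "\<eta> i < \<eta> j" if "i < j" "j < length s" for i j
    using assms that by (simp add: scattering_data_def sorted_wrt_iff_nth_less \<eta>_def)
  ultimately show ?thesis using that[of "length s" \<eta> \<delta>] pos by (simp add: \<eta>_def \<delta>_def)
qed

lemma det_mat_diag: "Determinant.det (mat_diag n f) = (\<Prod>i<n. f i :: real)"
proof -
  have "Determinant.det (mat_diag n f) = prod_list (diag_mat (mat_diag n f))"
    by (rule det_upper_triangular[where n = n]) (auto simp: mat_diag_def)
  also have "\<dots> = (\<Prod>i<n. f i)"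
    by (simp add: prod_list_diag_prod mat_diag_def atLeast0LessThan)
  finally show ?thesis .
qed

context soliton_rel begin

text \<open>Mode i with initial slope 1 is sinh(\<eta> i x) / \<eta> i; the entry is the
  contribution of its derivative minus p j times itself to component j. The end condition in
  \<open>fredholm_solution\<close> is linear in these quantities.\<close>

definition wmat :: "real \<Rightarrow> nat \<Rightarrow> nat \<Rightarrow> real" where
  "wmat x i j = v i j * (cosh (\<eta> i * x) - p j * (sinh (\<eta> i * x) / \<eta> i))"

text \<open>Write cosh(\<eta> x) - p sinh(\<eta> x) / \<eta> as exp(- \<eta> x) + (\<eta> - p)
  sinh(\<eta> x) / \<eta>, and put P k j = v k j (\<eta> k - p j). By \<open>ymat_v\<close>, v = Y
  P, so W(x) is a matrix times P. That matrix is I + G between two diagonal factors, whose roots of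
  \<eta> absorb those in sqrt(m_i m_k).\<close>

lemma wmat_factor:
  assumes ij: "i < n" "j < n"
  shows "wmat x i j = (\<Sum>k<n. (1 / (2 * sqrt (\<eta> i)) * (kron i k + G_mat (sdata n \<eta> \<delta>) x $$ (i, k)) * (exp (\<eta> k * x) / sqrt (\<eta> k)))
    * (v k j * (\<eta> k - p j)))"
proof -
  define P where "P = (\<lambda>k. v k j * (\<eta> k - p j))"
  have summand: "(1 / (2 * sqrt (\<eta> i)) * (kron i k + G_mat (sdata n \<eta> \<delta>) x $$ (i, k)) * (exp (\<eta> k * x) / sqrt (\<eta> k))) * P k
    = kron i k * ((exp (\<eta> i * x) - exp (- \<eta> i * x)) / (2 * \<eta> i) * P k) + exp (- \<eta> i * x) * (ymat \<eta> \<delta> i k * P k)"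
    if k: "k < n" for k
  proof -
    have e: "\<eta> i > 0" "\<eta> k > 0" using eta_pos ij k by auto
    define a b where "a = sqrt (\<eta> i)" and "b = sqrt (\<eta> k)"
    have ab: "a > 0" "b > 0" "\<eta> i = a * a" "\<eta> k = b * b" using e by (auto simp: a_def b_def)
    have sq: "sqrt (2 * \<eta> i * (\<delta> i)\<^sup>2 * (2 * \<eta> k * (\<delta> k)\<^sup>2)) = 2 * \<delta> i * \<delta> k * (a * b)"
    proof -
      have "2 * \<eta> i * (\<delta> i)\<^sup>2 * (2 * \<eta> k * (\<delta> k)\<^sup>2) = (2 * \<delta> i * \<delta> k * (a * b))\<^sup>2"
        unfolding ab(3,4) by (simp add: power2_eq_square)
      moreover have "2 * \<delta> i * \<delta> k * (a * b) \<ge> 0" using ab delta_pos[OF ij(1)] delta_pos[OF k] by simp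
      ultimately show ?thesis by simp
    qed
    have G: "G_mat (sdata n \<eta> \<delta>) x $$ (i, k) = 2 * \<delta> i * \<delta> k * (a * b) * (exp (- \<eta> i * x) * exp (- \<eta> k * x)) / (\<eta> i + \<eta> k)"
      using ij k sq by (simp add: G_mat_def sdata_nth exp_add[symmetric] algebra_simps)
    have ex: "exp (- \<eta> k * x) * exp (\<eta> k * x) = 1" by (simp add: exp_add[symmetric])
    have nz: "\<eta> i + \<eta> k \<noteq> 0" using e by simp
    have "1 / (2 * sqrt (\<eta> i)) * (G_mat (sdata n \<eta> \<delta>) x $$ (i, k)) * (exp (\<eta> k * x) / sqrt (\<eta> k))
      = (1 / (2 * a)) * (2 * \<delta> i * \<delta> k * (a * b) * exp (- \<eta> i * x) / (\<eta> i + \<eta> k)) * (1 / b) * (exp (- \<eta> k * x) * exp (\<eta> k * x))"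
      unfolding G a_def[symmetric] b_def[symmetric] by simp
    also have "\<dots> = exp (- \<eta> i * x) * (\<delta> i * \<delta> k / (\<eta> i + \<eta> k))"
      unfolding ex using ab by (simp add: field_simps)
    finally have 1: "1 / (2 * sqrt (\<eta> i)) * (G_mat (sdata n \<eta> \<delta>) x $$ (i, k)) * (exp (\<eta> k * x) / sqrt (\<eta> k))
      = exp (- \<eta> i * x) * (\<delta> i * \<delta> k / (\<eta> i + \<eta> k))" .
    have 2: "1 / (2 * sqrt (\<eta> i)) * kron i k * (exp (\<eta> k * x) / sqrt (\<eta> k)) = kron i k * (exp (\<eta> i * x) / (2 * \<eta> i))"
      using e by auto
    have 3: "ymat \<eta> \<delta> i k = \<delta> i * \<delta> k / (\<eta> i + \<eta> k) + kron i k * (1 / (2 * \<eta> i))"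
      by (auto simp: ymat_def add_divide_distrib)
    have "(1 / (2 * sqrt (\<eta> i)) * (kron i k + G_mat (sdata n \<eta> \<delta>) x $$ (i, k)) * (exp (\<eta> k * x) / sqrt (\<eta> k)))
      = 1 / (2 * sqrt (\<eta> i)) * kron i k * (exp (\<eta> k * x) / sqrt (\<eta> k))
        + 1 / (2 * sqrt (\<eta> i)) * (G_mat (sdata n \<eta> \<delta>) x $$ (i, k)) * (exp (\<eta> k * x) / sqrt (\<eta> k))"
      by (simp only: distrib_left distrib_right)
    also have "\<dots> = kron i k * (exp (\<eta> i * x) / (2 * \<eta> i)) + exp (- \<eta> i * x) * (\<delta> i * \<delta> k / (\<eta> i + \<eta> k))"
      unfolding 1 2 ..
    also have "\<dots> = kron i k * ((exp (\<eta> i * x) - exp (- \<eta> i * x)) / (2 * \<eta> i)) + exp (- \<eta> i * x) * ymat \<eta> \<delta> i k"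
      unfolding 3 by (simp add: algebra_simps diff_divide_distrib)
    finally show ?thesis by (simp only: distrib_right mult.assoc)
  qed
  have "(\<Sum>k<n. (1 / (2 * sqrt (\<eta> i)) * (kron i k + G_mat (sdata n \<eta> \<delta>) x $$ (i, k)) * (exp (\<eta> k * x) / sqrt (\<eta> k))) * P k)
     = (\<Sum>k<n. kron i k * ((exp (\<eta> i * x) - exp (- \<eta> i * x)) / (2 * \<eta> i) * P k) + exp (- \<eta> i * x) * (ymat \<eta> \<delta> i k * P k))"
    by (intro sum.cong refl summand) simp
  also have "\<dots> = (exp (\<eta> i * x) - exp (- \<eta> i * x)) / (2 * \<eta> i) * P i + exp (- \<eta> i * x) * v i j"
    unfolding sum.distrib sum_distrib_left[symmetric]
    using ymat_v[OF ij] ij(1) by (simp only: sum_kron P_def)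
  also have "\<dots> = wmat x i j"
    unfolding wmat_def P_def cosh_field_def sinh_field_def using eta_pos[OF ij(1)]
    by (simp add: field_simps)
  finally show ?thesis by (simp add: P_def)
qed

definition Wm :: "real \<Rightarrow> real mat" where "Wm x = Matrix.mat n n (\<lambda>(i, j). wmat x i j)"

text \<open>The constant collects the diagonal factors and det P, which is nonzero because Y P is
  the orthogonal matrix v. The exponential stems from the right diagonal factor.\<close>

theorem det_wmat:
  obtains \<kappa> where "\<kappa> \<noteq> 0"
    "\<And>x. Determinant.det (Wm x) = \<kappa> * exp ((\<Sum>i<n. \<eta> i) * x) * tau (sdata n \<eta> \<delta>) x"
proof -
  define Pm where "Pm = Matrix.mat n n (\<lambda>(k, j). v k j * (\<eta> k - p j))"
  define V where "V = Matrix.mat n n (\<lambda>(i, j). v i j)"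
  define Y where "Y = Matrix.mat n n (\<lambda>(i, k). ymat \<eta> \<delta> i k)"
  have c: "Pm \<in> carrier_mat n n" "V \<in> carrier_mat n n" "Y \<in> carrier_mat n n" by (simp_all add: Pm_def V_def Y_def)
  have "V * transpose_mat V = 1\<^sub>m n"
    by (rule eq_matI) (use orth in \<open>auto simp: V_def scalar_prod_def ip_def atLeast0LessThan\<close>)
  then have "Determinant.det V * Determinant.det (transpose_mat V) = 1"
    using det_mult[of V n "transpose_mat V"] c by simp
  then have V0: "Determinant.det V \<noteq> 0" by auto
  have "Y * Pm = V"
    by (rule eq_matI) (use ymat_v in \<open>auto simp: Y_def Pm_def V_def scalar_prod_def atLeast0LessThan\<close>)
  then have "Determinant.det Y * Determinant.det Pm = Determinant.det V" using det_mult[of Y n Pm] c by simp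
  then have P0: "Determinant.det Pm \<noteq> 0" using V0 by auto
  define \<kappa> where "\<kappa> = (\<Prod>i<n. 1 / (2 * sqrt (\<eta> i))) * (\<Prod>i<n. 1 / sqrt (\<eta> i)) * Determinant.det Pm"
  have e0: "sqrt (\<eta> i) \<noteq> 0" if "i < n" for i using eta_pos[OF that] by simp
  have "\<kappa> \<noteq> 0" using P0 e0 by (auto simp: \<kappa>_def prod_zero_iff)
  moreover have "Determinant.det (Wm x) = \<kappa> * exp ((\<Sum>i<n. \<eta> i) * x) * tau (sdata n \<eta> \<delta>) x" for x
  proof -
    define A where "A = 1\<^sub>m n + G_mat (sdata n \<eta> \<delta>) x"
    have A: "A \<in> carrier_mat n n" by (simp add: A_def G_mat_def)
    define D1 where "D1 = mat_diag n (\<lambda>i. 1 / (2 * sqrt (\<eta> i)))"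
    define D2 where "D2 = mat_diag n (\<lambda>i. exp (\<eta> i * x) / sqrt (\<eta> i))"
    have D: "D1 \<in> carrier_mat n n" "D2 \<in> carrier_mat n n" by (simp_all add: D1_def D2_def)
    have DAD: "D1 * A * D2 = Matrix.mat n n (\<lambda>(i, k). 1 / (2 * sqrt (\<eta> i)) * A $$ (i, k) * (exp (\<eta> k * x) / sqrt (\<eta> k)))"
      unfolding D1_def D2_def mat_diag_mult_left[OF A]
      by (subst mat_diag_mult_right[where nr = n]) auto
    have Aik: "A $$ (i, k) = kron i k + G_mat (sdata n \<eta> \<delta>) x $$ (i, k)" if "i < n" "k < n" for i k
      using that by (simp add: A_def G_mat_def)
    have "Wm x = D1 * A * D2 * Pm"
      unfolding DAD
      by (rule eq_matI) (auto simp: Wm_def Pm_def wmat_factor Aik scalar_prod_def atLeast0LessThan intro!: sum.cong)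
    then have "Determinant.det (Wm x) = Determinant.det D1 * Determinant.det A * Determinant.det D2 * Determinant.det Pm"
      using det_mult[of "D1 * A * D2" n Pm] det_mult[of "D1 * A" n D2] det_mult[of D1 n A] A D c by simp
    moreover have "Determinant.det D2 = (\<Prod>i<n. 1 / sqrt (\<eta> i)) * exp ((\<Sum>i<n. \<eta> i) * x)"
    proof -
      have "Determinant.det D2 = (\<Prod>i<n. (1 / sqrt (\<eta> i)) * exp (\<eta> i * x))"
        unfolding D2_def det_mat_diag by simp
      then show ?thesis by (simp only: prod.distrib exp_sum[OF finite_lessThan, symmetric] sum_distrib_right)
    qed
    moreover have "tau (sdata n \<eta> \<delta>) x = Determinant.det A" by (simp add: tau_def A_def)
    ultimately show ?thesis by (simp add: \<kappa>_def D1_def det_mat_diag)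
  qed
  ultimately show ?thesis using that by blast
qed

end

text \<open>An algebra of functions that is closed under differentiation and contains
  \<open>tau\<close>: smoothness of \<open>tau\<close> follows without differentiating a
  determinant.\<close>

inductive expoly :: "(real \<Rightarrow> real) \<Rightarrow> bool" where
  const: "expoly (\<lambda>x. c)"
| exp: "expoly (\<lambda>x. exp (b * x))"
| add: "expoly f \<Longrightarrow> expoly g \<Longrightarrow> expoly (\<lambda>x. f x + g x)"
| mult: "expoly f \<Longrightarrow> expoly g \<Longrightarrow> expoly (\<lambda>x. f x * g x)"

lemma expoly_has_derivative:
  "expoly f \<Longrightarrow> \<exists>f'. expoly f' \<and> (\<forall>x. (f has_real_derivative f' x) (at x))"
proof (induction rule: expoly.induct)
  case (const c)
  show ?case by (intro exI[of _ "\<lambda>_. 0"]) (auto intro: expoly.const)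
next
  case (exp b)
  show ?case
    by (intro exI[of _ "\<lambda>x. b * exp (b * x)"])
       (auto intro!: expoly.intros derivative_eq_intros)
next
  case (add f g)
  then obtain f' g' where "expoly f'" "expoly g'" "\<And>x. (f has_real_derivative f' x) (at x)" "\<And>x. (g has_real_derivative g' x) (at x)"
    by blast
  then show ?case
    by (intro exI[of _ "\<lambda>x. f' x + g' x"]) (auto intro!: expoly.add DERIV_add)
next
  case (mult f g)
  then obtain f' g' where *: "expoly f'" "expoly g'" "\<And>x. (f has_real_derivative f' x) (at x)" "\<And>x. (g has_real_derivative g' x) (at x)"
    by blast
  show ?case
  proof (intro exI[of _ "\<lambda>x. f' x * g x + g' x * f x"] conjI allI)
    show "expoly (\<lambda>x. f' x * g x + g' x * f x)" using * mult by (intro expoly.add expoly.mult)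
    show "((\<lambda>x. f x * g x) has_real_derivative f' x * g x + g' x * f x) (at x)" for x
      using DERIV_mult[OF *(3,4)] .
  qed
qed

lemma expoly_sum: "(\<And>i. i \<in> I \<Longrightarrow> expoly (f i)) \<Longrightarrow> expoly (\<lambda>x. \<Sum>i\<in>I. f i x)"
  by (induction I rule: infinite_finite_induct) (auto intro: expoly.intros)

lemma expoly_prod: "(\<And>i. i \<in> I \<Longrightarrow> expoly (f i)) \<Longrightarrow> expoly (\<lambda>x. \<Prod>i\<in>I. f i x)"
  by (induction I rule: infinite_finite_induct) (auto intro: expoly.intros)

section \<open>Positivity and asymptotics of tau\<close>

lemma det_mat_sum:
  fixes A :: "nat \<Rightarrow> nat \<Rightarrow> real"
  shows "Determinant.det (Matrix.mat n n (\<lambda>(i, j). A i j)) = (\<Sum>\<pi>\<in>{\<pi>. \<pi> permutes {0..<n}}. signof \<pi> * (\<Prod>i<n. A i (\<pi> i)))"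
  by (subst det_def'[where n = n]) (auto simp: atLeast0LessThan intro!: sum.cong prod.cong dest: permutes_in_image)

lemma tendsto_det:
  assumes "\<And>i j. i < n \<Longrightarrow> j < n \<Longrightarrow> ((\<lambda>x. A x i j) \<longlongrightarrow> (L i j :: real)) F"
  shows "((\<lambda>x. Determinant.det (Matrix.mat n n (\<lambda>(i, j). A x i j))) \<longlongrightarrow> Determinant.det (Matrix.mat n n (\<lambda>(i, j). L i j))) F"
  unfolding det_mat_sum
proof (intro tendsto_sum tendsto_mult tendsto_const tendsto_prod assms)
  fix \<pi> i assume "\<pi> \<in> {\<pi>. \<pi> permutes {0..<n}}" "i \<in> {..<n}"
  then show "\<pi> i < n" using permutes_in_image[of \<pi> "{0..<n}" i] by auto
qed auto

definition amat :: "(real \<times> real) list \<Rightarrow> real \<Rightarrow> nat \<Rightarrow> nat \<Rightarrow> real" where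
  "amat s x i j = kron i j + sqrt (snd (s ! i) * snd (s ! j)) * exp (- (fst (s ! i) + fst (s ! j)) * x)
       / (fst (s ! i) + fst (s ! j))"

lemma tau_amat: "tau s x = Determinant.det (Matrix.mat (length s) (length s) (\<lambda>(i, j). amat s x i j))"
proof -
  have "1\<^sub>m (length s) + G_mat s x = Matrix.mat (length s) (length s) (\<lambda>(i, j). amat s x i j)"
    by (rule eq_matI) (auto simp: G_mat_def amat_def)
  then show ?thesis by (simp add: tau_def)
qed

lemma expoly_tau: "expoly (tau s)"
proof -
  have a: "expoly (\<lambda>x. amat s x i j)" for i j
  proof -
    have "expoly (\<lambda>x. kron i j + (sqrt (snd (s ! i) * snd (s ! j)) / (fst (s ! i) + fst (s ! j))) * exp (- (fst (s ! i) + fst (s ! j)) * x))"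
      by (intro expoly.intros)
    then show ?thesis unfolding amat_def by simp
  qed
  show ?thesis
    unfolding tau_amat[abs_def] det_mat_sum
    by (intro expoly_sum expoly.mult expoly.const expoly_prod a)
qed

text \<open>Weaker than \<open>scattering_data\<close>: with ordering and nonemptiness dropped, all
  prefixes of a list qualify, the empty one included.\<close>

definition pos_data :: "(real \<times> real) list \<Rightarrow> bool" where
  "pos_data s \<longleftrightarrow> (\<forall>i<length s. fst (s ! i) > 0 \<and> snd (s ! i) > 0)"

lemma scattering_data_pos: "s \<in> scattering_data \<Longrightarrow> pos_data s"
  by (auto simp: scattering_data_def pos_data_def split_beta' dest: nth_mem)

text \<open>I + G is positive definite: its quadratic form is |y|^2 plus a Cauchy form.\<close>

lemma tau_nonzero:
  assumes s: "pos_data s"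
  shows "tau s x \<noteq> 0"
proof
  let ?n = "length s"
  let ?A = "Matrix.mat ?n ?n (\<lambda>(i, j). amat s x i j)"
  assume "tau s x = 0"
  then have "Determinant.det ?A = 0" by (simp add: tau_amat)
  then obtain u where u: "u \<in> carrier_vec ?n" "u \<noteq> 0\<^sub>v ?n" "?A *\<^sub>v u = 0\<^sub>v ?n"
    using det_0_iff_vec_prod_zero_field[of ?A ?n] by auto
  define y where "y = (\<lambda>i. vec_index u i)"
  have z: "(\<Sum>j<?n. amat s x i j * y j) = 0" if "i < ?n" for i
    using arg_cong[OF u(3), of "\<lambda>w. vec_index w i"] that u(1)
    by (simp add: scalar_prod_def atLeast0LessThan y_def)
  define b where "b = (\<lambda>i. y i * (sqrt (snd (s ! i)) * exp (- fst (s ! i) * x)))"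
  have "0 = (\<Sum>i<?n. y i * (\<Sum>j<?n. amat s x i j * y j))" using z by simp
  also have "\<dots> = (\<Sum>i<?n. \<Sum>j<?n. kron i j * (y i * y j) + b i * b j / (fst (s ! i) + fst (s ! j)))"
    unfolding sum_distrib_left
  proof (intro sum.cong refl)
    fix i j
    have e: "exp (- (fst (s ! i) + fst (s ! j)) * x) = exp (- fst (s ! i) * x) * exp (- fst (s ! j) * x)"
      by (simp add: exp_add[symmetric] algebra_simps)
    show "y i * (amat s x i j * y j) = kron i j * (y i * y j) + b i * b j / (fst (s ! i) + fst (s ! j))"
      unfolding amat_def b_def e real_sqrt_mult by (simp add: algebra_simps)
  qed
  also have "\<dots> = (\<Sum>i<?n. y i * y i) + (\<Sum>i<?n. \<Sum>j<?n. b i * b j / (fst (s ! i) + fst (s ! j)))"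
    unfolding sum.distrib by (intro arg_cong2[of _ _ _ _ "(+)"] refl sum.cong, rule sum_kron(1), simp)
  finally have "(\<Sum>i<?n. y i * y i) \<le> 0"
    using cauchy_kernel_nonneg[of ?n "\<lambda>i. fst (s ! i)" b] s by (simp add: pos_data_def)
  then have "ip ?n y y = 0" using ip_self_nonneg[of ?n y] by (simp add: ip_def)
  then have "y i = 0" if "i < ?n" for i using that by (simp add: ip_self_eq_0_iff)
  then have "u = 0\<^sub>v ?n" using u(1) by (intro eq_vecI) (auto simp: y_def)
  then show False using u by simp
qed

lemma exp_neg_tendsto_0:
  assumes "a > (0 :: real)"
  shows "((\<lambda>x. exp (- a * x)) \<longlongrightarrow> 0) at_top"
proof (rule filterlim_compose[OF exp_at_bot])
  show "filterlim (\<lambda>x. - a * x) at_bot at_top"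
    by (rule filterlim_tendsto_neg_mult_at_bot[OF tendsto_const _ filterlim_ident]) (use assms in simp)
qed

lemma tau_tendsto_1:
  assumes s: "pos_data s"
  shows "(tau s \<longlongrightarrow> 1) at_top"
proof -
  let ?n = "length s"
  have "((\<lambda>x. Determinant.det (Matrix.mat ?n ?n (\<lambda>(i, j). amat s x i j))) \<longlongrightarrow> Determinant.det (Matrix.mat ?n ?n (\<lambda>(i, j). kron i j))) at_top"
  proof (rule tendsto_det)
    fix i j assume "i < ?n" "j < ?n"
    then have p: "fst (s ! i) + fst (s ! j) > 0" using s by (simp add: pos_data_def add_pos_pos)
    have "((\<lambda>x. amat s x i j) \<longlongrightarrow> kron i j + sqrt (snd (s ! i) * snd (s ! j)) * 0 / (fst (s ! i) + fst (s ! j))) at_top"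
      unfolding amat_def using p by (intro tendsto_intros exp_neg_tendsto_0) auto
    then show "((\<lambda>x. amat s x i j) \<longlongrightarrow> kron i j) at_top" by simp
  qed
  moreover have "Matrix.mat ?n ?n (\<lambda>(i, j). kron i j) = 1\<^sub>m ?n" by (rule eq_matI) auto
  ultimately show ?thesis by (simp add: tau_amat[abs_def])
qed

lemma continuous_on_tau: "continuous_on A (tau s)"
  using expoly_has_derivative[OF expoly_tau[of s]] by (meson DERIV_continuous_on has_field_derivative_at_within)

text \<open>Being continuous, never zero and with limit 1 at plus infinity, \<open>tau\<close> keeps
  one sign.\<close>

lemma tau_pos:
  assumes s: "pos_data s"
  shows "tau s x > 0"
proof (rule ccontr)
  assume "\<not> tau s x > 0"
  then have x: "tau s x \<le> 0" by simp
  have "\<forall>\<^sub>F y in at_top. tau s y > 0"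
    using order_tendstoD(1)[OF tau_tendsto_1[OF s], of 0] by simp
  then obtain y where y: "y \<ge> x" "tau s y > 0"
    by (metis eventually_at_top_linorder linorder_le_cases order_refl)
  obtain z where "tau s z = 0"
    using IVT'[of "tau s" x 0 y] x y continuous_on_tau by force
  then show False using tau_nonzero[OF s] by simp
qed

text \<open>Subtracting the last unit vector from the last column lowers the determinant by the
  complementary minor, which is \<open>tau s\<close>. Multiplying the last row and the last column
  by exp(\<eta> x) distributes the factor exp(2 \<eta> x), and the scaled matrix tends to a diagonal
  one with last entry m / (2 \<eta>).\<close>

lemma tau_append_asymptotics:
  assumes s: "pos_data s" and m: "\<eta> > 0" "m > 0"
  shows "((\<lambda>x. (tau (s @ [(\<eta>, m)]) x - tau s x) * exp (2 * \<eta> * x)) \<longlongrightarrow> m / (2 * \<eta>)) at_top"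
proof -
  let ?n = "length s" and ?s = "s @ [(\<eta>, m)]"
  let ?N = "Suc ?n"
  define g where "g = (\<lambda>x i j. amat ?s x i j - kron i j)"
  define B where "B = (\<lambda>x i j. if j = ?n then g x i j else amat ?s x i j)"
  define f where "f = (\<lambda>x i. if i = ?n then exp (\<eta> * x) else 1 :: real)"
  have fs: "fst (?s ! i) > 0" if "i < ?N" for i
    using s m that by (cases "i < ?n") (auto simp: pos_data_def nth_append)
  have d: "tau ?s x - tau s x = Determinant.det (Matrix.mat ?N ?N (\<lambda>(i, j). B x i j))" for x
  proof -
    let ?A = "Matrix.mat ?N ?N (\<lambda>(i, j). amat ?s x i j)" and ?B = "Matrix.mat ?N ?N (\<lambda>(i, j). B x i j)"
    have del: "mat_delete ?B i ?n = mat_delete ?A i ?n" for i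
      by (rule eq_matI) (auto simp: mat_delete_def B_def)
    have "mat_delete ?A ?n ?n = Matrix.mat ?n ?n (\<lambda>(i, j). amat s x i j)"
      by (rule eq_matI) (auto simp: mat_delete_def amat_def nth_append)
    then have "cofactor ?A ?n ?n = tau s x" by (simp add: cofactor_def tau_amat)
    moreover have "Determinant.det ?A = (\<Sum>i<?N. ?A $$ (i, ?n) * cofactor ?A i ?n)"
      by (rule laplace_expansion_column) auto
    moreover have "Determinant.det ?B = (\<Sum>i<?N. ?B $$ (i, ?n) * cofactor ?A i ?n)"
      by (subst laplace_expansion_column[of ?B ?N ?n]) (auto simp: cofactor_def del)
    moreover have "(\<Sum>i<?N. ?A $$ (i, ?n) * cofactor ?A i ?n) = (\<Sum>i<?N. ?B $$ (i, ?n) * cofactor ?A i ?n) + cofactor ?A ?n ?n"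
      by (simp add: B_def g_def left_diff_distrib sum.distrib)
    ultimately show ?thesis by (simp add: tau_amat)
  qed
  have e: "Determinant.det (Matrix.mat ?N ?N (\<lambda>(i, j). B x i j)) * exp (2 * \<eta> * x)
      = Determinant.det (Matrix.mat ?N ?N (\<lambda>(i, j). f x i * B x i j * f x j))" for x
  proof -
    let ?B = "Matrix.mat ?N ?N (\<lambda>(i, j). B x i j)" and ?D = "mat_diag ?N (f x)"
    have "?D * ?B * ?D = Matrix.mat ?N ?N (\<lambda>(i, j). f x i * B x i j * f x j)"
      by (subst mat_diag_mult_left[of _ ?N ?N], simp, subst mat_diag_mult_right[of _ ?N], simp) (rule eq_matI, auto)
    moreover have "Determinant.det (?D * ?B * ?D) = Determinant.det ?D * Determinant.det ?B * Determinant.det ?D"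
      using det_mult[of "?D * ?B" ?N ?D] det_mult[of ?D ?N ?B] by simp
    moreover have "Determinant.det ?D = exp (\<eta> * x)" unfolding det_mat_diag by (simp add: f_def)
    moreover have "exp (\<eta> * x) * exp (\<eta> * x) = exp (2 * \<eta> * x)" by (simp add: exp_add[symmetric])
    ultimately show ?thesis by (simp add: ac_simps)
  qed
  define L where "L = (\<lambda>i j. kron i j * (if j = ?n then m / (2 * \<eta>) else 1))"
  have "((\<lambda>x. Determinant.det (Matrix.mat ?N ?N (\<lambda>(i, j). f x i * B x i j * f x j)))
      \<longlongrightarrow> Determinant.det (Matrix.mat ?N ?N (\<lambda>(i, j). L i j))) at_top"
  proof (rule tendsto_det)
    fix i j assume ij: "i < ?N" "j < ?N"
    define a b where "a = fst (?s ! i)" and "b = fst (?s ! j)"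
    define C where "C = sqrt (snd (?s ! i) * snd (?s ! j)) / (a + b)"
    have ab: "a > 0" "b > 0" using fs ij by (auto simp: a_def b_def)
    have gx: "g x i j = C * exp (- (a + b) * x)" for x by (simp add: g_def amat_def C_def a_def b_def)
    have last: "fst (?s ! ?n) = \<eta>" "snd (?s ! ?n) = m" by simp_all
    show "((\<lambda>x. f x i * B x i j * f x j) \<longlongrightarrow> L i j) at_top"
    proof (cases "i = ?n"; cases "j = ?n")
      assume c: "i \<noteq> ?n" "j \<noteq> ?n"
      have "((\<lambda>x. kron i j + C * exp (- (a + b) * x)) \<longlongrightarrow> kron i j + C * 0) at_top"
        using ab by (intro tendsto_intros exp_neg_tendsto_0) auto
      moreover have "f x i * B x i j * f x j = kron i j + C * exp (- (a + b) * x)" for x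
        using c gx[of x] by (simp add: f_def B_def g_def)
      ultimately show ?thesis using c by (simp add: L_def)
    next
      assume c: "i \<noteq> ?n" "j = ?n"
      then have "b = \<eta>" using last by (simp add: b_def)
      have "f x i * B x i j * f x j = C * exp (- a * x)" for x
      proof -
        have "f x i * B x i j * f x j = C * (exp (- (a + b) * x) * exp (\<eta> * x))"
          using c gx[of x] by (simp add: f_def B_def)
        also have "exp (- (a + b) * x) * exp (\<eta> * x) = exp (- a * x)"
          using \<open>b = \<eta>\<close> by (simp add: exp_add[symmetric] algebra_simps)
        finally show ?thesis .
      qed
      moreover have "((\<lambda>x. C * exp (- a * x)) \<longlongrightarrow> C * 0) at_top"
        using ab by (intro tendsto_intros exp_neg_tendsto_0) auto
      ultimately show ?thesis using c by (simp add: L_def)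
    next
      assume c: "i = ?n" "j \<noteq> ?n"
      then have a: "a = \<eta>" using last by (simp add: a_def)
      have "f x i * B x i j * f x j = C * exp (- b * x)" for x
      proof -
        have "amat ?s x i j = C * exp (- (a + b) * x)" using gx[of x] c by (simp add: g_def)
        then show ?thesis using c a by (simp add: f_def B_def exp_add[symmetric] algebra_simps)
      qed
      moreover have "((\<lambda>x. C * exp (- b * x)) \<longlongrightarrow> C * 0) at_top"
        using ab by (intro tendsto_intros exp_neg_tendsto_0) auto
      ultimately show ?thesis using c by (simp add: L_def)
    next
      assume c: "i = ?n" "j = ?n"
      then have a: "a = \<eta>" "b = \<eta>" "C = m / (2 * \<eta>)" using last m by (simp_all add: a_def b_def C_def)
      have "f x i * B x i j * f x j = m / (2 * \<eta>) * (exp (\<eta> * x) * exp (\<eta> * x) * exp (- (\<eta> + \<eta>) * x))" for x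
      proof -
        have "f x i * B x i j * f x j = exp (\<eta> * x) * (C * exp (- (a + b) * x)) * exp (\<eta> * x)"
          using c gx[of x] by (simp add: f_def B_def)
        then show ?thesis unfolding a by (simp only: ac_simps)
      qed
      moreover have "exp (\<eta> * x) * exp (\<eta> * x) * exp (- (\<eta> + \<eta>) * x) = 1" for x
        by (simp add: exp_add[symmetric] algebra_simps)
      ultimately show ?thesis using c by (simp add: L_def)
    qed
  qed
  moreover have "Determinant.det (Matrix.mat ?N ?N (\<lambda>(i, j). L i j)) = m / (2 * \<eta>)"
  proof -
    have "Matrix.mat ?N ?N (\<lambda>(i, j). L i j) = mat_diag ?N (\<lambda>j. if j = ?n then m / (2 * \<eta>) else 1)"
      unfolding mat_diag_def by (rule eq_matI) (auto simp: L_def)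
    then show ?thesis by (simp add: det_mat_diag)
  qed
  ultimately show ?thesis unfolding d e by simp
qed

lemma pos_data_take: "pos_data s \<Longrightarrow> pos_data (take k s)"
  by (simp add: pos_data_def)

text \<open>Telescope over the prefixes: every further entry has a larger \<eta>, so its increment
  stays negligible after multiplication by the exponential of entry \<open>k\<close>.\<close>

lemma tau_take_asymptotics:
  assumes s: "s \<in> scattering_data" and k: "k < length s"
  shows "((\<lambda>x. (tau s x - tau (take k s) x) * exp (2 * fst (s ! k) * x)) \<longlongrightarrow> snd (s ! k) / (2 * fst (s ! k))) at_top"
proof -
  have p: "pos_data s" using s by (rule scattering_data_pos)
  have step: "((\<lambda>x. (tau (take (Suc l) s) x - tau (take l s) x) * exp (2 * fst (s ! l) * x)) \<longlongrightarrow> snd (s ! l) / (2 * fst (s ! l))) at_top"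
    if "l < length s" for l
    using tau_append_asymptotics[OF pos_data_take[OF p], of "fst (s ! l)" "snd (s ! l)" l] p that
    by (simp add: take_Suc_conv_app_nth pos_data_def)
  have "l \<le> length s \<Longrightarrow> ((\<lambda>x. (tau (take l s) x - tau (take k s) x) * exp (2 * fst (s ! k) * x)) \<longlongrightarrow> snd (s ! k) / (2 * fst (s ! k))) at_top"
    if "Suc k \<le> l" for l
    using that
  proof (induction l rule: dec_induct)
    case base
    show ?case by (rule step[OF k])
  next
    case (step l)
    have l: "l < length s" "k < l" using step by auto
    have less: "fst (s ! k) < fst (s ! l)"
      using s l by (simp add: scattering_data_def sorted_wrt_iff_nth_less)
    have "((\<lambda>x. (tau (take l s) x - tau (take k s) x) * exp (2 * fst (s ! k) * x)
       + (tau (take (Suc l) s) x - tau (take l s) x) * exp (2 * fst (s ! l) * x) * exp (- (2 * (fst (s ! l) - fst (s ! k))) * x))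
      \<longlongrightarrow> snd (s ! k) / (2 * fst (s ! k)) + snd (s ! l) / (2 * fst (s ! l)) * 0) at_top"
      using step.IH step.prems l less
      by (intro tendsto_add tendsto_mult \<open>\<And>l. l < length s \<Longrightarrow> _\<close> exp_neg_tendsto_0) auto
    moreover have "(tau (take l s) x - tau (take k s) x) * exp (2 * fst (s ! k) * x)
       + (tau (take (Suc l) s) x - tau (take l s) x) * exp (2 * fst (s ! l) * x) * exp (- (2 * (fst (s ! l) - fst (s ! k))) * x)
      = (tau (take (Suc l) s) x - tau (take k s) x) * exp (2 * fst (s ! k) * x)" for x
    proof -
      have "exp (2 * fst (s ! l) * x) * exp (- (2 * (fst (s ! l) - fst (s ! k))) * x) = exp (2 * fst (s ! k) * x)"
        by (simp add: exp_add[symmetric] algebra_simps)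
      then show ?thesis unfolding mult.assoc[of _ "exp (2 * fst (s ! l) * x)"] by (simp add: algebra_simps)
    qed
    ultimately show ?case by simp
  qed
  from this[of "length s"] k show ?thesis by simp
qed

text \<open>Prefix by prefix: once the first k entries agree, \<open>tau\<close> minus the tau of
  this prefix behaves at plus infinity like m / (2 \<eta>) exp(- 2 \<eta> x) for the next entry, and
  is 0 if there is none. Thus length, exponent and mass can be read off in turn.\<close>

lemma tau_inj:
  assumes s: "s \<in> scattering_data" and t: "t \<in> scattering_data"
    and eq: "\<And>x. x \<ge> 0 \<Longrightarrow> tau s x = tau t x"
  shows "s = t"
proof -
  have ev: "\<forall>\<^sub>F x in at_top. (0::real) \<le> x" by (rule eventually_ge_at_top)
  have lim_pos: "snd (s ! k) / (2 * fst (s ! k)) > 0" if "s \<in> scattering_data" "k < length s" for s k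
    using scattering_data_pos[OF that(1)] that(2) by (simp add: pos_data_def)
  have no: False if s: "s \<in> scattering_data" and "take k s = take k t" "k < length s" "length t \<le> k"
      and eq: "\<And>x. x \<ge> 0 \<Longrightarrow> tau s x = tau t x" for s t k
  proof -
    have tt: "take k s = t" using that by simp
    have "((\<lambda>x. (tau s x - tau (take k s) x) * exp (2 * fst (s ! k) * x)) \<longlongrightarrow> snd (s ! k) / (2 * fst (s ! k))) at_top"
      by (rule tau_take_asymptotics[OF s that(3)])
    moreover have "((\<lambda>x. (tau s x - tau (take k s) x) * exp (2 * fst (s ! k) * x)) \<longlongrightarrow> 0) at_top"
      by (rule tendsto_eventually, rule eventually_mono[OF ev]) (simp add: tt eq)
    ultimately have "snd (s ! k) / (2 * fst (s ! k)) = 0" using tendsto_unique trivial_limit_at_top_linorder by blast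
    then show False using lim_pos[OF s that(3)] by linarith
  qed
  have le: "fst (t ! k) \<le> fst (s ! k)"
    if s: "s \<in> scattering_data" and t: "t \<in> scattering_data" and tk: "take k s = take k t" and k: "k < length s" "k < length t"
      and eq: "\<And>x. x \<ge> 0 \<Longrightarrow> tau s x = tau t x" for s t k
  proof (rule ccontr)
    assume "\<not> fst (t ! k) \<le> fst (s ! k)"
    then have less: "fst (s ! k) < fst (t ! k)" by simp
    have l: "((\<lambda>x. ((tau t x - tau (take k t) x) * exp (2 * fst (t ! k) * x)) * exp (- (2 * (fst (t ! k) - fst (s ! k))) * x))
       \<longlongrightarrow> snd (t ! k) / (2 * fst (t ! k)) * 0) at_top"
      using less by (intro tendsto_mult tau_take_asymptotics t k exp_neg_tendsto_0) simp
    have e: "((tau t x - tau (take k t) x) * exp (2 * fst (t ! k) * x)) * exp (- (2 * (fst (t ! k) - fst (s ! k))) * x)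
      = (tau t x - tau (take k t) x) * exp (2 * fst (s ! k) * x)" for x
    proof -
      have "exp (2 * fst (t ! k) * x) * exp (- (2 * (fst (t ! k) - fst (s ! k))) * x) = exp (2 * fst (s ! k) * x)"
        by (simp add: exp_add[symmetric] algebra_simps)
      then show ?thesis by (simp only: mult.assoc)
    qed
    have "((\<lambda>x. (tau t x - tau (take k t) x) * exp (2 * fst (s ! k) * x)) \<longlongrightarrow> 0) at_top"
      using l unfolding e mult_zero_right .
    moreover have "((\<lambda>x. (tau t x - tau (take k t) x) * exp (2 * fst (s ! k) * x)) \<longlongrightarrow> snd (s ! k) / (2 * fst (s ! k))) at_top"
      by (rule Lim_transform_eventually[OF tau_take_asymptotics[OF s k(1)]], rule eventually_mono[OF ev]) (simp add: tk eq)
    ultimately have "snd (s ! k) / (2 * fst (s ! k)) = 0" using tendsto_unique trivial_limit_at_top_linorder by blast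
    then show False using lim_pos[OF s k(1)] by linarith
  qed
  have "take k s = take k t" for k
  proof (induction k)
    case 0
    show ?case by simp
  next
    case (Suc k)
    consider "length s \<le> k" "length t \<le> k" | "k < length s" "length t \<le> k" | "length s \<le> k" "k < length t" | "k < length s" "k < length t"
      by linarith
    then show ?case
    proof cases
      case 1
      then show ?thesis using Suc by simp
    next
      case 2
      then show ?thesis using no[OF s Suc] eq by blast
    next
      case 3
      then show ?thesis using no[OF t Suc[symmetric]] eq[symmetric] by blast
    next
      case 4
      have f: "fst (s ! k) = fst (t ! k)"
        using le[OF s t Suc 4 eq] le[OF t s Suc[symmetric] 4(2,1) eq[symmetric]] by simp
      have "((\<lambda>x. (tau t x - tau (take k t) x) * exp (2 * fst (t ! k) * x)) \<longlongrightarrow> snd (s ! k) / (2 * fst (s ! k))) at_top"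
        by (rule Lim_transform_eventually[OF tau_take_asymptotics[OF s 4(1)]], rule eventually_mono[OF ev]) (simp add: Suc eq f)
      then have "snd (s ! k) / (2 * fst (s ! k)) = snd (t ! k) / (2 * fst (t ! k))"
        using tau_take_asymptotics[OF t 4(2)] tendsto_unique trivial_limit_at_top_linorder by blast
      then have "snd (s ! k) = snd (t ! k)" 
      proof -
        have "fst (t ! k) > 0" using scattering_data_pos[OF t] 4 by (simp add: pos_data_def)
        then show ?thesis using \<open>snd (s ! k) / (2 * fst (s ! k)) = snd (t ! k) / (2 * fst (t ! k))\<close> f by simp
      qed
      then have "s ! k = t ! k" using f by (simp add: prod_eq_iff)
      then show ?thesis using Suc 4 by (simp add: take_Suc_conv_app_nth)
    qed
  qed
  from this[of "max (length s) (length t)"] show ?thesis by simp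
qed

section \<open>From the potential back to tau\<close>

lemma ln_tau_derivatives:
  assumes s: "pos_data s"
  obtains g h where "\<And>x. ((\<lambda>x. ln (tau s x)) has_real_derivative g x) (at x)"
    "\<And>x. (g has_real_derivative h x) (at x)" "\<And>x. potential s x = - 2 * h x"
proof -
  obtain f' where f': "expoly f'" "\<And>x. (tau s has_real_derivative f' x) (at x)"
    using expoly_has_derivative[OF expoly_tau[of s]] by blast
  obtain f'' where f'': "\<And>x. (f' has_real_derivative f'' x) (at x)"
    using expoly_has_derivative[OF f'(1)] by blast
  define g where "g = (\<lambda>x. f' x / tau s x)"
  define h where "h = (\<lambda>x. (f'' x * tau s x - f' x * f' x) / (tau s x * tau s x))"
  have pos: "tau s x > 0" for x by (rule tau_pos[OF s])
  have 1: "((\<lambda>x. ln (tau s x)) has_real_derivative g x) (at x)" for x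
    using DERIV_chain2[OF DERIV_ln[OF pos] f'(2)] by (simp add: g_def field_simps)
  have 2: "(g has_real_derivative h x) (at x)" for x
    unfolding g_def h_def using pos[of x] by (intro DERIV_divide f' f'') simp
  have "deriv (\<lambda>x. ln (tau s x)) = g" using 1 DERIV_imp_deriv by blast
  moreover have "deriv g = h" using 2 DERIV_imp_deriv by blast
  ultimately have "potential s x = - 2 * h x" for x by (simp add: potential_def tau_def[symmetric])
  then show ?thesis using that 1 2 by blast
qed

text \<open>Integrating twice, the logarithms of the two tau functions differ by an affine function
  on the half line. Both tend to 0 at plus infinity, so the affine function is 0. Only x \<ge> 0 is
  compared because \<open>psi\<close> is specified there.\<close>

lemma potential_inj:
  assumes s: "s \<in> scattering_data" and t: "t \<in> scattering_data"
    and eq: "\<And>x. x \<ge> 0 \<Longrightarrow> potential s x = potential t x"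
  shows "s = t"
proof (rule tau_inj[OF s t])
  note ps = scattering_data_pos[OF s] and pt = scattering_data_pos[OF t]
  obtain g h where s': "\<And>x. ((\<lambda>x. ln (tau s x)) has_real_derivative g x) (at x)"
    "\<And>x. (g has_real_derivative h x) (at x)" "\<And>x. potential s x = - 2 * h x" using ln_tau_derivatives[OF ps] by metis
  obtain g' h' where t': "\<And>x. ((\<lambda>x. ln (tau t x)) has_real_derivative g' x) (at x)"
    "\<And>x. (g' has_real_derivative h' x) (at x)" "\<And>x. potential t x = - 2 * h' x" using ln_tau_derivatives[OF pt] by metis
  have hh: "h x = h' x" if "x \<ge> 0" for x using eq[OF that] s'(3) t'(3) by simp
  have "\<exists>b. \<forall>x\<in>{0..}. g x - g' x = b"
  proof (rule has_field_derivative_zero_constant)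
    show "((\<lambda>x. g x - g' x) has_real_derivative 0) (at x within {0..})" if "x \<in> {0..}" for x
      using DERIV_diff[OF s'(2)[of x] t'(2)[of x]] hh[of x] that by (auto intro: has_field_derivative_at_within)
  qed (rule convex_real_interval)
  then obtain b where b: "\<And>x. x \<ge> 0 \<Longrightarrow> g x - g' x = b" by auto
  have "\<exists>a. \<forall>x\<in>{0..}. ln (tau s x) - ln (tau t x) - b * x = a"
  proof (rule has_field_derivative_zero_constant)
    fix x :: real assume x: "x \<in> {0..}"
    have "((\<lambda>x. ln (tau s x) - ln (tau t x) - b * x) has_real_derivative g x - g' x - b * 1) (at x)"
      by (intro DERIV_diff DERIV_cmult DERIV_ident s'(1) t'(1))
    then show "((\<lambda>x. ln (tau s x) - ln (tau t x) - b * x) has_real_derivative 0) (at x within {0..})"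
      using b[of x] x by (auto intro: has_field_derivative_at_within)
  qed (rule convex_real_interval)
  then obtain a where a': "\<forall>x\<in>{0..}. ln (tau s x) - ln (tau t x) - b * x = a" by blast
  then have a: "ln (tau s x) - ln (tau t x) = a + b * x" if "x \<ge> 0" for x
  proof -
    have "ln (tau s x) - ln (tau t x) - b * x = a" using a' that by auto
    then show ?thesis by linarith
  qed
  have "((\<lambda>x. ln (tau s x) - ln (tau t x)) \<longlongrightarrow> ln 1 - ln 1) at_top"
    by (intro tendsto_diff tendsto_ln tau_tendsto_1 ps pt) auto
  then have lim: "((\<lambda>x. a + b * x) \<longlongrightarrow> 0) at_top"
    using Lim_transform_eventually[OF _ eventually_mono[OF eventually_ge_at_top[of 0] a]] by simp
  have "b = 0"
  proof -
    have "((\<lambda>x. (a + b * x) * (1 / x) - a * (1 / x)) \<longlongrightarrow> 0 * 0 - a * 0) at_top"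
      by (intro tendsto_diff tendsto_mult lim tendsto_const) (real_asymp | rule tendsto_divide_0[OF tendsto_const] | simp add: filterlim_ident filterlim_at_top_imp_at_infinity)+
    moreover have "\<forall>\<^sub>F x in at_top. (a + b * x) * (1 / x) - a * (1 / x) = b"
      using eventually_gt_at_top[of 0] by eventually_elim (simp add: field_simps)
    ultimately have "((\<lambda>x::real. b) \<longlongrightarrow> 0) at_top" using Lim_transform_eventually[of _ "0::real" at_top "\<lambda>_. b"] by simp
    then show ?thesis using tendsto_unique[OF trivial_limit_at_top_linorder _ tendsto_const] by metis
  qed
  moreover from this have "((\<lambda>x::real. a) \<longlongrightarrow> 0) at_top" using lim by simp
  then have "a = 0" using tendsto_unique[OF trivial_limit_at_top_linorder _ tendsto_const] by metis
  ultimately show "tau s x = tau t x" if "x \<ge> 0" for x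
    using a[OF that] tau_pos[OF ps, of x] tau_pos[OF pt, of x] by simp
qed

section \<open>Solution of the Fredholm equation\<close>

text \<open>Jacobi's formula: in the Leibniz expansion the product rule replaces one row by its
  derivative, and Laplace expansion along that row produces the cofactors.\<close>

lemma det_has_derivative:
  fixes A :: "real \<Rightarrow> nat \<Rightarrow> nat \<Rightarrow> real"
  assumes d: "\<And>i j. i < n \<Longrightarrow> j < n \<Longrightarrow> ((\<lambda>x. A x i j) has_real_derivative A' i j) (at T)"
  shows "((\<lambda>x. Determinant.det (Matrix.mat n n (\<lambda>(i, j). A x i j))) has_real_derivative
    (\<Sum>i<n. \<Sum>j<n. A' i j * cofactor (Matrix.mat n n (\<lambda>(i, j). A T i j)) i j)) (at T)"
proof -
  let ?P = "{\<pi>. \<pi> permutes {0..<n}}"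
  have pn: "\<pi> i < n" if "\<pi> \<in> ?P" "i < n" for \<pi> i
    using that permutes_in_image[of \<pi> "{0..<n}" i] by auto
  define B where "B = (\<lambda>k i j. if i = k then A' k j else A T i j)"
  have "((\<lambda>x. \<Sum>\<pi>\<in>?P. signof \<pi> * (\<Prod>i<n. A x i (\<pi> i))) has_real_derivative
      (\<Sum>\<pi>\<in>?P. signof \<pi> * (\<Sum>k<n. A' k (\<pi> k) * (\<Prod>i\<in>{..<n} - {k}. A T i (\<pi> i))))) (at T)"
    by (intro DERIV_sum DERIV_cmult has_field_derivative_prod d) (auto simp: pn)
  also have "(\<Sum>\<pi>\<in>?P. signof \<pi> * (\<Sum>k<n. A' k (\<pi> k) * (\<Prod>i\<in>{..<n} - {k}. A T i (\<pi> i))))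
     = (\<Sum>k<n. \<Sum>\<pi>\<in>?P. signof \<pi> * (\<Prod>i<n. B k i (\<pi> i)))"
  proof -
    have "A' k (\<pi> k) * (\<Prod>i\<in>{..<n} - {k}. A T i (\<pi> i)) = (\<Prod>i<n. B k i (\<pi> i))" if "k < n" for k \<pi>
      using that by (subst prod.remove[of _ k]) (auto simp: B_def intro!: prod.cong)
    then show ?thesis unfolding sum_distrib_left by (subst sum.swap) (auto intro!: sum.cong)
  qed
  also have "\<dots> = (\<Sum>k<n. \<Sum>j<n. A' k j * cofactor (Matrix.mat n n (\<lambda>(i, j). A T i j)) k j)"
  proof (intro sum.cong refl)
    fix k assume "k \<in> {..<n}"
    then have k: "k < n" by simp
    let ?B = "Matrix.mat n n (\<lambda>(i, j). B k i j)" and ?A = "Matrix.mat n n (\<lambda>(i, j). A T i j)"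
    have del: "mat_delete ?B k j = mat_delete ?A k j" for j
      by (rule eq_matI) (auto simp: mat_delete_def B_def)
    have "(\<Sum>\<pi>\<in>?P. signof \<pi> * (\<Prod>i<n. B k i (\<pi> i))) = Determinant.det ?B" by (simp add: det_mat_sum)
    also have "\<dots> = (\<Sum>j<n. ?B $$ (k, j) * cofactor ?B k j)"
      by (rule laplace_expansion_row) (use k in auto)
    also have "\<dots> = (\<Sum>j<n. A' k j * cofactor ?A k j)"
    proof (intro sum.cong refl)
      fix j assume "j \<in> {..<n}"
      then have "?B $$ (k, j) = A' k j" using k by (simp add: B_def)
      moreover have "cofactor ?B k j = cofactor ?A k j" by (simp only: cofactor_def del)
      ultimately show "?B $$ (k, j) * cofactor ?B k j = A' k j * cofactor ?A k j" by simp
    qed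
    finally show "(\<Sum>\<pi>\<in>?P. signof \<pi> * (\<Prod>i<n. B k i (\<pi> i))) = (\<Sum>j<n. A' k j * cofactor ?A k j)" .
  qed
  finally show ?thesis by (simp add: det_mat_sum)
qed

text \<open>f cosh - k sinh / \<eta> and k cosh - \<eta> f sinh are constants of motion with values
  0 and k 0; solving for f and k uses cosh^2 - sinh^2 = 1.\<close>

lemma sinh_ode_unique:
  fixes f k :: "real \<Rightarrow> real"
  assumes T: "T \<ge> 0" and e: "\<eta> > 0"
    and f: "\<And>s. s \<in> {0..T} \<Longrightarrow> (f has_real_derivative k s) (at s within {0..T})"
    and k: "\<And>s. s \<in> {0..T} \<Longrightarrow> (k has_real_derivative \<eta>\<^sup>2 * f s) (at s within {0..T})"
    and 0: "f 0 = 0"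
  shows "f T = k 0 * (sinh (\<eta> * T) / \<eta>)" "k T = k 0 * cosh (\<eta> * T)"
proof -
  let ?I = "{0..T}"
  have sc: "((\<lambda>s. sinh (\<eta> * s)) has_real_derivative \<eta> * cosh (\<eta> * s)) (at s within ?I)"
    "((\<lambda>s. cosh (\<eta> * s)) has_real_derivative \<eta> * sinh (\<eta> * s)) (at s within ?I)" for s
    by (auto intro!: derivative_eq_intros)
  have "\<exists>a. \<forall>s\<in>?I. f s * cosh (\<eta> * s) - k s * (sinh (\<eta> * s) / \<eta>) = a"
  proof (rule has_field_derivative_zero_constant)
    fix s assume s: "s \<in> ?I"
    show "((\<lambda>s. f s * cosh (\<eta> * s) - k s * (sinh (\<eta> * s) / \<eta>)) has_real_derivative 0) (at s within ?I)"
    proof -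
      have d: "((\<lambda>s. sinh (\<eta> * s) / \<eta>) has_real_derivative cosh (\<eta> * s)) (at s within ?I)"
        using DERIV_cdivide[OF sc(1), of \<eta>] e by simp
      show ?thesis
        by (rule DERIV_cong[OF DERIV_diff[OF DERIV_mult[OF f[OF s] sc(2)] DERIV_mult[OF k[OF s] d]]])
           (use e in \<open>simp add: field_simps power2_eq_square\<close>)
    qed
  qed (rule convex_real_interval)
  then obtain a where a: "\<And>s. s \<in> ?I \<Longrightarrow> f s * cosh (\<eta> * s) - k s * (sinh (\<eta> * s) / \<eta>) = a" by blast
  have "\<exists>b. \<forall>s\<in>?I. k s * cosh (\<eta> * s) - \<eta> * f s * sinh (\<eta> * s) = b"
  proof (rule has_field_derivative_zero_constant)
    fix s assume s: "s \<in> ?I"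
    show "((\<lambda>s. k s * cosh (\<eta> * s) - \<eta> * f s * sinh (\<eta> * s)) has_real_derivative 0) (at s within ?I)"
      by (rule DERIV_cong[OF DERIV_diff[OF DERIV_mult[OF k[OF s] sc(2)] DERIV_mult[OF DERIV_cmult[OF f[OF s]] sc(1)]]])
         (simp add: algebra_simps power2_eq_square)
  qed (rule convex_real_interval)
  then obtain b where b: "\<And>s. s \<in> ?I \<Longrightarrow> k s * cosh (\<eta> * s) - \<eta> * f s * sinh (\<eta> * s) = b" by blast
  define C Z where "C = cosh (\<eta> * T)" and "Z = sinh (\<eta> * T)"
  have CZ: "C * C - Z * Z = 1" using cosh_square_eq[of "\<eta> * T"] by (simp add: C_def Z_def power2_eq_square)
  have "a = 0" using a[of 0] T 0 by simp
  then have 1: "f T * C = k T * (Z / \<eta>)" using a[of T] T by (simp add: C_def Z_def)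
  have 2: "k T * C - \<eta> * f T * Z = k 0" using b[of T] b[of 0] T 0 by (simp add: C_def Z_def)
  have 3: "\<eta> * f T * C = k T * Z" using 1 e by (simp add: field_simps)
  have "k T = k T * (C * C - Z * Z)" using CZ by simp
  also have "\<dots> = (k T * C) * C - (k T * Z) * Z" by (simp add: algebra_simps)
  also have "\<dots> = (k T * C - \<eta> * f T * Z) * C" unfolding 3[symmetric] by (simp add: algebra_simps)
  finally have "k T = k 0 * C" unfolding 2 .
  then show "k T = k 0 * cosh (\<eta> * T)" by (simp add: C_def)
  have "\<eta> * f T = \<eta> * f T * (C * C - Z * Z)" using CZ by simp
  also have "\<dots> = (\<eta> * f T * C) * C - (\<eta> * f T * Z) * Z" by (simp add: algebra_simps)
  also have "\<dots> = (k T * C - \<eta> * f T * Z) * Z" unfolding 3 by (simp add: algebra_simps)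
  finally have "\<eta> * f T = k 0 * Z" unfolding 2 .
  then show "f T = k 0 * (sinh (\<eta> * T) / \<eta>)" using e by (simp add: Z_def field_simps)
qed

definition sh :: "real \<Rightarrow> real \<Rightarrow> real" where
  "sh p y = (if p = 0 then y else sinh (p * y) / p)"

lemma sh_has_derivative: "(sh p has_real_derivative cosh (p * y)) (at y within A)"
  unfolding sh_def by (cases "p = 0") (auto intro!: derivative_eq_intros)

lemma sh_0: "sh p 0 = 0" by (simp add: sh_def)

lemma mult_sh: "p * sh p y = sinh (p * y)" by (simp add: sh_def)

lemma continuous_on_sh: "continuous_on A (sh p)"
  using sh_has_derivative by (meson DERIV_continuous_on)

text \<open>The kernel is exp(p max) times \<open>sh p\<close> of the minimum. This product form
  reduces the integral operator to running integrals.\<close>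

lemma cov_kernel_le: "0 \<le> y \<Longrightarrow> y \<le> s \<Longrightarrow> cov_kernel s y p = exp (p * s) * sh p y"
  by (auto simp: cov_kernel_def sh_def sinh_field_def exp_add[symmetric] algebra_simps diff_divide_distrib)

lemma cov_kernel_ge: "0 \<le> s \<Longrightarrow> s \<le> y \<Longrightarrow> cov_kernel s y p = exp (p * y) * sh p s"
  by (auto simp: cov_kernel_def sh_def sinh_field_def exp_add[symmetric] algebra_simps diff_divide_distrib)

text \<open>The Fredholm operator with kernel \<open>cov_kernel\<close> is inverted by the first order system
  \<open>w' = p w + r\<close>, \<open>r' = - p r - G\<close> with \<open>w 0 = 0\<close> and \<open>r T = 0\<close>.\<close>

definition kop_r :: "real \<Rightarrow> real \<Rightarrow> (real \<Rightarrow> real) \<Rightarrow> real \<Rightarrow> real" where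
  "kop_r p T G s = exp (- p * s) * (integral {0..T} (\<lambda>y. exp (p * y) * G y) - integral {0..s} (\<lambda>y. exp (p * y) * G y))"

definition kop :: "real \<Rightarrow> real \<Rightarrow> (real \<Rightarrow> real) \<Rightarrow> real \<Rightarrow> real" where
  "kop p T G s = exp (p * s) * integral {0..s} (\<lambda>y. sh p y * G y)
     + sh p s * (integral {0..T} (\<lambda>y. exp (p * y) * G y) - integral {0..s} (\<lambda>y. exp (p * y) * G y))"

lemma cov_kernel_operator:
  fixes G :: "real \<Rightarrow> real"
  assumes T: "T \<ge> 0" and G: "continuous_on {0..T} G"
  shows "s \<in> {0..T} \<Longrightarrow> ((\<lambda>y. cov_kernel s y p * G y) has_integral kop p T G s) {0..T}"
    "s \<in> {0..T} \<Longrightarrow> (kop p T G has_real_derivative p * kop p T G s + kop_r p T G s) (at s within {0..T})"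
    "s \<in> {0..T} \<Longrightarrow> (kop_r p T G has_real_derivative - p * kop_r p T G s - G s) (at s within {0..T})"
    "kop p T G 0 = 0" "kop_r p T G T = 0"
proof -
  let ?I = "{0..T}"
  define A where "A = (\<lambda>s. integral {0..s} (\<lambda>y. sh p y * G y))"
  define B where "B = (\<lambda>s. integral {0..s} (\<lambda>y. exp (p * y) * G y))"
  define w where "w = (\<lambda>s. exp (p * s) * A s + sh p s * (B T - B s))"
  define r where "r = (\<lambda>s. exp (- p * s) * (B T - B s))"
  have cA: "continuous_on ?I (\<lambda>y. sh p y * G y)" and cB: "continuous_on ?I (\<lambda>y. exp (p * y) * G y)"
    using G continuous_on_sh by (auto intro!: continuous_intros)
  have dA: "(A has_real_derivative sh p s * G s) (at s within ?I)" if "s \<in> ?I" for s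
    unfolding A_def by (rule integral_has_real_derivative[OF cA that])
  have dB: "(B has_real_derivative exp (p * s) * G s) (at s within ?I)" if "s \<in> ?I" for s
    unfolding B_def by (rule integral_has_real_derivative[OF cB that])
  have 1: "((\<lambda>y. cov_kernel s y p * G y) has_integral w s) ?I" if s: "s \<in> ?I" for s
  proof -
    have sub: "continuous_on {0..s} (\<lambda>y. sh p y * G y)" "continuous_on {s..T} (\<lambda>y. exp (p * y) * G y)"
      "continuous_on {0..s} (\<lambda>y. exp (p * y) * G y)"
      using s by (auto intro: continuous_on_subset[OF cA] continuous_on_subset[OF cB])
    have BT: "integral {s..T} (\<lambda>y. exp (p * y) * G y) = B T - B s"
      using Henstock_Kurzweil_Integration.integral_combine[of 0 s T "\<lambda>y. exp (p * y) * G y"] s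
        integrable_continuous_real[OF cB] by (simp add: B_def)
    have "((\<lambda>y. exp (p * s) * (sh p y * G y)) has_integral exp (p * s) * A s) {0..s}"
      unfolding A_def by (intro has_integral_mult_right integrable_integral integrable_continuous_real sub)
    then have a: "((\<lambda>y. cov_kernel s y p * G y) has_integral exp (p * s) * A s) {0..s}"
      by (rule has_integral_eq[rotated]) (use s in \<open>auto simp: cov_kernel_le\<close>)
    have "((\<lambda>y. sh p s * (exp (p * y) * G y)) has_integral sh p s * (B T - B s)) {s..T}"
      unfolding BT[symmetric] by (intro has_integral_mult_right integrable_integral integrable_continuous_real sub)
    then have b: "((\<lambda>y. cov_kernel s y p * G y) has_integral sh p s * (B T - B s)) {s..T}"
      by (rule has_integral_eq[rotated]) (use s in \<open>auto simp: cov_kernel_ge\<close>)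
    show ?thesis unfolding w_def by (rule has_integral_combine[OF _ _ a b]) (use s in auto)
  qed
  have 2: "(w has_real_derivative p * w s + r s) (at s within ?I)" if s: "s \<in> ?I" for s
  proof -
    have "(w has_real_derivative (exp (p * s) * p * A s + sh p s * G s * exp (p * s)
        + (cosh (p * s) * (B T - B s) + (0 - exp (p * s) * G s) * sh p s))) (at s within ?I)"
      unfolding w_def
      by (intro DERIV_add DERIV_mult DERIV_diff DERIV_const dA dB s sh_has_derivative) (auto intro!: derivative_eq_intros)
    \<comment> \<open>This splits the derivative of \<open>sh p\<close> into p sh + exp(- p s); the
      first summand feeds p w, the second r.\<close>
    moreover have "cosh (p * s) = sinh (p * s) + exp (- p * s)"
      by (simp add: cosh_field_def sinh_field_def field_simps)
    ultimately show ?thesis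
      by (simp add: w_def r_def mult_sh[symmetric] algebra_simps)
  qed
  have 3: "(r has_real_derivative - p * r s - G s) (at s within ?I)" if s: "s \<in> ?I" for s
  proof -
    have "(r has_real_derivative (exp (- p * s) * - p) * (B T - B s) + (0 - exp (p * s) * G s) * exp (- p * s)) (at s within ?I)"
      unfolding r_def
      by (intro DERIV_mult DERIV_diff DERIV_const dB s) (auto intro!: derivative_eq_intros)
    moreover have "exp (p * s) * G s * exp (- p * s) = G s * (exp (p * s) * exp (- p * s))" by (simp only: ac_simps)
    then have "exp (p * s) * G s * exp (- p * s) = G s" by (simp add: exp_add[symmetric])
    then have "(exp (- p * s) * - p) * (B T - B s) + (0 - exp (p * s) * G s) * exp (- p * s) = - p * r s - G s"
      by (simp add: r_def)
    ultimately show ?thesis by (simp only:)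
  qed
  have w: "kop p T G = w" and r: "kop_r p T G = r"
    by (simp_all add: fun_eq_iff kop_def kop_r_def w_def r_def A_def B_def)
  show "kop p T G 0 = 0" by (simp add: w w_def A_def sh_0)
  show "kop_r p T G T = 0" by (simp add: r r_def)
  show "s \<in> ?I \<Longrightarrow> ((\<lambda>y. cov_kernel s y p * G y) has_integral kop p T G s) ?I"
    unfolding w by (rule 1)
  show "s \<in> ?I \<Longrightarrow> (kop p T G has_real_derivative p * kop p T G s + kop_r p T G s) (at s within ?I)"
    unfolding w r by (rule 2)
  show "s \<in> ?I \<Longrightarrow> (kop_r p T G has_real_derivative - p * kop_r p T G s - G s) (at s within ?I)"
    unfolding r by (rule 3)
qed

context soliton_rel begin

lemma orth_comp: "j < n \<Longrightarrow> (\<Sum>i<n. v i j * (\<Sum>l<n. v i l * f l)) = f j"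
proof -
  assume j: "j < n"
  have "(\<Sum>i<n. v i j * (\<Sum>l<n. v i l * f l)) = (\<Sum>i<n. \<Sum>l<n. (v i j * v i l) * f l)"
    by (simp add: sum_distrib_left mult.assoc)
  also have "\<dots> = (\<Sum>l<n. \<Sum>i<n. (v i j * v i l) * f l)" by (rule sum.swap)
  also have "\<dots> = (\<Sum>l<n. kron j l * f l)"
    by (intro sum.cong refl) (use orth2[OF orth j] in \<open>simp add: sum_distrib_right[symmetric]\<close>)
  also have "\<dots> = f j" using j by (simp only: sum_kron)
  finally show ?thesis .
qed

lemma fredholm_solution:
  assumes T: "T \<ge> 0" and G: "continuous_on {0..T} G"
    and R: "\<And>s y. R s y = (\<Sum>j<n. (c j)\<^sup>2 * cov_kernel s y (p j))"
    and eq: "\<And>s. s \<in> {0..T} \<Longrightarrow> G s = R s T * \<phi> - integral {0..T} (\<lambda>y. R s y * G y)"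
  shows "\<exists>b. (\<forall>j<n. (\<Sum>i<n. b i * wmat T i j) = c j * \<phi>) \<and>
     G T = (\<Sum>i<n. b i * (ip n c (v i) * (sinh (\<eta> i * T) / \<eta> i)))"
proof -
  let ?I = "{0..T}"
  define w \<rho> where "w = (\<lambda>j. kop (p j) T G)" and "\<rho> = (\<lambda>j. kop_r (p j) T G)"
  note op = cov_kernel_operator[OF T G]
  have wi: "((\<lambda>y. cov_kernel s y (p j) * G y) has_integral w j s) ?I" if "s \<in> ?I" for j s
    unfolding w_def by (rule op(1)[OF that])
  have wd: "(w j has_real_derivative p j * w j s + \<rho> j s) (at s within ?I)" if "s \<in> ?I" for j s
    unfolding w_def \<rho>_def by (rule op(2)[OF that])
  have \<rho>d: "(\<rho> j has_real_derivative - p j * \<rho> j s - G s) (at s within ?I)" if "s \<in> ?I" for j s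
    unfolding \<rho>_def by (rule op(3)[OF that])
  have w0: "w j 0 = 0" and \<rho>T: "\<rho> j T = 0" for j unfolding w_def \<rho>_def by (rule op(4) op(5))+
  \<comment> \<open>Up to a factor c j, the contribution of atom j to the right-hand side of the
    equation: for s \<le> T its kernel against T is \<open>exp (p j * T) * sh (p j) s\<close>. The
    companion \<open>r\<close> is chosen such that h and r satisfy a first order system.\<close>
  define h where "h = (\<lambda>j s. c j * (exp (p j * T) * sh (p j) s * \<phi> - w j s))"
  define r where "r = (\<lambda>j s. exp (p j * T) * exp (- p j * s) * \<phi> - \<rho> j s)"
  have hd: "(h j has_real_derivative p j * h j s + c j * r j s) (at s within ?I)" if s: "s \<in> ?I" for j s
  proof -
    have "(h j has_real_derivative c j * (exp (p j * T) * cosh (p j * s) * \<phi> - (p j * w j s + \<rho> j s))) (at s within ?I)"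
      unfolding h_def by (intro DERIV_cmult DERIV_diff DERIV_cmult_right wd s sh_has_derivative)
    moreover have "cosh (p j * s) = p j * sh (p j) s + exp (- p j * s)"
      by (simp add: mult_sh cosh_field_def sinh_field_def field_simps)
    ultimately show ?thesis by (simp add: h_def r_def algebra_simps)
  qed
  have rd: "(r j has_real_derivative - p j * r j s + G s) (at s within ?I)" if s: "s \<in> ?I" for j s
  proof -
    have "(r j has_real_derivative exp (p j * T) * (exp (- p j * s) * - p j) * \<phi> - (- p j * \<rho> j s - G s)) (at s within ?I)"
      unfolding r_def
      by (intro DERIV_diff DERIV_cmult_right DERIV_cmult \<rho>d s) (auto intro!: derivative_eq_intros)
    then show ?thesis by (simp add: r_def algebra_simps)
  qed
  have Gh: "G s = (\<Sum>j<n. c j * h j s)" if s: "s \<in> ?I" for s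
  proof -
    have "((\<lambda>y. \<Sum>j<n. (c j)\<^sup>2 * (cov_kernel s y (p j) * G y)) has_integral (\<Sum>j<n. (c j)\<^sup>2 * w j s)) ?I"
      by (intro has_integral_sum has_integral_mult_right wi s) simp
    moreover have "(\<lambda>y. \<Sum>j<n. (c j)\<^sup>2 * (cov_kernel s y (p j) * G y)) = (\<lambda>y. R s y * G y)"
      by (simp add: R sum_distrib_right mult.assoc)
    ultimately have "integral ?I (\<lambda>y. R s y * G y) = (\<Sum>j<n. (c j)\<^sup>2 * w j s)" by (simp add: integral_unique)
    then have "G s = (\<Sum>j<n. (c j)\<^sup>2 * (cov_kernel s T (p j) * \<phi> - w j s))"
      using eq[OF s] by (simp add: R sum_distrib_right sum_subtractf right_diff_distrib mult.assoc)
    also have "\<dots> = (\<Sum>j<n. c j * h j s)"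
      by (intro sum.cong refl) (use s in \<open>simp add: h_def cov_kernel_ge power2_eq_square\<close>)
    finally show ?thesis .
  qed
  define H where "H = (\<lambda>i s. \<Sum>j<n. v i j * h j s)"
  define D where "D = (\<lambda>i s. \<Sum>j<n. v i j * (p j * h j s + c j * r j s))"
  have Hd: "(H i has_real_derivative D i s) (at s within ?I)" if "s \<in> ?I" for i s
    unfolding H_def D_def by (intro DERIV_sum DERIV_cmult hd that)
  \<comment> \<open>The terms with r cancel. The remaining source is \<gamma> i G, and since G =
    \<Sum> c j h j the eigenvector relation completes (p j)^2 to (\<eta> i)^2.\<close>
  have Dd: "(D i has_real_derivative (\<eta> i)\<^sup>2 * H i s) (at s within ?I)" if i: "i < n" and s: "s \<in> ?I" for i s
  proof -
    have "(D i has_real_derivative (\<Sum>j<n. v i j * (p j * (p j * h j s + c j * r j s) + c j * (- p j * r j s + G s)))) (at s within ?I)"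
      unfolding D_def by (intro DERIV_sum DERIV_cmult DERIV_add hd rd s)
    also have "(\<Sum>j<n. v i j * (p j * (p j * h j s + c j * r j s) + c j * (- p j * r j s + G s)))
      = (\<Sum>j<n. v i j * (p j)\<^sup>2 * h j s) + ip n c (v i) * G s"
      unfolding ip_def sum_distrib_right sum.distrib[symmetric]
      by (intro sum.cong refl) (simp add: algebra_simps power2_eq_square)
    also have "ip n c (v i) * G s = (\<Sum>j<n. (v i j * ((\<eta> i)\<^sup>2 - (p j)\<^sup>2)) * h j s)"
      unfolding Gh[OF s] sum_distrib_left by (intro sum.cong refl) (use eigen i in simp)
    also have "(\<Sum>j<n. v i j * (p j)\<^sup>2 * h j s) + \<dots> = (\<eta> i)\<^sup>2 * H i s"
      unfolding H_def sum_distrib_left sum.distrib[symmetric]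
      by (intro sum.cong refl) (simp add: algebra_simps)
    finally show ?thesis .
  qed
  have H0: "H i 0 = 0" for i by (simp add: H_def h_def sh_0 w0)
  \<comment> \<open>The slopes at 0, left open by H i 0 = 0. The linear system that they satisfy
    expresses the end condition r j T = \<phi>.\<close>
  define b where "b = (\<lambda>i. D i 0)"
  have HT: "H i T = b i * (sinh (\<eta> i * T) / \<eta> i)" and DT: "D i T = b i * cosh (\<eta> i * T)" if i: "i < n" for i
    unfolding b_def using sinh_ode_unique[OF T eta_pos[OF i], of "H i" "D i", OF Hd Dd[OF i] H0] by auto
  have "(\<Sum>i<n. b i * wmat T i j) = c j * \<phi>" if j: "j < n" for j
  proof -
    have "(\<Sum>i<n. b i * wmat T i j) = (\<Sum>i<n. v i j * D i T) - p j * (\<Sum>i<n. v i j * H i T)"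
      unfolding wmat_def sum_distrib_left sum_subtractf[symmetric]
      by (intro sum.cong refl) (simp add: HT DT algebra_simps)
    also have "(\<Sum>i<n. v i j * D i T) = p j * h j T + c j * r j T" unfolding D_def by (rule orth_comp[OF j])
    also have "(\<Sum>i<n. v i j * H i T) = h j T" unfolding H_def by (rule orth_comp[OF j])
    also have "r j T = \<phi>" by (simp add: r_def \<rho>T exp_add[symmetric])
    finally show ?thesis by simp
  qed
  moreover have "G T = (\<Sum>i<n. b i * (ip n c (v i) * (sinh (\<eta> i * T) / \<eta> i)))"
  proof -
    have "(\<Sum>i<n. b i * (ip n c (v i) * (sinh (\<eta> i * T) / \<eta> i))) = (\<Sum>i<n. \<Sum>l<n. c l * (v i l * H i T))"
      unfolding ip_def by (intro sum.cong refl) (simp add: HT sum_distrib_left sum_distrib_right ac_simps)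
    also have "\<dots> = (\<Sum>l<n. \<Sum>i<n. c l * (v i l * H i T))" by (rule sum.swap)
    also have "\<dots> = (\<Sum>l<n. c l * h l T)"
      by (intro sum.cong refl) (simp add: sum_distrib_left[symmetric] H_def orth_comp)
    finally show ?thesis using Gh[of T] T by simp
  qed
  ultimately show ?thesis by blast
qed

text \<open>In matrix form W' = \<sigma> c^T - W diag(p) with \<sigma> i = \<gamma> i sinh(\<eta> i
  x) / \<eta> i: the eigenvector relation turns \<eta>^2 - p^2 into a term of rank one.\<close>

lemma wmat_has_derivative:
  assumes ij: "i < n" "j < n"
  shows "((\<lambda>x. wmat x i j) has_real_derivative c j * (ip n c (v i) * (sinh (\<eta> i * T) / \<eta> i)) - p j * wmat T i j) (at T)"
proof -
  have e: "\<eta> i \<noteq> 0" using eta_pos[OF ij(1)] by simp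
  have "((\<lambda>x. wmat x i j) has_real_derivative v i j * (\<eta> i * sinh (\<eta> i * T) - p j * (\<eta> i * cosh (\<eta> i * T) / \<eta> i))) (at T)"
    unfolding wmat_def using e by (auto intro!: derivative_eq_intros)
  moreover have "v i j * (\<eta> i * sinh (\<eta> i * T) - p j * (\<eta> i * cosh (\<eta> i * T) / \<eta> i))
    = (v i j * ((\<eta> i)\<^sup>2 - (p j)\<^sup>2)) * (sinh (\<eta> i * T) / \<eta> i) - p j * wmat T i j"
    unfolding wmat_def using e by (simp add: field_simps power2_eq_square)
  ultimately show ?thesis unfolding eigen[OF ij] by (simp add: ac_simps)
qed

lemma Wm_carrier: "Wm x \<in> carrier_mat n n"
  by (simp add: Wm_def)

text \<open>In Jacobi's formula the part - W diag(p) contributes - \<Sum> p j times det W. For the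
  rank one part, c is replaced by b W / \<phi>, and W times its adjugate leaves (b . \<sigma>) det W
  / \<phi>. Cofactors spare a division by det W.\<close>

lemma det_Wm_has_derivative:
  assumes b: "\<And>j. j < n \<Longrightarrow> (\<Sum>i<n. b i * wmat T i j) = c j * \<phi>" and \<phi>: "\<phi> \<noteq> 0"
    and g: "g = (\<Sum>i<n. b i * (ip n c (v i) * (sinh (\<eta> i * T) / \<eta> i)))"
  shows "((\<lambda>x. Determinant.det (Wm x)) has_real_derivative (g / \<phi> - (\<Sum>j<n. p j)) * Determinant.det (Wm T)) (at T)"
proof -
  define \<sigma> where "\<sigma> = (\<lambda>i. ip n c (v i) * (sinh (\<eta> i * T) / \<eta> i))"
  define C where "C = (\<lambda>i j. cofactor (Wm T) i j)"
  define d where "d = Determinant.det (Wm T)"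
  have der: "((\<lambda>x. Determinant.det (Wm x)) has_real_derivative (\<Sum>i<n. \<Sum>j<n. (c j * \<sigma> i - p j * wmat T i j) * C i j)) (at T)"
    unfolding Wm_def C_def \<sigma>_def by (rule det_has_derivative) (rule wmat_has_derivative)
  have col: "(\<Sum>i<n. wmat T i j * C i j) = d" if "j < n" for j
    unfolding d_def C_def using laplace_expansion_column[OF Wm_carrier that, of T] that by (simp add: Wm_def)
  have row: "(\<Sum>j<n. wmat T k j * C i j) = kron k i * d" if "k < n" "i < n" for k i
  proof -
    have "(Wm T * adj_mat (Wm T)) $$ (k, i) = (\<Sum>j<n. wmat T k j * C i j)"
      using that by (simp add: adj_mat_def scalar_prod_def atLeast0LessThan Wm_def C_def)
    moreover have "(Wm T * adj_mat (Wm T)) $$ (k, i) = kron k i * d"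
      using that by (simp add: adj_mat(2)[OF Wm_carrier] d_def)
    ultimately show ?thesis by simp
  qed
  have 1: "(\<Sum>i<n. \<Sum>j<n. p j * wmat T i j * C i j) = (\<Sum>j<n. p j) * d"
  proof -
    have "(\<Sum>i<n. \<Sum>j<n. p j * wmat T i j * C i j) = (\<Sum>j<n. \<Sum>i<n. p j * wmat T i j * C i j)" by (rule sum.swap)
    also have "\<dots> = (\<Sum>j<n. p j * d)"
      by (intro sum.cong refl) (use col in \<open>simp add: mult.assoc sum_distrib_left[symmetric]\<close>)
    finally show ?thesis by (simp add: sum_distrib_right)
  qed
  have 2: "\<phi> * (\<Sum>i<n. \<Sum>j<n. c j * \<sigma> i * C i j) = g * d"
  proof -
    have "\<phi> * (\<Sum>i<n. \<Sum>j<n. c j * \<sigma> i * C i j) = (\<Sum>i<n. \<Sum>j<n. \<Sum>k<n. (b k * \<sigma> i) * (wmat T k j * C i j))"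
      unfolding sum_distrib_left
    proof (intro sum.cong refl)
      fix i j assume "j \<in> {..<n}"
      then have "\<phi> * (c j * \<sigma> i * C i j) = (\<Sum>k<n. b k * wmat T k j) * (\<sigma> i * C i j)" using b by (simp add: ac_simps)
      then show "\<phi> * (c j * \<sigma> i * C i j) = (\<Sum>k<n. (b k * \<sigma> i) * (wmat T k j * C i j))"
        by (simp add: sum_distrib_left sum_distrib_right ac_simps)
    qed
    also have "\<dots> = (\<Sum>i<n. \<Sum>k<n. \<Sum>j<n. (b k * \<sigma> i) * (wmat T k j * C i j))"
      by (intro sum.cong refl sum.swap)
    also have "\<dots> = (\<Sum>i<n. \<Sum>k<n. (b k * \<sigma> i * d) * kron k i)"
      by (intro sum.cong refl) (simp add: sum_distrib_left[symmetric] row mult.assoc)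
    also have "\<dots> = (\<Sum>i<n. b i * \<sigma> i * d)"
      by (intro sum.cong refl) (rule sum_kron(2), simp)
    finally show ?thesis by (simp add: g \<sigma>_def sum_distrib_right)
  qed
  have "(\<Sum>i<n. \<Sum>j<n. c j * \<sigma> i * C i j) = g / \<phi> * d" using 2 \<phi> by (simp add: field_simps)
  then have "(\<Sum>i<n. \<Sum>j<n. (c j * \<sigma> i - p j * wmat T i j) * C i j) = (g / \<phi> - (\<Sum>j<n. p j)) * d"
    unfolding left_diff_distrib sum_subtractf 1 by simp
  then show ?thesis using der by (simp add: d_def)
qed

theorem functional_identity:
  assumes \<Phi>: "\<And>T. T \<ge> 0 \<Longrightarrow> (\<Phi> has_real_derivative - (1 / 2) * G T T) (at T within {0..})"
    and pos: "\<And>T. \<Phi> T > 0"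
    and G: "\<And>T. T \<ge> 0 \<Longrightarrow> continuous_on {0..T} (G T)"
    and R: "\<And>s y. R s y = (\<Sum>j<n. (c j)\<^sup>2 * cov_kernel s y (p j))"
    and eq: "\<And>T s. T \<ge> 0 \<Longrightarrow> s \<in> {0..T} \<Longrightarrow> G T s = R s T * \<Phi> T - integral {0..T} (\<lambda>y. R s y * G T y)"
    and T: "T \<ge> 0"
  shows "Determinant.det (Wm T) * exp ((\<Sum>j<n. p j) * T) * (\<Phi> T)\<^sup>2 = Determinant.det (Wm 0) * (\<Phi> 0)\<^sup>2"
proof -
  let ?D = "\<lambda>x. Determinant.det (Wm x)" and ?p = "\<Sum>j<n. p j"
  have "\<exists>a. \<forall>x\<in>{0..}. ?D x * exp (?p * x) * (\<Phi> x)\<^sup>2 = a"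
  proof (rule has_field_derivative_zero_constant)
    fix x :: real assume "x \<in> {0..}"
    then have x: "x \<ge> 0" by simp
    obtain b where "\<And>j. j < n \<Longrightarrow> (\<Sum>i<n. b i * wmat x i j) = c j * \<Phi> x"
      "G x x = (\<Sum>i<n. b i * (ip n c (v i) * (sinh (\<eta> i * x) / \<eta> i)))"
      using fredholm_solution[OF x G[OF x] R eq[OF x]] by blast
    from det_Wm_has_derivative[OF this(1) _ this(2)]
    have d: "(?D has_real_derivative (G x x / \<Phi> x - ?p) * ?D x) (at x within {0..})"
      using pos[of x] by (auto intro: has_field_derivative_at_within)
    have e: "((\<lambda>x. exp (?p * x)) has_real_derivative exp (?p * x) * ?p) (at x within {0..})"
      by (auto intro!: derivative_eq_intros)
    have f: "((\<lambda>x. (\<Phi> x)\<^sup>2) has_real_derivative - (G x x * \<Phi> x)) (at x within {0..})"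
      using DERIV_mult[OF \<Phi>[OF x] \<Phi>[OF x]] by (simp add: power2_eq_square mult.commute)
    have "((\<lambda>x. ?D x * exp (?p * x) * (\<Phi> x)\<^sup>2) has_real_derivative
      ((G x x / \<Phi> x - ?p) * ?D x * exp (?p * x) + exp (?p * x) * ?p * ?D x) * (\<Phi> x)\<^sup>2
       + - (G x x * \<Phi> x) * (?D x * exp (?p * x))) (at x within {0..})"
      by (intro DERIV_mult d e f)
    moreover have "((G x x / \<Phi> x - ?p) * ?D x * exp (?p * x) + exp (?p * x) * ?p * ?D x) * (\<Phi> x)\<^sup>2
       + - (G x x * \<Phi> x) * (?D x * exp (?p * x)) = 0"
      using pos[of x] by (simp add: field_simps power2_eq_square)
    ultimately show "((\<lambda>x. ?D x * exp (?p * x) * (\<Phi> x)\<^sup>2) has_real_derivative 0) (at x within {0..})" by simp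
  qed (rule convex_real_interval)
  then show ?thesis using T by force
qed

end

section \<open>The bijection and the reflection\<close>

definition amp :: "real \<Rightarrow> real \<Rightarrow> real" where
  "amp p x = exp (p * x) * (1 + clock p x)"

text \<open>The index \<open>q\<close> is a pair of atom and dyadic cell. The maximum with 0 extends
  the coefficient continuously to negative times, as \<open>cont_a\<close> speaks about all
  reals.\<close>

definition coef :: "(nat \<Rightarrow> real) \<Rightarrow> (nat \<Rightarrow> real) \<Rightarrow> nat \<Rightarrow> nat \<times> nat \<Rightarrow> real \<Rightarrow> real" where
  "coef c p l q t = c (fst q) * amp (p (fst q)) (max 0 t)
     * schauder l (snd q) (clock (p (fst q)) (max 0 t) / (1 + clock (p (fst q)) (max 0 t)))"

definition cov_sum :: "nat \<Rightarrow> (nat \<Rightarrow> real) \<Rightarrow> (nat \<Rightarrow> real) \<Rightarrow> real \<Rightarrow> real \<Rightarrow> real" where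
  "cov_sum n c p s t = (\<Sum>j<n. (c j)\<^sup>2 * cov_kernel s t (p j))"

lemma clock_max_pos: "1 + clock p (max 0 t) > 0"
  using clock_nonneg[of "max 0 t" p] by simp

text \<open>Each atom gets its own family of independent Gaussians, so covariances add up and a
  level has n 2^l of them.\<close>

lemma gauss_series_atoms: "gauss_series (\<lambda>l. {..<n} \<times> {..<2 ^ l}) (coef c p) (cov_sum n c p) n"
proof
  show "finite ({..<n} \<times> {..<2 ^ l :: nat})" for l by simp
  show "card ({..<n} \<times> {..<2 ^ l :: nat}) \<le> n * 2 ^ l" for l by simp
  have m: "continuous_on UNIV (\<lambda>t :: real. max 0 t)" by (intro continuous_intros)
  have cl: "continuous_on UNIV (\<lambda>t. clock r (max 0 t))" for r
    by (rule continuous_on_compose2[OF continuous_on_clock[of UNIV] m]) simp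
  have ca: "continuous_on UNIV (\<lambda>t. amp r (max 0 t))" for r
    unfolding amp_def by (intro continuous_intros cl m)
  show "continuous_on UNIV (coef c p l q)" for l q
  proof -
    have "continuous_on UNIV (\<lambda>t. tent (2 ^ l * (clock (p (fst q)) (max 0 t) / (1 + clock (p (fst q)) (max 0 t))) - real (snd q)))"
    proof (rule continuous_on_compose2[OF continuous_on_tent[of UNIV]])
      show "continuous_on UNIV (\<lambda>t. 2 ^ l * (clock (p (fst q)) (max 0 t) / (1 + clock (p (fst q)) (max 0 t))) - real (snd q))"
        using clock_max_pos by (intro continuous_intros cl) (auto simp: less_imp_neq[symmetric])
    qed simp
    then show ?thesis unfolding coef_def[abs_def] schauder_def by (intro continuous_intros ca)
  qed
  show "coef c p l q 0 = 0" for l q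
    by (simp add: coef_def clock_0 schauder_def tent_def)
  show "\<exists>C\<ge>0. \<forall>t\<in>{0..T}. \<forall>l. (\<Sum>q\<in>{..<n} \<times> {..<2 ^ l}. \<bar>coef c p l q t\<bar>) \<le> C * (1 / sqrt 2) ^ l" for T
  proof -
    define f where "f = (\<lambda>t. \<Sum>j<n. \<bar>c j\<bar> * amp (p j) (max 0 t))"
    have "continuous_on {0..T} f" unfolding f_def
      by (intro continuous_intros continuous_on_subset[OF ca]) auto
    from compact_imp_bounded[OF compact_continuous_image[OF this compact_Icc]]
    obtain C where C: "\<forall>t\<in>{0..T}. \<bar>f t\<bar> \<le> C" unfolding bounded_iff by auto
    have "(\<Sum>q\<in>{..<n} \<times> {..<2 ^ l}. \<bar>coef c p l q t\<bar>) \<le> max 0 C * (1 / sqrt 2) ^ l" if t: "t \<in> {0..T}" for t l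
    proof -
      have an: "amp (p j) (max 0 t) \<ge> 0" for j using clock_max_pos[of "p j" t] by (simp add: amp_def)
      have "(\<Sum>q\<in>{..<n} \<times> {..<2 ^ l}. \<bar>coef c p l q t\<bar>)
        = (\<Sum>j<n. \<bar>c j\<bar> * amp (p j) (max 0 t) * (\<Sum>k<2 ^ l. \<bar>schauder l k (clock (p j) (max 0 t) / (1 + clock (p j) (max 0 t)))\<bar>))"
        unfolding sum.cartesian_product[symmetric] sum_distrib_left coef_def using an
        by (simp add: sum.cartesian_product' abs_mult)
      also have "\<dots> \<le> (\<Sum>j<n. \<bar>c j\<bar> * amp (p j) (max 0 t) * (1 / sqrt 2) ^ l)"
        using an by (intro sum_mono mult_left_mono schauder_sum_abs_le) auto
      also have "\<dots> = f t * (1 / sqrt 2) ^ l" by (simp add: f_def sum_distrib_right)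
      also have "\<dots> \<le> max 0 C * (1 / sqrt 2) ^ l"
        using bspec[OF C t] by (intro mult_right_mono) auto
      finally show ?thesis .
    qed
    then show ?thesis by (intro exI[of _ "max 0 C"]) auto
  qed
  show "(\<lambda>l. \<Sum>q\<in>{..<n} \<times> {..<2 ^ l}. coef c p l q s * coef c p l q t) sums cov_sum n c p s t" if st: "s \<ge> 0" "t \<ge> 0" for s t
  proof -
    define \<phi> where "\<phi> = (\<lambda>j t. clock (p j) t / (1 + clock (p j) t))"
    have "(\<lambda>l. \<Sum>j<n. (c j)\<^sup>2 * (amp (p j) s * amp (p j) t) * (\<Sum>k<2 ^ l. schauder l k (\<phi> j s) * schauder l k (\<phi> j t)))
      sums (\<Sum>j<n. (c j)\<^sup>2 * (amp (p j) s * amp (p j) t) * bridge_kernel (\<phi> j s) (\<phi> j t))"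
      by (intro sums_sum sums_mult schauder_sums)
    moreover have "(\<Sum>j<n. (c j)\<^sup>2 * (amp (p j) s * amp (p j) t) * (\<Sum>k<2 ^ l. schauder l k (\<phi> j s) * schauder l k (\<phi> j t)))
       = (\<Sum>q\<in>{..<n} \<times> {..<2 ^ l}. coef c p l q s * coef c p l q t)" for l
    proof -
      have "coef c p l (j, k) s * coef c p l (j, k) t
        = (c j)\<^sup>2 * (amp (p j) s * amp (p j) t) * (schauder l k (\<phi> j s) * schauder l k (\<phi> j t))" for j k
        using st by (simp add: coef_def \<phi>_def power2_eq_square)
      then show ?thesis by (simp add: sum.cartesian_product' sum_distrib_left)
    qed
    moreover have "(\<Sum>j<n. (c j)\<^sup>2 * (amp (p j) s * amp (p j) t) * bridge_kernel (\<phi> j s) (\<phi> j t)) = cov_sum n c p s t"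
      unfolding cov_sum_def by (intro sum.cong refl) (simp add: cov_kernel_bridge[OF st] amp_def \<phi>_def)
    ultimately show ?thesis by simp
  qed
qed

text \<open>Atoms are numbered from 1 in \<open>atom_data\<close>, but from 0 in the linear
  algebra.\<close>

abbreviation shift :: "(nat \<Rightarrow> real) \<Rightarrow> nat \<Rightarrow> real" where "shift f \<equiv> (\<lambda>j. f (Suc j))"

lemma sum_shift: "(\<Sum>j=1..n. f j) = (\<Sum>j<n. f (Suc j))"
  by (simp add: sum.atLeast1_atMost_eq)

lemma atom_data_shift:
  assumes "atom_data n c p"
  shows "n \<ge> 1" "\<And>j. j < n \<Longrightarrow> c (Suc j) > 0" "inj_on (shift p) {..<n}"
proof -
  have *: "n \<ge> 1" "\<forall>j\<in>{1..n}. c j > 0" "inj_on p {1..n}" using assms by (simp_all add: atom_data_def)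
  show "n \<ge> 1" by (fact *(1))
  show "c (Suc j) > 0" if "j < n" for j using *(2) that by simp
  have "inj_on (p \<circ> Suc) {..<n}"
    by (rule comp_inj_on[OF inj_Suc]) (use *(3) in \<open>simp only: image_Suc_lessThan\<close>)
  then show "inj_on (shift p) {..<n}" by (simp only: comp_def)
qed

theorem gaussian_law_functional:
  assumes a: "atom_data n c p" and rel: "soliton_rel n (shift c) (shift p) \<eta> \<delta> v"
  shows "\<exists>\<alpha> \<beta>. \<forall>x\<ge>0. log_functional (gaussian_law (atomic_measure n c p)) x
    = \<alpha> + \<beta> * x - (1 / 2) * ln (tau (sdata n \<eta> \<delta>) x)"
proof -
  interpret W: gauss_series "\<lambda>l. {..<n} \<times> {..<2 ^ l}" "coef (shift c) (shift p)" "cov_sum n (shift c) (shift p)" n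
    by (rule gauss_series_atoms)
  interpret A: soliton_rel n "shift c" "shift p" \<eta> \<delta> v by fact
  have cov: "cov (atomic_measure n c p) = cov_sum n (shift c) (shift p)"
    by (intro ext) (simp only: cov_atomic_measure cov_sum_def sum_shift)
  have P: "gaussian_law (atomic_measure n c p) = W.law"
    by (rule gaussian_law_eqI) (use W.law_gaussian in \<open>simp_all add: cov\<close>)
  have L: "log_functional W.law x = ln (W.\<Phi> x)" for x
  proof -
    have "(\<integral>w. exp (- (1 / 2) * integral {0..x} (\<lambda>y. (coord y w)\<^sup>2)) \<partial>W.law)
      = (\<integral>w. exp (- (1 / 2) * integral {0..x} (\<lambda>y. (coord y (restrict (W.X w) {0..}))\<^sup>2)) \<partial>W.\<Omega>)"
      unfolding W.law_def by (rule integral_distr[OF W.measurable_restrict_X measurable_path_functional])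
    also have "\<dots> = W.\<Phi> x"
      unfolding W.\<Phi>_def W.E_def W.en_def
      by (intro Bochner_Integration.integral_cong refl arg_cong[of _ _ exp] arg_cong2[of _ _ _ _ "(*)"] Henstock_Kurzweil_Integration.integral_cong)
         (simp add: coord_def)
    finally show ?thesis by (simp add: log_functional_def)
  qed
  obtain \<kappa> where k: "\<kappa> \<noteq> 0"
    "\<And>x. Determinant.det (A.Wm x) = \<kappa> * exp ((\<Sum>i<n. \<eta> i) * x) * tau (sdata n \<eta> \<delta>) x"
    using A.det_wmat by blast
  have "pos_data (sdata n \<eta> \<delta>)"
    by (rule scattering_data_pos, rule sdata_in_scattering_data)
       (use atom_data_shift[OF a] A.eta_pos A.delta_pos A.eta_less in auto)
  then have tp: "tau (sdata n \<eta> \<delta>) x > 0" for x by (rule tau_pos)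
  \<comment> \<open>The exponents from \<open>det_wmat\<close> and from
    \<open>functional_identity\<close> combine. The identity involves \<Phi>^2, so the affine term
    in log \<Phi> has slope - e / 2.\<close>
  define e where "e = (\<Sum>i<n. \<eta> i) + (\<Sum>j<n. shift p j)"
  have "ln (W.\<Phi> x) = (1 / 2) * ln (tau (sdata n \<eta> \<delta>) 0) + (- (1 / 2) * e) * x - (1 / 2) * ln (tau (sdata n \<eta> \<delta>) x)"
    if x: "x \<ge> 0" for x
  proof -
    have E: "exp (e * x) = exp ((\<Sum>i<n. \<eta> i) * x) * exp ((\<Sum>j<n. shift p j) * x)"
      by (simp add: e_def distrib_right exp_add)
    have "Determinant.det (A.Wm x) * exp ((\<Sum>j<n. shift p j) * x) * (W.\<Phi> x)\<^sup>2 = Determinant.det (A.Wm 0) * (W.\<Phi> 0)\<^sup>2"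
      by (rule A.functional_identity[where G = W.G and R = "cov_sum n (shift c) (shift p)"])
         (use W.\<Phi>_has_derivative W.\<Phi>_pos W.continuous_G W.fredholm(2) x in \<open>auto simp: cov_sum_def\<close>)
    then have "\<kappa> * (exp (e * x) * tau (sdata n \<eta> \<delta>) x * (W.\<Phi> x)\<^sup>2) = \<kappa> * tau (sdata n \<eta> \<delta>) 0"
      unfolding k(2) W.\<Phi>_0 E by (simp add: ac_simps)
    then have "exp (e * x) * tau (sdata n \<eta> \<delta>) x * (W.\<Phi> x)\<^sup>2 = tau (sdata n \<eta> \<delta>) 0" using k(1) by simp
    then have "ln (exp (e * x) * tau (sdata n \<eta> \<delta>) x * (W.\<Phi> x)\<^sup>2) = ln (tau (sdata n \<eta> \<delta>) 0)" by simp
    moreover have "ln (exp (e * x) * tau (sdata n \<eta> \<delta>) x * (W.\<Phi> x)\<^sup>2)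
      = e * x + ln (tau (sdata n \<eta> \<delta>) x) + 2 * ln (W.\<Phi> x)"
      using tp[of x] W.\<Phi>_pos[of x] by (simp add: ln_mult ln_realpow)
    ultimately show ?thesis by (simp add: field_simps)
  qed
  then show ?thesis unfolding P L by blast
qed

section \<open>The mapping psi\<close>

lemma at_within_atLeast_nontrivial: "x \<ge> 0 \<Longrightarrow> at x within {0 :: real..} \<noteq> bot"
proof -
  assume x: "x \<ge> 0"
  have "{0 :: real..} \<noteq> {y}" for y
  proof
    assume "{0 :: real..} = {y}"
    moreover have "(0 :: real) \<in> {0..}" "(1 :: real) \<in> {0..}" by auto
    ultimately show False by auto
  qed
  then have "x islimpt {0..}" using connected_imp_perfect[of "{0 :: real..}" x] x by (auto simp: connected_iff_interval)
  then show ?thesis by (simp add: trivial_limit_within)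
qed

lemma real_derivative_unique_within:
  assumes "x \<ge> 0" "(f has_real_derivative a) (at x within {0..})" "(f has_real_derivative b) (at x within {0..})"
  shows "a = b"
  using vector_derivative_unique_within[OF at_within_atLeast_nontrivial[OF assms(1)]] assms(2,3)
  by (simp add: has_real_derivative_iff_has_vector_derivative)

text \<open>The candidate fits the description because \<open>log_functional\<close> is - 1/2 log
  tau plus an affine function. Derivatives within the half line are unique, also at 0, so every
  competitor agrees with it for x \<ge> 0, and \<open>potential_inj\<close> identifies the
  two.\<close>

theorem psi_gaussian_law:
  assumes a: "atom_data n c p" and rel: "soliton_rel n (shift c) (shift p) \<eta> \<delta> v"
  shows "sdata n \<eta> \<delta> \<in> scattering_data"
    "psi (gaussian_law (atomic_measure n c p)) = potential (sdata n \<eta> \<delta>)"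
proof -
  interpret A: soliton_rel n "shift c" "shift p" \<eta> \<delta> v by fact
  let ?s = "sdata n \<eta> \<delta>" and ?P = "gaussian_law (atomic_measure n c p)"
  show s: "?s \<in> scattering_data"
    by (rule sdata_in_scattering_data)
       (use atom_data_shift[OF a] A.eta_pos A.delta_pos A.eta_less in auto)
  obtain g h where gh: "\<And>x. ((\<lambda>x. ln (tau ?s x)) has_real_derivative g x) (at x)"
    "\<And>x. (g has_real_derivative h x) (at x)" "\<And>x. potential ?s x = - 2 * h x"
    using ln_tau_derivatives[OF scattering_data_pos[OF s]] by metis
  obtain \<alpha> \<beta> where L: "\<And>x. x \<ge> 0 \<Longrightarrow> log_functional ?P x = \<alpha> + \<beta> * x - (1 / 2) * ln (tau ?s x)"
    using gaussian_law_functional[OF a rel] by blast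
  have d1: "(log_functional ?P has_real_derivative \<beta> - (1 / 2) * g x) (at x within {0..})" if x: "x \<ge> 0" for x
  proof -
    have "((\<lambda>x. \<alpha> + \<beta> * x - (1 / 2) * ln (tau ?s x)) has_real_derivative \<beta> - (1 / 2) * g x) (at x within {0..})"
      by (rule has_field_derivative_at_within,
          use DERIV_diff[OF DERIV_add[OF DERIV_const[of \<alpha>] DERIV_cmult[OF DERIV_ident, of \<beta>]] DERIV_cmult[OF gh(1)[of x], of "1 / 2"]] in simp)
    then show ?thesis
      by (rule has_field_derivative_transform_within[where d = 1]) (use L x in auto)
  qed
  have d2: "((\<lambda>x. \<beta> - (1 / 2) * g x) has_real_derivative - (1 / 2) * h x) (at x within {0..})" for x
    by (rule has_field_derivative_at_within) (auto intro!: derivative_eq_intros gh(2))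
  show "psi ?P = potential ?s"
    unfolding psi_def
  proof (rule the_equality)
    show "potential ?s \<in> Xi0 \<and>
       (\<exists>f' f''. \<forall>x\<ge>0. (log_functional ?P has_real_derivative f' x) (at x within {0..}) \<and>
        (f' has_real_derivative f'' x) (at x within {0..}) \<and> potential ?s x = 4 * f'' x)"
    proof (intro conjI exI allI impI)
      show "potential ?s \<in> Xi0" using s by (simp add: Xi0_def)
      show "(log_functional ?P has_real_derivative \<beta> - (1 / 2) * g x) (at x within {0..})" if "x \<ge> 0" for x
        by (rule d1[OF that])
      show "((\<lambda>x. \<beta> - (1 / 2) * g x) has_real_derivative - (1 / 2) * h x) (at x within {0..})" for x by (rule d2)
      show "potential ?s x = 4 * (- (1 / 2) * h x)" for x by (simp add: gh(3))
    qed
  next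
    fix u assume u: "u \<in> Xi0 \<and> (\<exists>f' f''. \<forall>x\<ge>0.
        (log_functional ?P has_real_derivative f' x) (at x within {0..}) \<and>
        (f' has_real_derivative f'' x) (at x within {0..}) \<and> u x = 4 * f'' x)"
    then obtain t where t: "t \<in> scattering_data" "u = potential t" by (auto simp: Xi0_def)
    from u obtain f' f'' where f: "\<And>x. x \<ge> 0 \<Longrightarrow> (log_functional ?P has_real_derivative f' x) (at x within {0..})"
      "\<And>x. x \<ge> 0 \<Longrightarrow> (f' has_real_derivative f'' x) (at x within {0..})" "\<And>x. x \<ge> 0 \<Longrightarrow> u x = 4 * f'' x" by blast
    have f': "f' x = \<beta> - (1 / 2) * g x" if "x \<ge> 0" for x
      by (rule real_derivative_unique_within[OF that f(1)[OF that] d1[OF that]])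
    have f'': "f'' x = - (1 / 2) * h x" if x: "x \<ge> 0" for x
    proof (rule real_derivative_unique_within[OF x f(2)[OF x]])
      show "(f' has_real_derivative - (1 / 2) * h x) (at x within {0..})"
        by (rule has_field_derivative_transform_within[where d = 1, OF d2]) (use f' x in auto)
    qed
    have "potential t x = potential ?s x" if "x \<ge> 0" for x
      using f(3)[OF that] f''[OF that] gh(3)[of x] t(2) by simp
    from potential_inj[OF t(1) s this] show "u = potential ?s" using t(2) by simp
  qed
qed

text \<open>Equal scattering lists fix \<eta> and \<delta> below \<open>n\<close> only, whereas the
  locale takes them as functions on all naturals.\<close>

lemma soliton_rel_cong:
  assumes rel: "soliton_rel n c p \<eta> \<delta> v" and e: "\<And>i. i < n \<Longrightarrow> \<eta> i = \<eta>' i" "\<And>i. i < n \<Longrightarrow> \<delta> i = \<delta>' i"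
  shows "soliton_rel n c p \<eta>' \<delta>' v"
proof -
  interpret soliton_rel n c p \<eta> \<delta> v by fact
  have y: "ymat \<eta>' \<delta>' i k = ymat \<eta> \<delta> i k" if "i < n" "k < n" for i k
    using e that by (simp add: ymat_def)
  show ?thesis
  proof
    show "\<eta>' i > 0" "\<delta>' i > 0" if "i < n" for i using eta_pos delta_pos e that by auto
    show "\<eta>' i < \<eta>' j" if "i < j" "j < n" for i j using eta_less[OF that] e that by simp
    show "ip n (v i) (v k) = kron i k" if "i < n" "k < n" for i k by (rule orth[OF that])
    show "v i j * ((\<eta>' i)\<^sup>2 - (p j)\<^sup>2) = ip n c (v i) * c j" if "i < n" "j < n" for i j
      using eigen[OF that] e that by simp
    show "(\<Sum>k<n. ymat \<eta>' \<delta>' i k * (v k j * (\<eta>' k - p j))) = v i j" if "i < n" "j < n" for i j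
      unfolding ymat_v[OF that, symmetric] by (intro sum.cong refl) (use e y that in auto)
    show "(\<Sum>k<n. ymat \<eta>' \<delta>' i k * ip n c (v k)) = \<delta>' i" if "i < n" for i
      unfolding e(2)[OF that, symmetric] ymat_gamma[OF that, symmetric] by (intro sum.cong refl) (use y that in auto)
  qed
qed

lemma atom_data_soliton_rel:
  "atom_data n c p \<Longrightarrow> \<exists>\<eta> \<delta> v. soliton_rel n (shift c) (shift p) \<eta> \<delta> v"
  using atom_data_shift by (intro soliton_rel_exists) auto

lemma psi_in_Xi0: "P \<in> G0 \<Longrightarrow> psi P \<in> Xi0"
proof -
  assume "P \<in> G0"
  then obtain n c p where a: "atom_data n c p" and P: "P = gaussian_law (atomic_measure n c p)"
    by (auto simp: G0_def Sigma0_def)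
  from atom_data_soliton_rel[OF a] obtain \<eta> \<delta> v where "soliton_rel n (shift c) (shift p) \<eta> \<delta> v" by blast
  from psi_gaussian_law[OF a this] show ?thesis by (simp add: P Xi0_def)
qed

lemma psi_surj: "u \<in> Xi0 \<Longrightarrow> \<exists>P\<in>G0. psi P = u"
proof -
  assume "u \<in> Xi0"
  then obtain s where s: "s \<in> scattering_data" "u = potential s" by (auto simp: Xi0_def)
  obtain n \<eta> \<delta> where n: "n \<ge> 1" "s = sdata n \<eta> \<delta>" "\<And>i. i < n \<Longrightarrow> \<eta> i > 0" "\<And>i. i < n \<Longrightarrow> \<delta> i > 0"
    "\<And>i j. i < j \<Longrightarrow> j < n \<Longrightarrow> \<eta> i < \<eta> j"
    using scattering_data_sdata[OF s(1)] by blast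
  obtain c p v where c: "\<forall>j<n. c j > 0" and p: "inj_on p {..<n}" and rel: "soliton_rel n c p \<eta> \<delta> v"
    using soliton_rel_surj[of n \<eta> \<delta>, OF n(3-5)] by blast
  define c' p' where "c' = (\<lambda>j. c (j - 1))" and "p' = (\<lambda>j. p (j - 1))"
  have "atom_data n c' p'"
    unfolding atom_data_def
  proof (intro conjI ballI n(1) inj_onI)
    show "c' j > 0" if "j \<in> {1..n}" for j using c that by (auto simp: c'_def)
    fix i j assume ij: "i \<in> {1..n}" "j \<in> {1..n}" "p' i = p' j"
    then have "i - 1 = j - 1" using inj_onD[OF p, of "i - 1" "j - 1"] by (auto simp: p'_def)
    then show "i = j" using ij by auto
  qed
  moreover have "shift c' = c" "shift p' = p" by (simp_all add: c'_def p'_def)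
  ultimately have "psi (gaussian_law (atomic_measure n c' p')) = u" "gaussian_law (atomic_measure n c' p') \<in> G0"
    using psi_gaussian_law(2)[of n c' p'] rel s(2) n(2) by (auto simp: G0_def Sigma0_def)
  then show ?thesis by blast
qed

lemma psi_inj: "inj_on psi G0"
proof (rule inj_onI)
  fix P P' assume "P \<in> G0" "P' \<in> G0" and eq: "psi P = psi P'"
  then obtain n c p n' c' p' where a: "atom_data n c p" and P: "P = gaussian_law (atomic_measure n c p)"
    and a': "atom_data n' c' p'" and P': "P' = gaussian_law (atomic_measure n' c' p')"
    by (auto simp: G0_def Sigma0_def)
  obtain \<eta> \<delta> v where r: "soliton_rel n (shift c) (shift p) \<eta> \<delta> v" using atom_data_soliton_rel[OF a] by blast
  obtain \<eta>' \<delta>' v' where r': "soliton_rel n' (shift c') (shift p') \<eta>' \<delta>' v'" using atom_data_soliton_rel[OF a'] by blast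
  interpret A: soliton_rel n "shift c" "shift p" \<eta> \<delta> v by fact
  interpret B: soliton_rel n' "shift c'" "shift p'" \<eta>' \<delta>' v' by fact
  have "potential (sdata n \<eta> \<delta>) = potential (sdata n' \<eta>' \<delta>')"
    using eq psi_gaussian_law(2)[OF a r] psi_gaussian_law(2)[OF a' r'] by (simp add: P P')
  then have s: "sdata n \<eta> \<delta> = sdata n' \<eta>' \<delta>'"
    using potential_inj[OF psi_gaussian_law(1)[OF a r] psi_gaussian_law(1)[OF a' r']] by simp
  then have n: "n' = n" by (metis length_sdata)
  have e: "\<eta>' i = \<eta> i" "\<delta>' i = \<delta> i" if i: "i < n" for i
  proof -
    have q: "(\<eta> i, 2 * \<eta> i * (\<delta> i)\<^sup>2) = (\<eta>' i, 2 * \<eta>' i * (\<delta>' i)\<^sup>2)"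
      using arg_cong[OF s, of "\<lambda>s. s ! i"] i n by (simp only: sdata_nth)
    then show \<eta>: "\<eta>' i = \<eta> i" by simp
    have "2 * \<eta> i * (\<delta> i)\<^sup>2 = 2 * \<eta> i * (\<delta>' i)\<^sup>2" using q unfolding \<eta> by (simp only: prod.inject)
    then have "(\<delta>' i)\<^sup>2 = (\<delta> i)\<^sup>2" using A.eta_pos[OF i] by simp
    then show "\<delta>' i = \<delta> i" using A.delta_pos[OF i] B.delta_pos[of i] i n by (simp add: power2_eq_iff_nonneg)
  qed
  have r2: "soliton_rel n (shift c') (shift p') \<eta> \<delta> v'"
    by (rule soliton_rel_cong[OF r'[unfolded n]]) (use e in auto)
  \<comment> \<open>The atoms agree only up to renumbering; hence the measures are compared, with
    indicators as f in \<open>soliton_rel_unique\<close>.\<close>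
  have "atomic_measure n c p = atomic_measure n' c' p'"
  proof (rule atomic_measure_eqI)
    fix A :: "real set"
    show "(\<Sum>j=1..n. (c j)\<^sup>2 * indicator A (p j)) = (\<Sum>j=1..n'. (c' j)\<^sup>2 * indicator A (p' j) :: real)"
      unfolding sum_shift n by (rule soliton_rel_unique[OF r r2])
  qed
  then show "P = P'" by (simp add: P P')
qed

theorem psi_reflection:
  assumes a: "atom_data n c p"
  shows "psi (gaussian_law (atomic_measure n c p)) x = psi (gaussian_law (atomic_measure n c (\<lambda>j. - p j))) (- x)"
proof -
  have a': "atom_data n c (\<lambda>j. - p j)" using a unfolding atom_data_def inj_on_def neg_equal_iff_equal .
  obtain \<eta> \<delta> v where r: "soliton_rel n (shift c) (shift p) \<eta> \<delta> v" using atom_data_soliton_rel[OF a] by blast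
  interpret A: soliton_rel n "shift c" "shift p" \<eta> \<delta> v by fact
  \<comment> \<open>\<open>p\<close> enters the eigenvector relation only through its square:
    passing to \<open>- p\<close> keeps \<eta> and, up to signs, the eigenvectors, but \<delta> has
    to be determined anew.\<close>
  have "\<exists>\<delta>' s. soliton_rel n (shift c) (shift (\<lambda>j. - p j)) \<eta> \<delta>' (\<lambda>i j. s i * v i j) \<and> (\<forall>i<n. s i \<noteq> 0)"
    by (rule soliton_rel_of_eigenbasis[OF A.orth _ A.eta_less A.eta_pos])
       (use A.eigen atom_data_shift[OF a'] in auto)
  then obtain \<delta>' s where r': "soliton_rel n (shift c) (shift (\<lambda>j. - p j)) \<eta> \<delta>' (\<lambda>i j. s i * v i j)" by blast
  interpret B: soliton_rel n "shift c" "shift (\<lambda>j. - p j)" \<eta> \<delta>' "\<lambda>i j. s i * v i j" by fact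
  note sA = psi_gaussian_law[OF a r] and sB = psi_gaussian_law[OF a' r']
  note pA = scattering_data_pos[OF sA(1)] and pB = scattering_data_pos[OF sB(1)]
  let ?s = "sdata n \<eta> \<delta>" and ?t = "sdata n \<eta> \<delta>'" and ?e = "\<Sum>i<n. \<eta> i"
  \<comment> \<open>cosh is even and sinh is odd, so changing the sign of \<open>p\<close> amounts
    to changing that of x.\<close>
  have W: "B.Wm x = mat_diag n s * A.Wm (- x)" for x
  proof -
    have "B.wmat x i j = s i * A.wmat (- x) i j" for i j
      by (simp add: B.wmat_def A.wmat_def algebra_simps)
    then show ?thesis
      unfolding mat_diag_mult_left[OF A.Wm_carrier] by (intro eq_matI) (auto simp: B.Wm_def A.Wm_def)
  qed
  obtain \<kappa> where k: "\<kappa> \<noteq> 0" "\<And>x. Determinant.det (A.Wm x) = \<kappa> * exp (?e * x) * tau ?s x"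
    using A.det_wmat by blast
  obtain \<kappa>' where k': "\<kappa>' \<noteq> 0" "\<And>x. Determinant.det (B.Wm x) = \<kappa>' * exp (?e * x) * tau ?t x"
    using B.det_wmat by blast
  define C where "C = (\<Prod>i<n. s i) * \<kappa> / \<kappa>'"
  \<comment> \<open>The two representations of det W are evaluated at opposite points, so their
    exponentials combine to exp(- 2 x \<Sum> \<eta> i). This is an affine term in the logarithm and
    disappears from the potential.\<close>
  have tt: "tau ?t x = C * exp (- 2 * ?e * x) * tau ?s (- x)" for x
  proof -
    have "\<kappa>' * exp (?e * x) * tau ?t x = (\<Prod>i<n. s i) * (\<kappa> * exp (?e * (- x)) * tau ?s (- x))"
      unfolding k(2)[symmetric] k'(2)[symmetric] W
      using det_mult[OF mat_diag_dim A.Wm_carrier, of s "- x"] by (simp add: det_mat_diag)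
    then have "tau ?t x * exp (?e * x) = C * (exp (?e * (- x)) * tau ?s (- x))"
      using k'(1) by (simp add: C_def field_simps)
    then have "tau ?t x * exp (?e * x) * exp (- (?e * x)) = C * (exp (?e * (- x)) * tau ?s (- x)) * exp (- (?e * x))" by simp
    moreover have "exp (?e * x) * exp (- (?e * x)) = 1" "exp (?e * (- x)) * exp (- (?e * x)) = exp (- 2 * ?e * x)"
      by (simp_all add: exp_add[symmetric])
    moreover have "a = C * d * t" if "a * e1 * e2 = C * (e3 * t) * e2" "e1 * e2 = 1" "e3 * e2 = d" for a t d e1 e2 e3 :: real
    proof -
      have "a = a * e1 * e2" using that(2) by (simp add: mult.assoc)
      also have "\<dots> = C * (e3 * e2) * t" unfolding that(1) by (simp add: mult_ac)
      finally show ?thesis unfolding that(3) .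
    qed
    ultimately show ?thesis by blast
  qed
  \<comment> \<open>Needed to split the logarithm. The factors of C may have either sign, so
    positivity is taken from that of both tau functions.\<close>
  have C: "C > 0"
  proof -
    have "C * tau ?s 0 = tau ?t 0" using tt[of 0] by simp
    then show ?thesis using tau_pos[OF pA, of 0] tau_pos[OF pB, of 0] by (metis zero_less_mult_pos2)
  qed
  obtain g h where gh: "\<And>x. ((\<lambda>x. ln (tau ?s x)) has_real_derivative g x) (at x)"
    "\<And>x. (g has_real_derivative h x) (at x)" "\<And>x. potential ?s x = - 2 * h x"
    using ln_tau_derivatives[OF pA] by metis
  obtain g' h' where gh': "\<And>x. ((\<lambda>x. ln (tau ?t x)) has_real_derivative g' x) (at x)"
    "\<And>x. (g' has_real_derivative h' x) (at x)" "\<And>x. potential ?t x = - 2 * h' x"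
    using ln_tau_derivatives[OF pB] by metis
  have L: "(\<lambda>x. ln (tau ?t x)) = (\<lambda>x. ln C + - 2 * ?e * x + ln (tau ?s (- x)))"
    using C tau_pos[OF pA, THEN less_imp_neq, symmetric] by (simp add: tt ln_mult fun_eq_iff)
  have neg: "((\<lambda>x. f (- x)) has_real_derivative - d) (at x)" if "(f has_real_derivative d) (at (- x))" for f d and x :: real
    using DERIV_chain2[where f = f and g = uminus and x = x and s = UNIV and Db = "- 1", OF that] DERIV_minus[OF DERIV_ident, of x] by simp
  have "((\<lambda>x. ln (tau ?t x)) has_real_derivative - 2 * ?e + - g (- x)) (at x)" for x
    unfolding L by (intro DERIV_add neg gh(1)) (auto intro!: derivative_eq_intros)
  then have g': "g' = (\<lambda>x. - 2 * ?e + - g (- x))" using gh'(1) DERIV_unique by blast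
  have "(g' has_real_derivative 0 + - (- h (- x))) (at x)" for x
    unfolding g' by (intro DERIV_add DERIV_const DERIV_minus neg gh(2))
  then have "h' x = h (- x)" for x using gh'(2) DERIV_unique by fastforce
  then have "potential ?t (- x) = potential ?s x" by (simp add: gh(3) gh'(3))
  then show ?thesis using sA(2) sB(2) by simp
qed

theorem theorem1:
  "bij_betw psi G0 Xi0 \<and>
   (\<forall>n c p. atom_data n c p \<longrightarrow>
      (\<forall>x\<le>0. psi (gaussian_law (atomic_measure n c p)) x =
              psi (gaussian_law (atomic_measure n c (\<lambda>j. - p j))) (- x)))"
  using psi_inj psi_in_Xi0 psi_surj psi_reflection unfolding bij_betw_def by (auto simp: image_iff)

end
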